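(* Let $\mathcal{C}$ be a category with finite limits, let $\mathbb{H}$ and $\mathbb{G}$ be stably Frobenius groupoids internal to $\mathcal{C}$ and let $\mathfrak{P}:\mathbb{H}\to\mathbb{G}$ be a Hilsum-Skandalis map. Then there exists a stably Frobenius adjunction $L^{\mathfrak{P}}\dashv R^{\mathfrak{P}}:[\mathbb{H},\mathcal{C}]\rightleftarrows[\mathbb{G},\mathcal{C}]$ over $\mathcal{C}$ such that $\mathfrak{P}\cong\mathfrak{P}_{L^{\mathfrak{P}},R^{\mathfrak{P}}}$, where $\mathfrak{P}_{L,R}$ denotes the Hilsum-Skandalis map associated with a stably Frobenius adjunction $L\dashv R$ over $\mathcal{C}$.
   Context: All categories have finite limits. An adjunction $L\dashv R:\mathcal{D}\rightleftarrows\mathcal{C}$ has $L:\mathcal{D}\to\mathcal{C}$ left adjoint to $R$. It is Frobenius if the canonical map $L(W\times RX)\to LW\times X$ (components $L\pi_1$, $\epsilon_XL\pi_2$) is always an isomorphism. The sliced adjunction $L_X\dashv R_X:\mathcal{D}/RX\rightleftarrows\mathcal{C}/X$ has $L_X(g)$ the adjoint transpose of $g$ and $R_X(f)=Rf$; $L\dashv R$ is stably Frobenius if every $L_X\dashv R_X$ is Frobenius. Internal groupoid: $\mathbb{G}=(d_0,d_1:G_1\rightrightarrows G_0,\ m,e,i)$, where the domain of $m$ consists of pairs $(g_1,g_2)$ with $d_0g_1=d_1g_2$. A $\mathbb{G}$-object is $(X_f,a)$ with $f:X\to G_0$ and action $a:G_1\times_{G_0}X\to X$ (pullback of $d_0$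 and $f$), $fa=d_1\pi_1$, satisfying unit and associativity laws; these with equivariant maps over $G_0$ form $[\mathbb{G},\mathcal{C}]$. The forgetful functor $U_{\mathbb{G}}:[\mathbb{G},\mathcal{C}]\to\mathcal{C}/G_0$ has left adjoint $\mathbb{T}_{\mathbb{G}}$ (the free action on $G_1\times_{G_0}X$); in particular $\mathbb{T}_{\mathbb{G}}1=(d_1:G_1\to G_0,m)$. $\mathbb{G}^*:\mathcal{C}\to[\mathbb{G},\mathcal{C}]$ sends $X$ to $\pi_1:G_0\times X\to G_0$ with trivial action; $\mathbb{G}$ is stably Frobenius if $\mathbb{G}^*$ has a left adjoint $\Sigma_{\mathbb{G}}$ and $\Sigma_{\mathbb{G}}\dashv\mathbb{G}^*$ is stably Frobenius. An adjunction $L\dashv R:[\mathbb{H},\mathcal{C}]\rightleftarrows[\mathbb{G},\mathcal{C}]$ is over $\mathcal{C}$ if it is equipped with a natural isomorphism $\Sigma_{\mathbb{G}}L\cong\Sigma_{\mathbb{H}}$. A morphism $f:X\to Y$ is an effective descent morphism if $f^*:\mathcal{C}/Y\to\mathcal{C}/X$ is monadic. A Hilsum-Skandalis map from $\mathbb{H}$ to $\mathbb{G}$ is data $(P\xrightarrow{(p,q)}H_0\times G_0,\ c:H_1\times_{H_0}P\to P,\ d:G_1\times_{G_0}P\to P)$ where $(P_p,c)$ is an $\mathbb{H}$-object, $(P_q,d)$ is a $\mathbb{G}$-object, $p$ is $d$-invariant, $q$ is $c$-invariant, the actions commute (i.e. an $\mathbb{H}\times\mathbb{G}$-object), and such that (i)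 $(d,\pi_2):G_1\times_{G_0}P\to P\times_{H_0}P$ is an isomorphism, (ii) $p$ is an effective descent morphism. Morphisms are maps that are both $\mathbb{H}$- and $\mathbb{G}$-homomorphisms. The map $\mathfrak{P}_{L,R}$: given a stably Frobenius adjunction $L\dashv R:[\mathbb{H},\mathcal{C}]\rightleftarrows[\mathbb{G},\mathcal{C}]$ over $\mathcal{C}$, write $(P_p,c)=R\mathbb{T}_{\mathbb{G}}1$ and $(Q_q,d)=L\mathbb{T}_{\mathbb{H}}1$. There is a canonical isomorphism $\psi:P\to Q$, the composite $P\cong\Sigma_{\mathbb{H}}(\mathbb{T}_{\mathbb{H}}1\times R\mathbb{T}_{\mathbb{G}}1)\cong\Sigma_{\mathbb{G}}L(\mathbb{T}_{\mathbb{H}}1\times R\mathbb{T}_{\mathbb{G}}1)\cong\Sigma_{\mathbb{G}}(L\mathbb{T}_{\mathbb{H}}1\times\mathbb{T}_{\mathbb{G}}1)\cong Q$; here the outer isomorphisms are instances of $X\cong\Sigma_{\mathbb{G}}\mathbb{T}_{\mathbb{G}}U_{\mathbb{G}}(X_f,a)\cong\Sigma_{\mathbb{G}}(\mathbb{T}_{\mathbb{G}}1\times(X_f,a))$ (and similarly for $\mathbb{H}$), the second is from $L\dashv R$ being over $\mathcal{C}$ and the third is Frobenius reciprocity. Then $\mathfrak{P}_{L,R}=(P_{(p,q\psi)},\ c,\ \psi^{-1}d(\mathrm{Id}_{G_1}\times\psi))$, which is a Hilsum-Skandalis map. *)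

theory Defs
  imports Main
begin

section \<open>Categories, functors, natural transformations, adjunctions\<close>

text \<open>
  Arrows know their domain and codomain. \<open>g \<cdot>\<^bsub>C\<^esub> f\<close> is "first \<open>f\<close>, then \<open>g\<close>" and is meaningful
  only for composable arrows of \<open>C\<close>.
\<close>

record ('o, 'm) cat =
  Obj :: "'o set"
  Arr :: "'m set"
  Dom :: "'m \<Rightarrow> 'o"
  Cod :: "'m \<Rightarrow> 'o"
  Id :: "'o \<Rightarrow> 'm"
  Comp :: "'m \<Rightarrow> 'm \<Rightarrow> 'm"  (infixl \<open>\<cdot>\<index>\<close> 70)

definition hom :: "('o, 'm) cat \<Rightarrow> 'o \<Rightarrow> 'o \<Rightarrow> 'm set" where
  "hom C A B = {f \<in> Arr C. Dom C f = A \<and> Cod C f = B}"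

definition category :: "('o, 'm) cat \<Rightarrow> bool" where
  "category C \<longleftrightarrow>
     (\<forall>f\<in>Arr C. Dom C f \<in> Obj C \<and> Cod C f \<in> Obj C) \<and>
     (\<forall>A\<in>Obj C. Id C A \<in> hom C A A) \<and>
     (\<forall>f\<in>Arr C. \<forall>g\<in>Arr C. Cod C f = Dom C g \<longrightarrow> g \<cdot>\<^bsub>C\<^esub> f \<in> hom C (Dom C f) (Cod C g)) \<and>
     (\<forall>f\<in>Arr C. f \<cdot>\<^bsub>C\<^esub> Id C (Dom C f) = f \<and> Id C (Cod C f) \<cdot>\<^bsub>C\<^esub> f = f) \<and>
     (\<forall>f\<in>Arr C. \<forall>g\<in>Arr C. \<forall>h\<in>Arr C. Cod C f = Dom C g \<and> Cod C g = Dom C h \<longrightarrow>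
        h \<cdot>\<^bsub>C\<^esub> (g \<cdot>\<^bsub>C\<^esub> f) = (h \<cdot>\<^bsub>C\<^esub> g) \<cdot>\<^bsub>C\<^esub> f)"

definition is_inverse :: "('o, 'm) cat \<Rightarrow> 'm \<Rightarrow> 'm \<Rightarrow> bool" where
  "is_inverse C f g \<longleftrightarrow>
     f \<in> Arr C \<and> g \<in> hom C (Cod C f) (Dom C f) \<and>
     g \<cdot>\<^bsub>C\<^esub> f = Id C (Dom C f) \<and> f \<cdot>\<^bsub>C\<^esub> g = Id C (Cod C f)"

definition iso :: "('o, 'm) cat \<Rightarrow> 'm \<Rightarrow> bool" where
  "iso C f \<longleftrightarrow> (\<exists>g. is_inverse C f g)"

definition inv_arr :: "('o, 'm) cat \<Rightarrow> 'm \<Rightarrow> 'm" where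
  "inv_arr C f = (THE g. is_inverse C f g)"

definition isomorphic :: "('o, 'm) cat \<Rightarrow> 'o \<Rightarrow> 'o \<Rightarrow> bool" where
  "isomorphic C A B \<longleftrightarrow> (\<exists>f\<in>hom C A B. iso C f)"

record ('o1, 'm1, 'o2, 'm2) func =
  FO :: "'o1 \<Rightarrow> 'o2"
  FA :: "'m1 \<Rightarrow> 'm2"

definition is_functor ::
  "('o1, 'm1) cat \<Rightarrow> ('o2, 'm2) cat \<Rightarrow> ('o1, 'm1, 'o2, 'm2) func \<Rightarrow> bool" where
  "is_functor C D F \<longleftrightarrow>
     (\<forall>A\<in>Obj C. FO F A \<in> Obj D) \<and>
     (\<forall>f\<in>Arr C. FA F f \<in> hom D (FO F (Dom C f)) (FO F (Cod C f))) \<and>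
     (\<forall>A\<in>Obj C. FA F (Id C A) = Id D (FO F A)) \<and>
     (\<forall>f\<in>Arr C. \<forall>g\<in>Arr C. Cod C f = Dom C g \<longrightarrow> FA F (g \<cdot>\<^bsub>C\<^esub> f) = FA F g \<cdot>\<^bsub>D\<^esub> FA F f)"

definition id_func :: "('o, 'm, 'o, 'm) func" where
  "id_func = \<lparr>FO = (\<lambda>A. A), FA = (\<lambda>f. f)\<rparr>"

definition comp_func ::
  "('o2, 'm2, 'o3, 'm3) func \<Rightarrow> ('o1, 'm1, 'o2, 'm2) func \<Rightarrow> ('o1, 'm1, 'o3, 'm3) func"
  (infixl \<open>\<circ>F\<close> 55) where
  "G \<circ>F F = \<lparr>FO = (\<lambda>A. FO G (FO F A)), FA = (\<lambda>f. FA G (FA F f))\<rparr>"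

definition nat_trans ::
  "('o1, 'm1) cat \<Rightarrow> ('o2, 'm2) cat \<Rightarrow> ('o1, 'm1, 'o2, 'm2) func \<Rightarrow> ('o1, 'm1, 'o2, 'm2) func \<Rightarrow>
   ('o1 \<Rightarrow> 'm2) \<Rightarrow> bool" where
  "nat_trans C D F F' \<tau> \<longleftrightarrow>
     is_functor C D F \<and> is_functor C D F' \<and>
     (\<forall>A\<in>Obj C. \<tau> A \<in> hom D (FO F A) (FO F' A)) \<and>
     (\<forall>f\<in>Arr C. FA F' f \<cdot>\<^bsub>D\<^esub> \<tau> (Dom C f) = \<tau> (Cod C f) \<cdot>\<^bsub>D\<^esub> FA F f)"

definition nat_iso ::
  "('o1, 'm1) cat \<Rightarrow> ('o2, 'm2) cat \<Rightarrow> ('o1, 'm1, 'o2, 'm2) func \<Rightarrow> ('o1, 'm1, 'o2, 'm2) func \<Rightarrow>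
   ('o1 \<Rightarrow> 'm2) \<Rightarrow> bool" where
  "nat_iso C D F F' \<tau> \<longleftrightarrow> nat_trans C D F F' \<tau> \<and> (\<forall>A\<in>Obj C. iso D (\<tau> A))"

definition is_equivalence ::
  "('o1, 'm1) cat \<Rightarrow> ('o2, 'm2) cat \<Rightarrow> ('o1, 'm1, 'o2, 'm2) func \<Rightarrow> bool" where
  "is_equivalence C D F \<longleftrightarrow>
     is_functor C D F \<and>
     (\<exists>F' \<sigma> \<tau>. is_functor D C F' \<and> nat_iso C C (F' \<circ>F F) id_func \<sigma> \<and> nat_iso D D (F \<circ>F F') id_func \<tau>)"

text \<open>
  \<open>adjunction D C J\<close>: \<open>Ladj J : D \<rightarrow> C\<close> is left adjoint to \<open>Radj J : C \<rightarrow> D\<close>.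
\<close>

record ('o1, 'm1, 'o2, 'm2) adj =
  Ladj :: "('o1, 'm1, 'o2, 'm2) func"
  Radj :: "('o2, 'm2, 'o1, 'm1) func"
  unit :: "'o1 \<Rightarrow> 'm1"
  counit :: "'o2 \<Rightarrow> 'm2"

definition adjunction ::
  "('o1, 'm1) cat \<Rightarrow> ('o2, 'm2) cat \<Rightarrow> ('o1, 'm1, 'o2, 'm2) adj \<Rightarrow> bool" where
  "adjunction D C J \<longleftrightarrow>
     is_functor D C (Ladj J) \<and> is_functor C D (Radj J) \<and>
     nat_trans D D id_func (Radj J \<circ>F Ladj J) (unit J) \<and>
     nat_trans C C (Ladj J \<circ>F Radj J) id_func (counit J) \<and>
     (\<forall>W\<in>Obj D. counit J (FO (Ladj J) W) \<cdot>\<^bsub>C\<^esub> FA (Ladj J) (unit J W) = Id C (FO (Ladj J) W)) \<and>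
     (\<forall>X\<in>Obj C. FA (Radj J) (counit J X) \<cdot>\<^bsub>D\<^esub> unit J (FO (Radj J) X) = Id D (FO (Radj J) X))"

text \<open>
  Slices, Eilenberg--Moore categories, categories of actions, and the category of
  Hilsum--Skandalis maps all consist of structures \<open>X\<close> with an underlying object \<open>u X\<close> of \<open>C\<close>,
  and of the arrows of \<open>C\<close> between underlying objects that satisfy a condition \<open>Q\<close>. An arrow is
  tagged with the structures at its two ends, so that domain and codomain are determined.
\<close>

definition structure_cat ::
  "('o, 'm) cat \<Rightarrow> 's set \<Rightarrow> ('s \<Rightarrow> 'o) \<Rightarrow> ('s \<Rightarrow> 'm \<Rightarrow> 's \<Rightarrow> bool) \<Rightarrow> ('s, 's \<times> 'm \<times> 's) cat" where
  "structure_cat C S u Q =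
     \<lparr>Obj = S,
      Arr = {(X, h, Y). X \<in> S \<and> Y \<in> S \<and> h \<in> hom C (u X) (u Y) \<and> Q X h Y},
      Dom = (\<lambda>(X, h, Y). X),
      Cod = (\<lambda>(X, h, Y). Y),
      Id = (\<lambda>X. (X, Id C (u X), X)),
      Comp = (\<lambda>(Y', k, Z) (X, h, Y). (X, k \<cdot>\<^bsub>C\<^esub> h, Z))\<rparr>"


section \<open>Finite limits\<close>

definition is_cone ::
  "('j, 'a) cat \<Rightarrow> ('o, 'm) cat \<Rightarrow> ('j, 'a, 'o, 'm) func \<Rightarrow> 'o \<Rightarrow> ('j \<Rightarrow> 'm) \<Rightarrow> bool" where
  "is_cone J C D A \<pi> \<longleftrightarrow>
     A \<in> Obj C \<and> (\<forall>j\<in>Obj J. \<pi> j \<in> hom C A (FO D j)) \<and>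
     (\<forall>u\<in>Arr J. FA D u \<cdot>\<^bsub>C\<^esub> \<pi> (Dom J u) = \<pi> (Cod J u))"

definition is_limit ::
  "('j, 'a) cat \<Rightarrow> ('o, 'm) cat \<Rightarrow> ('j, 'a, 'o, 'm) func \<Rightarrow> 'o \<Rightarrow> ('j \<Rightarrow> 'm) \<Rightarrow> bool" where
  "is_limit J C D A \<pi> \<longleftrightarrow>
     is_cone J C D A \<pi> \<and>
     (\<forall>B \<rho>. is_cone J C D B \<rho> \<longrightarrow> (\<exists>!h. h \<in> hom C B A \<and> (\<forall>j\<in>Obj J. \<pi> j \<cdot>\<^bsub>C\<^esub> h = \<rho> j)))"

text \<open>
  Every finite category is isomorphic to one whose objects and arrows are natural numbers, so
  these suffice as diagram shapes.
\<close>

definition has_finite_limits :: "('o, 'm) cat \<Rightarrow> bool" where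
  "has_finite_limits C \<longleftrightarrow>
     (\<forall>(J :: (nat, nat) cat) D.
        category J \<and> finite (Obj J) \<and> finite (Arr J) \<and> is_functor J C D \<longrightarrow>
        (\<exists>A \<pi>. is_limit J C D A \<pi>))"

text \<open>
  Binary products and pullbacks are chosen once and for all by Hilbert choice. The product of
  \<open>A\<close> and \<open>B\<close> has projections \<open>pr1 C A B\<close>, \<open>pr2 C A B\<close>. The pullback of \<open>f\<close> and \<open>g\<close> has
  projections \<open>pb1 C f g\<close> to the domain of \<open>f\<close> and \<open>pb2 C f g\<close> to the domain of \<open>g\<close>.
\<close>

definition is_product :: "('o, 'm) cat \<Rightarrow> 'o \<Rightarrow> 'o \<Rightarrow> 'm \<Rightarrow> 'm \<Rightarrow> bool" where
  "is_product C A B p q \<longleftrightarrow>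
     p \<in> hom C (Dom C p) A \<and> q \<in> hom C (Dom C p) B \<and>
     (\<forall>T. \<forall>f\<in>hom C T A. \<forall>g\<in>hom C T B.
        \<exists>!h. h \<in> hom C T (Dom C p) \<and> p \<cdot>\<^bsub>C\<^esub> h = f \<and> q \<cdot>\<^bsub>C\<^esub> h = g)"

definition prod_cone :: "('o, 'm) cat \<Rightarrow> 'o \<Rightarrow> 'o \<Rightarrow> 'm \<times> 'm" where
  "prod_cone C A B = (SOME s. is_product C A B (fst s) (snd s))"

definition pr1 :: "('o, 'm) cat \<Rightarrow> 'o \<Rightarrow> 'o \<Rightarrow> 'm" where
  "pr1 C A B = fst (prod_cone C A B)"

definition pr2 :: "('o, 'm) cat \<Rightarrow> 'o \<Rightarrow> 'o \<Rightarrow> 'm" where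
  "pr2 C A B = snd (prod_cone C A B)"

definition prod_obj :: "('o, 'm) cat \<Rightarrow> 'o \<Rightarrow> 'o \<Rightarrow> 'o" where
  "prod_obj C A B = Dom C (pr1 C A B)"

definition prod_pair :: "('o, 'm) cat \<Rightarrow> 'm \<Rightarrow> 'm \<Rightarrow> 'm" where
  "prod_pair C f g =
     (THE h. h \<in> hom C (Dom C f) (prod_obj C (Cod C f) (Cod C g)) \<and>
             pr1 C (Cod C f) (Cod C g) \<cdot>\<^bsub>C\<^esub> h = f \<and> pr2 C (Cod C f) (Cod C g) \<cdot>\<^bsub>C\<^esub> h = g)"

definition prod_swap :: "('o, 'm) cat \<Rightarrow> 'o \<Rightarrow> 'o \<Rightarrow> 'm" where
  "prod_swap C A B = prod_pair C (pr2 C A B) (pr1 C A B)"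

definition is_pullback :: "('o, 'm) cat \<Rightarrow> 'm \<Rightarrow> 'm \<Rightarrow> 'm \<Rightarrow> 'm \<Rightarrow> bool" where
  "is_pullback C f g p q \<longleftrightarrow>
     p \<in> hom C (Dom C p) (Dom C f) \<and> q \<in> hom C (Dom C p) (Dom C g) \<and> f \<cdot>\<^bsub>C\<^esub> p = g \<cdot>\<^bsub>C\<^esub> q \<and>
     (\<forall>T. \<forall>u\<in>hom C T (Dom C f). \<forall>v\<in>hom C T (Dom C g). f \<cdot>\<^bsub>C\<^esub> u = g \<cdot>\<^bsub>C\<^esub> v \<longrightarrow>
        (\<exists>!h. h \<in> hom C T (Dom C p) \<and> p \<cdot>\<^bsub>C\<^esub> h = u \<and> q \<cdot>\<^bsub>C\<^esub> h = v))"

definition pb_cone :: "('o, 'm) cat \<Rightarrow> 'm \<Rightarrow> 'm \<Rightarrow> 'm \<times> 'm" where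
  "pb_cone C f g = (SOME s. is_pullback C f g (fst s) (snd s))"

definition pb1 :: "('o, 'm) cat \<Rightarrow> 'm \<Rightarrow> 'm \<Rightarrow> 'm" where
  "pb1 C f g = fst (pb_cone C f g)"

definition pb2 :: "('o, 'm) cat \<Rightarrow> 'm \<Rightarrow> 'm \<Rightarrow> 'm" where
  "pb2 C f g = snd (pb_cone C f g)"

definition pb_obj :: "('o, 'm) cat \<Rightarrow> 'm \<Rightarrow> 'm \<Rightarrow> 'o" where
  "pb_obj C f g = Dom C (pb1 C f g)"

text \<open>\<open>pb_pair C f g u v\<close> is the arrow \<open>(u, v)\<close> into the pullback of \<open>f\<close> and \<open>g\<close>.\<close>

definition pb_pair :: "('o, 'm) cat \<Rightarrow> 'm \<Rightarrow> 'm \<Rightarrow> 'm \<Rightarrow> 'm \<Rightarrow> 'm" where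
  "pb_pair C f g u v =
     (THE h. h \<in> hom C (Dom C u) (pb_obj C f g) \<and> pb1 C f g \<cdot>\<^bsub>C\<^esub> h = u \<and> pb2 C f g \<cdot>\<^bsub>C\<^esub> h = v)"


section \<open>Slices and (stably) Frobenius adjunctions\<close>

definition slice :: "('o, 'm) cat \<Rightarrow> 'o \<Rightarrow> ('m, 'm \<times> 'm \<times> 'm) cat" where
  "slice C X = structure_cat C {f \<in> Arr C. Cod C f = X} (Dom C) (\<lambda>f h g. g \<cdot>\<^bsub>C\<^esub> h = f)"

text \<open>The canonical map \<open>L(W \<times> R X) \<rightarrow> L W \<times> X\<close> of an adjunction \<open>J : D \<rightleftarrows> C\<close>.\<close>

definition frob_map ::
  "('o1, 'm1) cat \<Rightarrow> ('o2, 'm2) cat \<Rightarrow> ('o1, 'm1, 'o2, 'm2) adj \<Rightarrow> 'o1 \<Rightarrow> 'o2 \<Rightarrow> 'm2" where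
  "frob_map D C J W X =
     prod_pair C (FA (Ladj J) (pr1 D W (FO (Radj J) X)))
                 (counit J X \<cdot>\<^bsub>C\<^esub> FA (Ladj J) (pr2 D W (FO (Radj J) X)))"

definition frobenius ::
  "('o1, 'm1) cat \<Rightarrow> ('o2, 'm2) cat \<Rightarrow> ('o1, 'm1, 'o2, 'm2) adj \<Rightarrow> bool" where
  "frobenius D C J \<longleftrightarrow> (\<forall>W\<in>Obj D. \<forall>X\<in>Obj C. iso C (frob_map D C J W X))"

definition adj_transpose ::
  "('o1, 'm1) cat \<Rightarrow> ('o2, 'm2) cat \<Rightarrow> ('o1, 'm1, 'o2, 'm2) adj \<Rightarrow> 'o2 \<Rightarrow> 'm1 \<Rightarrow> 'm2" where
  "adj_transpose D C J X g = counit J X \<cdot>\<^bsub>C\<^esub> FA (Ladj J) g"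

text \<open>
  The adjunction between \<open>slice D (R X)\<close> and \<open>slice C X\<close>; its unit and counit have those of \<open>J\<close>
  as underlying arrows.
\<close>

definition sliced_adj ::
  "('o1, 'm1) cat \<Rightarrow> ('o2, 'm2) cat \<Rightarrow> ('o1, 'm1, 'o2, 'm2) adj \<Rightarrow> 'o2 \<Rightarrow>
   ('m1, 'm1 \<times> 'm1 \<times> 'm1, 'm2, 'm2 \<times> 'm2 \<times> 'm2) adj" where
  "sliced_adj D C J X =
     \<lparr>Ladj = \<lparr>FO = adj_transpose D C J X,
              FA = (\<lambda>(g, h, g'). (adj_transpose D C J X g, FA (Ladj J) h, adj_transpose D C J X g'))\<rparr>,
      Radj = \<lparr>FO = FA (Radj J),
              FA = (\<lambda>(f, h, f'). (FA (Radj J) f, FA (Radj J) h, FA (Radj J) f'))\<rparr>,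
      unit = (\<lambda>g. (g, unit J (Dom D g), FA (Radj J) (adj_transpose D C J X g))),
      counit = (\<lambda>f. (adj_transpose D C J X (FA (Radj J) f), counit J (Dom C f), f))\<rparr>"

definition stably_frobenius ::
  "('o1, 'm1) cat \<Rightarrow> ('o2, 'm2) cat \<Rightarrow> ('o1, 'm1, 'o2, 'm2) adj \<Rightarrow> bool" where
  "stably_frobenius D C J \<longleftrightarrow>
     (\<forall>X\<in>Obj C. frobenius (slice D (FO (Radj J) X)) (slice C X) (sliced_adj D C J X))"


section \<open>Monadicity and effective descent\<close>

text \<open>Algebras of the monad \<open>(T, \<eta>, \<mu>)\<close> on \<open>B\<close>; the structure map is an arrow \<open>T X \<rightarrow> X\<close>.\<close>

definition em_cat ::
  "('o, 'm) cat \<Rightarrow> ('o, 'm, 'o, 'm) func \<Rightarrow> ('o \<Rightarrow> 'm) \<Rightarrow> ('o \<Rightarrow> 'm) \<Rightarrow>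
   ('o \<times> 'm, ('o \<times> 'm) \<times> 'm \<times> ('o \<times> 'm)) cat" where
  "em_cat B T \<eta> \<mu> =
     structure_cat B
       {(X, \<xi>). X \<in> Obj B \<and> \<xi> \<in> hom B (FO T X) X \<and>
                \<xi> \<cdot>\<^bsub>B\<^esub> \<eta> X = Id B X \<and> \<xi> \<cdot>\<^bsub>B\<^esub> FA T \<xi> = \<xi> \<cdot>\<^bsub>B\<^esub> \<mu> X}
       fst
       (\<lambda>(X, \<xi>) h (Y, \<zeta>). h \<cdot>\<^bsub>B\<^esub> \<xi> = \<zeta> \<cdot>\<^bsub>B\<^esub> FA T h)"

definition em_of_adj ::
  "('o1, 'm1) cat \<Rightarrow> ('o1, 'm1, 'o2, 'm2) adj \<Rightarrow>
   ('o1 \<times> 'm1, ('o1 \<times> 'm1) \<times> 'm1 \<times> ('o1 \<times> 'm1)) cat" where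
  "em_of_adj B J =
     em_cat B (Radj J \<circ>F Ladj J) (unit J) (\<lambda>X. FA (Radj J) (counit J (FO (Ladj J) X)))"

definition comparison ::
  "('o2, 'm2) cat \<Rightarrow> ('o1, 'm1, 'o2, 'm2) adj \<Rightarrow>
   ('o2, 'm2, 'o1 \<times> 'm1, ('o1 \<times> 'm1) \<times> 'm1 \<times> ('o1 \<times> 'm1)) func" where
  "comparison A J =
     (let K = (\<lambda>Y. (FO (Radj J) Y, FA (Radj J) (counit J Y)))
      in \<lparr>FO = K, FA = (\<lambda>h. (K (Dom A h), FA (Radj J) h, K (Cod A h)))\<rparr>)"

definition monadic ::
  "('o2, 'm2) cat \<Rightarrow> ('o1, 'm1) cat \<Rightarrow> ('o2, 'm2, 'o1, 'm1) func \<Rightarrow> bool" where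
  "monadic A B U \<longleftrightarrow>
     (\<exists>J. adjunction B A J \<and> Radj J = U \<and> is_equivalence A (em_of_adj B J) (comparison A J))"

definition pullback_functor ::
  "('o, 'm) cat \<Rightarrow> 'm \<Rightarrow> ('m, 'm \<times> 'm \<times> 'm, 'm, 'm \<times> 'm \<times> 'm) func" where
  "pullback_functor C f =
     \<lparr>FO = pb1 C f,
      FA = (\<lambda>(g, h, g'). (pb1 C f g, pb_pair C f g' (pb1 C f g) (h \<cdot>\<^bsub>C\<^esub> pb2 C f g), pb1 C f g'))\<rparr>"

definition effective_descent :: "('o, 'm) cat \<Rightarrow> 'm \<Rightarrow> bool" where
  "effective_descent C f \<longleftrightarrow>
     f \<in> Arr C \<and> monadic (slice C (Cod C f)) (slice C (Dom C f)) (pullback_functor C f)"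


section \<open>Internal groupoids and their actions\<close>

text \<open>
  Laws between arrows out of (iterated) pullbacks are stated for generalized elements, that is,
  for arrows \<open>x \<in> hom C T X\<close> with arbitrary domain \<open>T\<close>.
\<close>

record ('o, 'm) igpd =
  G0 :: 'o
  G1 :: 'o
  d0 :: 'm
  d1 :: 'm
  gm :: 'm
  ge :: 'm
  gi :: 'm

text \<open>The product \<open>g1 g2\<close> is defined when \<open>d0 g1 = d1 g2\<close>: read \<open>d0\<close> as source, \<open>d1\<close> as target.\<close>

definition gmul :: "('o, 'm) cat \<Rightarrow> ('o, 'm) igpd \<Rightarrow> 'm \<Rightarrow> 'm \<Rightarrow> 'm" where
  "gmul C G g1 g2 = gm G \<cdot>\<^bsub>C\<^esub> pb_pair C (d0 G) (d1 G) g1 g2"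

definition internal_groupoid :: "('o, 'm) cat \<Rightarrow> ('o, 'm) igpd \<Rightarrow> bool" where
  "internal_groupoid C G \<longleftrightarrow>
     G0 G \<in> Obj C \<and> G1 G \<in> Obj C \<and>
     d0 G \<in> hom C (G1 G) (G0 G) \<and> d1 G \<in> hom C (G1 G) (G0 G) \<and>
     gm G \<in> hom C (pb_obj C (d0 G) (d1 G)) (G1 G) \<and>
     ge G \<in> hom C (G0 G) (G1 G) \<and> gi G \<in> hom C (G1 G) (G1 G) \<and>
     d0 G \<cdot>\<^bsub>C\<^esub> ge G = Id C (G0 G) \<and> d1 G \<cdot>\<^bsub>C\<^esub> ge G = Id C (G0 G) \<and>
     d0 G \<cdot>\<^bsub>C\<^esub> gi G = d1 G \<and> d1 G \<cdot>\<^bsub>C\<^esub> gi G = d0 G \<and>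
     d0 G \<cdot>\<^bsub>C\<^esub> gm G = d0 G \<cdot>\<^bsub>C\<^esub> pb2 C (d0 G) (d1 G) \<and>
     d1 G \<cdot>\<^bsub>C\<^esub> gm G = d1 G \<cdot>\<^bsub>C\<^esub> pb1 C (d0 G) (d1 G) \<and>
     (\<forall>T. \<forall>a\<in>hom C T (G1 G). \<forall>b\<in>hom C T (G1 G). \<forall>c\<in>hom C T (G1 G).
        d0 G \<cdot>\<^bsub>C\<^esub> a = d1 G \<cdot>\<^bsub>C\<^esub> b \<and> d0 G \<cdot>\<^bsub>C\<^esub> b = d1 G \<cdot>\<^bsub>C\<^esub> c \<longrightarrow>
        gmul C G (gmul C G a b) c = gmul C G a (gmul C G b c)) \<and>
     (\<forall>T. \<forall>a\<in>hom C T (G1 G).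
        gmul C G a (ge G \<cdot>\<^bsub>C\<^esub> (d0 G \<cdot>\<^bsub>C\<^esub> a)) = a \<and>
        gmul C G (ge G \<cdot>\<^bsub>C\<^esub> (d1 G \<cdot>\<^bsub>C\<^esub> a)) a = a \<and>
        gmul C G a (gi G \<cdot>\<^bsub>C\<^esub> a) = ge G \<cdot>\<^bsub>C\<^esub> (d1 G \<cdot>\<^bsub>C\<^esub> a) \<and>
        gmul C G (gi G \<cdot>\<^bsub>C\<^esub> a) a = ge G \<cdot>\<^bsub>C\<^esub> (d0 G \<cdot>\<^bsub>C\<^esub> a))"

text \<open>\<open>act C G f a g x\<close> is \<open>a(g, x)\<close>, for \<open>a\<close> an arrow out of the pullback of \<open>d0\<close> and \<open>f\<close>.\<close>

definition act :: "('o, 'm) cat \<Rightarrow> ('o, 'm) igpd \<Rightarrow> 'm \<Rightarrow> 'm \<Rightarrow> 'm \<Rightarrow> 'm \<Rightarrow> 'm" where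
  "act C G f a g x = a \<cdot>\<^bsub>C\<^esub> pb_pair C (d0 G) f g x"

definition is_gobj :: "('o, 'm) cat \<Rightarrow> ('o, 'm) igpd \<Rightarrow> 'm \<Rightarrow> 'm \<Rightarrow> bool" where
  "is_gobj C G f a \<longleftrightarrow>
     f \<in> hom C (Dom C f) (G0 G) \<and> a \<in> hom C (pb_obj C (d0 G) f) (Dom C f) \<and>
     f \<cdot>\<^bsub>C\<^esub> a = d1 G \<cdot>\<^bsub>C\<^esub> pb1 C (d0 G) f \<and>
     (\<forall>T. \<forall>x\<in>hom C T (Dom C f). act C G f a (ge G \<cdot>\<^bsub>C\<^esub> (f \<cdot>\<^bsub>C\<^esub> x)) x = x) \<and>
     (\<forall>T. \<forall>g1\<in>hom C T (G1 G). \<forall>g2\<in>hom C T (G1 G). \<forall>x\<in>hom C T (Dom C f).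
        d0 G \<cdot>\<^bsub>C\<^esub> g1 = d1 G \<cdot>\<^bsub>C\<^esub> g2 \<and> d0 G \<cdot>\<^bsub>C\<^esub> g2 = f \<cdot>\<^bsub>C\<^esub> x \<longrightarrow>
        act C G f a g1 (act C G f a g2 x) = act C G f a (gmul C G g1 g2) x)"

definition equivariant ::
  "('o, 'm) cat \<Rightarrow> ('o, 'm) igpd \<Rightarrow> 'm \<times> 'm \<Rightarrow> 'm \<Rightarrow> 'm \<times> 'm \<Rightarrow> bool" where
  "equivariant C G = (\<lambda>(f, a) h (f', a').
     f' \<cdot>\<^bsub>C\<^esub> h = f \<and> h \<cdot>\<^bsub>C\<^esub> a = act C G f' a' (pb1 C (d0 G) f) (h \<cdot>\<^bsub>C\<^esub> pb2 C (d0 G) f))"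

text \<open>The category \<open>[G, C]\<close>.\<close>

definition gcat ::
  "('o, 'm) cat \<Rightarrow> ('o, 'm) igpd \<Rightarrow> ('m \<times> 'm, ('m \<times> 'm) \<times> 'm \<times> ('m \<times> 'm)) cat" where
  "gcat C G =
     structure_cat C {(f, a). is_gobj C G f a} (\<lambda>(f, a). Dom C f) (equivariant C G)"

text \<open>The functor \<open>G\<^sup>*\<close>: trivial actions \<open>(g, (y, x)) \<mapsto> (d1 g, x)\<close> on \<open>G0 \<times> X\<close>.\<close>

definition star_obj :: "('o, 'm) cat \<Rightarrow> ('o, 'm) igpd \<Rightarrow> 'o \<Rightarrow> 'm \<times> 'm" where
  "star_obj C G X =
     (let f = pr1 C (G0 G) X
      in (f, prod_pair C (d1 G \<cdot>\<^bsub>C\<^esub> pb1 C (d0 G) f) (pr2 C (G0 G) X \<cdot>\<^bsub>C\<^esub> pb2 C (d0 G) f)))"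

definition star ::
  "('o, 'm) cat \<Rightarrow> ('o, 'm) igpd \<Rightarrow> ('o, 'm, 'm \<times> 'm, ('m \<times> 'm) \<times> 'm \<times> ('m \<times> 'm)) func" where
  "star C G =
     \<lparr>FO = star_obj C G,
      FA = (\<lambda>h. (star_obj C G (Dom C h),
                 prod_pair C (pr1 C (G0 G) (Dom C h)) (h \<cdot>\<^bsub>C\<^esub> pr2 C (G0 G) (Dom C h)),
                 star_obj C G (Cod C h)))\<rparr>"

type_synonym ('o, 'm) sigma_adj = "('m \<times> 'm, ('m \<times> 'm) \<times> 'm \<times> ('m \<times> 'm), 'o, 'm) adj"

text \<open>
  \<open>S\<close> is a choice of adjunction \<open>\<Sigma>\<^sub>G \<stileturn> G\<^sup>*\<close>; \<open>\<Sigma>\<^sub>G\<close> is \<open>Ladj S\<close>.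
\<close>

definition stably_frobenius_groupoid ::
  "('o, 'm) cat \<Rightarrow> ('o, 'm) igpd \<Rightarrow> ('o, 'm) sigma_adj \<Rightarrow> bool" where
  "stably_frobenius_groupoid C G S \<longleftrightarrow>
     internal_groupoid C G \<and>
     adjunction (gcat C G) C S \<and> Radj S = star C G \<and> stably_frobenius (gcat C G) C S"

type_synonym 'm gcat_adj =
  "('m \<times> 'm, ('m \<times> 'm) \<times> 'm \<times> ('m \<times> 'm), 'm \<times> 'm, ('m \<times> 'm) \<times> 'm \<times> ('m \<times> 'm)) adj"

text \<open>\<open>\<theta>\<close> is a natural isomorphism \<open>\<Sigma>\<^sub>G L \<cong> \<Sigma>\<^sub>H\<close>.\<close>

definition over_base ::
  "('o, 'm) cat \<Rightarrow> ('o, 'm) igpd \<Rightarrow> ('o, 'm) sigma_adj \<Rightarrow> ('o, 'm) sigma_adj \<Rightarrow> 'm gcat_adj \<Rightarrow>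
   ('m \<times> 'm \<Rightarrow> 'm) \<Rightarrow> bool" where
  "over_base C H SH SG J \<theta> \<longleftrightarrow> nat_iso (gcat C H) C (Ladj SG \<circ>F Ladj J) (Ladj SH) \<theta>"


section \<open>Free actions and the isomorphism between \<open>\<Sigma>\<^sub>G(T\<^sub>G 1 \<times> X)\<close> and the carrier of \<open>X\<close>\<close>

text \<open>
  \<open>free_gobj C G f\<close> is the free action on \<open>f : X \<rightarrow> G0\<close>, carried by the pullback of \<open>d0\<close> and \<open>f\<close>:
  \<open>g' (g, x) = (g' g, x)\<close>. For the terminal object of the slice over \<open>G0\<close> the carrier is
  identified with \<open>G1\<close>.
\<close>

definition free_gobj :: "('o, 'm) cat \<Rightarrow> ('o, 'm) igpd \<Rightarrow> 'm \<Rightarrow> 'm \<times> 'm" where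
  "free_gobj C G f =
     (let p = pb1 C (d0 G) f; x = pb2 C (d0 G) f; t = d1 G \<cdot>\<^bsub>C\<^esub> p;
          g' = pb1 C (d0 G) t; y = pb2 C (d0 G) t
      in (t, pb_pair C (d0 G) f (gmul C G g' (p \<cdot>\<^bsub>C\<^esub> y)) (x \<cdot>\<^bsub>C\<^esub> y)))"

definition free_one :: "('o, 'm) igpd \<Rightarrow> 'm \<times> 'm" where
  "free_one G = (d1 G, gm G)"

text \<open>
  The isomorphism \<open>T\<^sub>G U\<^sub>G X \<rightarrow> T\<^sub>G 1 \<times> X\<close>, \<open>(g, x) \<mapsto> (g, a(g, x))\<close>. Its components are the image under
  \<open>T\<^sub>G\<close> of the map from \<open>U\<^sub>G X\<close> to the terminal object, and the counit of \<open>T\<^sub>G \<stileturn> U\<^sub>G\<close>, whose underlying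
  arrow is the action itself.
\<close>

definition free_to_prod ::
  "('o, 'm) cat \<Rightarrow> ('o, 'm) igpd \<Rightarrow> 'm \<times> 'm \<Rightarrow> ('m \<times> 'm) \<times> 'm \<times> ('m \<times> 'm)" where
  "free_to_prod C G = (\<lambda>(f, a).
     prod_pair (gcat C G)
       (free_gobj C G f, pb1 C (d0 G) f, free_one G)
       (free_gobj C G f, a, (f, a)))"

text \<open>
  The isomorphism \<open>\<Sigma>\<^sub>G T\<^sub>G U\<^sub>G X \<rightarrow> X\<close>. Both \<open>\<Sigma>\<^sub>G T\<^sub>G\<close> and the domain functor from the slice over \<open>G0\<close>
  are left adjoint to \<open>X \<mapsto> (G0 \<times> X \<rightarrow> G0)\<close>; the isomorphism is the transpose under \<open>\<Sigma>\<^sub>G \<stileturn> G\<^sup>*\<close> of the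
  map \<open>T\<^sub>G U\<^sub>G X \<rightarrow> G\<^sup>* X\<close>, \<open>(g, x) \<mapsto> (d1 g, x)\<close>, which corresponds under \<open>T\<^sub>G \<stileturn> U\<^sub>G\<close> to
  \<open>(f, 1) : X \<rightarrow> G0 \<times> X\<close>.
\<close>

definition free_to_star ::
  "('o, 'm) cat \<Rightarrow> ('o, 'm) igpd \<Rightarrow> 'm \<Rightarrow> ('m \<times> 'm) \<times> 'm \<times> ('m \<times> 'm)" where
  "free_to_star C G f =
     (free_gobj C G f,
      prod_pair C (d1 G \<cdot>\<^bsub>C\<^esub> pb1 C (d0 G) f) (pb2 C (d0 G) f),
      star_obj C G (Dom C f))"

definition sigma_free :: "('o, 'm) cat \<Rightarrow> ('o, 'm) igpd \<Rightarrow> ('o, 'm) sigma_adj \<Rightarrow> 'm \<Rightarrow> 'm" where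
  "sigma_free C G S f = adj_transpose (gcat C G) C S (Dom C f) (free_to_star C G f)"

text \<open>The composite \<open>\<Sigma>\<^sub>G(T\<^sub>G 1 \<times> X) \<cong> \<Sigma>\<^sub>G T\<^sub>G U\<^sub>G X \<cong> X\<close>.\<close>

definition sigma_prod ::
  "('o, 'm) cat \<Rightarrow> ('o, 'm) igpd \<Rightarrow> ('o, 'm) sigma_adj \<Rightarrow> 'm \<times> 'm \<Rightarrow> 'm" where
  "sigma_prod C G S X =
     sigma_free C G S (fst X) \<cdot>\<^bsub>C\<^esub> FA (Ladj S) (inv_arr (gcat C G) (free_to_prod C G X))"


section \<open>Hilsum--Skandalis maps\<close>

text \<open>The carrier \<open>P\<close> is the common domain of \<open>hs_p : P \<rightarrow> H0\<close> and \<open>hs_q : P \<rightarrow> G0\<close>.\<close>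

record 'm hs_map =
  hs_p :: 'm
  hs_q :: 'm
  hs_c :: 'm
  hs_d :: 'm

definition hilsum_skandalis ::
  "('o, 'm) cat \<Rightarrow> ('o, 'm) igpd \<Rightarrow> ('o, 'm) igpd \<Rightarrow> 'm hs_map \<Rightarrow> bool" where
  "hilsum_skandalis C H G P \<longleftrightarrow>
     Dom C (hs_p P) = Dom C (hs_q P) \<and>
     is_gobj C H (hs_p P) (hs_c P) \<and> is_gobj C G (hs_q P) (hs_d P) \<and>
     hs_p P \<cdot>\<^bsub>C\<^esub> hs_d P = hs_p P \<cdot>\<^bsub>C\<^esub> pb2 C (d0 G) (hs_q P) \<and>
     hs_q P \<cdot>\<^bsub>C\<^esub> hs_c P = hs_q P \<cdot>\<^bsub>C\<^esub> pb2 C (d0 H) (hs_p P) \<and>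
     (\<forall>T. \<forall>h\<in>hom C T (G1 H). \<forall>g\<in>hom C T (G1 G). \<forall>x\<in>hom C T (Dom C (hs_p P)).
        d0 H \<cdot>\<^bsub>C\<^esub> h = hs_p P \<cdot>\<^bsub>C\<^esub> x \<and> d0 G \<cdot>\<^bsub>C\<^esub> g = hs_q P \<cdot>\<^bsub>C\<^esub> x \<longrightarrow>
        act C H (hs_p P) (hs_c P) h (act C G (hs_q P) (hs_d P) g x) =
        act C G (hs_q P) (hs_d P) g (act C H (hs_p P) (hs_c P) h x)) \<and>
     iso C (pb_pair C (hs_p P) (hs_p P) (hs_d P) (pb2 C (d0 G) (hs_q P))) \<and>
     effective_descent C (hs_p P)"

definition hs_cat ::
  "('o, 'm) cat \<Rightarrow> ('o, 'm) igpd \<Rightarrow> ('o, 'm) igpd \<Rightarrow> ('m hs_map, 'm hs_map \<times> 'm \<times> 'm hs_map) cat" where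
  "hs_cat C H G =
     structure_cat C {P. hilsum_skandalis C H G P} (\<lambda>P. Dom C (hs_p P))
       (\<lambda>P h Q. equivariant C H (hs_p P, hs_c P) h (hs_p Q, hs_c Q) \<and>
                equivariant C G (hs_q P, hs_d P) h (hs_q Q, hs_d Q))"

text \<open>
  The canonical isomorphism \<open>\<psi>\<close> from the carrier of \<open>R T\<^sub>G 1\<close> to the carrier of \<open>L T\<^sub>H 1\<close>:
  \<open>P \<cong> \<Sigma>\<^sub>H(T\<^sub>H 1 \<times> R T\<^sub>G 1) \<cong> \<Sigma>\<^sub>G L(T\<^sub>H 1 \<times> R T\<^sub>G 1) \<cong> \<Sigma>\<^sub>G(L T\<^sub>H 1 \<times> T\<^sub>G 1) \<cong> \<Sigma>\<^sub>G(T\<^sub>G 1 \<times> L T\<^sub>H 1) \<cong> Q\<close>.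
\<close>

definition hs_psi ::
  "('o, 'm) cat \<Rightarrow> ('o, 'm) igpd \<Rightarrow> ('o, 'm) igpd \<Rightarrow> ('o, 'm) sigma_adj \<Rightarrow> ('o, 'm) sigma_adj \<Rightarrow>
   'm gcat_adj \<Rightarrow> ('m \<times> 'm \<Rightarrow> 'm) \<Rightarrow> 'm" where
  "hs_psi C H G SH SG J \<theta> =
     (let RT = FO (Radj J) (free_one G); LT = FO (Ladj J) (free_one H)
      in sigma_prod C G SG LT \<cdot>\<^bsub>C\<^esub>
         (FA (Ladj SG) (prod_swap (gcat C G) LT (free_one G)) \<cdot>\<^bsub>C\<^esub>
          (FA (Ladj SG) (frob_map (gcat C H) (gcat C G) J (free_one H) (free_one G)) \<cdot>\<^bsub>C\<^esub>
           (inv_arr C (\<theta> (prod_obj (gcat C H) (free_one H) RT)) \<cdot>\<^bsub>C\<^esub>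
            inv_arr C (sigma_prod C H SH RT)))))"

definition hs_of_adj ::
  "('o, 'm) cat \<Rightarrow> ('o, 'm) igpd \<Rightarrow> ('o, 'm) igpd \<Rightarrow> ('o, 'm) sigma_adj \<Rightarrow> ('o, 'm) sigma_adj \<Rightarrow>
   'm gcat_adj \<Rightarrow> ('m \<times> 'm \<Rightarrow> 'm) \<Rightarrow> 'm hs_map" where
  "hs_of_adj C H G SH SG J \<theta> =
     (let (p, c) = FO (Radj J) (free_one G);
          (q, d) = FO (Ladj J) (free_one H);
          \<psi> = hs_psi C H G SH SG J \<theta>;
          q' = q \<cdot>\<^bsub>C\<^esub> \<psi>
      in \<lparr>hs_p = p, hs_q = q', hs_c = c,
          hs_d = inv_arr C \<psi> \<cdot>\<^bsub>C\<^esub>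
               (d \<cdot>\<^bsub>C\<^esub> pb_pair C (d0 G) q (pb1 C (d0 G) q') (\<psi> \<cdot>\<^bsub>C\<^esub> pb2 C (d0 G) q'))\<rparr>)"

end

theory Submission imports Defs begin

text \<open>
  Call a map \<open>\<phi> : P \<times>\<^bsub>H0\<^esub> W \<rightarrow> X\<close> over \<open>G0\<close>, for \<open>W\<close> in \<open>[H, C]\<close> and \<open>X\<close> in \<open>[G, C]\<close>, bilinear if it is
  \<open>G\<close>-equivariant and \<open>H\<close>-invariant. Bilinear maps form a profunctor, which is represented on both
  sides, and this is the adjunction. On the right, \<open>P \<times>\<^bsub>G0\<^esub> X\<close> with the diagonal \<open>G\<close>-action is a descent
  datum for \<open>p\<close>, since the kernel pair of \<open>p\<close> is \<open>G1 \<times>\<^bsub>G0\<^esub> P\<close>; it descends to the carrier of \<open>R X\<close>. On the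
  left, \<open>L W\<close> is carried by \<open>\<Sigma>\<^sub>H (P \<times> W)\<close>. Stable Frobenius reciprocity for \<open>\<Sigma>\<^sub>H\<close> says that quotients by
  \<open>H\<close> are stable under pullback. Hence the \<open>G\<close>-action on \<open>P\<close> passes to \<open>L W\<close>, and hence \<open>L \<stileturn> R\<close> is stably
  Frobenius: both sides of the canonical map are quotients of the same \<open>H\<close>-object. Moreover \<open>\<Sigma>\<^sub>G L W\<close> and \<open>\<Sigma>\<^sub>H W\<close>
  are both the quotient of \<open>P \<times> W\<close> by \<open>G\<close> and \<open>H\<close>. Finally \<open>R T\<^sub>G 1\<close> and \<open>L T\<^sub>H 1\<close> can be taken to be \<open>P\<close>
  itself, and then \<open>\<psi>\<close> is the identity because \<open>\<delta>(x, y)\<inverse> h\<inverse> x = h\<inverse> y\<close> for the division map \<open>\<delta>\<close> of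
  the \<open>G\<close>-torsor \<open>P\<close>.
\<close>

text \<open>The category has finite limits and nothing more, so no quotient exists for free. The
  only ones available are values of \<open>\<Sigma>\<close> for the two groupoids;
  \<open>quot\<close> isolates their universal property, so that it can be carried along
  isomorphisms and pullbacks without mention of an adjunction. Elements of a quotient have no
  representatives, so equations about them are tested after pulling the quotient map back along the
  element in question: by stable Frobenius reciprocity the result is again a quotient, hence right
  cancellable (\<open>quot_local\<close>). Pullbacks of \<open>p\<close> serve the same purpose for
  descent (\<open>descend_unique\<close>).

  Effective descent is given as monadicity with an unspecified left adjoint, which must be compared
  with composition with \<open>p\<close> before its algebras can be read as descent data.

  Laws are stated for generalized elements, which removes the isomorphisms between iterated
  pullbacks. Universal properties fix objects only up to isomorphism, whereas \<open>\<psi>\<close>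
  goes from one carrier to another; choosing both carriers equal to that of \<open>P\<close> gives
  sense to the claim that it is the identity.\<close>

declare hom_def [simp]

section \<open>Categories\<close>

locale catl =
  fixes C :: "('o, 'm) cat" (structure)
  assumes category: "category C"
begin

lemma Dom_Obj [simp]: "f \<in> Arr C \<Longrightarrow> Dom C f \<in> Obj C"
  and Cod_Obj [simp]: "f \<in> Arr C \<Longrightarrow> Cod C f \<in> Obj C"
  and Id_Arr [simp]: "A \<in> Obj C \<Longrightarrow> Id C A \<in> Arr C"
  and Dom_Id [simp]: "A \<in> Obj C \<Longrightarrow> Dom C (Id C A) = A"
  and Cod_Id [simp]: "A \<in> Obj C \<Longrightarrow> Cod C (Id C A) = A"
  and comp_Id [simp]: "f \<in> Arr C \<Longrightarrow> Dom C f = A \<Longrightarrow> f \<cdot> Id C A = f"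
  and Id_comp [simp]: "f \<in> Arr C \<Longrightarrow> Cod C f = A \<Longrightarrow> Id C A \<cdot> f = f"
  and comp_Arr [simp]: "f \<in> Arr C \<Longrightarrow> g \<in> Arr C \<Longrightarrow> Cod C f = Dom C g \<Longrightarrow> g \<cdot> f \<in> Arr C"
  and Dom_comp [simp]: "f \<in> Arr C \<Longrightarrow> g \<in> Arr C \<Longrightarrow> Cod C f = Dom C g \<Longrightarrow> Dom C (g \<cdot> f) = Dom C f"
  and Cod_comp [simp]: "f \<in> Arr C \<Longrightarrow> g \<in> Arr C \<Longrightarrow> Cod C f = Dom C g \<Longrightarrow> Cod C (g \<cdot> f) = Cod C g"
  and comp_assoc [simp]: "f \<in> Arr C \<Longrightarrow> g \<in> Arr C \<Longrightarrow> h \<in> Arr C \<Longrightarrow> Cod C f = Dom C g \<Longrightarrow>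
     Cod C g = Dom C h \<Longrightarrow> (h \<cdot> g) \<cdot> f = h \<cdot> (g \<cdot> f)"
  using category unfolding category_def by auto

text \<open>The simplifier nests composites to the right, so an equation
  \<open>h \<cdot> g = k\<close> no longer matches inside a longer composite. This rule restores it
  in front of an arbitrary tail \<open>f\<close>.\<close>

lemma comp_reassoc:
  assumes "h \<cdot> g = k" "f \<in> Arr C" "g \<in> Arr C" "h \<in> Arr C" "Cod C f = Dom C g" "Cod C g = Dom C h"
  shows "h \<cdot> (g \<cdot> f) = k \<cdot> f"
  using assms by (metis comp_assoc)

lemma inverse_unique:
  assumes "is_inverse C f g" "is_inverse C f g'"
  shows "g = g'"
proof -
  have t: "f \<in> Arr C" "g \<in> Arr C" "g' \<in> Arr C" "Dom C g = Cod C f" "Cod C g = Dom C f"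
      "Dom C g' = Cod C f" "Cod C g' = Dom C f" "g \<cdot> f = Id C (Dom C f)" "f \<cdot> g' = Id C (Cod C f)"
    using assms unfolding is_inverse_def by auto
  have "g = g \<cdot> (f \<cdot> g')" using t by simp
  also have "\<dots> = g'" using comp_reassoc[OF t(8), of g'] t(1-7) by simp
  finally show ?thesis .
qed

lemma inv_arrI: "is_inverse C f g \<Longrightarrow> inv_arr C f = g"
  unfolding inv_arr_def using inverse_unique by (intro the_equality) auto

lemma inv_arr: "iso C f \<Longrightarrow> is_inverse C f (inv_arr C f)"
  unfolding iso_def using inv_arrI by metis

lemma inv_arr_simps [simp]:
  assumes "iso C f"
  shows "f \<in> Arr C" "inv_arr C f \<in> Arr C" "Dom C (inv_arr C f) = Cod C f" "Cod C (inv_arr C f) = Dom C f"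
    "inv_arr C f \<cdot> f = Id C (Dom C f)" "f \<cdot> inv_arr C f = Id C (Cod C f)"
  using inv_arr[OF assms] unfolding is_inverse_def by auto

lemma isoI:
  "f \<in> Arr C \<Longrightarrow> g \<in> Arr C \<Longrightarrow> Dom C g = Cod C f \<Longrightarrow> Cod C g = Dom C f \<Longrightarrow>
   g \<cdot> f = Id C (Dom C f) \<Longrightarrow> f \<cdot> g = Id C (Cod C f) \<Longrightarrow> iso C f"
  unfolding iso_def is_inverse_def by auto

lemma inv_arr_cancel [simp]:
  assumes "iso C f"
  shows "x \<in> Arr C \<Longrightarrow> Cod C x = Dom C f \<Longrightarrow> inv_arr C f \<cdot> (f \<cdot> x) = x"
    and "y \<in> Arr C \<Longrightarrow> Cod C y = Cod C f \<Longrightarrow> f \<cdot> (inv_arr C f \<cdot> y) = y"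
proof -
  assume "x \<in> Arr C" "Cod C x = Dom C f"
  then show "inv_arr C f \<cdot> (f \<cdot> x) = x"
    using comp_reassoc[OF inv_arr_simps(5)[OF assms]] assms by simp
next
  assume "y \<in> Arr C" "Cod C y = Cod C f"
  then show "f \<cdot> (inv_arr C f \<cdot> y) = y"
    using comp_reassoc[OF inv_arr_simps(6)[OF assms]] assms by simp
qed

lemma iso_inv_arr [simp]: "iso C f \<Longrightarrow> iso C (inv_arr C f)"
  by (rule isoI[where g = f]) auto

lemma inv_arr_Id [simp]: "A \<in> Obj C \<Longrightarrow> inv_arr C (Id C A) = Id C A"
  by (rule inv_arrI) (auto simp: is_inverse_def)

lemma iso_comp [simp]:
  assumes "iso C f" "iso C g" "Cod C f = Dom C g"
  shows "iso C (g \<cdot> f)"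
  by (rule isoI[where g = "inv_arr C f \<cdot> inv_arr C g"]) (use assms in auto)

section \<open>Products and pullbacks of given arrows, and their uniqueness\<close>

lemma is_product_iso:
  assumes p: "is_product C A B p q" and p': "is_product C A B p' q'"
  shows "\<exists>j. iso C j \<and> j \<in> hom C (Dom C p') (Dom C p) \<and> p \<cdot> j = p' \<and> q \<cdot> j = q'"
proof -
  have t: "p \<in> hom C (Dom C p) A" "q \<in> hom C (Dom C p) B" "p' \<in> hom C (Dom C p') A" "q' \<in> hom C (Dom C p') B"
    using p p' unfolding is_product_def by blast+
  have u: "\<exists>!h. h \<in> hom C T (Dom C p) \<and> p \<cdot> h = f \<and> q \<cdot> h = g"
    if "f \<in> hom C T A" "g \<in> hom C T B" for T f g
    using p that unfolding is_product_def by blast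
  have u': "\<exists>!h. h \<in> hom C T (Dom C p') \<and> p' \<cdot> h = f \<and> q' \<cdot> h = g"
    if "f \<in> hom C T A" "g \<in> hom C T B" for T f g
    using p' that unfolding is_product_def by blast
  from u[OF t(3,4)] obtain j where j: "j \<in> hom C (Dom C p') (Dom C p)" "p \<cdot> j = p'" "q \<cdot> j = q'" by blast
  from u'[OF t(1,2)] obtain k where k: "k \<in> hom C (Dom C p) (Dom C p')" "p' \<cdot> k = p" "q' \<cdot> k = q" by blast
  have r: "p \<cdot> (j \<cdot> k) = p" "q \<cdot> (j \<cdot> k) = q" "p' \<cdot> (k \<cdot> j) = p'" "q' \<cdot> (k \<cdot> j) = q'"
    using j k t comp_reassoc[OF j(2)] comp_reassoc[OF j(3)] comp_reassoc[OF k(2)] comp_reassoc[OF k(3)] by auto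
  have "j \<cdot> k \<in> hom C (Dom C p) (Dom C p)" "Id C (Dom C p) \<in> hom C (Dom C p) (Dom C p)"
    "k \<cdot> j \<in> hom C (Dom C p') (Dom C p')" "Id C (Dom C p') \<in> hom C (Dom C p') (Dom C p')"
    "p \<cdot> Id C (Dom C p) = p" "q \<cdot> Id C (Dom C p) = q" "p' \<cdot> Id C (Dom C p') = p'" "q' \<cdot> Id C (Dom C p') = q'"
    using j k t by auto
  then have "j \<cdot> k = Id C (Dom C p)" "k \<cdot> j = Id C (Dom C p')"
    using u[OF t(1,2)] u'[OF t(3,4)] r by blast+
  then have "iso C j"
    using j k by (intro isoI[where g = k]) auto
  with j show ?thesis by blast
qed

text \<open>Existence is assumed for the one pair \<open>A\<close>, \<open>B\<close> only, because
  the chosen products are also used in slices and in \<open>[G, C]\<close>, where existence is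
  proved pair by pair and not obtained from finite limits.\<close>

lemma prod_ex:
  assumes "\<exists>p q. is_product C A B p q"
  shows is_product_pr: "is_product C A B (pr1 C A B) (pr2 C A B)"
    and pr_simps: "pr1 C A B \<in> Arr C" "Cod C (pr1 C A B) = A" "Dom C (pr1 C A B) = prod_obj C A B"
      "pr2 C A B \<in> Arr C" "Cod C (pr2 C A B) = B" "Dom C (pr2 C A B) = prod_obj C A B"
    and prod_pair_simps: "\<And>f g. f \<in> Arr C \<Longrightarrow> g \<in> Arr C \<Longrightarrow> Dom C f = Dom C g \<Longrightarrow> Cod C f = A \<Longrightarrow> Cod C g = B \<Longrightarrow>
       prod_pair C f g \<in> Arr C \<and> Dom C (prod_pair C f g) = Dom C g \<and> Cod C (prod_pair C f g) = prod_obj C A B \<and>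
       pr1 C A B \<cdot> prod_pair C f g = f \<and> pr2 C A B \<cdot> prod_pair C f g = g"
    and prod_ext: "\<And>h k. h \<in> Arr C \<Longrightarrow> k \<in> Arr C \<Longrightarrow> Dom C h = Dom C k \<Longrightarrow> Cod C h = prod_obj C A B \<Longrightarrow>
       Cod C k = prod_obj C A B \<Longrightarrow> pr1 C A B \<cdot> h = pr1 C A B \<cdot> k \<Longrightarrow> pr2 C A B \<cdot> h = pr2 C A B \<cdot> k \<Longrightarrow> h = k"
proof -
  have "\<exists>s. is_product C A B (fst s) (snd s)"
    using assms by auto
  then show p: "is_product C A B (pr1 C A B) (pr2 C A B)"
    unfolding pr1_def pr2_def prod_cone_def by (rule someI_ex)
  then show t: "pr1 C A B \<in> Arr C" "Cod C (pr1 C A B) = A" "Dom C (pr1 C A B) = prod_obj C A B"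
      "pr2 C A B \<in> Arr C" "Cod C (pr2 C A B) = B" "Dom C (pr2 C A B) = prod_obj C A B"
    unfolding is_product_def prod_obj_def by auto
  have u: "\<exists>!h. h \<in> hom C T (prod_obj C A B) \<and> pr1 C A B \<cdot> h = f \<and> pr2 C A B \<cdot> h = g"
    if "f \<in> hom C T A" "g \<in> hom C T B" for T f g
    using p that unfolding is_product_def prod_obj_def by blast
  show "prod_pair C f g \<in> Arr C \<and> Dom C (prod_pair C f g) = Dom C g \<and> Cod C (prod_pair C f g) = prod_obj C A B \<and>
       pr1 C A B \<cdot> prod_pair C f g = f \<and> pr2 C A B \<cdot> prod_pair C f g = g"
    if "f \<in> Arr C" "g \<in> Arr C" "Dom C f = Dom C g" "Cod C f = A" "Cod C g = B" for f g
  proof -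
    have "\<exists>!h. h \<in> hom C (Dom C f) (prod_obj C A B) \<and> pr1 C A B \<cdot> h = f \<and> pr2 C A B \<cdot> h = g"
      using u[of f "Dom C f" g] that by simp
    from theI'[OF this] show ?thesis
      using that unfolding prod_pair_def by simp
  qed
  show "h = k" if "h \<in> Arr C" "k \<in> Arr C" "Dom C h = Dom C k" "Cod C h = prod_obj C A B"
       "Cod C k = prod_obj C A B" "pr1 C A B \<cdot> h = pr1 C A B \<cdot> k" "pr2 C A B \<cdot> h = pr2 C A B \<cdot> k" for h k
  proof -
    have "\<exists>!l. l \<in> hom C (Dom C h) (prod_obj C A B) \<and> pr1 C A B \<cdot> l = pr1 C A B \<cdot> h \<and> pr2 C A B \<cdot> l = pr2 C A B \<cdot> h"
      using u[of "pr1 C A B \<cdot> h" "Dom C h" "pr2 C A B \<cdot> h"] that t by simp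
    then show ?thesis using that by auto
  qed
qed

lemma is_pullbackD:
  assumes "is_pullback C f g p q"
  shows "p \<in> Arr C" "q \<in> Arr C" "Dom C q = Dom C p" "Cod C p = Dom C f" "Cod C q = Dom C g" "f \<cdot> p = g \<cdot> q"
  using assms unfolding is_pullback_def by auto

lemma is_pullback_sym:
  assumes "is_pullback C f g p q"
  shows "is_pullback C g f q p"
proof -
  have "Dom C p = Dom C q" using is_pullbackD[OF assms] by simp
  then show ?thesis using assms unfolding is_pullback_def by metis
qed

lemma is_pullback_ex:
  assumes "is_pullback C f g p q" "u \<in> Arr C" "v \<in> Arr C" "Dom C u = Dom C v" "Cod C u = Dom C f" "Cod C v = Dom C g"
    "f \<cdot> u = g \<cdot> v"
  obtains h where "h \<in> Arr C" "Dom C h = Dom C v" "Cod C h = Dom C p" "p \<cdot> h = u" "q \<cdot> h = v"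
proof -
  have "\<exists>!h. h \<in> hom C (Dom C v) (Dom C p) \<and> p \<cdot> h = u \<and> q \<cdot> h = v"
  proof -
    have "u \<in> hom C (Dom C v) (Dom C f)" "v \<in> hom C (Dom C v) (Dom C g)" using assms by auto
    then show ?thesis using assms(1,7) unfolding is_pullback_def by blast
  qed
  then show ?thesis using that by auto
qed

lemma is_pullback_ext:
  assumes "is_pullback C f g p q" "f \<in> Arr C" "g \<in> Arr C" "Cod C f = Cod C g"
    "h \<in> Arr C" "k \<in> Arr C" "Dom C h = Dom C k" "Cod C h = Dom C p" "Cod C k = Dom C p"
    "p \<cdot> h = p \<cdot> k" "q \<cdot> h = q \<cdot> k"
  shows "h = k"
proof -
  note t = is_pullbackD[OF assms(1)]
  have c: "f \<cdot> (p \<cdot> h) = g \<cdot> (q \<cdot> h)"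
    using comp_reassoc[OF t(6)] t assms by simp
  have "p \<cdot> h \<in> hom C (Dom C h) (Dom C f)" "q \<cdot> h \<in> hom C (Dom C h) (Dom C g)"
    using t assms(2-9) by auto
  then have "\<exists>!l. l \<in> hom C (Dom C h) (Dom C p) \<and> p \<cdot> l = p \<cdot> h \<and> q \<cdot> l = q \<cdot> h"
    using c assms(1) unfolding is_pullback_def by blast
  then show ?thesis using assms by auto
qed

lemma is_pullbackI:
  assumes "p \<in> Arr C" "q \<in> Arr C" "Dom C q = Dom C p" "Cod C p = Dom C f" "Cod C q = Dom C g" "f \<cdot> p = g \<cdot> q"
    and "\<And>u v. u \<in> Arr C \<Longrightarrow> v \<in> Arr C \<Longrightarrow> Dom C u = Dom C v \<Longrightarrow> Cod C u = Dom C f \<Longrightarrow> Cod C v = Dom C g \<Longrightarrow>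
      f \<cdot> u = g \<cdot> v \<Longrightarrow> \<exists>h. h \<in> Arr C \<and> Dom C h = Dom C v \<and> Cod C h = Dom C p \<and> p \<cdot> h = u \<and> q \<cdot> h = v"
    and "\<And>h k. h \<in> Arr C \<Longrightarrow> k \<in> Arr C \<Longrightarrow> Dom C h = Dom C k \<Longrightarrow> Cod C h = Dom C p \<Longrightarrow> Cod C k = Dom C p \<Longrightarrow>
      p \<cdot> h = p \<cdot> k \<Longrightarrow> q \<cdot> h = q \<cdot> k \<Longrightarrow> h = k"
  shows "is_pullback C f g p q"
  unfolding is_pullback_def
proof (intro conjI allI ballI impI)
  fix T u v assume uv: "u \<in> hom C T (Dom C f)" "v \<in> hom C T (Dom C g)" "f \<cdot> u = g \<cdot> v"
  obtain h where "h \<in> Arr C" "Dom C h = Dom C v" "Cod C h = Dom C p" "p \<cdot> h = u" "q \<cdot> h = v"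
    using assms(7)[of u v] uv by auto
  then show "\<exists>!h. h \<in> hom C T (Dom C p) \<and> p \<cdot> h = u \<and> q \<cdot> h = v"
    using assms(8) uv by (intro ex1I[of _ h]) auto
qed (use assms(1-6) in auto)

lemma is_pullback_iso:
  assumes pb: "is_pullback C f g p q" and j: "iso C j" "Cod C j = Dom C p"
    and fg: "f \<in> Arr C" "g \<in> Arr C" "Cod C f = Cod C g"
  shows "is_pullback C f g (p \<cdot> j) (q \<cdot> j)"
proof (rule is_pullbackI)
  note t = is_pullbackD[OF pb]
  show "f \<cdot> (p \<cdot> j) = g \<cdot> (q \<cdot> j)"
    using comp_reassoc[OF t(6)] t j fg by simp
  fix u v assume uv: "u \<in> Arr C" "v \<in> Arr C" "Dom C u = Dom C v" "Cod C u = Dom C f" "Cod C v = Dom C g" "f \<cdot> u = g \<cdot> v"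
  obtain h where "h \<in> Arr C" "Dom C h = Dom C v" "Cod C h = Dom C p" "p \<cdot> h = u" "q \<cdot> h = v"
    using is_pullback_ex[OF pb] uv by blast
  then show "\<exists>h. h \<in> Arr C \<and> Dom C h = Dom C v \<and> Cod C h = Dom C (p \<cdot> j) \<and> p \<cdot> j \<cdot> h = u \<and> q \<cdot> j \<cdot> h = v"
    using t j by (intro exI[of _ "inv_arr C j \<cdot> h"]) auto
next
  note t = is_pullbackD[OF pb]
  fix h k assume hk: "h \<in> Arr C" "k \<in> Arr C" "Dom C h = Dom C k" "Cod C h = Dom C (p \<cdot> j)" "Cod C k = Dom C (p \<cdot> j)"
    "p \<cdot> j \<cdot> h = p \<cdot> j \<cdot> k" "q \<cdot> j \<cdot> h = q \<cdot> j \<cdot> k"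
  have "j \<cdot> h = j \<cdot> k"
    by (rule is_pullback_ext[OF pb fg]) (use hk t j in auto)
  then have "inv_arr C j \<cdot> (j \<cdot> h) = inv_arr C j \<cdot> (j \<cdot> k)" by simp
  then show "h = k" using hk t j by simp
qed (use is_pullbackD[OF pb] j in auto)

section \<open>Categories of structures, in particular slices\<close>

lemma structure_simps:
  "Obj (structure_cat C S u Q) = S"
  "(X, h, Y) \<in> Arr (structure_cat C S u Q) \<longleftrightarrow> X \<in> S \<and> Y \<in> S \<and> h \<in> hom C (u X) (u Y) \<and> Q X h Y"
  "Dom (structure_cat C S u Q) (X, h, Y) = X" "Cod (structure_cat C S u Q) (X, h, Y) = Y"
  "(Y', k, Z) \<cdot>\<^bsub>structure_cat C S u Q\<^esub> (X, h, Y) = (X, k \<cdot> h, Z)"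
  "Id (structure_cat C S u Q) X = (X, Id C (u X), X)"
  unfolding structure_cat_def by auto

lemma category_structure:
  assumes "\<And>X. X \<in> S \<Longrightarrow> u X \<in> Obj C" "\<And>X. X \<in> S \<Longrightarrow> Q X (Id C (u X)) X"
    and "\<And>X h Y k Z. X \<in> S \<Longrightarrow> Y \<in> S \<Longrightarrow> Z \<in> S \<Longrightarrow> h \<in> hom C (u X) (u Y) \<Longrightarrow> k \<in> hom C (u Y) (u Z) \<Longrightarrow>
      Q X h Y \<Longrightarrow> Q Y k Z \<Longrightarrow> Q X (k \<cdot> h) Z"
  shows "category (structure_cat C S u Q)"
  unfolding category_def split_paired_Ball_Sigma Ball_def split_paired_All structure_simps
  using assms by (intro conjI allI impI) (auto simp: structure_simps)

lemma slice_simps [simp]: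
  "Obj (slice C X) = {f \<in> Arr C. Cod C f = X}"
  "Arr (slice C X) = {(f, h, g). f \<in> Arr C \<and> Cod C f = X \<and> g \<in> Arr C \<and> Cod C g = X \<and>
     h \<in> hom C (Dom C f) (Dom C g) \<and> g \<cdot> h = f}"
  "Dom (slice C X) (f, h, g) = f" "Cod (slice C X) (f, h, g) = g"
  "(g', k, l) \<cdot>\<^bsub>slice C X\<^esub> (f, h, g) = (f, k \<cdot> h, l)"
  "Id (slice C X) f = (f, Id C (Dom C f), f)"
  unfolding slice_def structure_cat_def by auto

lemma category_slice: "category (slice C X)"
  unfolding slice_def by (rule category_structure) (auto simp flip: comp_assoc)

lemma iso_slice:
  assumes "(f, h, g) \<in> Arr (slice C X)"
  shows "iso (slice C X) (f, h, g) \<longleftrightarrow> iso C h"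
proof
  assume "iso (slice C X) (f, h, g)"
  then obtain k where "is_inverse (slice C X) (f, h, g) k" unfolding iso_def by blast
  then show "iso C h"
  proof (cases k)
    case (fields r l s)
    then have "l \<in> hom C (Dom C g) (Dom C f)" "l \<cdot> h = Id C (Dom C f)" "h \<cdot> l = Id C (Dom C g)"
      using \<open>is_inverse (slice C X) (f, h, g) k\<close> unfolding is_inverse_def by auto
    moreover have "h \<in> hom C (Dom C f) (Dom C g)" using assms by simp
    ultimately show ?thesis by (intro isoI[where g = l]) auto
  qed
next
  assume i: "iso C h"
  have t: "f \<in> Arr C" "g \<in> Arr C" "Cod C f = X" "Cod C g = X" "Dom C h = Dom C f" "Cod C h = Dom C g" "g \<cdot> h = f"
    using assms by simp_all
  have "f \<cdot> inv_arr C h = g"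
    using comp_reassoc[OF t(7), of "inv_arr C h"] t(1-6) i by simp
  then have "is_inverse (slice C X) (f, h, g) (g, inv_arr C h, f)"
    using t i unfolding is_inverse_def by simp
  then show "iso (slice C X) (f, h, g)" unfolding iso_def by blast
qed

text \<open>Products in a slice are Hilbert choices, so nothing is known of them but their universal
  property. The equivalence recovers from it the tags and an underlying pullback, whichever product
  was chosen.\<close>

lemma slice_product:
  assumes "f \<in> Arr C" "g \<in> Arr C" "Cod C f = X" "Cod C g = X"
  shows "is_product (slice C X) f g p q \<longleftrightarrow>
    (\<exists>a b. p = (f \<cdot> a, a, f) \<and> q = (f \<cdot> a, b, g) \<and> is_pullback C f g a b)"
proof
  assume P: "is_product (slice C X) f g p q"
  obtain r a s where p: "p = (r, a, s)" by (cases p)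
  obtain r' b s' where q: "q = (r', b, s')" by (cases q)
  have t: "p = (f \<cdot> a, a, f)" "q = (f \<cdot> a, b, g)" "a \<in> Arr C" "b \<in> Arr C" "Dom C b = Dom C a" "Cod C a = Dom C f"
      "Cod C b = Dom C g" "f \<cdot> a = g \<cdot> b"
    using P assms unfolding is_product_def p q by auto
  have u: "\<exists>!h. h \<in> hom (slice C X) T (f \<cdot> a) \<and> p \<cdot>\<^bsub>slice C X\<^esub> h = k \<and> q \<cdot>\<^bsub>slice C X\<^esub> h = l"
    if "k \<in> hom (slice C X) T f" "l \<in> hom (slice C X) T g" for T k l
  proof -
    have "Dom (slice C X) p = f \<cdot> a" using t(1) by simp
    then show ?thesis using P that unfolding is_product_def by metis
  qed
  have "is_pullback C f g a b"
  proof (rule is_pullbackI)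
    fix u v assume uv: "u \<in> Arr C" "v \<in> Arr C" "Dom C u = Dom C v" "Cod C u = Dom C f" "Cod C v = Dom C g" "f \<cdot> u = g \<cdot> v"
    obtain h where "h \<in> hom (slice C X) (f \<cdot> u) (f \<cdot> a)" "p \<cdot>\<^bsub>slice C X\<^esub> h = (f \<cdot> u, u, f)" "q \<cdot>\<^bsub>slice C X\<^esub> h = (f \<cdot> u, v, g)"
      using u[of "(f \<cdot> u, u, f)" "f \<cdot> u" "(f \<cdot> u, v, g)"] uv assms by auto
    then obtain l where "l \<in> Arr C" "Dom C l = Dom C v" "Cod C l = Dom C a" "a \<cdot> l = u" "b \<cdot> l = v"
      using t uv assms by (cases h) auto
    then show "\<exists>h. h \<in> Arr C \<and> Dom C h = Dom C v \<and> Cod C h = Dom C a \<and> a \<cdot> h = u \<and> b \<cdot> h = v"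
      by blast
  next
    fix h k assume hk: "h \<in> Arr C" "k \<in> Arr C" "Dom C h = Dom C k" "Cod C h = Dom C a" "Cod C k = Dom C a"
      "a \<cdot> h = a \<cdot> k" "b \<cdot> h = b \<cdot> k"
    \<comment> \<open>An arrow of the slice needs a structure map at its domain; \<open>?r\<close>
      is the one that makes both \<open>h\<close> and \<open>k\<close> arrows of the slice into
      \<open>f \<cdot> a\<close>.\<close>
    let ?r = "f \<cdot> (a \<cdot> h)"
    have c: "f \<cdot> (a \<cdot> h) = g \<cdot> (b \<cdot> h)"
      using comp_reassoc[OF t(8)] t hk assms by simp
    have 1: "(?r, a \<cdot> h, f) \<in> hom (slice C X) ?r f" "(?r, b \<cdot> h, g) \<in> hom (slice C X) ?r g"
      using hk t assms c by auto
    have 2: "(?r, h, f \<cdot> a) \<in> hom (slice C X) ?r (f \<cdot> a)" "(?r, k, f \<cdot> a) \<in> hom (slice C X) ?r (f \<cdot> a)"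
      using hk t assms c by auto
    have 3: "p \<cdot>\<^bsub>slice C X\<^esub> (?r, h, f \<cdot> a) = (?r, a \<cdot> h, f)" "p \<cdot>\<^bsub>slice C X\<^esub> (?r, k, f \<cdot> a) = (?r, a \<cdot> h, f)"
      "q \<cdot>\<^bsub>slice C X\<^esub> (?r, h, f \<cdot> a) = (?r, b \<cdot> h, g)" "q \<cdot>\<^bsub>slice C X\<^esub> (?r, k, f \<cdot> a) = (?r, b \<cdot> h, g)"
      using hk t by auto
    have "(?r, h, f \<cdot> a) = (?r, k, f \<cdot> a)"
      using u[OF 1] 2 3 by blast
    then show "h = k" by simp
  qed (use t in auto)
  with t show "\<exists>a b. p = (f \<cdot> a, a, f) \<and> q = (f \<cdot> a, b, g) \<and> is_pullback C f g a b" by blast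
next
  assume "\<exists>a b. p = (f \<cdot> a, a, f) \<and> q = (f \<cdot> a, b, g) \<and> is_pullback C f g a b"
  then obtain a b where pq: "p = (f \<cdot> a, a, f)" "q = (f \<cdot> a, b, g)" and pb: "is_pullback C f g a b" by blast
  note t = is_pullbackD[OF pb]
  show "is_product (slice C X) f g p q"
    unfolding is_product_def
  proof (intro conjI allI ballI)
    show "p \<in> hom (slice C X) (Dom (slice C X) p) f" "q \<in> hom (slice C X) (Dom (slice C X) p) g"
      using t assms by (auto simp: pq)
    fix T k l assume kl: "k \<in> hom (slice C X) T f" "l \<in> hom (slice C X) T g"
    then obtain u v where k: "k = (T, u, f)" and l: "l = (T, v, g)" and
      uv': "u \<in> Arr C" "v \<in> Arr C" "Dom C u = Dom C T" "Dom C v = Dom C T" "Cod C u = Dom C f" "Cod C v = Dom C g"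
         "f \<cdot> u = T" "g \<cdot> v = T" "T \<in> Arr C" "Cod C T = X"
      by (cases k; cases l) auto
    obtain S where S: "Dom C T = S" by blast
    note uv = S uv'[unfolded S]
    obtain h where h: "h \<in> Arr C" "Dom C h = Dom C v" "Cod C h = Dom C a" "a \<cdot> h = u" "b \<cdot> h = v"
      using is_pullback_ex[OF pb, of u v] uv by auto
    show "\<exists>!h. h \<in> hom (slice C X) T (Dom (slice C X) p) \<and> p \<cdot>\<^bsub>slice C X\<^esub> h = k \<and> q \<cdot>\<^bsub>slice C X\<^esub> h = l"
    proof (rule ex1I[of _ "(T, h, f \<cdot> a)"])
      show "(T, h, f \<cdot> a) \<in> hom (slice C X) T (Dom (slice C X) p) \<and>
          p \<cdot>\<^bsub>slice C X\<^esub> (T, h, f \<cdot> a) = k \<and> q \<cdot>\<^bsub>slice C X\<^esub> (T, h, f \<cdot> a) = l"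
        using h t uv assms comp_reassoc[OF t(6), of h] unfolding pq k l by simp
      fix h' assume h': "h' \<in> hom (slice C X) T (Dom (slice C X) p) \<and> p \<cdot>\<^bsub>slice C X\<^esub> h' = k \<and> q \<cdot>\<^bsub>slice C X\<^esub> h' = l"
      obtain h2 where h2: "h' = (T, h2, f \<cdot> a)" "h2 \<in> Arr C" "Dom C h2 = S" "Cod C h2 = Dom C a"
          "a \<cdot> h2 = u" "b \<cdot> h2 = v"
        using h' t assms k l S by (cases h') (auto simp: pq)
      have "h2 = h"
        by (rule is_pullback_ext[OF pb]) (use h h2 assms uv in auto)
      with h2 show "h' = (T, h, f \<cdot> a)" by simp
    qed
  qed
qed

text \<open>A pullback is a product in the slice over the common codomain, so uniqueness of products
  applies there.\<close>

lemma pullback_is_iso: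
  assumes pb: "is_pullback C f g p q" and pb': "is_pullback C f g p' q'"
    and "f \<in> Arr C" "g \<in> Arr C" "Cod C f = Cod C g"
  shows "\<exists>j. iso C j \<and> j \<in> hom C (Dom C p') (Dom C p) \<and> p \<cdot> j = p' \<and> q \<cdot> j = q'"
proof -
  note t = is_pullbackD[OF pb] is_pullbackD[OF pb']
  interpret S: catl "slice C (Cod C f)" by (unfold_locales) (rule category_slice)
  have "is_product (slice C (Cod C f)) f g (f \<cdot> p, p, f) (f \<cdot> p, q, g)"
     "is_product (slice C (Cod C f)) f g (f \<cdot> p', p', f) (f \<cdot> p', q', g)"
    using assms by (auto simp: slice_product)
  from S.is_product_iso[OF this] obtain j where j: "iso (slice C (Cod C f)) (f \<cdot> p', j, f \<cdot> p)"
      "(f \<cdot> p', j, f \<cdot> p) \<in> Arr (slice C (Cod C f))" "p \<cdot> j = p'" "q \<cdot> j = q'"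
    by auto
  then show ?thesis
    using iso_slice[OF j(2)] t assms by (intro exI[of _ j]) auto
qed

lemma pullback_of_iso:
  assumes pb: "is_pullback C f g p q" and "iso C f" "g \<in> Arr C" "Cod C f = Cod C g"
  shows "iso C q"
proof -
  note t = is_pullbackD[OF pb]
  obtain h where h: "h \<in> Arr C" "Dom C h = Dom C g" "Cod C h = Dom C p" "p \<cdot> h = inv_arr C f \<cdot> g" "q \<cdot> h = Id C (Dom C g)"
    using is_pullback_ex[OF pb, of "inv_arr C f \<cdot> g" "Id C (Dom C g)"] assms(2-) by auto
  have 1: "p \<cdot> (h \<cdot> q) = p"
    using comp_reassoc[OF h(4)] h t assms by (simp flip: t(6))
  have 2: "q \<cdot> (h \<cdot> q) = q"
    using comp_reassoc[OF h(5)] h t assms by simp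
  have "h \<cdot> q = Id C (Dom C p)"
    by (rule is_pullback_ext[OF pb]) (use assms(2-) h t 1 2 in auto)
  then show ?thesis using h t by (intro isoI[where g = h]) auto
qed

end

section \<open>Adjunctions\<close>

lemma func_simps [simp]:
  "FO id_func A = A" "FA id_func f = f" "FO (G \<circ>F F) A = FO G (FO F A)" "FA (G \<circ>F F) f = FA G (FA F f)"
  unfolding id_func_def comp_func_def by auto

lemma is_functorD:
  assumes "is_functor C D F"
  shows "A \<in> Obj C \<Longrightarrow> FO F A \<in> Obj D"
    and "f \<in> Arr C \<Longrightarrow> FA F f \<in> Arr D"
    and "f \<in> Arr C \<Longrightarrow> Dom D (FA F f) = FO F (Dom C f)"
    and "f \<in> Arr C \<Longrightarrow> Cod D (FA F f) = FO F (Cod C f)"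
    and "A \<in> Obj C \<Longrightarrow> FA F (Id C A) = Id D (FO F A)"
    and "f \<in> Arr C \<Longrightarrow> g \<in> Arr C \<Longrightarrow> Cod C f = Dom C g \<Longrightarrow> FA F (g \<cdot>\<^bsub>C\<^esub> f) = FA F g \<cdot>\<^bsub>D\<^esub> FA F f"
  using assms unfolding is_functor_def by auto

locale adjl = D: catl D + C: catl C
  for D :: "('o1, 'm1) cat" and C :: "('o2, 'm2) cat" +
  fixes J :: "('o1, 'm1, 'o2, 'm2) adj"
  assumes adjunction: "adjunction D C J"
begin

abbreviation "L \<equiv> FO (Ladj J)"
abbreviation "LA \<equiv> FA (Ladj J)"
abbreviation "R \<equiv> FO (Radj J)"
abbreviation "RA \<equiv> FA (Radj J)"
abbreviation "tr \<equiv> adj_transpose D C J"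

lemma functor_L: "is_functor D C (Ladj J)" and functor_R: "is_functor C D (Radj J)"
  using adjunction unfolding adjunction_def by auto

lemmas LR_simps [simp] = is_functorD[OF functor_L] is_functorD[OF functor_R]

lemma unit_simps [simp]:
  assumes "W \<in> Obj D"
  shows "unit J W \<in> Arr D" "Dom D (unit J W) = W" "Cod D (unit J W) = R (L W)"
    "counit J (L W) \<cdot>\<^bsub>C\<^esub> LA (unit J W) = Id C (L W)"
  using adjunction assms unfolding adjunction_def nat_trans_def by auto

lemma counit_simps [simp]:
  assumes "X \<in> Obj C"
  shows "counit J X \<in> Arr C" "Cod C (counit J X) = X" "Dom C (counit J X) = L (R X)"
    "RA (counit J X) \<cdot>\<^bsub>D\<^esub> unit J (R X) = Id D (R X)"
  using adjunction assms unfolding adjunction_def nat_trans_def by auto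

lemma unit_nat: "f \<in> Arr D \<Longrightarrow> RA (LA f) \<cdot>\<^bsub>D\<^esub> unit J (Dom D f) = unit J (Cod D f) \<cdot>\<^bsub>D\<^esub> f"
  using adjunction unfolding adjunction_def nat_trans_def by auto

lemma counit_nat: "f \<in> Arr C \<Longrightarrow> counit J (Cod C f) \<cdot>\<^bsub>C\<^esub> LA (RA f) = f \<cdot>\<^bsub>C\<^esub> counit J (Dom C f)"
  using adjunction unfolding adjunction_def nat_trans_def by auto

lemma tr_simps [simp]:
  assumes "g \<in> Arr D" "Cod D g = R X" "X \<in> Obj C"
  shows "tr X g \<in> Arr C" "Dom C (tr X g) = L (Dom D g)" "Cod C (tr X g) = X"
  using assms unfolding adj_transpose_def by auto

lemma tr_unit:
  assumes "g \<in> Arr D" "Cod D g = R X" "X \<in> Obj C"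
  shows "RA (tr X g) \<cdot>\<^bsub>D\<^esub> unit J (Dom D g) = g"
proof -
  have "RA (tr X g) \<cdot>\<^bsub>D\<^esub> unit J (Dom D g) = RA (counit J X) \<cdot>\<^bsub>D\<^esub> (RA (LA g) \<cdot>\<^bsub>D\<^esub> unit J (Dom D g))"
    using assms unfolding adj_transpose_def by simp
  also have "\<dots> = RA (counit J X) \<cdot>\<^bsub>D\<^esub> (unit J (R X) \<cdot>\<^bsub>D\<^esub> g)"
    using unit_nat[of g] assms by simp
  also have "\<dots> = g"
    using D.comp_reassoc[OF counit_simps(4)[of X], of g] assms by simp
  finally show ?thesis .
qed

lemma tr_unique:
  assumes "h \<in> Arr C" "Dom C h = L W" "W \<in> Obj D"
  shows "tr (Cod C h) (RA h \<cdot>\<^bsub>D\<^esub> unit J W) = h"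
proof -
  have "tr (Cod C h) (RA h \<cdot>\<^bsub>D\<^esub> unit J W) = (counit J (Cod C h) \<cdot>\<^bsub>C\<^esub> LA (RA h)) \<cdot>\<^bsub>C\<^esub> LA (unit J W)"
    using assms unfolding adj_transpose_def by simp
  also have "\<dots> = h \<cdot>\<^bsub>C\<^esub> (counit J (L W) \<cdot>\<^bsub>C\<^esub> LA (unit J W))"
    using assms by (subst counit_nat) simp_all
  finally show ?thesis using assms by simp
qed

lemma tr_ext:
  assumes "h \<in> Arr C" "h' \<in> Arr C" "Dom C h = L W" "Dom C h' = L W" "W \<in> Obj D" "Cod C h = Cod C h'"
    "RA h \<cdot>\<^bsub>D\<^esub> unit J W = RA h' \<cdot>\<^bsub>D\<^esub> unit J W"
  shows "h = h'"
  using assms tr_unique by metis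

lemma tr_comp:
  assumes "g \<in> Arr D" "Cod D g = R X" "X \<in> Obj C" "k \<in> Arr D" "Cod D k = Dom D g"
  shows "tr X g \<cdot>\<^bsub>C\<^esub> LA k = tr X (g \<cdot>\<^bsub>D\<^esub> k)"
  using assms unfolding adj_transpose_def by simp

lemma tr_RA:
  assumes "f \<in> Arr C"
  shows "tr (Cod C f) (RA f) = f \<cdot>\<^bsub>C\<^esub> counit J (Dom C f)"
  unfolding adj_transpose_def by (rule counit_nat[OF assms])

text \<open>Products in the slices are pullbacks, so the canonical map of the sliced adjunction is the
  comparison arrow \<open>k\<close> from \<open>L\<close> of a pullback to a pullback.\<close>

lemma frob_map_slice:
  assumes X: "X \<in> Obj C" and g: "g \<in> Arr D" "Cod D g = R X" and f: "f \<in> Arr C" "Cod C f = X"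
    and exD: "\<exists>n1 n2. is_pullback D g (RA f) n1 n2"
    and exC: "\<exists>m1 m2. is_pullback C (tr X g) f m1 m2"
  shows "\<exists>n1 n2 m1 m2 k. is_pullback D g (RA f) n1 n2 \<and> is_pullback C (tr X g) f m1 m2 \<and>
    k \<in> hom C (L (Dom D n1)) (Dom C m1) \<and> m1 \<cdot>\<^bsub>C\<^esub> k = LA n1 \<and> m2 \<cdot>\<^bsub>C\<^esub> k = counit J (Dom C f) \<cdot>\<^bsub>C\<^esub> LA n2 \<and>
    (iso (slice C X) (frob_map (slice D (R X)) (slice C X) (sliced_adj D C J X) g f) \<longleftrightarrow> iso C k)"
proof -
  interpret SD: catl "slice D (R X)" by unfold_locales (rule D.category_slice)
  interpret SC: catl "slice C X" by unfold_locales (rule C.category_slice)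
  have Rf: "RA f \<in> Arr D" "Cod D (RA f) = R X" using f by auto
  have eD: "\<exists>p q. is_product (slice D (R X)) g (RA f) p q"
    using exD D.slice_product[OF g(1) Rf(1) g(2) Rf(2)] by blast
  have eC: "\<exists>p q. is_product (slice C X) (tr X g) f p q"
    using exC C.slice_product[of "tr X g" f X] g f X by auto
  \<comment> \<open>The products entering \<open>frob_map\<close> are whatever Hilbert choice
    returned; only their form as tagged pullbacks is known. Hence the pullbacks in the conclusion
    are existentially quantified.\<close>
  obtain n1 n2 where n: "pr1 (slice D (R X)) g (RA f) = (g \<cdot>\<^bsub>D\<^esub> n1, n1, g)"
      "pr2 (slice D (R X)) g (RA f) = (g \<cdot>\<^bsub>D\<^esub> n1, n2, RA f)" and pbn: "is_pullback D g (RA f) n1 n2"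
    using SD.is_product_pr[OF eD] D.slice_product[OF g(1) Rf(1) g(2) Rf(2)] by auto
  obtain m1 m2 where m: "pr1 (slice C X) (tr X g) f = (tr X g \<cdot>\<^bsub>C\<^esub> m1, m1, tr X g)"
      "pr2 (slice C X) (tr X g) f = (tr X g \<cdot>\<^bsub>C\<^esub> m1, m2, f)" and pbm: "is_pullback C (tr X g) f m1 m2"
    using SC.is_product_pr[OF eC] C.slice_product[of "tr X g" f X] g f X by auto
  note nt = D.is_pullbackD[OF pbn] and mt = C.is_pullbackD[OF pbm]
  let ?J = "sliced_adj D C J X"
  let ?N = "tr X (g \<cdot>\<^bsub>D\<^esub> n1)"
  have 1: "FA (Ladj ?J) (pr1 (slice D (R X)) g (RA f)) = (?N, LA n1, tr X g)"
    unfolding n sliced_adj_def by simp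
  have "counit J (Dom C f) \<cdot>\<^bsub>C\<^esub> LA n2 \<in> hom C (L (Dom D n1)) (Dom C f)"
    using nt f by simp
  have 2: "counit ?J f \<cdot>\<^bsub>slice C X\<^esub> FA (Ladj ?J) (pr2 (slice D (R X)) g (RA f)) =
      (?N, counit J (Dom C f) \<cdot>\<^bsub>C\<^esub> LA n2, f)"
    unfolding n sliced_adj_def by simp
  have trRf: "tr X (RA f) = f \<cdot>\<^bsub>C\<^esub> counit J (Dom C f)"
    using tr_RA[OF f(1)] f by simp
  \<comment> \<open>The two components have the same structure map \<open>?N\<close>, so they are
    arrows of the slice with a common domain. For the second one this is naturality of the counit,
    in the form \<open>tr_RA\<close>.\<close>
  have c: "tr X g \<cdot>\<^bsub>C\<^esub> LA n1 = ?N" "f \<cdot>\<^bsub>C\<^esub> (counit J (Dom C f) \<cdot>\<^bsub>C\<^esub> LA n2) = ?N"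
  proof -
    show "tr X g \<cdot>\<^bsub>C\<^esub> LA n1 = ?N" using tr_comp[OF g X] nt by simp
    have "f \<cdot>\<^bsub>C\<^esub> (counit J (Dom C f) \<cdot>\<^bsub>C\<^esub> LA n2) = tr X (RA f) \<cdot>\<^bsub>C\<^esub> LA n2"
      using trRf f nt by simp
    also have "\<dots> = tr X (RA f \<cdot>\<^bsub>D\<^esub> n2)" using tr_comp[OF Rf X] nt by simp
    finally show "f \<cdot>\<^bsub>C\<^esub> (counit J (Dom C f) \<cdot>\<^bsub>C\<^esub> LA n2) = ?N" using nt by simp
  qed
  let ?F = "frob_map (slice D (R X)) (slice C X) ?J g f"
  have F: "?F \<in> Arr (slice C X)" "Dom (slice C X) ?F = ?N"
      "Cod (slice C X) ?F = prod_obj (slice C X) (tr X g) f"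
      "pr1 (slice C X) (tr X g) f \<cdot>\<^bsub>slice C X\<^esub> ?F = (?N, LA n1, tr X g)"
      "pr2 (slice C X) (tr X g) f \<cdot>\<^bsub>slice C X\<^esub> ?F = (?N, counit J (Dom C f) \<cdot>\<^bsub>C\<^esub> LA n2, f)"
  proof -
    have R': "FO (Radj ?J) f = RA f" unfolding sliced_adj_def by simp
    have a: "(?N, LA n1, tr X g) \<in> Arr (slice C X)" "(?N, counit J (Dom C f) \<cdot>\<^bsub>C\<^esub> LA n2, f) \<in> Arr (slice C X)"
      using c nt g f X by simp_all
    note 3 = SC.prod_pair_simps[OF eC a, unfolded C.slice_simps(3,4), OF refl refl refl]
    show "?F \<in> Arr (slice C X)" "Dom (slice C X) ?F = ?N"
      "Cod (slice C X) ?F = prod_obj (slice C X) (tr X g) f"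
      "pr1 (slice C X) (tr X g) f \<cdot>\<^bsub>slice C X\<^esub> ?F = (?N, LA n1, tr X g)"
      "pr2 (slice C X) (tr X g) f \<cdot>\<^bsub>slice C X\<^esub> ?F = (?N, counit J (Dom C f) \<cdot>\<^bsub>C\<^esub> LA n2, f)"
      unfolding frob_map_def R' 1 2 using 3 by blast+
  qed
  have "prod_obj (slice C X) (tr X g) f = tr X g \<cdot>\<^bsub>C\<^esub> m1"
    unfolding prod_obj_def m by simp
  with F(2,3) obtain k where k: "?F = (?N, k, tr X g \<cdot>\<^bsub>C\<^esub> m1)"
    by (cases ?F) simp
  have "k \<in> hom C (L (Dom D n1)) (Dom C m1)" "m1 \<cdot>\<^bsub>C\<^esub> k = LA n1" "m2 \<cdot>\<^bsub>C\<^esub> k = counit J (Dom C f) \<cdot>\<^bsub>C\<^esub> LA n2"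
    using F(1,4,5) mt nt g f X unfolding k m by simp_all
  moreover have "iso (slice C X) ?F \<longleftrightarrow> iso C k"
    using C.iso_slice F(1) unfolding k by blast
  ultimately show ?thesis using pbn pbm by blast
qed

lemma category_em: "category (em_of_adj D J)"
  unfolding em_of_adj_def em_cat_def
proof (rule D.category_structure, goal_cases)
  case (3 X h Y k Z)
  then have "k \<cdot>\<^bsub>D\<^esub> (snd Y \<cdot>\<^bsub>D\<^esub> RA (LA h)) = (snd Z \<cdot>\<^bsub>D\<^esub> RA (LA k)) \<cdot>\<^bsub>D\<^esub> RA (LA h)"
    by (intro D.comp_reassoc) auto
  with 3 show ?case by auto
qed auto

end

text \<open>Conjugation by \<open>\<sigma>\<close> recovers an arrow from its image under
  \<open>F\<close> after \<open>K\<close> (\<open>fK\<close>), so \<open>K\<close> is faithful;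
  \<open>fF\<close> shows the same for \<open>F\<close>. A preimage of \<open>e\<close> is the
  conjugate of \<open>FA F e\<close>: naturality of \<open>\<sigma>\<close> shows that its image
  under \<open>K\<close> and \<open>e\<close> agree after \<open>F\<close>, hence agree. Essential
  surjectivity is witnessed by \<open>\<tau>\<close>.\<close>

lemma equivalence_ff:
  assumes A: "category A" and E: "category E" and K: "is_equivalence A E K"
  shows "h \<in> hom A a b \<Longrightarrow> h' \<in> hom A a b \<Longrightarrow> FA K h = FA K h' \<Longrightarrow> h = h'"
    and "a \<in> Obj A \<Longrightarrow> b \<in> Obj A \<Longrightarrow> e \<in> hom E (FO K a) (FO K b) \<Longrightarrow> \<exists>h\<in>hom A a b. FA K h = e"
    and "z \<in> Obj E \<Longrightarrow> \<exists>a\<in>Obj A. \<exists>i\<in>hom E (FO K a) z. iso E i"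
proof -
  interpret A: catl A by unfold_locales (rule A)
  interpret E: catl E by unfold_locales (rule E)
  obtain F \<sigma> \<tau> where KF: "is_functor A E K" "is_functor E A F" and
    nat: "nat_iso A A (F \<circ>F K) id_func \<sigma>" "nat_iso E E (K \<circ>F F) id_func \<tau>"
    using K unfolding is_equivalence_def by blast
  note [simp] = is_functorD[OF KF(1)] is_functorD[OF KF(2)]
  have \<sigma>: "a \<in> Obj A \<Longrightarrow> \<sigma> a \<in> Arr A" "a \<in> Obj A \<Longrightarrow> Dom A (\<sigma> a) = FO F (FO K a)" "a \<in> Obj A \<Longrightarrow> Cod A (\<sigma> a) = a"
      "a \<in> Obj A \<Longrightarrow> iso A (\<sigma> a)" "f \<in> Arr A \<Longrightarrow> f \<cdot>\<^bsub>A\<^esub> \<sigma> (Dom A f) = \<sigma> (Cod A f) \<cdot>\<^bsub>A\<^esub> FA F (FA K f)" for a f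
    using nat(1) unfolding nat_iso_def nat_trans_def by auto
  have \<tau>: "a \<in> Obj E \<Longrightarrow> \<tau> a \<in> Arr E" "a \<in> Obj E \<Longrightarrow> Dom E (\<tau> a) = FO K (FO F a)" "a \<in> Obj E \<Longrightarrow> Cod E (\<tau> a) = a"
      "a \<in> Obj E \<Longrightarrow> iso E (\<tau> a)" "f \<in> Arr E \<Longrightarrow> f \<cdot>\<^bsub>E\<^esub> \<tau> (Dom E f) = \<tau> (Cod E f) \<cdot>\<^bsub>E\<^esub> FA K (FA F f)" for a f
    using nat(2) unfolding nat_iso_def nat_trans_def by auto
  have fK: "h = \<sigma> (Cod A h) \<cdot>\<^bsub>A\<^esub> (FA F (FA K h) \<cdot>\<^bsub>A\<^esub> inv_arr A (\<sigma> (Dom A h)))" if "h \<in> Arr A" for h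
  proof -
    have "h = (h \<cdot>\<^bsub>A\<^esub> \<sigma> (Dom A h)) \<cdot>\<^bsub>A\<^esub> inv_arr A (\<sigma> (Dom A h))"
      using that \<sigma>(1-4)[of "Dom A h"] by simp
    also have "\<dots> = (\<sigma> (Cod A h) \<cdot>\<^bsub>A\<^esub> FA F (FA K h)) \<cdot>\<^bsub>A\<^esub> inv_arr A (\<sigma> (Dom A h))"
      using \<sigma>(5)[OF that] by simp
    finally show ?thesis using that \<sigma>(1-4)[of "Dom A h"] \<sigma>(1-4)[of "Cod A h"] by simp
  qed
  have fF: "h = \<tau> (Cod E h) \<cdot>\<^bsub>E\<^esub> (FA K (FA F h) \<cdot>\<^bsub>E\<^esub> inv_arr E (\<tau> (Dom E h)))" if "h \<in> Arr E" for h
  proof -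
    have "h = (h \<cdot>\<^bsub>E\<^esub> \<tau> (Dom E h)) \<cdot>\<^bsub>E\<^esub> inv_arr E (\<tau> (Dom E h))"
      using that \<tau>(1-4)[of "Dom E h"] by simp
    also have "\<dots> = (\<tau> (Cod E h) \<cdot>\<^bsub>E\<^esub> FA K (FA F h)) \<cdot>\<^bsub>E\<^esub> inv_arr E (\<tau> (Dom E h))"
      using \<tau>(5)[OF that] by simp
    finally show ?thesis using that \<tau>(1-4)[of "Dom E h"] \<tau>(1-4)[of "Cod E h"] by simp
  qed
  show "h = h'" if "h \<in> hom A a b" "h' \<in> hom A a b" "FA K h = FA K h'"
    using fK[of h] fK[of h'] that by simp
  show "\<exists>h\<in>hom A a b. FA K h = e" if "a \<in> Obj A" "b \<in> Obj A" and e: "e \<in> hom E (FO K a) (FO K b)"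
  proof -
    let ?h = "\<sigma> b \<cdot>\<^bsub>A\<^esub> (FA F e \<cdot>\<^bsub>A\<^esub> inv_arr A (\<sigma> a))"
    note s = \<sigma>(1-4)[OF that(1)] \<sigma>(1-4)[OF that(2)]
    have h: "?h \<in> hom A a b" using that s by simp
    have "\<sigma> b \<cdot>\<^bsub>A\<^esub> FA F (FA K ?h) = ?h \<cdot>\<^bsub>A\<^esub> \<sigma> a"
      using \<sigma>(5)[of ?h] h by simp
    also have "\<dots> = \<sigma> b \<cdot>\<^bsub>A\<^esub> FA F e" using that s by simp
    finally have "inv_arr A (\<sigma> b) \<cdot>\<^bsub>A\<^esub> (\<sigma> b \<cdot>\<^bsub>A\<^esub> FA F (FA K ?h)) = inv_arr A (\<sigma> b) \<cdot>\<^bsub>A\<^esub> (\<sigma> b \<cdot>\<^bsub>A\<^esub> FA F e)" by simp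
    moreover have "FA F (FA K ?h) \<in> hom A (FO F (FO K a)) (FO F (FO K b))" "FA F e \<in> hom A (FO F (FO K a)) (FO F (FO K b))"
      using h e is_functorD(2-4)[OF KF(1), of ?h] by auto
    ultimately have "FA F (FA K ?h) = FA F e" using s by simp
    moreover have "FA K ?h \<in> hom E (FO K a) (FO K b)"
      using h is_functorD(2-4)[OF KF(1), of ?h] by auto
    ultimately have "FA K ?h = e"
      using fF[of "FA K ?h"] fF[of e] e by simp
    with h show ?thesis by blast
  qed
  show "\<exists>a\<in>Obj A. \<exists>i\<in>hom E (FO K a) z. iso E i" if "z \<in> Obj E"
    using that \<tau>(1-4)[of z] by (intro bexI[of _ "FO F z"] bexI[of _ "\<tau> z"]) auto
qed

text \<open>An adjunction from a profunctor \<open>Bil\<close> that is represented on both sides: \<open>lam W\<close> and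
  \<open>rho X\<close> are the universal elements, \<open>lc\<close> and \<open>rc\<close> the actions of arrows on elements.\<close>

locale biprofunctor = D: catl D + C: catl C
  for D :: "('o1, 'm1) cat" and C :: "('o2, 'm2) cat" +
  fixes Bil :: "'o1 \<Rightarrow> 'b \<Rightarrow> 'o2 \<Rightarrow> bool" and lc :: "'m2 \<Rightarrow> 'b \<Rightarrow> 'b" and rc :: "'b \<Rightarrow> 'm1 \<Rightarrow> 'b"
    and L :: "'o1 \<Rightarrow> 'o2" and lam :: "'o1 \<Rightarrow> 'b" and R :: "'o2 \<Rightarrow> 'o1" and rho :: "'o2 \<Rightarrow> 'b"
  assumes Bil_lc: "\<And>W \<phi> X h. Bil W \<phi> X \<Longrightarrow> W \<in> Obj D \<Longrightarrow> h \<in> Arr C \<Longrightarrow> Dom C h = X \<Longrightarrow> Bil W (lc h \<phi>) (Cod C h)"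
    and Bil_rc: "\<And>W \<phi> X k. Bil W \<phi> X \<Longrightarrow> X \<in> Obj C \<Longrightarrow> k \<in> Arr D \<Longrightarrow> Cod D k = W \<Longrightarrow> Bil (Dom D k) (rc \<phi> k) X"
    and lc_Id: "\<And>W \<phi> X. Bil W \<phi> X \<Longrightarrow> W \<in> Obj D \<Longrightarrow> X \<in> Obj C \<Longrightarrow> lc (Id C X) \<phi> = \<phi>"
    and rc_Id: "\<And>W \<phi> X. Bil W \<phi> X \<Longrightarrow> W \<in> Obj D \<Longrightarrow> X \<in> Obj C \<Longrightarrow> rc \<phi> (Id D W) = \<phi>"
    and lc_comp: "\<And>W \<phi> X f g. Bil W \<phi> X \<Longrightarrow> W \<in> Obj D \<Longrightarrow> f \<in> Arr C \<Longrightarrow> g \<in> Arr C \<Longrightarrow> Dom C f = X \<Longrightarrow> Cod C f = Dom C g \<Longrightarrow>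
      lc (g \<cdot>\<^bsub>C\<^esub> f) \<phi> = lc g (lc f \<phi>)"
    and rc_comp: "\<And>W \<phi> X f g. Bil W \<phi> X \<Longrightarrow> X \<in> Obj C \<Longrightarrow> f \<in> Arr D \<Longrightarrow> g \<in> Arr D \<Longrightarrow> Cod D g = W \<Longrightarrow> Cod D f = Dom D g \<Longrightarrow>
      rc \<phi> (g \<cdot>\<^bsub>D\<^esub> f) = rc (rc \<phi> g) f"
    and lc_rc: "\<And>W \<phi> X h k. Bil W \<phi> X \<Longrightarrow> h \<in> Arr C \<Longrightarrow> Dom C h = X \<Longrightarrow> k \<in> Arr D \<Longrightarrow> Cod D k = W \<Longrightarrow> rc (lc h \<phi>) k = lc h (rc \<phi> k)"
    and L_Obj: "\<And>W. W \<in> Obj D \<Longrightarrow> L W \<in> Obj C" and lam: "\<And>W. W \<in> Obj D \<Longrightarrow> Bil W (lam W) (L W)"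
    and R_Obj: "\<And>X. X \<in> Obj C \<Longrightarrow> R X \<in> Obj D" and rho: "\<And>X. X \<in> Obj C \<Longrightarrow> Bil (R X) (rho X) X"
    and lam_univ: "\<And>W \<phi> X. W \<in> Obj D \<Longrightarrow> X \<in> Obj C \<Longrightarrow> Bil W \<phi> X \<Longrightarrow> \<exists>!h. h \<in> hom C (L W) X \<and> lc h (lam W) = \<phi>"
    and rho_univ: "\<And>W \<phi> X. W \<in> Obj D \<Longrightarrow> X \<in> Obj C \<Longrightarrow> Bil W \<phi> X \<Longrightarrow> \<exists>!k. k \<in> hom D W (R X) \<and> rc (rho X) k = \<phi>"
begin

definition lfac where "lfac W \<phi> X = (THE h. h \<in> hom C (L W) X \<and> lc h (lam W) = \<phi>)"
definition rfac where "rfac W \<phi> X = (THE k. k \<in> hom D W (R X) \<and> rc (rho X) k = \<phi>)"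

lemma lfac:
  assumes "Bil W \<phi> X" "W \<in> Obj D" "X \<in> Obj C"
  shows "lfac W \<phi> X \<in> Arr C" "Dom C (lfac W \<phi> X) = L W" "Cod C (lfac W \<phi> X) = X" "lc (lfac W \<phi> X) (lam W) = \<phi>"
  using theI'[OF lam_univ[OF assms(2,3,1)]] unfolding lfac_def by auto

lemma rfac:
  assumes "Bil W \<phi> X" "W \<in> Obj D" "X \<in> Obj C"
  shows "rfac W \<phi> X \<in> Arr D" "Dom D (rfac W \<phi> X) = W" "Cod D (rfac W \<phi> X) = R X" "rc (rho X) (rfac W \<phi> X) = \<phi>"
  using theI'[OF rho_univ[OF assms(2,3,1)]] unfolding rfac_def by auto

lemma lfac_ext:
  assumes "W \<in> Obj D" "h \<in> Arr C" "h' \<in> Arr C" "Dom C h = L W" "Dom C h' = L W" "Cod C h = Cod C h'"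
    "lc h (lam W) = lc h' (lam W)"
  shows "h = h'"
proof -
  have "Bil W (lc h (lam W)) (Cod C h)" using Bil_lc[OF lam] assms by auto
  from lam_univ[OF assms(1) _ this] show ?thesis using assms by auto
qed

lemma rfac_ext:
  assumes "X \<in> Obj C" "h \<in> Arr D" "h' \<in> Arr D" "Cod D h = R X" "Cod D h' = R X" "Dom D h = Dom D h'"
    "rc (rho X) h = rc (rho X) h'"
  shows "h = h'"
proof -
  have "Bil (Dom D h) (rc (rho X) h) X" using Bil_rc[OF rho] assms by auto
  from rho_univ[OF _ assms(1) this] show ?thesis using assms by auto
qed

text \<open>The elements of \<open>Bil W X\<close> correspond to arrows \<open>L W\<close> to
  \<open>X\<close> and to arrows \<open>W\<close> to \<open>R X\<close>. Unit and counit are the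
  partners of the identities under the composite bijection.\<close>

definition bi_adj :: "('o1, 'm1, 'o2, 'm2) adj" where
  "bi_adj = \<lparr>Ladj = \<lparr>FO = L, FA = (\<lambda>k. lfac (Dom D k) (rc (lam (Cod D k)) k) (L (Cod D k)))\<rparr>,
     Radj = \<lparr>FO = R, FA = (\<lambda>h. rfac (R (Dom C h)) (lc h (rho (Dom C h))) (Cod C h))\<rparr>,
     unit = (\<lambda>W. rfac W (lam W) (L W)), counit = (\<lambda>X. lfac (R X) (rho X) X)\<rparr>"

lemma bi_FO [simp]: "FO (Ladj bi_adj) = L" "FO (Radj bi_adj) = R"
  unfolding bi_adj_def by auto

lemma bi_LA [simp]:
  assumes "k \<in> Arr D"
  shows "FA (Ladj bi_adj) k \<in> Arr C" "Dom C (FA (Ladj bi_adj) k) = L (Dom D k)" "Cod C (FA (Ladj bi_adj) k) = L (Cod D k)"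
    "lc (FA (Ladj bi_adj) k) (lam (Dom D k)) = rc (lam (Cod D k)) k"
proof -
  have "Bil (Dom D k) (rc (lam (Cod D k)) k) (L (Cod D k))"
    using assms Bil_rc[OF lam] L_Obj by auto
  note lfac[OF this]
  then show "FA (Ladj bi_adj) k \<in> Arr C" "Dom C (FA (Ladj bi_adj) k) = L (Dom D k)" "Cod C (FA (Ladj bi_adj) k) = L (Cod D k)"
    "lc (FA (Ladj bi_adj) k) (lam (Dom D k)) = rc (lam (Cod D k)) k"
    using assms L_Obj unfolding bi_adj_def by auto
qed

lemma bi_RA [simp]:
  assumes "h \<in> Arr C"
  shows "FA (Radj bi_adj) h \<in> Arr D" "Dom D (FA (Radj bi_adj) h) = R (Dom C h)" "Cod D (FA (Radj bi_adj) h) = R (Cod C h)"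
    "rc (rho (Cod C h)) (FA (Radj bi_adj) h) = lc h (rho (Dom C h))"
proof -
  have "Bil (R (Dom C h)) (lc h (rho (Dom C h))) (Cod C h)"
    using assms Bil_lc[OF rho] R_Obj by auto
  note rfac[OF this]
  then show "FA (Radj bi_adj) h \<in> Arr D" "Dom D (FA (Radj bi_adj) h) = R (Dom C h)" "Cod D (FA (Radj bi_adj) h) = R (Cod C h)"
    "rc (rho (Cod C h)) (FA (Radj bi_adj) h) = lc h (rho (Dom C h))"
    using assms R_Obj unfolding bi_adj_def by auto
qed

lemma bi_unit [simp]:
  assumes "W \<in> Obj D"
  shows "unit bi_adj W \<in> Arr D" "Dom D (unit bi_adj W) = W" "Cod D (unit bi_adj W) = R (L W)"
    "rc (rho (L W)) (unit bi_adj W) = lam W"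
  using rfac[OF lam] L_Obj assms unfolding bi_adj_def by auto

lemma bi_counit [simp]:
  assumes "X \<in> Obj C"
  shows "counit bi_adj X \<in> Arr C" "Dom C (counit bi_adj X) = L (R X)" "Cod C (counit bi_adj X) = X"
    "lc (counit bi_adj X) (lam (R X)) = rho X"
  using lfac[OF rho] R_Obj assms unfolding bi_adj_def by auto

text \<open>By \<open>lfac_ext\<close>, arrows out of \<open>L W\<close> are equal as soon as they
  act equally on the universal element \<open>lam W\<close>. Every law of the adjunction reduces in
  this way, or dually by \<open>rfac_ext\<close>, to a computation with \<open>lc\<close> and
  \<open>rc\<close>, which commute by \<open>lc_rc\<close>.\<close>

lemma functor_bi_L: "is_functor D C (Ladj bi_adj)"
  unfolding is_functor_def
proof (intro conjI ballI impI)
  fix A assume A: "A \<in> Obj D"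
  then show "FA (Ladj bi_adj) (Id D A) = Id C (FO (Ladj bi_adj) A)"
    using L_Obj bi_LA[of "Id D A"] lc_Id[OF lam] rc_Id[OF lam] by (intro lfac_ext[of A]) auto
next
  fix f g assume fg: "f \<in> Arr D" "g \<in> Arr D" "Cod D f = Dom D g"
  have "lc (FA (Ladj bi_adj) (g \<cdot>\<^bsub>D\<^esub> f)) (lam (Dom D f)) = rc (lam (Cod D g)) (g \<cdot>\<^bsub>D\<^esub> f)"
    using bi_LA(4)[of "g \<cdot>\<^bsub>D\<^esub> f"] fg by simp
  also have "\<dots> = rc (rc (lam (Cod D g)) g) f"
    using rc_comp[OF lam] fg L_Obj by auto
  also have "\<dots> = rc (lc (FA (Ladj bi_adj) g) (lam (Dom D g))) f" using fg by simp
  also have "\<dots> = lc (FA (Ladj bi_adj) g) (lc (FA (Ladj bi_adj) f) (lam (Dom D f)))"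
    using lc_rc[OF lam[of "Dom D g"], of "FA (Ladj bi_adj) g" f] fg by simp
  also have "\<dots> = lc (FA (Ladj bi_adj) g \<cdot>\<^bsub>C\<^esub> FA (Ladj bi_adj) f) (lam (Dom D f))"
    using lc_comp[OF lam[of "Dom D f"]] fg by simp
  finally show "FA (Ladj bi_adj) (g \<cdot>\<^bsub>D\<^esub> f) = FA (Ladj bi_adj) g \<cdot>\<^bsub>C\<^esub> FA (Ladj bi_adj) f"
    using fg by (intro lfac_ext[of "Dom D f"]) auto
qed (auto simp: L_Obj)

lemma functor_bi_R: "is_functor C D (Radj bi_adj)"
  unfolding is_functor_def
proof (intro conjI ballI impI)
  fix A assume A: "A \<in> Obj C"
  then show "FA (Radj bi_adj) (Id C A) = Id D (FO (Radj bi_adj) A)"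
    using R_Obj bi_RA[of "Id C A"] lc_Id[OF rho] rc_Id[OF rho] by (intro rfac_ext[of A]) auto
next
  fix f g assume fg: "f \<in> Arr C" "g \<in> Arr C" "Cod C f = Dom C g"
  have "rc (rho (Cod C g)) (FA (Radj bi_adj) (g \<cdot>\<^bsub>C\<^esub> f)) = lc (g \<cdot>\<^bsub>C\<^esub> f) (rho (Dom C f))"
    using bi_RA(4)[of "g \<cdot>\<^bsub>C\<^esub> f"] fg by simp
  also have "\<dots> = lc g (lc f (rho (Dom C f)))"
    using lc_comp[OF rho] fg R_Obj by auto
  also have "\<dots> = lc g (rc (rho (Dom C g)) (FA (Radj bi_adj) f))" using bi_RA(4)[of f] fg by simp
  also have "\<dots> = rc (rc (rho (Cod C g)) (FA (Radj bi_adj) g)) (FA (Radj bi_adj) f)"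
    using lc_rc[OF rho[of "Dom C g"], of g "FA (Radj bi_adj) f"] fg by simp
  also have "\<dots> = rc (rho (Cod C g)) (FA (Radj bi_adj) g \<cdot>\<^bsub>D\<^esub> FA (Radj bi_adj) f)"
    using rc_comp[OF rho[of "Cod C g"]] fg by simp
  finally show "FA (Radj bi_adj) (g \<cdot>\<^bsub>C\<^esub> f) = FA (Radj bi_adj) g \<cdot>\<^bsub>D\<^esub> FA (Radj bi_adj) f"
    using fg by (intro rfac_ext[of "Cod C g"]) auto
qed (auto simp: R_Obj)

lemma adjunction_bi: "adjunction D C bi_adj"
  unfolding adjunction_def nat_trans_def
proof (intro conjI ballI functor_bi_L functor_bi_R)
  show "is_functor D D id_func" "is_functor C C id_func" unfolding is_functor_def by auto
  show "is_functor D D (Radj bi_adj \<circ>F Ladj bi_adj)" "is_functor C C (Ladj bi_adj \<circ>F Radj bi_adj)"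
    using is_functorD[OF functor_bi_L] is_functorD[OF functor_bi_R] unfolding is_functor_def by auto
next
  fix f assume f: "f \<in> Arr D"
  have "rc (rho (L (Cod D f))) (FA (Radj bi_adj) (FA (Ladj bi_adj) f) \<cdot>\<^bsub>D\<^esub> unit bi_adj (Dom D f))
     = rc (lc (FA (Ladj bi_adj) f) (rho (L (Dom D f)))) (unit bi_adj (Dom D f))"
    using f L_Obj rc_comp[OF rho] bi_RA(4)[of "FA (Ladj bi_adj) f"] by simp
  also have "\<dots> = lc (FA (Ladj bi_adj) f) (lam (Dom D f))"
    using f L_Obj lc_rc[OF rho] by simp
  also have "\<dots> = rc (rc (rho (L (Cod D f))) (unit bi_adj (Cod D f))) f"
    using f by simp
  also have "\<dots> = rc (rho (L (Cod D f))) (unit bi_adj (Cod D f) \<cdot>\<^bsub>D\<^esub> f)"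
    using f L_Obj rc_comp[OF rho] by simp
  finally show "FA (Radj bi_adj \<circ>F Ladj bi_adj) f \<cdot>\<^bsub>D\<^esub> unit bi_adj (Dom D f) = unit bi_adj (Cod D f) \<cdot>\<^bsub>D\<^esub> FA id_func f"
    using f L_Obj by (intro rfac_ext[of "L (Cod D f)"]) auto
next
  fix f assume f: "f \<in> Arr C"
  have "lc (counit bi_adj (Cod C f) \<cdot>\<^bsub>C\<^esub> FA (Ladj bi_adj) (FA (Radj bi_adj) f)) (lam (R (Dom C f)))
     = lc (counit bi_adj (Cod C f)) (rc (lam (R (Cod C f))) (FA (Radj bi_adj) f))"
    using f R_Obj lc_comp[OF lam] bi_LA(4)[of "FA (Radj bi_adj) f"] by simp
  also have "\<dots> = rc (rho (Cod C f)) (FA (Radj bi_adj) f)"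
    using f R_Obj lc_rc[OF lam[of "R (Cod C f)"], of "counit bi_adj (Cod C f)" "FA (Radj bi_adj) f"] by simp
  also have "\<dots> = lc f (lc (counit bi_adj (Dom C f)) (lam (R (Dom C f))))"
    using f by simp
  also have "\<dots> = lc (f \<cdot>\<^bsub>C\<^esub> counit bi_adj (Dom C f)) (lam (R (Dom C f)))"
    using f R_Obj lc_comp[OF lam] by simp
  finally show "FA id_func f \<cdot>\<^bsub>C\<^esub> counit bi_adj (Dom C f) = counit bi_adj (Cod C f) \<cdot>\<^bsub>C\<^esub> FA (Ladj bi_adj \<circ>F Radj bi_adj) f"
    using f R_Obj by (intro lfac_ext[of "R (Dom C f)"]) auto
next
  fix W assume W: "W \<in> Obj D"
  have "lc (counit bi_adj (L W) \<cdot>\<^bsub>C\<^esub> FA (Ladj bi_adj) (unit bi_adj W)) (lam W)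
    = lc (counit bi_adj (L W)) (rc (lam (R (L W))) (unit bi_adj W))"
    using W L_Obj R_Obj lc_comp[OF lam] bi_LA(4)[of "unit bi_adj W"] by simp
  also have "\<dots> = lam W"
    using W L_Obj R_Obj lc_rc[OF lam[of "R (L W)"], of "counit bi_adj (L W)" "unit bi_adj W"] by simp
  finally show "counit bi_adj (FO (Ladj bi_adj) W) \<cdot>\<^bsub>C\<^esub> FA (Ladj bi_adj) (unit bi_adj W) = Id C (FO (Ladj bi_adj) W)"
    using W L_Obj R_Obj lc_Id[OF lam] by (intro lfac_ext[of W]) auto
next
  fix X assume X: "X \<in> Obj C"
  have "rc (rho X) (FA (Radj bi_adj) (counit bi_adj X) \<cdot>\<^bsub>D\<^esub> unit bi_adj (R X))
    = rc (lc (counit bi_adj X) (rho (L (R X)))) (unit bi_adj (R X))"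
    using X L_Obj R_Obj rc_comp[OF rho] bi_RA(4)[of "counit bi_adj X"] by simp
  also have "\<dots> = rho X"
    using X L_Obj R_Obj lc_rc[OF rho] by simp
  finally show "FA (Radj bi_adj) (counit bi_adj X) \<cdot>\<^bsub>D\<^esub> unit bi_adj (FO (Radj bi_adj) X) = Id D (FO (Radj bi_adj) X)"
    using X L_Obj R_Obj rc_Id[OF rho] by (intro rfac_ext[of X]) auto
qed (auto simp: L_Obj R_Obj)

text \<open>An arrow and its transpose represent the same element of the profunctor. Transposes can
  thus be computed later without unfolding the counit.\<close>

lemma lc_adj_transpose:
  assumes "g \<in> Arr D" "Cod D g = R X" "X \<in> Obj C"
  shows "lc (adj_transpose D C bi_adj X g) (lam (Dom D g)) = rc (rho X) g"
proof -
  have "lc (adj_transpose D C bi_adj X g) (lam (Dom D g)) = lc (counit bi_adj X) (rc (lam (R X)) g)"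
    using assms lc_comp[OF lam] R_Obj unfolding adj_transpose_def by simp
  also have "\<dots> = rc (rho X) g"
    using assms R_Obj lc_rc[OF lam[of "R X"], of "counit bi_adj X" g] by simp
  finally show ?thesis .
qed

end

section \<open>Pullbacks\<close>

locale fincat = catl C for C :: "('o, 'm) cat" (structure) +
  assumes finite_limits: "has_finite_limits C"
begin

lemma pullback_ex:
  assumes [simp]: "f \<in> Arr C" "g \<in> Arr C" "Cod C f = Cod C g"
  shows "\<exists>p q. is_pullback C f g p q"
proof -
  \<comment> \<open>The cospan: objects \<open>0\<close>, \<open>1\<close>, \<open>2\<close> with
    identities of the same names, and arrows \<open>3\<close> from \<open>0\<close> to
    \<open>2\<close> and \<open>4\<close> from \<open>1\<close> to \<open>2\<close>. In a composite
    of \<open>b\<close> after \<open>a\<close>, either \<open>b\<close> is \<open>3\<close> or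
    \<open>4\<close> and \<open>a\<close> is an identity, or \<open>b\<close> is an
    identity.\<close>
  define J :: "(nat, nat) cat" where
    "J = \<lparr>Obj = {0, 1, 2}, Arr = {0, 1, 2, 3, 4}, Dom = (\<lambda>a. if a = 3 then 0 else if a = 4 then 1 else a),
      Cod = (\<lambda>a. if a \<ge> 3 then 2 else a), Id = (\<lambda>a. a), Comp = (\<lambda>b a. if b \<ge> 3 then b else a)\<rparr>"
  define ob where "ob = (\<lambda>j::nat. if j = 0 then Dom C f else if j = 1 then Dom C g else Cod C g)"
  define D where "D = \<lparr>FO = ob, FA = (\<lambda>a. if a = 3 then f else if a = 4 then g else Id C (ob a))\<rparr>"
  have "category J" "finite (Obj J)" "finite (Arr J)"
    unfolding category_def J_def by auto
  moreover have "is_functor J C D"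
    unfolding is_functor_def J_def D_def ob_def by auto
  ultimately obtain A \<pi> where lim: "is_limit J C D A \<pi>"
    using finite_limits unfolding has_finite_limits_def by blast
  then have cone: "A \<in> Obj C" "\<pi> 0 \<in> hom C A (Dom C f)" "\<pi> 1 \<in> hom C A (Dom C g)" "f \<cdot> \<pi> 0 = \<pi> 2" "g \<cdot> \<pi> 1 = \<pi> 2"
    unfolding is_limit_def is_cone_def J_def D_def ob_def by auto
  have "is_pullback C f g (\<pi> 0) (\<pi> 1)"
    unfolding is_pullback_def
  proof (intro conjI allI ballI impI)
    fix T u v assume uv: "u \<in> hom C T (Dom C f)" "v \<in> hom C T (Dom C g)" "f \<cdot> u = g \<cdot> v"
    define \<rho> where "\<rho> = (\<lambda>j::nat. if j = 0 then u else if j = 1 then v else f \<cdot> u)"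
    have "is_cone J C D T \<rho>"
      using uv unfolding is_cone_def J_def D_def ob_def \<rho>_def by auto
    then have "\<exists>!h. h \<in> hom C T A \<and> (\<forall>j\<in>Obj J. \<pi> j \<cdot> h = \<rho> j)"
      using lim unfolding is_limit_def by blast
    \<comment> \<open>The leg to object \<open>2\<close> is forced by the leg to object
      \<open>0\<close>, so a cone over the cospan amounts to a commuting pair of legs.\<close>
    moreover have "(\<forall>j\<in>Obj J. \<pi> j \<cdot> h = \<rho> j) \<longleftrightarrow> \<pi> 0 \<cdot> h = u \<and> \<pi> 1 \<cdot> h = v" if "h \<in> hom C T A" for h
    proof -
      have "\<pi> 2 \<cdot> h = f \<cdot> (\<pi> 0 \<cdot> h)"
        using comp_reassoc[OF cone(4), of h] that cone(1-3) by simp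
      then show ?thesis unfolding J_def \<rho>_def by auto
    qed
    moreover have "Dom C (\<pi> 0) = A" using cone by simp
    ultimately show "\<exists>!h. h \<in> hom C T (Dom C (\<pi> 0)) \<and> \<pi> 0 \<cdot> h = u \<and> \<pi> 1 \<cdot> h = v"
      by metis
  qed (use cone in auto)
  then show ?thesis by blast
qed

lemma product_ex:
  assumes [simp]: "A \<in> Obj C" "B \<in> Obj C"
  shows "\<exists>p q. is_product C A B p q"
proof -
  \<comment> \<open>The discrete category on two objects.\<close>
  define J :: "(nat, nat) cat" where
    "J = \<lparr>Obj = {0, 1}, Arr = {0, 1}, Dom = (\<lambda>a. a), Cod = (\<lambda>a. a), Id = (\<lambda>a. a), Comp = (\<lambda>b a. a)\<rparr>"
  define ob where "ob = (\<lambda>j::nat. if j = 0 then A else B)"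
  define D where "D = \<lparr>FO = ob, FA = (\<lambda>a. Id C (ob a))\<rparr>"
  have "category J" "finite (Obj J)" "finite (Arr J)"
    unfolding category_def J_def by auto
  moreover have "is_functor J C D"
    unfolding is_functor_def J_def D_def ob_def by auto
  ultimately obtain S \<pi> where lim: "is_limit J C D S \<pi>"
    using finite_limits unfolding has_finite_limits_def by blast
  then have cone: "S \<in> Obj C" "\<pi> 0 \<in> hom C S A" "\<pi> 1 \<in> hom C S B"
    unfolding is_limit_def is_cone_def J_def D_def ob_def by auto
  have "is_product C A B (\<pi> 0) (\<pi> 1)"
    unfolding is_product_def
  proof (intro conjI allI ballI impI)
    fix T u v assume uv: "u \<in> hom C T A" "v \<in> hom C T B"
    define \<rho> where "\<rho> = (\<lambda>j::nat. if j = 0 then u else v)"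
    have "is_cone J C D T \<rho>"
      using uv unfolding is_cone_def J_def D_def ob_def \<rho>_def by auto
    then have "\<exists>!h. h \<in> hom C T S \<and> (\<forall>j\<in>Obj J. \<pi> j \<cdot> h = \<rho> j)"
      using lim unfolding is_limit_def by blast
    moreover have "(\<forall>j\<in>Obj J. \<pi> j \<cdot> h = \<rho> j) \<longleftrightarrow> \<pi> 0 \<cdot> h = u \<and> \<pi> 1 \<cdot> h = v" for h
      unfolding J_def \<rho>_def by auto
    moreover have "Dom C (\<pi> 0) = S" using cone by simp
    ultimately show "\<exists>!h. h \<in> hom C T (Dom C (\<pi> 0)) \<and> \<pi> 0 \<cdot> h = u \<and> \<pi> 1 \<cdot> h = v"
      by metis
  qed (use cone in auto)
  then show ?thesis by blast
qed

lemma pr_arr [simp]: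
  assumes "A \<in> Obj C" "B \<in> Obj C"
  shows "pr1 C A B \<in> Arr C" "Cod C (pr1 C A B) = A" "Dom C (pr1 C A B) = prod_obj C A B"
      "pr2 C A B \<in> Arr C" "Cod C (pr2 C A B) = B" "Dom C (pr2 C A B) = prod_obj C A B"
  using pr_simps[OF product_ex[OF assms]] by auto

lemma prod_pair_arr [simp]:
  assumes "f \<in> Arr C" "g \<in> Arr C" "Dom C f = Dom C g"
  shows "prod_pair C f g \<in> Arr C" "Dom C (prod_pair C f g) = Dom C g"
    "Cod C (prod_pair C f g) = prod_obj C (Cod C f) (Cod C g)"
  using prod_pair_simps[OF product_ex, of "Cod C f" "Cod C g" f g] assms by auto

lemma pr_prod_pair [simp]:
  assumes "f \<in> Arr C" "g \<in> Arr C" "Dom C f = Dom C g"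
  shows "Cod C f = A \<Longrightarrow> Cod C g = B \<Longrightarrow> pr1 C A B \<cdot> prod_pair C f g = f"
    "Cod C f = A \<Longrightarrow> Cod C g = B \<Longrightarrow> pr2 C A B \<cdot> prod_pair C f g = g"
  using prod_pair_simps[OF product_ex, of "Cod C f" "Cod C g" f g] assms by auto

lemma prod_obj_Obj [simp]:
  assumes "A \<in> Obj C" "B \<in> Obj C" shows "prod_obj C A B \<in> Obj C"
  using Dom_Obj[OF pr_arr(1)[OF assms]] assms by simp

lemma prod_eqI:
  assumes "A \<in> Obj C" "B \<in> Obj C" "h \<in> Arr C" "k \<in> Arr C" "Dom C h = Dom C k" "Cod C h = prod_obj C A B" "Cod C k = prod_obj C A B"
    "pr1 C A B \<cdot> h = pr1 C A B \<cdot> k" "pr2 C A B \<cdot> h = pr2 C A B \<cdot> k"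
  shows "h = k"
  using prod_ext[OF product_ex[OF assms(1,2)]] assms by blast

lemma prod_pair_comp [simp]:
  assumes "f \<in> Arr C" "g \<in> Arr C" "Dom C f = Dom C g" "s \<in> Arr C" "Cod C s = Dom C g"
  shows "prod_pair C f g \<cdot> s = prod_pair C (f \<cdot> s) (g \<cdot> s)"
  by (rule prod_eqI[of "Cod C f" "Cod C g"])
    (use assms comp_reassoc[OF pr_prod_pair(1)[OF assms(1-3) refl refl], of s]
       comp_reassoc[OF pr_prod_pair(2)[OF assms(1-3) refl refl], of s] in auto)

lemma pb_is_pullback:
  assumes "f \<in> Arr C" "g \<in> Arr C" "Cod C f = Cod C g"
  shows "is_pullback C f g (pb1 C f g) (pb2 C f g)"
proof -
  have "\<exists>s. is_pullback C f g (fst s) (snd s)"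
    using pullback_ex[OF assms] by auto
  then show ?thesis
    unfolding pb1_def pb2_def pb_cone_def by (rule someI_ex)
qed

lemma pb_arr [simp]:
  assumes "f \<in> Arr C" "g \<in> Arr C" "Cod C f = Cod C g"
  shows "pb1 C f g \<in> Arr C" "Cod C (pb1 C f g) = Dom C f" "Dom C (pb1 C f g) = pb_obj C f g"
    "pb2 C f g \<in> Arr C" "Cod C (pb2 C f g) = Dom C g" "Dom C (pb2 C f g) = pb_obj C f g"
  using is_pullbackD[OF pb_is_pullback[OF assms]] unfolding pb_obj_def by auto

lemma pb_obj_Obj [simp]:
  assumes "f \<in> Arr C" "g \<in> Arr C" "Cod C f = Cod C g"
  shows "pb_obj C f g \<in> Obj C"
  using Dom_Obj[OF pb_arr(1)[OF assms]] assms by simp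

lemma pb_comm:
  assumes "f \<in> Arr C" "g \<in> Arr C" "Cod C f = Cod C g"
  shows "f \<cdot> pb1 C f g = g \<cdot> pb2 C f g"
    and "x \<in> Arr C \<Longrightarrow> Cod C x = pb_obj C f g \<Longrightarrow> f \<cdot> (pb1 C f g \<cdot> x) = g \<cdot> (pb2 C f g \<cdot> x)"
proof -
  show *: "f \<cdot> pb1 C f g = g \<cdot> pb2 C f g"
    using is_pullbackD[OF pb_is_pullback[OF assms]] by auto
  show "x \<in> Arr C \<Longrightarrow> Cod C x = pb_obj C f g \<Longrightarrow> f \<cdot> (pb1 C f g \<cdot> x) = g \<cdot> (pb2 C f g \<cdot> x)"
    using comp_reassoc[OF *, of x] assms by simp
qed

lemma pb_pair_arr [simp]:
  assumes "u \<in> Arr C" "v \<in> Arr C" "f \<in> Arr C" "g \<in> Arr C" "Cod C f = Cod C g" "Dom C u = Dom C v"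
     "Cod C u = Dom C f" "Cod C v = Dom C g" "f \<cdot> u = g \<cdot> v"
  shows "pb_pair C f g u v \<in> Arr C" "Dom C (pb_pair C f g u v) = Dom C v" "Cod C (pb_pair C f g u v) = pb_obj C f g"
    "pb1 C f g \<cdot> pb_pair C f g u v = u" "pb2 C f g \<cdot> pb_pair C f g u v = v"
proof -
  have "u \<in> hom C (Dom C u) (Dom C f)" "v \<in> hom C (Dom C u) (Dom C g)" using assms by auto
  then have "\<exists>!h. h \<in> hom C (Dom C u) (pb_obj C f g) \<and> pb1 C f g \<cdot> h = u \<and> pb2 C f g \<cdot> h = v"
    using pb_is_pullback[OF assms(3-5)] assms(9) unfolding is_pullback_def pb_obj_def by blast
  from theI'[OF this]
  show "pb_pair C f g u v \<in> Arr C" "Dom C (pb_pair C f g u v) = Dom C v" "Cod C (pb_pair C f g u v) = pb_obj C f g"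
    "pb1 C f g \<cdot> pb_pair C f g u v = u" "pb2 C f g \<cdot> pb_pair C f g u v = v"
    unfolding pb_pair_def using assms(6) by auto
qed

lemma pb_eqI:
  assumes "f \<in> Arr C" "g \<in> Arr C" "Cod C f = Cod C g" "h \<in> Arr C" "k \<in> Arr C" "Dom C h = Dom C k"
    "Cod C h = pb_obj C f g" "Cod C k = pb_obj C f g"
    "pb1 C f g \<cdot> h = pb1 C f g \<cdot> k" "pb2 C f g \<cdot> h = pb2 C f g \<cdot> k"
  shows "h = k"
  using is_pullback_ext[OF pb_is_pullback[OF assms(1-3)] assms(1-6)] assms by simp

lemma pb_pair_comp [simp]:
  assumes "u \<in> Arr C" "v \<in> Arr C" "f \<in> Arr C" "g \<in> Arr C" "Cod C f = Cod C g" "Dom C u = Dom C v"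
     "Cod C u = Dom C f" "Cod C v = Dom C g" "f \<cdot> u = g \<cdot> v" "s \<in> Arr C" "Cod C s = Dom C v"
  shows "pb_pair C f g u v \<cdot> s = pb_pair C f g (u \<cdot> s) (v \<cdot> s)"
proof -
  have "f \<cdot> (u \<cdot> s) = g \<cdot> (v \<cdot> s)"
    using comp_reassoc[OF assms(9), of s] assms by simp
  moreover note [simp] = assms pb_pair_arr[OF assms(1-9)]
  have "pb1 C f g \<cdot> (pb_pair C f g u v \<cdot> s) = u \<cdot> s" "pb2 C f g \<cdot> (pb_pair C f g u v \<cdot> s) = v \<cdot> s"
    using comp_reassoc[OF pb_pair_arr(4)[OF assms(1-9)], of s] comp_reassoc[OF pb_pair_arr(5)[OF assms(1-9)], of s]
    by auto
  ultimately show ?thesis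
    by - (rule pb_eqI[OF assms(3-5)], simp_all)
qed

lemma pb_pair_eta [simp]:
  assumes "f \<in> Arr C" "g \<in> Arr C" "Cod C f = Cod C g"
  shows "pb_pair C f g (pb1 C f g) (pb2 C f g) = Id C (pb_obj C f g)"
    and "x \<in> Arr C \<Longrightarrow> Cod C x = pb_obj C f g \<Longrightarrow> pb_pair C f g (pb1 C f g \<cdot> x) (pb2 C f g \<cdot> x) = x"
proof -
  show "pb_pair C f g (pb1 C f g) (pb2 C f g) = Id C (pb_obj C f g)"
    by (rule pb_eqI[of f g]) (simp_all add: assms pb_comm(1)[OF assms])
  show "pb_pair C f g (pb1 C f g \<cdot> x) (pb2 C f g \<cdot> x) = x" if "x \<in> Arr C" "Cod C x = pb_obj C f g"
    by (rule pb_eqI[of f g]) (simp_all add: assms that pb_comm(2)[OF assms that])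
qed

text \<open>\<open>pel f g x y\<close>: the pair \<open>(x, y)\<close> is a generalized element of the pullback of \<open>f\<close> and \<open>g\<close>.\<close>

abbreviation "pel f g x y \<equiv>
  x \<in> Arr C \<and> y \<in> Arr C \<and> Dom C x = Dom C y \<and> Cod C x = Dom C f \<and> Cod C y = Dom C g \<and> f \<cdot> x = g \<cdot> y"

end

section \<open>Effective descent\<close>

text \<open>Monadicity provides some adjunction with the pullback functor as right adjoint. Its left
  adjoint is isomorphic to composition with \<open>p\<close>, but it cannot be replaced by that
  functor, because the Eilenberg--Moore category and the comparison functor are built from
  \<open>J\<close> itself. The following lemmas express all data of \<open>J\<close> through this
  isomorphism.\<close>

locale monadic_pullback = fincat C for C :: "('o, 'm) cat" (structure) +
  fixes p J
  assumes p [simp]: "p \<in> Arr C" and adj: "adjunction (slice C (Dom C p)) (slice C (Cod C p)) J"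
    and Radj_J: "Radj J = pullback_functor C p"
    and equiv: "is_equivalence (slice C (Cod C p)) (em_of_adj (slice C (Dom C p)) J) (comparison (slice C (Cod C p)) J)"
begin

sublocale A: adjl "slice C (Dom C p)" "slice C (Cod C p)" J
  by unfold_locales (auto simp: category_slice adj)

abbreviation "F \<equiv> FO (Ladj J)"

text \<open>The unit corresponds to an arrow \<open>ep y : dom y \<rightarrow> dom (F y)\<close>; as \<open>\<Sigma>\<^sub>p\<close> is also left adjoint to
  the pullback functor, this is an isomorphism, with inverse \<open>en y\<close>.\<close>

definition "ep y = pb2 C p (F y) \<cdot> fst (snd (unit J y))"
definition "en y = fst (snd (A.tr (p \<cdot> y) (y, pb_pair C p (p \<cdot> y) y (Id C (Dom C y)), pb1 C p (p \<cdot> y))))"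

lemma R_obj: "A.R w = pb1 C p w"
  and R_arr: "A.RA (v, h, w) = (pb1 C p v, pb_pair C p w (pb1 C p v) (h \<cdot> pb2 C p v), pb1 C p w)"
  unfolding Radj_J pullback_functor_def by auto

context
  fixes y
  assumes y [simp]: "y \<in> Arr C" "Cod C y = Dom C p"
begin

lemma F_simps [simp]: "F y \<in> Arr C" "Cod C (F y) = Cod C p"
proof -
  have "F y \<in> Obj (slice C (Cod C p))" by (rule A.LR_simps(1)) simp
  then show "F y \<in> Arr C" "Cod C (F y) = Cod C p" by simp_all
qed

text \<open>An arrow over the domain of \<open>p\<close> into the pullback of \<open>p\<close> and
  \<open>F y\<close> is determined by its second component, so \<open>ep y\<close> contains the
  whole unit.\<close>

lemma unit_form:
  "ep y \<in> Arr C" "Dom C (ep y) = Dom C y" "Cod C (ep y) = Dom C (F y)" "F y \<cdot> ep y = p \<cdot> y"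
  "unit J y = (y, pb_pair C p (F y) y (ep y), pb1 C p (F y))"
proof -
  obtain a h b where u: "unit J y = (a, h, b)" by (cases "unit J y")
  have "unit J y \<in> Arr (slice C (Dom C p))" "Dom (slice C (Dom C p)) (unit J y) = y"
     "Cod (slice C (Dom C p)) (unit J y) = pb1 C p (F y)"
    using A.unit_simps(1-3)[of y] by (simp_all add: R_obj del: slice_simps(2))
  then have h: "a = y" "b = pb1 C p (F y)" "h \<in> Arr C" "Dom C h = Dom C y" "Cod C h = pb_obj C p (F y)"
      "pb1 C p (F y) \<cdot> h = y"
    unfolding u by auto
  have ep: "ep y = pb2 C p (F y) \<cdot> h" unfolding ep_def u by simp
  then show t: "ep y \<in> Arr C" "Dom C (ep y) = Dom C y" "Cod C (ep y) = Dom C (F y)" using h by simp_all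
  show "F y \<cdot> ep y = p \<cdot> y"
    using pb_comm(2)[of p "F y" h] h by (simp add: ep)
  then have "h = pb_pair C p (F y) y (ep y)"
    using h t by - (rule pb_eqI[of p "F y"], simp_all add: ep)
  then show "unit J y = (y, pb_pair C p (F y) y (ep y), pb1 C p (F y))"
    using u h by simp
qed

lemmas ep_simps [simp] = unit_form(1-4)

text \<open>\<open>en y\<close> is the transpose under \<open>J\<close> of the unit
  \<open>(y, 1)\<close> of the adjunction between composition with \<open>p\<close> and pullback
  along \<open>p\<close>. One composite with \<open>ep y\<close> is the second component of
  \<open>tr_unit\<close>; the other follows since it agrees with the identity after composition with
  the unit.\<close>

lemma en_simps [simp]: "en y \<in> Arr C" "Dom C (en y) = Dom C (F y)" "Cod C (en y) = Dom C y" "p \<cdot> (y \<cdot> en y) = F y"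
  and en_ep: "en y \<cdot> ep y = Id C (Dom C y)" and ep_en: "ep y \<cdot> en y = Id C (Dom C (F y))"
proof -
  let ?g = "(y, pb_pair C p (p \<cdot> y) y (Id C (Dom C y)), pb1 C p (p \<cdot> y))"
  have g: "?g \<in> Arr (slice C (Dom C p))" "Cod (slice C (Dom C p)) ?g = A.R (p \<cdot> y)" "p \<cdot> y \<in> Obj (slice C (Cod C p))"
    by (simp_all add: R_obj)
  obtain a e b where e: "A.tr (p \<cdot> y) ?g = (a, e, b)" by (cases "A.tr (p \<cdot> y) ?g")
  have t: "a = F y" "b = p \<cdot> y" "e \<in> Arr C" "Dom C e = Dom C (F y)" "Cod C e = Dom C y" "p \<cdot> (y \<cdot> e) = F y"
    using A.tr_simps[OF g] unfolding e by auto
  have en: "en y = e" unfolding en_def e by simp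
  from t show "en y \<in> Arr C" "Dom C (en y) = Dom C (F y)" "Cod C (en y) = Dom C y" "p \<cdot> (y \<cdot> en y) = F y"
    unfolding en by simp_all
  have pe: "p \<cdot> (y \<cdot> (e \<cdot> ep y)) = p \<cdot> y"
    using comp_reassoc[OF ep_simps(4), of "Id C (Dom C y)"] t ep_simps
    by (metis (no_types, lifting) comp_assoc comp_Arr Cod_comp Dom_comp y p)
  have F1: "p \<cdot> (pb1 C p (F y)) = F y \<cdot> pb2 C p (F y)" by (rule pb_comm) simp_all
  have "A.RA (A.tr (p \<cdot> y) ?g) \<cdot>\<^bsub>slice C (Dom C p)\<^esub> unit J y = ?g"
    using A.tr_unit[OF g] by simp
  then have "pb_pair C p (p \<cdot> y) (pb1 C p (F y)) (e \<cdot> pb2 C p (F y)) \<cdot> pb_pair C p (F y) y (ep y) = pb_pair C p (p \<cdot> y) y (Id C (Dom C y))"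
    unfolding e unit_form(5) R_arr t(1,2) by simp
  then have "pb2 C p (p \<cdot> y) \<cdot> (pb_pair C p (p \<cdot> y) (pb1 C p (F y)) (e \<cdot> pb2 C p (F y)) \<cdot> pb_pair C p (F y) y (ep y)) = Id C (Dom C y)"
    by simp
  moreover have "p \<cdot> pb1 C p (F y) = p \<cdot> (y \<cdot> (e \<cdot> pb2 C p (F y)))"
    using F1 comp_reassoc[OF t(6), of "pb2 C p (F y)"] t by simp
  ultimately show 1: "en y \<cdot> ep y = Id C (Dom C y)"
    unfolding en using t pe by simp
  have F: "F y \<cdot> (ep y \<cdot> en y) = F y"
    using comp_reassoc[OF ep_simps(4), of "en y"] t unfolding en by simp
  have "(F y, ep y \<cdot> en y, F y) = (F y, Id C (Dom C (F y)), F y)"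
  proof (rule A.tr_ext[of _ _ y])
    have a: "ep y \<cdot> (en y \<cdot> ep y) = ep y" unfolding 1 by simp
    have b: "p \<cdot> pb1 C p (F y) = F y \<cdot> (ep y \<cdot> (en y \<cdot> pb2 C p (F y)))"
      using F1 comp_reassoc[OF F, of "pb2 C p (F y)"] t unfolding en by simp
    show "A.RA (F y, ep y \<cdot> en y, F y) \<cdot>\<^bsub>slice C (Dom C p)\<^esub> unit J y =
        A.RA (F y, Id C (Dom C (F y)), F y) \<cdot>\<^bsub>slice C (Dom C p)\<^esub> unit J y"
      unfolding R_arr unit_form(5) using a b t F1 unfolding en by simp
  qed (use F t en in auto)
  then show "ep y \<cdot> en y = Id C (Dom C (F y))" by simp
qed

lemma en_ep_comp [simp]: "x \<in> Arr C \<Longrightarrow> Cod C x = Dom C y \<Longrightarrow> en y \<cdot> (ep y \<cdot> x) = x"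
  and ep_en_comp [simp]: "x \<in> Arr C \<Longrightarrow> Cod C x = Dom C (F y) \<Longrightarrow> ep y \<cdot> (en y \<cdot> x) = x"
  using comp_reassoc[OF en_ep, of x] comp_reassoc[OF ep_en, of x] by simp_all

end

text \<open>The second component of naturality of the unit reads
  \<open>m \<cdot> ep y = ep y' \<cdot> k\<close>, and \<open>ep y\<close> is invertible.\<close>

lemma LA_form:
  assumes "(y, k, y') \<in> Arr (slice C (Dom C p))"
  shows "A.LA (y, k, y') = (F y, ep y' \<cdot> (k \<cdot> en y), F y')"
proof -
  have [simp]: "y \<in> Arr C" "Cod C y = Dom C p" "y' \<in> Arr C" "Cod C y' = Dom C p"
      "k \<in> Arr C" "Dom C k = Dom C y" "Cod C k = Dom C y'" "y' \<cdot> k = y"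
    using assms by simp_all
  obtain a m b where m: "A.LA (y, k, y') = (a, m, b)" by (cases "A.LA (y, k, y')")
  have [simp]: "a = F y" "b = F y'" "m \<in> Arr C" "Dom C m = Dom C (F y)" "Cod C m = Dom C (F y')" "F y' \<cdot> m = F y"
    using A.LR_simps(2-4)[OF assms] unfolding m by auto
  have [simp]: "p \<cdot> pb1 C p (F y) = F y' \<cdot> (m \<cdot> pb2 C p (F y))"
    using comp_reassoc[of "F y'" m "F y" "pb2 C p (F y)"] by (simp add: pb_comm)
  have "F y' \<cdot> (m \<cdot> ep y) = F y \<cdot> ep y"
    by (rule comp_reassoc) simp_all
  then have [simp]: "F y' \<cdot> (m \<cdot> ep y) = p \<cdot> y" by simp
  have "pb_pair C p (F y') (pb1 C p (F y)) (m \<cdot> pb2 C p (F y)) \<cdot> pb_pair C p (F y) y (ep y) = pb_pair C p (F y') y' (ep y') \<cdot> k"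
    using A.unit_nat[OF assms] unfolding m by (simp add: unit_form(5) R_arr del: pb_pair_comp)
  then have "pb2 C p (F y') \<cdot> (pb_pair C p (F y') (pb1 C p (F y)) (m \<cdot> pb2 C p (F y)) \<cdot> pb_pair C p (F y) y (ep y)) =
      pb2 C p (F y') \<cdot> (pb_pair C p (F y') y' (ep y') \<cdot> k)"
    by simp
  moreover have "F y' \<cdot> (ep y' \<cdot> k) = p \<cdot> y"
    using comp_reassoc[of "F y'" "ep y'" "p \<cdot> y'" k] by simp
  ultimately have "m \<cdot> ep y = ep y' \<cdot> k" by simp
  then have "m \<cdot> (ep y \<cdot> en y) = (ep y' \<cdot> k) \<cdot> en y"
    using comp_assoc[of "en y" "ep y" m] by simp
  then show ?thesis unfolding m by (simp add: ep_en)
qed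

text \<open>The second component of a triangle identity reads
  \<open>m \<cdot> ep ?y = pb2 C p w\<close>, where \<open>m\<close> underlies the counit, and
  \<open>ep ?y\<close> is invertible.\<close>

lemma counit_form:
  assumes [simp]: "w \<in> Arr C" "Cod C w = Cod C p"
  shows "counit J w = (F (pb1 C p w), pb2 C p w \<cdot> en (pb1 C p w), w)"
proof -
  let ?y = "pb1 C p w"
  obtain a m b where m: "counit J w = (a, m, b)" by (cases "counit J w")
  have w: "w \<in> Obj (slice C (Cod C p))" by simp
  have [simp]: "a = F ?y" "b = w" "m \<in> Arr C" "Dom C m = Dom C (F ?y)" "Cod C m = Dom C w" "w \<cdot> m = F ?y"
    using A.counit_simps(1-3)[OF w] unfolding m by (auto simp: R_obj)
  have [simp]: "p \<cdot> pb1 C p (F ?y) = w \<cdot> (m \<cdot> pb2 C p (F ?y))"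
    using comp_reassoc[of w m "F ?y" "pb2 C p (F ?y)"] by (simp add: pb_comm)
  have "w \<cdot> (m \<cdot> ep ?y) = F ?y \<cdot> ep ?y"
    by (rule comp_reassoc) simp_all
  then have [simp]: "w \<cdot> (m \<cdot> ep ?y) = p \<cdot> ?y" by simp
  have "pb_pair C p w (pb1 C p (F ?y)) (m \<cdot> pb2 C p (F ?y)) \<cdot> pb_pair C p (F ?y) ?y (ep ?y) = Id C (pb_obj C p w)"
    using A.counit_simps(4)[OF w] unfolding m by (simp add: unit_form(5) R_arr R_obj del: pb_pair_comp)
  then have "pb2 C p w \<cdot> (pb_pair C p w (pb1 C p (F ?y)) (m \<cdot> pb2 C p (F ?y)) \<cdot> pb_pair C p (F ?y) ?y (ep ?y)) = pb2 C p w"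
    by simp
  then have "m \<cdot> ep ?y = pb2 C p w" by simp
  then have "m \<cdot> (ep ?y \<cdot> en ?y) = pb2 C p w \<cdot> en ?y"
    using comp_assoc[of "en ?y" "ep ?y" m] by simp
  then show ?thesis unfolding m by (simp add: ep_en)
qed

abbreviation "E \<equiv> em_of_adj (slice C (Dom C p)) J"
abbreviation "K \<equiv> comparison (slice C (Cod C p)) J"

lemmas em_ff = equivalence_ff[OF category_slice A.category_em equiv]

lemma K_simps:
  "FO K w = (A.R w, A.RA (counit J w))" "FA K h = (FO K (Dom (slice C (Cod C p)) h), A.RA h, FO K (Cod (slice C (Cod C p)) h))"
  unfolding comparison_def by (simp_all add: Let_def)

lemma em_simps:
  "(X, \<xi>) \<in> Obj E \<longleftrightarrow> X \<in> Obj (slice C (Dom C p)) \<and> \<xi> \<in> hom (slice C (Dom C p)) (A.R (F X)) X \<and>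
     \<xi> \<cdot>\<^bsub>slice C (Dom C p)\<^esub> unit J X = Id (slice C (Dom C p)) X \<and>
     \<xi> \<cdot>\<^bsub>slice C (Dom C p)\<^esub> A.RA (A.LA \<xi>) = \<xi> \<cdot>\<^bsub>slice C (Dom C p)\<^esub> A.RA (counit J (F X))"
  "((X, \<xi>), h, (Y, \<zeta>)) \<in> Arr E \<longleftrightarrow> (X, \<xi>) \<in> Obj E \<and> (Y, \<zeta>) \<in> Obj E \<and> h \<in> hom (slice C (Dom C p)) X Y \<and>
     h \<cdot>\<^bsub>slice C (Dom C p)\<^esub> \<xi> = \<zeta> \<cdot>\<^bsub>slice C (Dom C p)\<^esub> A.RA (A.LA h)"
  "Dom E (a, h, b) = a" "Cod E (a, h, b) = b" "(b', k, c) \<cdot>\<^bsub>E\<^esub> (a, h, b) = (a, k \<cdot>\<^bsub>slice C (Dom C p)\<^esub> h, c)"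
  "Id E a = (a, Id (slice C (Dom C p)) (fst a), a)"
  unfolding em_of_adj_def em_cat_def structure_cat_def by auto

lemma K_Obj:
  assumes "w \<in> Arr C" "Cod C w = Cod C p"
  shows "FO K w \<in> Obj E"
  using is_functorD(1)[of "slice C (Cod C p)" E K w] equiv assms unfolding is_equivalence_def by auto

lemma RA_counit:
  assumes [simp]: "w \<in> Arr C" "Cod C w = Cod C p"
  shows "A.RA (counit J w) = (pb1 C p (F (pb1 C p w)),
    pb_pair C p w (pb1 C p (F (pb1 C p w))) (pb2 C p w \<cdot> (en (pb1 C p w) \<cdot> pb2 C p (F (pb1 C p w)))), pb1 C p w)"
  unfolding counit_form[OF assms] R_arr by simp

text \<open>The arrow \<open>\<phi>\<close> goes to an object and not to an object over the codomain
  of \<open>p\<close>, so it is first paired with the structure map. This gives an arrow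
  \<open>k\<close> from the pullback of \<open>w\<close> to the pullback of the projection
  \<open>w'\<close> of a product. The hypothesis \<open>inv\<close> says that \<open>k\<close> is a
  homomorphism of algebras; fullness of the comparison functor yields an arrow from \<open>w\<close>
  to \<open>w'\<close>, whose second component is the descended arrow.\<close>

lemma arrow_descends:
  assumes w [simp]: "w \<in> Arr C" "Cod C w = Cod C p" and \<phi> [simp]: "\<phi> \<in> Arr C" "Dom C \<phi> = pb_obj C p w"
    and inv: "\<And>x x' v. x \<in> Arr C \<Longrightarrow> x' \<in> Arr C \<Longrightarrow> v \<in> Arr C \<Longrightarrow> Dom C x = Dom C v \<Longrightarrow> Dom C x' = Dom C v \<Longrightarrow>
      Cod C x = Dom C p \<Longrightarrow> Cod C x' = Dom C p \<Longrightarrow> Cod C v = Dom C w \<Longrightarrow> p \<cdot> x = w \<cdot> v \<Longrightarrow> p \<cdot> x' = w \<cdot> v \<Longrightarrow>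
      \<phi> \<cdot> pb_pair C p w x v = \<phi> \<cdot> pb_pair C p w x' v"
  shows "\<exists>k. k \<in> Arr C \<and> Dom C k = Dom C w \<and> Cod C k = Cod C \<phi> \<and> k \<cdot> pb2 C p w = \<phi>"
proof -
  define w' where "w' = pr1 C (Cod C p) (Cod C \<phi>)"
  define pr where "pr = pr2 C (Cod C p) (Cod C \<phi>)"
  have [simp]: "w' \<in> Arr C" "Cod C w' = Cod C p" "pr \<in> Arr C" "Dom C pr = Dom C w'" "Cod C pr = Cod C \<phi>"
     "Dom C w' = prod_obj C (Cod C p) (Cod C \<phi>)"
    unfolding w'_def pr_def by simp_all
  have [simp]: "w' \<cdot> prod_pair C f g = f" "pr \<cdot> prod_pair C f g = g"
    if "f \<in> Arr C" "g \<in> Arr C" "Dom C f = Dom C g" "Cod C f = Cod C p" "Cod C g = Cod C \<phi>" for f g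
    unfolding w'_def pr_def using that by simp_all
  define k where "k = pb_pair C p w' (pb1 C p w) (prod_pair C (w \<cdot> pb2 C p w) \<phi>)"
  note pw [simp] = pb_comm[OF p w(1) w(2)[symmetric]]
  have k [simp]: "k \<in> Arr C" "Dom C k = pb_obj C p w" "Cod C k = pb_obj C p w'" "pb1 C p w' \<cdot> k = pb1 C p w"
      "pb2 C p w' \<cdot> k = prod_pair C (w \<cdot> pb2 C p w) \<phi>"
    unfolding k_def by simp_all
  let ?k = "(pb1 C p w, k, pb1 C p w')"
  have kk: "?k \<in> hom (slice C (Dom C p)) (pb1 C p w) (pb1 C p w')" by simp
  define y where "y = pb1 C p w"
  define y' where "y' = pb1 C p w'"
  have [simp]: "y \<in> Arr C" "Cod C y = Dom C p" "y' \<in> Arr C" "Cod C y' = Dom C p" "Dom C y = pb_obj C p w" "Dom C y' = pb_obj C p w'"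
    unfolding y_def y'_def by simp_all
  \<comment> \<open>With \<open>F y\<close> identified with \<open>p \<cdot> y\<close> by
    \<open>en y\<close>, the generic element of the free algebra on \<open>y\<close> is the pair
    \<open>(x, z)\<close>. The algebra structure on the pullback of \<open>w\<close> sends it to
    \<open>(x, pb2 C p w \<cdot> z)\<close>: it keeps the point of \<open>w\<close> and replaces the
    point over it.\<close>
  define x where "x = pb1 C p (F y)"
  define z where "z = en y \<cdot> pb2 C p (F y)"
  have [simp]: "x \<in> Arr C" "Cod C x = Dom C p" "z \<in> Arr C" "Dom C x = pb_obj C p (F y)" "Dom C z = pb_obj C p (F y)" "Cod C z = pb_obj C p w"
    unfolding x_def z_def by simp_all
  have "p \<cdot> x = (p \<cdot> (y \<cdot> en y)) \<cdot> pb2 C p (F y)"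
    unfolding x_def by (simp add: pb_comm)
  then have "p \<cdot> x = p \<cdot> (y \<cdot> z)" unfolding z_def by (simp del: en_simps(4))
  then have px [simp]: "p \<cdot> x = w \<cdot> (pb2 C p w \<cdot> z)" unfolding y_def by simp
  have kz: "k \<cdot> pb_pair C p w x (pb2 C p w \<cdot> z) =
      pb_pair C p w' x (prod_pair C (w \<cdot> (pb2 C p w \<cdot> z)) (\<phi> \<cdot> pb_pair C p w x (pb2 C p w \<cdot> z)))"
    unfolding k_def by simp
  have "pb2 C p w' \<cdot> (k \<cdot> z) = prod_pair C (w \<cdot> (pb2 C p w \<cdot> z)) (\<phi> \<cdot> z)"
    using comp_reassoc[OF k(5), of z] by simp
  \<comment> \<open>This is where \<open>inv\<close> is used: \<open>\<phi>\<close> does not notice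
    that the point of the domain of \<open>p\<close> has been replaced by \<open>x\<close>.\<close>
  moreover have "\<phi> \<cdot> pb_pair C p w x (pb2 C p w \<cdot> z) = \<phi> \<cdot> pb_pair C p w (pb1 C p w \<cdot> z) (pb2 C p w \<cdot> z)"
    by (rule inv) simp_all
  ultimately have eq: "k \<cdot> pb_pair C p w x (pb2 C p w \<cdot> z) = pb_pair C p w' x (pb2 C p w' \<cdot> (k \<cdot> z))"
    unfolding kz by simp
  have Fk: "p \<cdot> x = F y' \<cdot> (ep y' \<cdot> (k \<cdot> z))"
  proof -
    have "F y' \<cdot> (ep y' \<cdot> (k \<cdot> z)) = (p \<cdot> y') \<cdot> (k \<cdot> z)"
      by (rule comp_reassoc) simp_all
    also have "\<dots> = p \<cdot> ((y' \<cdot> k) \<cdot> z)" by simp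
    also have "\<dots> = p \<cdot> x" by (simp add: y'_def)
    finally show ?thesis by simp
  qed
  have c2: "p \<cdot> pb1 C p (F y') = w' \<cdot> (pb2 C p w' \<cdot> (en y' \<cdot> pb2 C p (F y')))"
  proof -
    have "p \<cdot> pb1 C p (F y') = (p \<cdot> (y' \<cdot> en y')) \<cdot> pb2 C p (F y')" by (simp add: pb_comm)
    also have "\<dots> = p \<cdot> (y' \<cdot> (en y' \<cdot> pb2 C p (F y')))" by (simp del: en_simps(4))
    also have "\<dots> = w' \<cdot> (pb2 C p w' \<cdot> (en y' \<cdot> pb2 C p (F y')))"
      unfolding y'_def using pb_comm(2)[of p w' "en (pb1 C p w') \<cdot> pb2 C p (F (pb1 C p w'))"] by simp
    finally show ?thesis .
  qed
  have "k \<cdot> pb_pair C p w x (pb2 C p w \<cdot> z) =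
      pb_pair C p w' (pb1 C p (F y')) (pb2 C p w' \<cdot> (en y' \<cdot> pb2 C p (F y'))) \<cdot> pb_pair C p (F y') x (ep y' \<cdot> (k \<cdot> z))"
    unfolding eq using Fk c2 by simp
  moreover have "A.LA ?k = (F y, ep y' \<cdot> (k \<cdot> en y), F y')"
    unfolding y_def y'_def by (rule LA_form) simp
  moreover have "(ep y' \<cdot> (k \<cdot> en y)) \<cdot> pb2 C p (F y) = ep y' \<cdot> (k \<cdot> z)"
    unfolding z_def by simp
  moreover have "A.RA (counit J w) = (pb1 C p (F y), pb_pair C p w x (pb2 C p w \<cdot> z), y)"
    unfolding y_def x_def z_def by (rule RA_counit) simp_all
  moreover have "A.RA (counit J w') = (pb1 C p (F y'), pb_pair C p w' (pb1 C p (F y')) (pb2 C p w' \<cdot> (en y' \<cdot> pb2 C p (F y'))), y')"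
    unfolding y'_def by (rule RA_counit) simp_all
  ultimately have "?k \<cdot>\<^bsub>slice C (Dom C p)\<^esub> A.RA (counit J w) = A.RA (counit J w') \<cdot>\<^bsub>slice C (Dom C p)\<^esub> A.RA (A.LA ?k)"
    by (simp only: slice_simps(5) R_arr x_def y'_def)
  then have "(FO K w, ?k, FO K w') \<in> Arr E"
    using kk K_Obj[OF w] K_Obj[OF \<open>w' \<in> Arr C\<close> \<open>Cod C w' = Cod C p\<close>] unfolding em_simps(2) K_simps(1) R_obj by blast
  then have e: "(FO K w, ?k, FO K w') \<in> hom E (FO K w) (FO K w')"
    by (simp only: hom_def mem_Collect_eq em_simps(3,4))
  have "w \<in> Obj (slice C (Cod C p))" "w' \<in> Obj (slice C (Cod C p))" by simp_all
  from em_ff(2)[OF this e] obtain h where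
    h: "h \<in> hom (slice C (Cod C p)) w w'" "FA K h = (FO K w, ?k, FO K w')" by blast
  obtain m where m: "h = (w, m, w')" "m \<in> Arr C" "Dom C m = Dom C w" "Cod C m = Dom C w'" "w' \<cdot> m = w"
    using h(1) by (cases h) auto
  have mp: "p \<cdot> pb1 C p w = w' \<cdot> (m \<cdot> pb2 C p w)"
    using comp_reassoc[OF m(5), of "pb2 C p w"] m by simp
  have mt: "m \<cdot> pb2 C p w \<in> Arr C" "Dom C (pb1 C p w) = Dom C (m \<cdot> pb2 C p w)" "Cod C (m \<cdot> pb2 C p w) = Dom C w'"
    using m(2-4) by simp_all
  have mk: "pb_pair C p w' (pb1 C p w) (m \<cdot> pb2 C p w) = k"
    using h(2) unfolding m(1) K_simps(2) R_arr by (simp only: prod.inject)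
  have "pb2 C p w' \<cdot> pb_pair C p w' (pb1 C p w) (m \<cdot> pb2 C p w) = m \<cdot> pb2 C p w"
    by (rule pb_pair_arr(5)[OF _ mt(1) _ _ _ mt(2) _ mt(3) mp]) simp_all
  then have "m \<cdot> pb2 C p w = prod_pair C (w \<cdot> pb2 C p w) \<phi>"
    unfolding mk k(5) by (rule sym)
  then have "pr \<cdot> (m \<cdot> pb2 C p w) = \<phi>" by simp
  then show ?thesis
    using m(2-4) by (intro exI[of _ "pr \<cdot> m"]) simp
qed

text \<open>Faithfulness of the comparison functor, applied to \<open>(w, k)\<close> and
  \<open>(w, k')\<close> as arrows into the same projection \<open>w'\<close> as for
  existence.\<close>

lemma arrow_descends_unique:
  assumes w [simp]: "w \<in> Arr C" "Cod C w = Cod C p" and k [simp]: "k \<in> Arr C" "k' \<in> Arr C" "Dom C k = Dom C w" "Dom C k' = Dom C w"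
    "Cod C k = Cod C k'" and eq: "k \<cdot> pb2 C p w = k' \<cdot> pb2 C p w"
  shows "k = k'"
proof -
  define w' where "w' = pr1 C (Cod C p) (Cod C k')"
  have [simp]: "w' \<in> Arr C" "Cod C w' = Cod C p" "Dom C w' = prod_obj C (Cod C p) (Cod C k')"
     "w' \<cdot> prod_pair C w k = w" "w' \<cdot> prod_pair C w k' = w"
    unfolding w'_def by simp_all
  have "(w, prod_pair C w k, w') = (w, prod_pair C w k', w')"
  proof (rule em_ff(1)[where a = w and b = w'])
    show "FA K (w, prod_pair C w k, w') = FA K (w, prod_pair C w k', w')"
      using eq by (simp add: K_simps R_arr)
  qed simp_all
  then have "pr2 C (Cod C p) (Cod C k') \<cdot> prod_pair C w k = pr2 C (Cod C p) (Cod C k') \<cdot> prod_pair C w k'"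
    by simp
  then show ?thesis by simp
qed

text \<open>Read \<open>s(x, v)\<close> as the transport of \<open>v\<close> from its own fibre of
  \<open>y\<close> to the fibre over \<open>x\<close>, where \<open>x\<close> and \<open>y v\<close>
  have the same image under \<open>p\<close>. The hypotheses are the laws of an algebra for the
  monad of composition with \<open>p\<close> followed by pullback. Transported along
  \<open>en\<close> this is an algebra for the monad of \<open>J\<close>, and essential surjectivity
  of the comparison functor gives \<open>w\<close>. The last clause of the conclusion says that
  \<open>\<sigma>\<close> is a homomorphism.\<close>

lemma descent_datum_effective:
  assumes y [simp]: "y \<in> Arr C" "Cod C y = Dom C p"
    and s [simp]: "s \<in> Arr C" "Dom C s = pb_obj C p (p \<cdot> y)" "Cod C s = Dom C y" "y \<cdot> s = pb1 C p (p \<cdot> y)"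
    and s_unit: "s \<cdot> pb_pair C p (p \<cdot> y) y (Id C (Dom C y)) = Id C (Dom C y)"
    and s_assoc: "\<And>x x' v. x \<in> Arr C \<Longrightarrow> x' \<in> Arr C \<Longrightarrow> v \<in> Arr C \<Longrightarrow> Dom C x = Dom C v \<Longrightarrow> Dom C x' = Dom C v \<Longrightarrow>
      Cod C x = Dom C p \<Longrightarrow> Cod C x' = Dom C p \<Longrightarrow> Cod C v = Dom C y \<Longrightarrow> p \<cdot> x = p \<cdot> (y \<cdot> v) \<Longrightarrow> p \<cdot> x' = p \<cdot> (y \<cdot> v) \<Longrightarrow>
      s \<cdot> pb_pair C p (p \<cdot> y) x (s \<cdot> pb_pair C p (p \<cdot> y) x' v) = s \<cdot> pb_pair C p (p \<cdot> y) x v"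
  shows "\<exists>w \<sigma>. w \<in> Arr C \<and> Cod C w = Cod C p \<and> iso C \<sigma> \<and> Dom C \<sigma> = pb_obj C p w \<and> Cod C \<sigma> = Dom C y \<and> y \<cdot> \<sigma> = pb1 C p w \<and>
     (\<forall>x x' v. x \<in> Arr C \<and> x' \<in> Arr C \<and> v \<in> Arr C \<and> Dom C x = Dom C v \<and> Dom C x' = Dom C v \<and>
      Cod C x = Dom C p \<and> Cod C x' = Dom C p \<and> Cod C v = Dom C w \<and> p \<cdot> x = w \<cdot> v \<and> p \<cdot> x' = w \<cdot> v \<longrightarrow>
      \<sigma> \<cdot> pb_pair C p w x v = s \<cdot> pb_pair C p (p \<cdot> y) x (\<sigma> \<cdot> pb_pair C p w x' v))"
proof -
  \<comment> \<open>The structure map \<open>s\<close> on the free object \<open>F y\<close> of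
    \<open>J\<close> in place of \<open>p \<cdot> y\<close>.\<close>
  define s' where "s' = s \<cdot> pb_pair C p (p \<cdot> y) (pb1 C p (F y)) (en y \<cdot> pb2 C p (F y))"
  have [simp]: "p \<cdot> (y \<cdot> (en y \<cdot> v)) = F y \<cdot> v" if "v \<in> Arr C" "Cod C v = Dom C (F y)" for v
    using comp_reassoc[OF en_simps(4)[OF y], of v] that by simp
  have ysx [simp]: "y \<cdot> (s \<cdot> v) = pb1 C p (p \<cdot> y) \<cdot> v" if "v \<in> Arr C" "Cod C v = pb_obj C p (p \<cdot> y)" for v
    using comp_reassoc[OF s(4), of v] that by simp
  note pF [simp] = pb_comm[of p "F y"]
  have s'_t [simp]: "s' \<in> Arr C" "Dom C s' = pb_obj C p (F y)" "Cod C s' = Dom C y" "y \<cdot> s' = pb1 C p (F y)"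
    unfolding s'_def by simp_all
  have s'_pair: "s' \<cdot> pb_pair C p (F y) x v = s \<cdot> pb_pair C p (p \<cdot> y) x (en y \<cdot> v)"
    if "x \<in> Arr C" "v \<in> Arr C" "Dom C x = Dom C v" "Cod C x = Dom C p" "Cod C v = Dom C (F y)" "p \<cdot> x = F y \<cdot> v" for x v
    unfolding s'_def using that by simp
  let ?\<xi> = "(pb1 C p (F y), s', y)"
  define y1 where "y1 = pb1 C p (F y)"
  have [simp]: "y1 \<in> Arr C" "Cod C y1 = Dom C p" "Dom C y1 = pb_obj C p (F y)"
    unfolding y1_def by simp_all
  define x where "x = pb1 C p (F y1)"
  define z where "z = en y1 \<cdot> pb2 C p (F y1)"
  have [simp]: "x \<in> Arr C" "Cod C x = Dom C p" "z \<in> Arr C" "Dom C x = pb_obj C p (F y1)" "Dom C z = pb_obj C p (F y1)" "Cod C z = pb_obj C p (F y)"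
    unfolding x_def z_def by simp_all
  have "p \<cdot> x = (p \<cdot> (y1 \<cdot> en y1)) \<cdot> pb2 C p (F y1)"
    unfolding x_def by (simp add: pb_comm)
  then have "p \<cdot> x = p \<cdot> (y1 \<cdot> z)" unfolding z_def by (simp del: en_simps(4))
  then have px [simp]: "p \<cdot> x = F y \<cdot> (pb2 C p (F y) \<cdot> z)" unfolding y1_def by simp
  have obj: "(y, ?\<xi>) \<in> Obj E"
  proof -
    have 1: "s' \<cdot> pb_pair C p (F y) y (ep y) = Id C (Dom C y)"
      using s_unit by (simp add: s'_pair en_ep)
    have sz: "s' \<cdot> z = s \<cdot> pb_pair C p (p \<cdot> y) (pb1 C p (F y) \<cdot> z) (en y \<cdot> (pb2 C p (F y) \<cdot> z))"
      unfolding s'_def by simp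
    have ysz: "y \<cdot> (s' \<cdot> z) = pb1 C p (F y) \<cdot> z"
      by (rule comp_reassoc) simp_all
    have F2: "F y \<cdot> (ep y \<cdot> (s' \<cdot> z)) = F y \<cdot> (pb2 C p (F y) \<cdot> z)"
      using comp_reassoc[OF ep_simps(4)[OF y], of "s' \<cdot> z"] ysz by simp
    have "s' \<cdot> pb_pair C p (F y) x (ep y \<cdot> (s' \<cdot> z)) = s \<cdot> pb_pair C p (p \<cdot> y) x (s' \<cdot> z)"
      using F2 by (simp add: s'_pair)
    also have "\<dots> = s \<cdot> pb_pair C p (p \<cdot> y) x (en y \<cdot> (pb2 C p (F y) \<cdot> z))"
      unfolding sz by (rule s_assoc) simp_all
    also have "\<dots> = s' \<cdot> pb_pair C p (F y) x (pb2 C p (F y) \<cdot> z)"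
      by (simp add: s'_pair)
    finally have 2: "s' \<cdot> pb_pair C p (F y) x (ep y \<cdot> (s' \<cdot> z)) = s' \<cdot> pb_pair C p (F y) x (pb2 C p (F y) \<cdot> z)" .
    show ?thesis
      unfolding em_simps using 1 2 LA_form[of "pb1 C p (F y)" s' y] unfolding x_def z_def y1_def
      by (simp add: R_obj unit_form(5) R_arr RA_counit)
  qed
  obtain w i where w: "w \<in> Obj (slice C (Cod C p))" and i: "i \<in> hom E (FO K w) (y, ?\<xi>)" "iso E i"
    using em_ff(3)[OF obj] by blast
  have w' [simp]: "w \<in> Arr C" "Cod C w = Cod C p" using w by simp_all
  obtain \<sigma> where \<sigma>: "i = (FO K w, (pb1 C p w, \<sigma>, y), (y, ?\<xi>))" "(pb1 C p w, \<sigma>, y) \<in> Arr (slice C (Dom C p))"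
      "(pb1 C p w, \<sigma>, y) \<cdot>\<^bsub>slice C (Dom C p)\<^esub> A.RA (counit J w) = ?\<xi> \<cdot>\<^bsub>slice C (Dom C p)\<^esub> A.RA (A.LA (pb1 C p w, \<sigma>, y))"
  proof -
    obtain a f r b where ia: "i = (a, (f, r, b), (y, ?\<xi>))" using i(1) by (cases i) (auto simp: em_simps)
    then have "a = FO K w" "f = pb1 C p w" "b = y" using i(1) by (auto simp: em_simps K_simps R_obj)
    with ia i(1) show ?thesis by (intro that[of r]) (auto simp: em_simps K_simps R_obj)
  qed
  have \<sigma>_t [simp]: "\<sigma> \<in> Arr C" "Dom C \<sigma> = pb_obj C p w" "Cod C \<sigma> = Dom C y" "y \<cdot> \<sigma> = pb1 C p w"
    using \<sigma>(2) by simp_all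
  have iso: "iso C \<sigma>"
  proof -
    obtain j where j: "is_inverse E i j" using i(2) unfolding iso_def by blast
    obtain a f r b c where "j = (a, (f, r, b), c)" by (cases j) auto
    with j show ?thesis unfolding is_inverse_def \<sigma>(1)
      by (intro isoI[where g = r]) (auto simp: em_simps K_simps R_obj)
  qed
  define y2 where "y2 = pb1 C p w"
  have y2 [simp]: "y2 \<in> Arr C" "Cod C y2 = Dom C p" "Dom C y2 = pb_obj C p w" and y\<sigma>2: "y \<cdot> \<sigma> = y2"
    unfolding y2_def by simp_all
  note pF2 [simp] = pb_comm[of p "F y2"] pb_comm[of p w]
  have [simp]: "p \<cdot> y2 = w \<cdot> pb2 C p w" "v \<in> Arr C \<Longrightarrow> Cod C v = pb_obj C p w \<Longrightarrow> p \<cdot> (y2 \<cdot> v) = w \<cdot> (pb2 C p w \<cdot> v)" for v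
    unfolding y2_def by simp_all
  define z2 where "z2 = en y2 \<cdot> pb2 C p (F y2)"
  have [simp]: "z2 \<in> Arr C" "Dom C z2 = pb_obj C p (F y2)" "Cod C z2 = pb_obj C p w"
    unfolding z2_def by simp_all
  have px2 [simp]: "F y2 \<cdot> pb2 C p (F y2) = w \<cdot> (pb2 C p w \<cdot> z2)"
  proof -
    have "F y2 \<cdot> pb2 C p (F y2) = (p \<cdot> (y2 \<cdot> en y2)) \<cdot> pb2 C p (F y2)" by simp
    also have "\<dots> = p \<cdot> (y2 \<cdot> z2)" unfolding z2_def by (simp del: en_simps(4))
    finally show ?thesis by simp
  qed
  have F\<sigma>: "F y \<cdot> (ep y \<cdot> (\<sigma> \<cdot> v)) = w \<cdot> (pb2 C p w \<cdot> v)" if "v \<in> Arr C" "Cod C v = pb_obj C p w" for v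
  proof -
    have "F y \<cdot> (ep y \<cdot> (\<sigma> \<cdot> v)) = p \<cdot> ((y \<cdot> \<sigma>) \<cdot> v)"
      using comp_reassoc[OF ep_simps(4)[OF y], of "\<sigma> \<cdot> v"] that by (simp del: \<sigma>_t(4))
    then show ?thesis using that by (simp del: \<sigma>_t(4) add: y\<sigma>2)
  qed
  \<comment> \<open>The homomorphism law for \<open>\<sigma>\<close> at the generic element of the
    free algebra, with \<open>s'\<close> rewritten into \<open>s\<close>.\<close>
  have eq: "\<sigma> \<cdot> pb_pair C p w (pb1 C p (F y2)) (pb2 C p w \<cdot> z2) = s \<cdot> pb_pair C p (p \<cdot> y) (pb1 C p (F y2)) (\<sigma> \<cdot> z2)"
  proof -
    let ?x = "pb1 C p (F y2)"
    have "A.LA (y2, \<sigma>, y) = (F y2, ep y \<cdot> (\<sigma> \<cdot> en y2), F y)"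
      by (rule LA_form) (simp add: y\<sigma>2 del: \<sigma>_t(4))
    moreover have "(ep y \<cdot> (\<sigma> \<cdot> en y2)) \<cdot> pb2 C p (F y2) = ep y \<cdot> (\<sigma> \<cdot> z2)"
      unfolding z2_def by simp
    moreover have "A.RA (counit J w) = (?x, pb_pair C p w ?x (pb2 C p w \<cdot> z2), y2)"
      unfolding y2_def z2_def by (rule RA_counit) simp_all
    ultimately have "\<sigma> \<cdot> pb_pair C p w ?x (pb2 C p w \<cdot> z2) = s' \<cdot> pb_pair C p (F y) ?x (ep y \<cdot> (\<sigma> \<cdot> z2))"
      using \<sigma>(3) unfolding y2_def[symmetric] by (simp only: slice_simps(5) R_arr prod.inject)
    also have "\<dots> = s \<cdot> pb_pair C p (p \<cdot> y) ?x (\<sigma> \<cdot> z2)"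
      using F\<sigma>[of z2] by (simp add: s'_pair)
    finally show ?thesis .
  qed
  have "\<sigma> \<cdot> pb_pair C p w x v = s \<cdot> pb_pair C p (p \<cdot> y) x (\<sigma> \<cdot> pb_pair C p w x' v)"
    if [simp]: "x \<in> Arr C" "x' \<in> Arr C" "v \<in> Arr C" "Dom C x = Dom C v" "Dom C x' = Dom C v"
      "Cod C x = Dom C p" "Cod C x' = Dom C p" "Cod C v = Dom C w" "p \<cdot> x = w \<cdot> v" "p \<cdot> x' = w \<cdot> v" for x x' v
  proof -
    define u where "u = pb_pair C p w x' v"
    have u [simp]: "u \<in> Arr C" "Dom C u = Dom C v" "Cod C u = pb_obj C p w" "pb2 C p w \<cdot> u = v"
      unfolding u_def by simp_all
    \<comment> \<open>The generalized element at which the generic equation \<open>eq\<close>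
      specializes to the points \<open>x\<close> and \<open>u\<close>.\<close>
    define t where "t = pb_pair C p (F y2) x (ep y2 \<cdot> u)"
    have "F y2 \<cdot> (ep y2 \<cdot> u) = (p \<cdot> y2) \<cdot> u" by (rule comp_reassoc) simp_all
    then have "p \<cdot> x = F y2 \<cdot> (ep y2 \<cdot> u)" by simp
    then have t [simp]: "t \<in> Arr C" "Dom C t = Dom C v" "Cod C t = pb_obj C p (F y2)" "pb1 C p (F y2) \<cdot> t = x"
        "pb2 C p (F y2) \<cdot> t = ep y2 \<cdot> u"
      unfolding t_def by simp_all
    have zt [simp]: "z2 \<cdot> t = u" unfolding z2_def by simp
    have y\<sigma>: "y \<cdot> (\<sigma> \<cdot> z2) = y2 \<cdot> z2" by (rule comp_reassoc[OF y\<sigma>2]) simp_all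
    have "\<sigma> \<cdot> (pb_pair C p w (pb1 C p (F y2)) (pb2 C p w \<cdot> z2) \<cdot> t) = s \<cdot> (pb_pair C p (p \<cdot> y) (pb1 C p (F y2)) (\<sigma> \<cdot> z2) \<cdot> t)"
      using comp_reassoc[OF eq, of t] y\<sigma> by simp
    then show ?thesis
      using y\<sigma> unfolding u_def[symmetric] by simp
  qed
  then show ?thesis using iso \<sigma>_t w' by blast
qed

end

locale effective_descent_arrow = fincat C for C :: "('o, 'm) cat" (structure) +
  fixes p
  assumes effective: "effective_descent C p"
begin

text \<open>The descent results do not mention the adjunction, so one choice of it suffices to
  export them.\<close>

lemma monadic_some: "monadic_pullback C p (SOME J. monadic_pullback C p J)"
proof (rule someI_ex)
  show "\<exists>J. monadic_pullback C p J"
    using effective category finite_limits unfolding effective_descent_def monadic_def monadic_pullback_def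
      monadic_pullback_axioms_def fincat_def fincat_axioms_def catl_def by blast
qed

lemma arr_p [simp]: "p \<in> Arr C"
  using effective unfolding effective_descent_def by simp

lemmas descend = monadic_pullback.arrow_descends[OF monadic_some]
lemmas descend_unique = monadic_pullback.arrow_descends_unique[OF monadic_some]
lemmas datum_effective = monadic_pullback.descent_datum_effective[OF monadic_some]

end

section \<open>Internal groupoids\<close>

locale groupoid = fincat C for C :: "('o, 'm) cat" (structure) +
  fixes G :: "('o, 'm) igpd"
  assumes internal_groupoid: "internal_groupoid C G"
begin

abbreviation "mul \<equiv> gmul C G"
abbreviation "ac \<equiv> act C G"

lemma gpd_arr [simp]:
  "G0 G \<in> Obj C" "G1 G \<in> Obj C" "d0 G \<in> Arr C" "Dom C (d0 G) = G1 G" "Cod C (d0 G) = G0 G"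
  "d1 G \<in> Arr C" "Dom C (d1 G) = G1 G" "Cod C (d1 G) = G0 G"
  "gm G \<in> Arr C" "Dom C (gm G) = pb_obj C (d0 G) (d1 G)" "Cod C (gm G) = G1 G"
  "ge G \<in> Arr C" "Dom C (ge G) = G0 G" "Cod C (ge G) = G1 G"
  "gi G \<in> Arr C" "Dom C (gi G) = G1 G" "Cod C (gi G) = G1 G"
  using internal_groupoid unfolding internal_groupoid_def by auto

lemma d_simps [simp]:
  assumes "x \<in> Arr C"
  shows "Cod C x = G0 G \<Longrightarrow> d0 G \<cdot> (ge G \<cdot> x) = x" "Cod C x = G0 G \<Longrightarrow> d1 G \<cdot> (ge G \<cdot> x) = x"
    "Cod C x = G1 G \<Longrightarrow> d0 G \<cdot> (gi G \<cdot> x) = d1 G \<cdot> x" "Cod C x = G1 G \<Longrightarrow> d1 G \<cdot> (gi G \<cdot> x) = d0 G \<cdot> x"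
proof -
  have *: "d0 G \<cdot> ge G = Id C (G0 G)" "d1 G \<cdot> ge G = Id C (G0 G)" "d0 G \<cdot> gi G = d1 G" "d1 G \<cdot> gi G = d0 G"
    using internal_groupoid unfolding internal_groupoid_def by auto
  show "Cod C x = G0 G \<Longrightarrow> d0 G \<cdot> (ge G \<cdot> x) = x" "Cod C x = G0 G \<Longrightarrow> d1 G \<cdot> (ge G \<cdot> x) = x"
    "Cod C x = G1 G \<Longrightarrow> d0 G \<cdot> (gi G \<cdot> x) = d1 G \<cdot> x" "Cod C x = G1 G \<Longrightarrow> d1 G \<cdot> (gi G \<cdot> x) = d0 G \<cdot> x"
    using assms comp_reassoc[OF *(1), of x] comp_reassoc[OF *(2), of x] comp_reassoc[OF *(3), of x]
      comp_reassoc[OF *(4), of x] by auto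
qed

lemma mul_arr [simp]:
  assumes "a \<in> Arr C" "b \<in> Arr C" "Dom C a = Dom C b" "Cod C a = G1 G" "Cod C b = G1 G" "d0 G \<cdot> a = d1 G \<cdot> b"
  shows "mul a b \<in> Arr C" "Dom C (mul a b) = Dom C b" "Cod C (mul a b) = G1 G"
    "d0 G \<cdot> mul a b = d0 G \<cdot> b" "d1 G \<cdot> mul a b = d1 G \<cdot> a"
proof -
  have p: "pb_pair C (d0 G) (d1 G) a b \<in> Arr C" "Dom C (pb_pair C (d0 G) (d1 G) a b) = Dom C b"
     "Cod C (pb_pair C (d0 G) (d1 G) a b) = pb_obj C (d0 G) (d1 G)"
     "pb1 C (d0 G) (d1 G) \<cdot> pb_pair C (d0 G) (d1 G) a b = a" "pb2 C (d0 G) (d1 G) \<cdot> pb_pair C (d0 G) (d1 G) a b = b"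
    using assms by (auto intro!: pb_pair_arr)
  then show "mul a b \<in> Arr C" "Dom C (mul a b) = Dom C b" "Cod C (mul a b) = G1 G"
    unfolding gmul_def by simp_all
  have *: "d0 G \<cdot> gm G = d0 G \<cdot> pb2 C (d0 G) (d1 G)" "d1 G \<cdot> gm G = d1 G \<cdot> pb1 C (d0 G) (d1 G)"
    using internal_groupoid unfolding internal_groupoid_def by auto
  show "d0 G \<cdot> mul a b = d0 G \<cdot> b" "d1 G \<cdot> mul a b = d1 G \<cdot> a"
    unfolding gmul_def using p comp_reassoc[OF *(1), of "pb_pair C (d0 G) (d1 G) a b"]
      comp_reassoc[OF *(2), of "pb_pair C (d0 G) (d1 G) a b"] by simp_all
qed

lemma mul_comp [simp]:
  assumes "a \<in> Arr C" "b \<in> Arr C" "Dom C a = Dom C b" "Cod C a = G1 G" "Cod C b = G1 G" "d0 G \<cdot> a = d1 G \<cdot> b"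
    "s \<in> Arr C" "Cod C s = Dom C b"
  shows "mul a b \<cdot> s = mul (a \<cdot> s) (b \<cdot> s)"
  unfolding gmul_def using assms by simp

lemma mul_assoc [simp]:
  assumes "a \<in> Arr C" "b \<in> Arr C" "c \<in> Arr C" "Dom C a = Dom C c" "Dom C b = Dom C c" "Cod C a = G1 G" "Cod C b = G1 G"
    "Cod C c = G1 G" "d0 G \<cdot> a = d1 G \<cdot> b" "d0 G \<cdot> b = d1 G \<cdot> c"
  shows "mul (mul a b) c = mul a (mul b c)"
proof -
  have "a \<in> hom C (Dom C c) (G1 G)" "b \<in> hom C (Dom C c) (G1 G)" "c \<in> hom C (Dom C c) (G1 G)"
    using assms by auto
  then show ?thesis using assms(9,10) internal_groupoid unfolding internal_groupoid_def by blast
qed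

lemma mul_unit_inv:
  assumes "a \<in> Arr C" "Cod C a = G1 G"
  shows "mul a (ge G \<cdot> (d0 G \<cdot> a)) = a" "mul (ge G \<cdot> (d1 G \<cdot> a)) a = a"
    "mul a (gi G \<cdot> a) = ge G \<cdot> (d1 G \<cdot> a)" "mul (gi G \<cdot> a) a = ge G \<cdot> (d0 G \<cdot> a)"
proof -
  have "a \<in> hom C (Dom C a) (G1 G)" using assms by auto
  then show "mul a (ge G \<cdot> (d0 G \<cdot> a)) = a" "mul (ge G \<cdot> (d1 G \<cdot> a)) a = a"
    "mul a (gi G \<cdot> a) = ge G \<cdot> (d1 G \<cdot> a)" "mul (gi G \<cdot> a) a = ge G \<cdot> (d0 G \<cdot> a)"
    using internal_groupoid unfolding internal_groupoid_def by blast+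
qed

text \<open>In the unit laws the end of \<open>a\<close> is a variable \<open>t\<close>, so that the
  rules still apply when \<open>d0 G \<cdot> a\<close> has been rewritten to something else.\<close>

lemma mul_simps [simp]:
  assumes "a \<in> Arr C" "Cod C a = G1 G"
  shows "d0 G \<cdot> a = t \<Longrightarrow> mul a (ge G \<cdot> t) = a" "d1 G \<cdot> a = t \<Longrightarrow> mul (ge G \<cdot> t) a = a"
    "mul a (gi G \<cdot> a) = ge G \<cdot> (d1 G \<cdot> a)" "mul (gi G \<cdot> a) a = ge G \<cdot> (d0 G \<cdot> a)"
  using mul_unit_inv[OF assms] by auto

lemma mul_cancel [simp]:
  assumes "a \<in> Arr C" "b \<in> Arr C" "Dom C a = Dom C b" "Cod C a = G1 G" "Cod C b = G1 G"
  shows "d0 G \<cdot> a = d1 G \<cdot> b \<Longrightarrow> mul (gi G \<cdot> a) (mul a b) = b"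
    "d1 G \<cdot> a = d1 G \<cdot> b \<Longrightarrow> mul a (mul (gi G \<cdot> a) b) = b"
proof -
  show "d0 G \<cdot> a = d1 G \<cdot> b \<Longrightarrow> mul (gi G \<cdot> a) (mul a b) = b"
    using mul_assoc[of "gi G \<cdot> a" a b] assms by simp
  show "d1 G \<cdot> a = d1 G \<cdot> b \<Longrightarrow> mul a (mul (gi G \<cdot> a) b) = b"
    using mul_assoc[of a "gi G \<cdot> a" b] assms by simp
qed

section \<open>Objects with an action and equivariant arrows, in generalized elements\<close>

lemma gobj_arr:
  assumes "is_gobj C G f a"
  shows "f \<in> Arr C" "Cod C f = G0 G" "a \<in> Arr C" "Dom C a = pb_obj C (d0 G) f" "Cod C a = Dom C f"
  using assms unfolding is_gobj_def by auto

lemma ac_arr [simp]: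
  assumes X: "is_gobj C G f a" and "pel (d0 G) f g x"
  shows "ac f a g x \<in> Arr C" "Dom C (ac f a g x) = Dom C x" "Cod C (ac f a g x) = Dom C f"
    "f \<cdot> ac f a g x = d1 G \<cdot> g"
proof -
  note [simp] = gobj_arr[OF X] and fa = assms(2)
  show "ac f a g x \<in> Arr C" "Dom C (ac f a g x) = Dom C x" "Cod C (ac f a g x) = Dom C f"
    unfolding act_def using fa by simp_all
  have *: "f \<cdot> a = d1 G \<cdot> pb1 C (d0 G) f" using X unfolding is_gobj_def by blast
  show "f \<cdot> ac f a g x = d1 G \<cdot> g"
    unfolding act_def using fa comp_reassoc[OF *, of "pb_pair C (d0 G) f g x"] by simp
qed

lemma ac_comp [simp]:
  assumes X: "is_gobj C G f a" and "pel (d0 G) f g x" and "s \<in> Arr C" "Cod C s = Dom C x"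
  shows "ac f a g x \<cdot> s = ac f a (g \<cdot> s) (x \<cdot> s)"
  unfolding act_def using assms gobj_arr[OF X] by simp

lemma ac_unit [simp]:
  assumes X: "is_gobj C G f a" and "x \<in> Arr C" "Cod C x = Dom C f" "f \<cdot> x = t"
  shows "ac f a (ge G \<cdot> t) x = x"
proof -
  have "x \<in> hom C (Dom C x) (Dom C f)" using assms by simp
  then show ?thesis using X assms(4) unfolding is_gobj_def by blast
qed

lemma ac_ac [simp]:
  assumes X: "is_gobj C G f a" and "pel (d0 G) f g2 x" "g1 \<in> Arr C" "Dom C g1 = Dom C x" "Cod C g1 = G1 G" "d0 G \<cdot> g1 = d1 G \<cdot> g2"
  shows "ac f a g1 (ac f a g2 x) = ac f a (mul g1 g2) x"
proof -
  have "x \<in> hom C (Dom C x) (Dom C f)" "g1 \<in> hom C (Dom C x) (G1 G)" "g2 \<in> hom C (Dom C x) (G1 G)" "d0 G \<cdot> g2 = f \<cdot> x"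
    using assms by simp_all
  then show ?thesis using X assms(6) unfolding is_gobj_def by blast
qed

lemma ac_inj:
  assumes X: "is_gobj C G f a" and x: "pel (d0 G) f g x" "pel (d0 G) f g y" and eq: "ac f a g x = ac f a g y"
  shows "x = y"
proof -
  have "x = ac f a (gi G \<cdot> g) (ac f a g x)" "y = ac f a (gi G \<cdot> g) (ac f a g y)" using X x by simp_all
  then show ?thesis using eq by simp
qed

lemma ac_eta:
  assumes X: "is_gobj C G f a"
  shows "ac f a (pb1 C (d0 G) f) (pb2 C (d0 G) f) = a"
  unfolding act_def using gobj_arr[OF X] by simp

lemma ac_eta_comp:
  assumes X: "is_gobj C G f a" and "z \<in> Arr C" "Cod C z = pb_obj C (d0 G) f"
  shows "a \<cdot> z = ac f a (pb1 C (d0 G) f \<cdot> z) (pb2 C (d0 G) f \<cdot> z)"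
  unfolding act_def using gobj_arr[OF X] assms by simp

lemma gobjI:
  assumes t [simp]: "f \<in> Arr C" "Cod C f = G0 G" "a \<in> Arr C" "Dom C a = pb_obj C (d0 G) f" "Cod C a = Dom C f"
    and 1: "\<And>g x. pel (d0 G) f g x \<Longrightarrow> f \<cdot> ac f a g x = d1 G \<cdot> g"
    and 2: "\<And>x. x \<in> Arr C \<Longrightarrow> Cod C x = Dom C f \<Longrightarrow> ac f a (ge G \<cdot> (f \<cdot> x)) x = x"
    and 3: "\<And>g1 g2 x. pel (d0 G) f g2 x \<Longrightarrow> g1 \<in> Arr C \<Longrightarrow> Dom C g1 = Dom C x \<Longrightarrow> Cod C g1 = G1 G \<Longrightarrow> d0 G \<cdot> g1 = d1 G \<cdot> g2 \<Longrightarrow>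
      ac f a g1 (ac f a g2 x) = ac f a (mul g1 g2) x"
  shows "is_gobj C G f a"
  unfolding is_gobj_def
proof (intro conjI allI ballI impI)
  show "f \<cdot> a = d1 G \<cdot> pb1 C (d0 G) f"
    using 1[of "pb1 C (d0 G) f" "pb2 C (d0 G) f"] pb_comm(1)[of "d0 G" f] by (simp add: act_def)
qed (use 2 3 in auto)

text \<open>The definition states equivariance at the generic element, the pair of projections.
  Precomposition with \<open>pb_pair\<close> gives it at all generalized elements;
  \<open>equivariantI\<close> goes back by evaluating at the projections.\<close>

lemma equivariantD:
  assumes "equivariant C G (f, a) h (f', a')" "is_gobj C G f a" "is_gobj C G f' a'"
    and h [simp]: "h \<in> Arr C" "Dom C h = Dom C f" "Cod C h = Dom C f'"
  shows "f' \<cdot> h = f" "x \<in> Arr C \<Longrightarrow> Cod C x = Dom C f \<Longrightarrow> f' \<cdot> (h \<cdot> x) = f \<cdot> x"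
    "pel (d0 G) f g x \<Longrightarrow> h \<cdot> ac f a g x = ac f' a' g (h \<cdot> x)"
proof -
  note [simp] = gobj_arr[OF assms(2)] gobj_arr[OF assms(3)] assms(2,3)
  show *: "f' \<cdot> h = f" using assms(1) unfolding equivariant_def by simp
  then show **: "f' \<cdot> (h \<cdot> x) = f \<cdot> x" if "x \<in> Arr C" "Cod C x = Dom C f" for x
    using comp_reassoc[OF *, of x] that by simp
  assume gx: "pel (d0 G) f g x"
  have eq: "h \<cdot> a = ac f' a' (pb1 C (d0 G) f) (h \<cdot> pb2 C (d0 G) f)"
    using assms(1) unfolding equivariant_def by simp
  have "d0 G \<cdot> pb1 C (d0 G) f = f' \<cdot> (h \<cdot> pb2 C (d0 G) f)"
    by (simp add: ** pb_comm)
  then show "h \<cdot> ac f a g x = ac f' a' g (h \<cdot> x)"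
    using comp_reassoc[OF eq, of "pb_pair C (d0 G) f g x"] gx by (simp add: act_def[of C G f])
qed

lemma equivariantI:
  assumes [simp]: "is_gobj C G f a" "is_gobj C G f' a'" "h \<in> Arr C" "Dom C h = Dom C f" "Cod C h = Dom C f'" "f' \<cdot> h = f"
    and "\<And>g x. pel (d0 G) f g x \<Longrightarrow> h \<cdot> ac f a g x = ac f' a' g (h \<cdot> x)"
  shows "equivariant C G (f, a) h (f', a')"
proof -
  note [simp] = gobj_arr[OF assms(1)]
  have "h \<cdot> ac f a (pb1 C (d0 G) f) (pb2 C (d0 G) f) = ac f' a' (pb1 C (d0 G) f) (h \<cdot> pb2 C (d0 G) f)"
    by (rule assms(7)) (simp add: pb_comm)
  then show ?thesis unfolding equivariant_def by (simp add: ac_eta)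
qed

lemma gcat_simps:
  "(f, a) \<in> Obj (gcat C G) \<longleftrightarrow> is_gobj C G f a"
  "((f, a), h, (f', a')) \<in> Arr (gcat C G) \<longleftrightarrow> is_gobj C G f a \<and> is_gobj C G f' a' \<and> h \<in> Arr C \<and> Dom C h = Dom C f \<and>
     Cod C h = Dom C f' \<and> equivariant C G (f, a) h (f', a')"
  "Dom (gcat C G) (X, h, Y) = X" "Cod (gcat C G) (X, h, Y) = Y"
  "(Y', k, Z) \<cdot>\<^bsub>gcat C G\<^esub> (X, h, Y) = (X, k \<cdot> h, Z)"
  "Id (gcat C G) (f, a) = ((f, a), Id C (Dom C f), (f, a))"
  unfolding gcat_def structure_cat_def by auto

lemma category_gcat: "category (gcat C G)"
  unfolding gcat_def
proof (rule category_structure, goal_cases)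
  case (1 X)
  then show ?case by (cases X) (simp add: gobj_arr)
next
  case (2 X)
  obtain f a where X: "X = (f, a)" by (cases X)
  with 2 show ?case by (auto intro!: equivariantI simp: gobj_arr)
next
  case (3 X h Y k Z)
  obtain f a f' a' f'' a'' where XYZ: "X = (f, a)" "Y = (f', a')" "Z = (f'', a'')"
    by (cases X, cases Y, cases Z)
  note g = 3(1-3)[unfolded XYZ mem_Collect_eq case_prod_conv]
  note [simp] = gobj_arr[OF g(1)] gobj_arr[OF g(2)] gobj_arr[OF g(3)] g
  have [simp]: "h \<in> Arr C" "Dom C h = Dom C f" "Cod C h = Dom C f'" "k \<in> Arr C" "Dom C k = Dom C f'" "Cod C k = Dom C f''"
    using 3(4,5) unfolding XYZ by auto
  note h = equivariantD[OF 3(6)[unfolded XYZ], simplified] and k = equivariantD[OF 3(7)[unfolded XYZ], simplified]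
  show ?case unfolding XYZ
    by (rule equivariantI) (simp_all add: h k)
qed

lemma equivariant_Id: "is_gobj C G f a \<Longrightarrow> equivariant C G (f, a) (Id C (Dom C f)) (f, a)"
  by (rule equivariantI) (simp_all add: gobj_arr)

lemma equivariant_inv:
  assumes "equivariant C G (f, a) h (f', a')" and i [simp]: "iso C h" and [simp]: "is_gobj C G f a" "is_gobj C G f' a'"
    "Dom C h = Dom C f" "Cod C h = Dom C f'"
  shows "equivariant C G (f', a') (inv_arr C h) (f, a)"
proof -
  note [simp] = gobj_arr[OF assms(3)] gobj_arr[OF assms(4)]
  note h = equivariantD[OF assms(1), simplified]
  have f: "f \<cdot> (inv_arr C h \<cdot> x) = f' \<cdot> x" if "x \<in> Arr C" "Cod C x = Dom C f'" for x
    using h(2)[of "inv_arr C h \<cdot> x"] that by simp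
  show ?thesis
  proof (rule equivariantI)
    show "f \<cdot> inv_arr C h = f'" using f[of "Id C (Dom C f')"] by simp
    fix g x assume gx: "pel (d0 G) f' g x"
    have "h \<cdot> ac f a g (inv_arr C h \<cdot> x) = ac f' a' g x"
      using gx by (simp add: h f)
    then have "inv_arr C h \<cdot> ac f' a' g x = inv_arr C h \<cdot> (h \<cdot> ac f a g (inv_arr C h \<cdot> x))" by simp
    then show "inv_arr C h \<cdot> ac f' a' g x = ac f a g (inv_arr C h \<cdot> x)"
      using gx by (simp add: f)
  qed simp_all
qed

lemma iso_gcat:
  assumes "((f, a), h, (f', a')) \<in> Arr (gcat C G)"
  shows "iso (gcat C G) ((f, a), h, (f', a')) \<longleftrightarrow> iso C h"
proof
  assume "iso (gcat C G) ((f, a), h, (f', a'))"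
  then obtain j where j: "is_inverse (gcat C G) ((f, a), h, (f', a')) j" unfolding iso_def by blast
  then obtain k where "j = ((f', a'), k, (f, a))" by (cases j) (auto simp: is_inverse_def gcat_simps)
  with j show "iso C h"
    by (intro isoI[where g = k]) (auto simp: is_inverse_def gcat_simps)
next
  assume "iso C h"
  then show "iso (gcat C G) ((f, a), h, (f', a'))"
    using assms equivariant_inv[of f a h f' a'] unfolding iso_def[of "gcat C G"] is_inverse_def
    by (intro exI[of _ "((f', a'), inv_arr C h, (f, a))"]) (simp add: gcat_simps)
qed

subsection \<open>Pullbacks of objects with an action\<close>

text \<open>Here \<open>b\<close> gives the second component of the action on the pullback of \<open>u\<close> and \<open>v\<close>.\<close>

definition "pb_act f a u v b = (f \<cdot> pb1 C u v,
  pb_pair C u v (ac f a (pb1 C (d0 G) (f \<cdot> pb1 C u v)) (pb1 C u v \<cdot> pb2 C (d0 G) (f \<cdot> pb1 C u v))) b)"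

text \<open>The common source of the diagonal action (\<open>diag\<close>) and of the action that
  fixes the second component (\<open>quot_lift\<close>). In \<open>b3\<close> the arrow
  \<open>z'\<close> stands for the result of acting with \<open>g2\<close> on \<open>z\<close>; it
  is described by its components because the action is still under construction.\<close>

lemma pb_act:
  assumes X [simp]: "is_gobj C G f a" and u [simp]: "u \<in> Arr C" "v \<in> Arr C" "Dom C u = Dom C f" "Cod C u = Cod C v"
    and b: "b \<in> Arr C" "Dom C b = pb_obj C (d0 G) (f \<cdot> pb1 C u v)" "Cod C b = Dom C v"
    and b1: "\<And>g z. pel (d0 G) (f \<cdot> pb1 C u v) g z \<Longrightarrow>
      v \<cdot> (b \<cdot> pb_pair C (d0 G) (f \<cdot> pb1 C u v) g z) = u \<cdot> ac f a g (pb1 C u v \<cdot> z)"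
    and b2: "\<And>z. z \<in> Arr C \<Longrightarrow> Cod C z = pb_obj C u v \<Longrightarrow>
      b \<cdot> pb_pair C (d0 G) (f \<cdot> pb1 C u v) (ge G \<cdot> (f \<cdot> (pb1 C u v \<cdot> z))) z = pb2 C u v \<cdot> z"
    and b3: "\<And>g1 g2 z z'. pel (d0 G) (f \<cdot> pb1 C u v) g2 z \<Longrightarrow> g1 \<in> Arr C \<Longrightarrow> Dom C g1 = Dom C z \<Longrightarrow> Cod C g1 = G1 G \<Longrightarrow>
      d0 G \<cdot> g1 = d1 G \<cdot> g2 \<Longrightarrow> z' \<in> Arr C \<Longrightarrow> Dom C z' = Dom C z \<Longrightarrow> Cod C z' = pb_obj C u v \<Longrightarrow>
      pb1 C u v \<cdot> z' = ac f a g2 (pb1 C u v \<cdot> z) \<Longrightarrow> pb2 C u v \<cdot> z' = b \<cdot> pb_pair C (d0 G) (f \<cdot> pb1 C u v) g2 z \<Longrightarrow>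
      b \<cdot> pb_pair C (d0 G) (f \<cdot> pb1 C u v) g1 z' = b \<cdot> pb_pair C (d0 G) (f \<cdot> pb1 C u v) (mul g1 g2) z"
  shows "case pb_act f a u v b of (f', a') \<Rightarrow> is_gobj C G f' a' \<and> f' = f \<cdot> pb1 C u v \<and>
    (\<forall>g z. pel (d0 G) (f \<cdot> pb1 C u v) g z \<longrightarrow> pb1 C u v \<cdot> ac f' a' g z = ac f a g (pb1 C u v \<cdot> z) \<and>
      pb2 C u v \<cdot> ac f' a' g z = b \<cdot> pb_pair C (d0 G) (f \<cdot> pb1 C u v) g z)"
proof -
  note [simp] = gobj_arr[OF X]
  define f' where "f' = f \<cdot> pb1 C u v"
  have f' [simp]: "f' \<in> Arr C" "Dom C f' = pb_obj C u v" "Cod C f' = G0 G" unfolding f'_def by simp_all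
  have f'x [simp]: "f \<cdot> (pb1 C u v \<cdot> x) = f' \<cdot> x" if "x \<in> Arr C" "Cod C x = pb_obj C u v" for x
    unfolding f'_def using that by simp
  define g0 where "g0 = pb1 C (d0 G) f'"
  define z0 where "z0 = pb2 C (d0 G) f'"
  have [simp]: "g0 \<in> Arr C" "z0 \<in> Arr C" "Dom C g0 = pb_obj C (d0 G) f'" "Dom C z0 = pb_obj C (d0 G) f'" "Cod C g0 = G1 G"
      "Cod C z0 = pb_obj C u v" "d0 G \<cdot> g0 = f' \<cdot> z0"
    unfolding g0_def z0_def by (simp_all add: pb_comm)
  define x0 where "x0 = ac f a g0 (pb1 C u v \<cdot> z0)"
  have [simp]: "x0 \<in> Arr C" "Dom C x0 = pb_obj C (d0 G) f'" "Cod C x0 = Dom C f" "f \<cdot> x0 = d1 G \<cdot> g0"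
    unfolding x0_def by simp_all
  note b' [simp] = b[folded f'_def] and b1' = b1[folded f'_def] and b2' = b2[folded f'_def] and b3' = b3[folded f'_def]
  have "v \<cdot> (b \<cdot> pb_pair C (d0 G) f' g0 z0) = u \<cdot> x0"
    unfolding x0_def by (rule b1') simp
  then have ub [simp]: "u \<cdot> x0 = v \<cdot> b"
    unfolding g0_def z0_def by simp
  define a' where "a' = pb_pair C u v x0 b"
  have a' [simp]: "a' \<in> Arr C" "Dom C a' = pb_obj C (d0 G) f'" "Cod C a' = pb_obj C u v"
      "pb1 C u v \<cdot> a' = x0" "pb2 C u v \<cdot> a' = b"
    unfolding a'_def by simp_all
  have xp: "x0 \<cdot> pb_pair C (d0 G) f' g z = ac f a g (pb1 C u v \<cdot> z)" if "pel (d0 G) f' g z" for g z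
    using that unfolding x0_def g0_def z0_def by (simp add: pb_comm)
  have ca [simp]: "pb1 C u v \<cdot> ac f' a' g z = ac f a g (pb1 C u v \<cdot> z)"
      "pb2 C u v \<cdot> ac f' a' g z = b \<cdot> pb_pair C (d0 G) f' g z"
      "ac f' a' g z \<in> Arr C" "Dom C (ac f' a' g z) = Dom C z" "Cod C (ac f' a' g z) = pb_obj C u v" if "pel (d0 G) f' g z" for g z
    using comp_reassoc[OF a'(4), of "pb_pair C (d0 G) f' g z"] comp_reassoc[OF a'(5), of "pb_pair C (d0 G) f' g z"] xp[OF that] that
    unfolding act_def[of C G f'] by simp_all
  have fa: "f' \<cdot> ac f' a' g z = d1 G \<cdot> g" if "pel (d0 G) f' g z" for g z
    using that f'x[of "ac f' a' g z"] by (simp del: f'x)  (simp)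
  have "is_gobj C G f' a'"
  proof (rule gobjI)
    fix x assume x: "x \<in> Arr C" "Cod C x = Dom C f'"
    have p: "pel (d0 G) f' (ge G \<cdot> (f' \<cdot> x)) x" using x by simp
    show "ac f' a' (ge G \<cdot> (f' \<cdot> x)) x = x"
      by (rule pb_eqI[of u v]) (use x p ca[OF p] b2'[of x] in simp_all)
  next
    fix g1 g2 x assume x: "pel (d0 G) f' g2 x" and g1: "g1 \<in> Arr C" "Dom C g1 = Dom C x" "Cod C g1 = G1 G" "d0 G \<cdot> g1 = d1 G \<cdot> g2"
    have p: "pel (d0 G) f' g1 (ac f' a' g2 x)" using x g1 fa[OF x] by simp
    have q: "pel (d0 G) f' (mul g1 g2) x" using x g1 by simp
    show "ac f' a' g1 (ac f' a' g2 x) = ac f' a' (mul g1 g2) x"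
    proof (rule pb_eqI[of u v])
      show "pb1 C u v \<cdot> ac f' a' g1 (ac f' a' g2 x) = pb1 C u v \<cdot> ac f' a' (mul g1 g2) x"
        unfolding ca(1)[OF p] ca(1)[OF q] ca(1)[OF x] using x g1 by simp
      show "pb2 C u v \<cdot> ac f' a' g1 (ac f' a' g2 x) = pb2 C u v \<cdot> ac f' a' (mul g1 g2) x"
        unfolding ca(2)[OF p] ca(2)[OF q] by (rule b3') (use x g1 ca[OF x] in simp_all)
    qed (use x g1 ca[OF p] ca[OF q] ca[OF x] in simp_all)
  qed (use fa in simp_all)
  moreover have "pb_act f a u v b = (f', a')"
    unfolding pb_act_def f'_def[symmetric] a'_def x0_def g0_def z0_def ..
  ultimately show ?thesis using ca(1,2) unfolding f'_def[symmetric] by simp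
qed

subsection \<open>Quotients by an action\<close>

definition "invariant f a z \<longleftrightarrow> z \<in> Arr C \<and> Dom C z = Dom C f \<and> (\<forall>g x. pel (d0 G) f g x \<longrightarrow> z \<cdot> ac f a g x = z \<cdot> x)"

text \<open>The coequalizer of the action and the projection to the carrier, in the base category.
  It is stated apart from \<open>\<Sigma>\<close> so that it applies to every representative of the
  quotient.\<close>

definition "quot f a z \<longleftrightarrow> invariant f a z \<and>
  (\<forall>t. invariant f a t \<longrightarrow> (\<exists>!k. k \<in> Arr C \<and> Dom C k = Cod C z \<and> Cod C k = Cod C t \<and> k \<cdot> z = t))"

lemma invariantD:
  assumes "invariant f a z"
  shows "z \<in> Arr C" "Dom C z = Dom C f" "pel (d0 G) f g x \<Longrightarrow> z \<cdot> ac f a g x = z \<cdot> x"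
  using assms unfolding invariant_def by auto

lemma invariantI:
  assumes "z \<in> Arr C" "Dom C z = Dom C f" "\<And>g x. pel (d0 G) f g x \<Longrightarrow> z \<cdot> ac f a g x = z \<cdot> x"
  shows "invariant f a z"
  using assms unfolding invariant_def by auto

lemma invariant_comp:
  assumes X: "is_gobj C G f a" and z: "invariant f a z" and k: "k \<in> Arr C" "Dom C k = Cod C z"
  shows "invariant f a (k \<cdot> z)"
proof -
  note [simp] = gobj_arr[OF X] invariantD[OF z] X k
  show ?thesis by (rule invariantI) simp_all
qed

lemma invariant_pre:
  assumes X: "is_gobj C G f a" "is_gobj C G f' a'" and z: "invariant f a z"
    and j: "equivariant C G (f', a') j (f, a)" "j \<in> Arr C" "Dom C j = Dom C f'" "Cod C j = Dom C f"
  shows "invariant f' a' (z \<cdot> j)"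
proof -
  note [simp] = gobj_arr[OF X(1)] gobj_arr[OF X(2)] X j(2-4) invariantD[OF z]
  note h = equivariantD[OF j(1), simplified]
  show ?thesis
  proof (rule invariantI)
    fix g x assume gx: "pel (d0 G) f' g x"
    then have "(z \<cdot> j) \<cdot> ac f' a' g x = z \<cdot> ac f a g (j \<cdot> x)" using h(3)[of g x] by simp
    also have "\<dots> = z \<cdot> (j \<cdot> x)" using gx h(2)[of x] by simp
    finally show "(z \<cdot> j) \<cdot> ac f' a' g x = (z \<cdot> j) \<cdot> x" using gx by simp
  qed simp_all
qed

lemma quotD:
  assumes "quot f a z"
  shows "invariant f a z" "z \<in> Arr C" "Dom C z = Dom C f" "pel (d0 G) f g x \<Longrightarrow> z \<cdot> ac f a g x = z \<cdot> x"
  using assms unfolding quot_def invariant_def by auto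

lemma quot_ex:
  assumes "quot f a z" "invariant f a t"
  obtains k where "k \<in> Arr C" "Dom C k = Cod C z" "Cod C k = Cod C t" "k \<cdot> z = t"
  using assms unfolding quot_def by blast

lemma quot_ext:
  assumes X: "is_gobj C G f a" and q: "quot f a z" and k: "k \<in> Arr C" "k' \<in> Arr C" "Dom C k = Cod C z" "Dom C k' = Cod C z"
    "Cod C k = Cod C k'" "k \<cdot> z = k' \<cdot> z"
  shows "k = k'"
proof -
  have "invariant f a (k \<cdot> z)" using invariant_comp[OF X quotD(1)[OF q]] k by auto
  then have "\<exists>!l. l \<in> Arr C \<and> Dom C l = Cod C z \<and> Cod C l = Cod C (k \<cdot> z) \<and> l \<cdot> z = k \<cdot> z"
    using q unfolding quot_def by blast
  moreover have "Cod C (k \<cdot> z) = Cod C k" using k quotD[OF q] by auto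
  ultimately show ?thesis using k by metis
qed

lemma quotI:
  assumes "invariant f a z"
    and "\<And>t. invariant f a t \<Longrightarrow> \<exists>k. k \<in> Arr C \<and> Dom C k = Cod C z \<and> Cod C k = Cod C t \<and> k \<cdot> z = t"
    and "\<And>k k'. k \<in> Arr C \<Longrightarrow> k' \<in> Arr C \<Longrightarrow> Dom C k = Cod C z \<Longrightarrow> Dom C k' = Cod C z \<Longrightarrow> Cod C k = Cod C k' \<Longrightarrow>
      k \<cdot> z = k' \<cdot> z \<Longrightarrow> k = k'"
  shows "quot f a z"
  unfolding quot_def
proof (intro conjI allI impI)
  fix t assume "invariant f a t"
  then obtain k where "k \<in> Arr C" "Dom C k = Cod C z" "Cod C k = Cod C t" "k \<cdot> z = t" using assms(2) by blast
  then show "\<exists>!k. k \<in> Arr C \<and> Dom C k = Cod C z \<and> Cod C k = Cod C t \<and> k \<cdot> z = t"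
    using assms(3) by (intro ex1I[of _ k]) auto
qed (rule assms(1))

lemma quot_iso:
  assumes X: "is_gobj C G f a" and q: "quot f a z" and q': "quot f a z'"
    and k: "k \<in> Arr C" "Dom C k = Cod C z" "Cod C k = Cod C z'" "k \<cdot> z = z'"
  shows "iso C k"
proof -
  note z = quotD(2,3)[OF q] quotD(2,3)[OF q']
  obtain l where l: "l \<in> Arr C" "Dom C l = Cod C z'" "Cod C l = Cod C z" "l \<cdot> z' = z"
    using quot_ex[OF q' quotD(1)[OF q]] by blast
  have "(l \<cdot> k) \<cdot> z = Id C (Cod C z) \<cdot> z" using k l z by simp
  then have 1: "l \<cdot> k = Id C (Cod C z)" using k l z by - (rule quot_ext[OF X q], auto)
  have "(k \<cdot> l) \<cdot> z' = Id C (Cod C z') \<cdot> z'" using k l z by simp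
  then have 2: "k \<cdot> l = Id C (Cod C z')" using k l z by - (rule quot_ext[OF X q'], auto)
  from 1 2 show ?thesis using k l by (intro isoI[where g = l]) auto
qed

lemma quot_post:
  assumes X: "is_gobj C G f a" and q: "quot f a z" and i: "iso C i" "Dom C i = Cod C z"
  shows "quot f a (i \<cdot> z)"
proof (rule quotI)
  note z = quotD(2,3)[OF q]
  show "invariant f a (i \<cdot> z)" using invariant_comp[OF X quotD(1)[OF q]] i by auto
  show "\<exists>k. k \<in> Arr C \<and> Dom C k = Cod C (i \<cdot> z) \<and> Cod C k = Cod C t \<and> k \<cdot> (i \<cdot> z) = t" if t: "invariant f a t" for t
  proof -
    obtain k where "k \<in> Arr C" "Dom C k = Cod C z" "Cod C k = Cod C t" "k \<cdot> z = t" using quot_ex[OF q t] by blast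
    then show ?thesis using i z by (intro exI[of _ "k \<cdot> inv_arr C i"]) simp
  qed
  fix k k' assume k: "k \<in> Arr C" "k' \<in> Arr C" "Dom C k = Cod C (i \<cdot> z)" "Dom C k' = Cod C (i \<cdot> z)" "Cod C k = Cod C k'"
      "k \<cdot> (i \<cdot> z) = k' \<cdot> (i \<cdot> z)"
  then have "(k \<cdot> i) \<cdot> z = (k' \<cdot> i) \<cdot> z" using i z by simp
  then have "k \<cdot> i = k' \<cdot> i" using k i z by - (rule quot_ext[OF X q], auto)
  then have "(k \<cdot> i) \<cdot> inv_arr C i = (k' \<cdot> i) \<cdot> inv_arr C i" by simp
  then show "k = k'" using k i z by simp
qed

lemma quot_pre:
  assumes X: "is_gobj C G f a" "is_gobj C G f' a'" and q: "quot f a z"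
    and j: "equivariant C G (f', a') j (f, a)" "iso C j" "Dom C j = Dom C f'" "Cod C j = Dom C f"
  shows "quot f' a' (z \<cdot> j)"
proof (rule quotI)
  note z = quotD(2,3)[OF q] and jt [simp] = inv_arr_simps[OF j(2)]
  note j' = equivariant_inv[OF j(1,2) X(2,1) j(3,4)]
  show "invariant f' a' (z \<cdot> j)" using invariant_pre[OF X quotD(1)[OF q] j(1)] j by simp
  show "\<exists>k. k \<in> Arr C \<and> Dom C k = Cod C (z \<cdot> j) \<and> Cod C k = Cod C t \<and> k \<cdot> (z \<cdot> j) = t" if t: "invariant f' a' t" for t
  proof -
    have "invariant f a (t \<cdot> inv_arr C j)" using invariant_pre[OF X(2,1) t j'] j by simp
    then obtain k where k: "k \<in> Arr C" "Dom C k = Cod C z" "Cod C k = Cod C (t \<cdot> inv_arr C j)" "k \<cdot> z = t \<cdot> inv_arr C j"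
      using quot_ex[OF q] by blast
    have "k \<cdot> (z \<cdot> j) = (t \<cdot> inv_arr C j) \<cdot> j" using k j z by (intro comp_reassoc) auto
    then show ?thesis using k j z invariantD(1,2)[OF t] by (intro exI[of _ k]) simp
  qed
  fix k k' assume k: "k \<in> Arr C" "k' \<in> Arr C" "Dom C k = Cod C (z \<cdot> j)" "Dom C k' = Cod C (z \<cdot> j)" "Cod C k = Cod C k'"
      "k \<cdot> (z \<cdot> j) = k' \<cdot> (z \<cdot> j)"
  have "k \<cdot> z = (k \<cdot> (z \<cdot> j)) \<cdot> inv_arr C j" "k' \<cdot> z = (k' \<cdot> (z \<cdot> j)) \<cdot> inv_arr C j"
    using k(1-5) j z by simp_all
  then have "k \<cdot> z = k' \<cdot> z" using k(6) by simp
  then show "k = k'" using k j z by - (rule quot_ext[OF X(1) q], auto)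
qed

subsection \<open>Limits of objects with an action\<close>

text \<open>The two projections are jointly monic, so equivariance can be tested after composing
  with them. The cone is arbitrary, since the pullbacks met later need not be the chosen
  ones.\<close>

lemma equivariant_into_pullback:
  assumes X: "is_gobj C G f a" "is_gobj C G f' a'" "is_gobj C G t A" "is_gobj C G s B"
    and uv: "u \<in> Arr C" "v \<in> Arr C" "Cod C u = Cod C v"
    and pb: "is_pullback C u v k1 k2" and [simp]: "Dom C u = Dom C f" "Dom C v = Dom C f'" "Dom C k1 = Dom C t"
    and k: "equivariant C G (t, A) k1 (f, a)" "equivariant C G (t, A) k2 (f', a')"
    and h [simp]: "h \<in> Arr C" "Dom C h = Dom C s" "Cod C h = Dom C t"
    and e: "equivariant C G (s, B) (k1 \<cdot> h) (f, a)" "equivariant C G (s, B) (k2 \<cdot> h) (f', a')"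
  shows "equivariant C G (s, B) h (t, A)"
proof -
  note [simp] = gobj_arr[OF X(1)] gobj_arr[OF X(2)] gobj_arr[OF X(3)] gobj_arr[OF X(4)] X uv
  have kt: "k1 \<in> Arr C" "Dom C k1 = Dom C t" "Cod C k1 = Dom C f" "k2 \<in> Arr C" "Dom C k2 = Dom C t" "Cod C k2 = Dom C f'"
    using is_pullbackD(1-5)[OF pb] by simp_all
  then have kh: "k1 \<cdot> h \<in> Arr C" "Dom C (k1 \<cdot> h) = Dom C s" "Cod C (k1 \<cdot> h) = Dom C f"
     "k2 \<cdot> h \<in> Arr C" "Dom C (k2 \<cdot> h) = Dom C s" "Cod C (k2 \<cdot> h) = Dom C f'"
    by simp_all
  note [simp] = kt
  note k1 = equivariantD[OF k(1) X(3,1) kt(1-3)] and k2 = equivariantD[OF k(2) X(3,2) kt(4-6)]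
    and e1 = equivariantD[OF e(1) X(4,1) kh(1-3)] and e2 = equivariantD[OF e(2) X(4,2) kh(4-6)]
  have th: "t \<cdot> (h \<cdot> x) = s \<cdot> x" if "x \<in> Arr C" "Cod C x = Dom C s" for x
    using k1(2)[of "h \<cdot> x"] e1(2)[of x] that by simp
  show ?thesis
  proof (rule equivariantI)
    show "t \<cdot> h = s" using th[of "Id C (Dom C s)"] by simp
    fix g x assume gx: "pel (d0 G) s g x"
    then have p: "pel (d0 G) t g (h \<cdot> x)" using th by simp
    show "h \<cdot> ac s B g x = ac t A g (h \<cdot> x)"
    proof (rule is_pullback_ext[OF pb])
      show "k1 \<cdot> (h \<cdot> ac s B g x) = k1 \<cdot> ac t A g (h \<cdot> x)"
        unfolding k1(3)[OF p] using e1(3)[OF gx] gx by simp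
      show "k2 \<cdot> (h \<cdot> ac s B g x) = k2 \<cdot> ac t A g (h \<cdot> x)"
        unfolding k2(3)[OF p] using e2(3)[OF gx] gx by simp
    qed (use gx p in simp_all)
  qed simp_all
qed

definition "diag f a f' a' u v = pb_act f a u v
  (ac f' a' (pb1 C (d0 G) (f \<cdot> pb1 C u v)) (pb2 C u v \<cdot> pb2 C (d0 G) (f \<cdot> pb1 C u v)))"

text \<open>By \<open>c1\<close> both components of an element have the same image in
  \<open>G0\<close>, so one arrow acts on both; by \<open>c2\<close> the result is again in the
  pullback. The two uses are equivariant \<open>u\<close>, \<open>v\<close>, giving pullbacks in
  \<open>[G, C]\<close>, and \<open>u = f\<close>, \<open>v = f'\<close>, giving products.\<close>

lemma diag:
  assumes X [simp]: "is_gobj C G f a" "is_gobj C G f' a'"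
    and u [simp]: "u \<in> Arr C" "v \<in> Arr C" "Dom C u = Dom C f" "Dom C v = Dom C f'" "Cod C u = Cod C v"
    and c1: "\<And>x y. pel u v x y \<Longrightarrow> f \<cdot> x = f' \<cdot> y"
    and c2: "\<And>g x y. pel u v x y \<Longrightarrow> pel (d0 G) f g x \<Longrightarrow> u \<cdot> ac f a g x = v \<cdot> ac f' a' g y"
  shows "case diag f a f' a' u v of (t, A) \<Rightarrow> is_gobj C G t A \<and> t = f \<cdot> pb1 C u v \<and>
    equivariant C G (t, A) (pb1 C u v) (f, a) \<and> equivariant C G (t, A) (pb2 C u v) (f', a') \<and>
    (\<forall>g z. pel (d0 G) t g z \<longrightarrow> pb1 C u v \<cdot> ac t A g z = ac f a g (pb1 C u v \<cdot> z) \<and>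
      pb2 C u v \<cdot> ac t A g z = ac f' a' g (pb2 C u v \<cdot> z))"
proof -
  note [simp] = gobj_arr[OF X(1)] gobj_arr[OF X(2)]
  define t where "t = f \<cdot> pb1 C u v"
  have t [simp]: "t \<in> Arr C" "Dom C t = pb_obj C u v" "Cod C t = G0 G" unfolding t_def by simp_all
  have pc: "pel u v (pb1 C u v \<cdot> z) (pb2 C u v \<cdot> z)" if "z \<in> Arr C" "Cod C z = pb_obj C u v" for z
    using that pb_comm(2)[of u v z] by simp
  have f'z [simp]: "f \<cdot> (pb1 C u v \<cdot> z) = t \<cdot> z" "f' \<cdot> (pb2 C u v \<cdot> z) = t \<cdot> z" if "z \<in> Arr C" "Cod C z = pb_obj C u v" for z
    using c1[OF pc[OF that]] that unfolding t_def by simp_all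
  define g0 where "g0 = pb1 C (d0 G) t"
  define z0 where "z0 = pb2 C (d0 G) t"
  have [simp]: "g0 \<in> Arr C" "z0 \<in> Arr C" "Dom C g0 = pb_obj C (d0 G) t" "Dom C z0 = pb_obj C (d0 G) t" "Cod C g0 = G1 G"
      "Cod C z0 = pb_obj C u v" "d0 G \<cdot> g0 = t \<cdot> z0"
    unfolding g0_def z0_def by (simp_all add: pb_comm)
  define b where "b = ac f' a' g0 (pb2 C u v \<cdot> z0)"
  have b [simp]: "b \<in> Arr C" "Dom C b = pb_obj C (d0 G) t" "Cod C b = Dom C f'" unfolding b_def by simp_all
  have bp [simp]: "b \<cdot> pb_pair C (d0 G) t g z = ac f' a' g (pb2 C u v \<cdot> z)" if "pel (d0 G) t g z" for g z
    using that unfolding b_def g0_def z0_def by (simp add: pb_comm)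
  obtain t' A where tA: "diag f a f' a' u v = (t', A)" by (cases "diag f a f' a' u v")
  have "pb_act f a u v b = (t', A)"
    unfolding tA[symmetric] diag_def t_def[symmetric] b_def g0_def z0_def ..
  moreover have "case pb_act f a u v b of (f', a') \<Rightarrow> is_gobj C G f' a' \<and> f' = f \<cdot> pb1 C u v \<and>
    (\<forall>g z. pel (d0 G) (f \<cdot> pb1 C u v) g z \<longrightarrow> pb1 C u v \<cdot> ac f' a' g z = ac f a g (pb1 C u v \<cdot> z) \<and>
      pb2 C u v \<cdot> ac f' a' g z = b \<cdot> pb_pair C (d0 G) (f \<cdot> pb1 C u v) g z)"
  proof (rule pb_act, unfold t_def[symmetric])
    fix g z assume gz: "pel (d0 G) t g z"
    have "u \<cdot> ac f a g (pb1 C u v \<cdot> z) = v \<cdot> ac f' a' g (pb2 C u v \<cdot> z)"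
      by (rule c2) (use gz pc[of z] in simp_all)
    then show "v \<cdot> (b \<cdot> pb_pair C (d0 G) t g z) = u \<cdot> ac f a g (pb1 C u v \<cdot> z)" using gz by simp
  next
    fix g1 g2 z z' assume z: "pel (d0 G) t g2 z" "g1 \<in> Arr C" "Dom C g1 = Dom C z" "Cod C g1 = G1 G" "d0 G \<cdot> g1 = d1 G \<cdot> g2"
      "z' \<in> Arr C" "Dom C z' = Dom C z" "Cod C z' = pb_obj C u v" "pb1 C u v \<cdot> z' = ac f a g2 (pb1 C u v \<cdot> z)"
      "pb2 C u v \<cdot> z' = b \<cdot> pb_pair C (d0 G) t g2 z"
    have "t \<cdot> z' = f \<cdot> (pb1 C u v \<cdot> z')" using z(6,8) by simp
    also have "\<dots> = d1 G \<cdot> g2" unfolding z(9) using z(1) by simp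
    finally show "b \<cdot> pb_pair C (d0 G) t g1 z' = b \<cdot> pb_pair C (d0 G) t (mul g1 g2) z"
      using z by simp
  qed simp_all
  ultimately have *: "is_gobj C G t' A" "t' = t" "\<And>g z. pel (d0 G) t g z \<Longrightarrow> pb1 C u v \<cdot> ac t' A g z = ac f a g (pb1 C u v \<cdot> z) \<and>
      pb2 C u v \<cdot> ac t' A g z = ac f' a' g (pb2 C u v \<cdot> z)"
    unfolding t_def[symmetric] by auto
  have fp: "f \<cdot> pb1 C u v = t" "f' \<cdot> pb2 C u v = t"
    using f'z[of "Id C (pb_obj C u v)"] by simp_all
  have g: "is_gobj C G t A" using *(1) unfolding *(2) .
  have ca: "pb1 C u v \<cdot> ac t A g z = ac f a g (pb1 C u v \<cdot> z)" "pb2 C u v \<cdot> ac t A g z = ac f' a' g (pb2 C u v \<cdot> z)"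
    if "pel (d0 G) t g z" for g z
    using *(3)[OF that] unfolding *(2) by blast+
  have "equivariant C G (t, A) (pb1 C u v) (f, a)"
    by (rule equivariantI) (simp_all add: g fp ca)
  moreover have "equivariant C G (t, A) (pb2 C u v) (f', a')"
    by (rule equivariantI) (simp_all add: g fp ca)
  ultimately show ?thesis unfolding tA case_prod_conv *(2) t_def[symmetric] using g ca by blast
qed

lemma gcat_pullbackI:
  assumes X: "is_gobj C G f a" "is_gobj C G f' a'" "is_gobj C G f'' a''" "is_gobj C G t A"
    and pb: "is_pullback C u v k1 k2" and k: "((t, A), k1, (f, a)) \<in> Arr (gcat C G)" "((t, A), k2, (f', a')) \<in> Arr (gcat C G)"
    and u: "((f, a), u, (f'', a'')) \<in> Arr (gcat C G)" "((f', a'), v, (f'', a'')) \<in> Arr (gcat C G)"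
  shows "is_pullback (gcat C G) ((f, a), u, (f'', a'')) ((f', a'), v, (f'', a'')) ((t, A), k1, (f, a)) ((t, A), k2, (f', a'))"
proof -
  interpret gc: catl "gcat C G" by unfold_locales (rule category_gcat)
  have ut [simp]: "u \<in> Arr C" "Dom C u = Dom C f" "Cod C u = Dom C f''" "v \<in> Arr C" "Dom C v = Dom C f'" "Cod C v = Dom C f''"
    and kt [simp]: "k1 \<in> Arr C" "Dom C k1 = Dom C t" "Cod C k1 = Dom C f" "k2 \<in> Arr C" "Dom C k2 = Dom C t" "Cod C k2 = Dom C f'"
    and ke: "equivariant C G (t, A) k1 (f, a)" "equivariant C G (t, A) k2 (f', a')"
    using u k unfolding gcat_simps by auto
  show ?thesis
  proof (rule gc.is_pullbackI)
    show "((f, a), u, (f'', a'')) \<cdot>\<^bsub>gcat C G\<^esub> ((t, A), k1, (f, a)) = ((f', a'), v, (f'', a'')) \<cdot>\<^bsub>gcat C G\<^esub> ((t, A), k2, (f', a'))"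
      using is_pullbackD(6)[OF pb] by (simp add: gcat_simps)
    fix r s assume rs: "r \<in> Arr (gcat C G)" "s \<in> Arr (gcat C G)" "Dom (gcat C G) r = Dom (gcat C G) s"
      "Cod (gcat C G) r = Dom (gcat C G) ((f, a), u, (f'', a''))" "Cod (gcat C G) s = Dom (gcat C G) ((f', a'), v, (f'', a''))"
      "((f, a), u, (f'', a'')) \<cdot>\<^bsub>gcat C G\<^esub> r = ((f', a'), v, (f'', a'')) \<cdot>\<^bsub>gcat C G\<^esub> s"
    then obtain b B x y where r: "r = ((b, B), x, (f, a))" and s: "s = ((b, B), y, (f', a'))" and uv: "u \<cdot> x = v \<cdot> y"
      by (cases r; cases s) (auto simp: gcat_simps)
    have xy: "x \<in> Arr C" "y \<in> Arr C" "Dom C x = Dom C b" "Dom C y = Dom C b" "Cod C x = Dom C f" "Cod C y = Dom C f'" "is_gobj C G b B"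
      "equivariant C G (b, B) x (f, a)" "equivariant C G (b, B) y (f', a')"
      using rs(1,2) unfolding r s gcat_simps by auto
    obtain h where h: "h \<in> Arr C" "Dom C h = Dom C b" "Cod C h = Dom C t" "k1 \<cdot> h = x" "k2 \<cdot> h = y"
      using is_pullback_ex[OF pb, of x y] xy uv by auto
    have "equivariant C G (b, B) h (t, A)"
      by (rule equivariant_into_pullback[OF X(1,2,4) xy(7) _ _ _ pb _ _ _ ke]) (use h xy in simp_all)
    then show "\<exists>h. h \<in> Arr (gcat C G) \<and> Dom (gcat C G) h = Dom (gcat C G) s \<and> Cod (gcat C G) h = Dom (gcat C G) ((t, A), k1, (f, a)) \<and>
       ((t, A), k1, (f, a)) \<cdot>\<^bsub>gcat C G\<^esub> h = r \<and> ((t, A), k2, (f', a')) \<cdot>\<^bsub>gcat C G\<^esub> h = s"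
      using h xy X by (intro exI[of _ "((b, B), h, (t, A))"]) (simp add: gcat_simps r s)
  next
    fix h k assume hk: "h \<in> Arr (gcat C G)" "k \<in> Arr (gcat C G)" "Dom (gcat C G) h = Dom (gcat C G) k"
      "Cod (gcat C G) h = Dom (gcat C G) ((t, A), k1, (f, a))" "Cod (gcat C G) k = Dom (gcat C G) ((t, A), k1, (f, a))"
      "((t, A), k1, (f, a)) \<cdot>\<^bsub>gcat C G\<^esub> h = ((t, A), k1, (f, a)) \<cdot>\<^bsub>gcat C G\<^esub> k"
      "((t, A), k2, (f', a')) \<cdot>\<^bsub>gcat C G\<^esub> h = ((t, A), k2, (f', a')) \<cdot>\<^bsub>gcat C G\<^esub> k"
    then obtain b B x y where r: "h = ((b, B), x, (t, A))" and s: "k = ((b, B), y, (t, A))" and uv: "k1 \<cdot> x = k1 \<cdot> y" "k2 \<cdot> x = k2 \<cdot> y"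
      by (cases h; cases k) (auto simp: gcat_simps)
    have xy: "x \<in> Arr C" "y \<in> Arr C" "Dom C x = Dom C b" "Dom C y = Dom C b" "Cod C x = Dom C t" "Cod C y = Dom C t"
      using hk(1,2) unfolding r s gcat_simps by auto
    have "x = y" by (rule is_pullback_ext[OF pb]) (use xy uv in simp_all)
    then show "h = k" unfolding r s by simp
  qed (use k in \<open>simp_all add: gcat_simps\<close>)
qed

lemma gcat_pullback_ex:
  assumes u: "((f, a), u, (f'', a'')) \<in> Arr (gcat C G)" "((f', a'), v, (f'', a'')) \<in> Arr (gcat C G)"
  shows "\<exists>N k1 k2. is_pullback C u v k1 k2 \<and>
    is_pullback (gcat C G) ((f, a), u, (f'', a'')) ((f', a'), v, (f'', a'')) (N, k1, (f, a)) (N, k2, (f', a'))"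
proof -
  have X [simp]: "is_gobj C G f a" "is_gobj C G f' a'" "is_gobj C G f'' a''"
    and ut [simp]: "u \<in> Arr C" "Dom C u = Dom C f" "Cod C u = Dom C f''" "v \<in> Arr C" "Dom C v = Dom C f'" "Cod C v = Dom C f''"
    and e: "equivariant C G (f, a) u (f'', a'')" "equivariant C G (f', a') v (f'', a'')"
    using u unfolding gcat_simps by auto
  note [simp] = gobj_arr[OF X(1)] gobj_arr[OF X(2)] gobj_arr[OF X(3)]
  note ue = equivariantD[OF e(1), simplified] and ve = equivariantD[OF e(2), simplified]
  obtain t A where tA: "diag f a f' a' u v = (t, A)" by (cases "diag f a f' a' u v")
  have c1: "f \<cdot> x = f' \<cdot> y" if "pel u v x y" for x y
    using ue(2)[of x] ve(2)[of y] that by simp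
  have "case diag f a f' a' u v of (t, A) \<Rightarrow> is_gobj C G t A \<and> t = f \<cdot> pb1 C u v \<and>
    equivariant C G (t, A) (pb1 C u v) (f, a) \<and> equivariant C G (t, A) (pb2 C u v) (f', a') \<and>
    (\<forall>g z. pel (d0 G) t g z \<longrightarrow> pb1 C u v \<cdot> ac t A g z = ac f a g (pb1 C u v \<cdot> z) \<and>
      pb2 C u v \<cdot> ac t A g z = ac f' a' g (pb2 C u v \<cdot> z))"
    by (rule diag) (use c1 in \<open>simp_all add: ue ve\<close>)
  then have d: "is_gobj C G t A" "t = f \<cdot> pb1 C u v" "equivariant C G (t, A) (pb1 C u v) (f, a)"
      "equivariant C G (t, A) (pb2 C u v) (f', a')"
    unfolding tA case_prod_conv by blast+
  from d(2) have [simp]: "Dom C t = pb_obj C u v" by simp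
  have "is_pullback (gcat C G) ((f, a), u, (f'', a'')) ((f', a'), v, (f'', a'')) ((t, A), pb1 C u v, (f, a)) ((t, A), pb2 C u v, (f', a'))"
    by (rule gcat_pullbackI) (use d(1,3,4) e in \<open>simp_all add: pb_is_pullback gcat_simps\<close>)
  then show ?thesis using pb_is_pullback[of u v] by auto
qed

text \<open>A pullback in \<open>[G, C]\<close> obtained by choice is isomorphic there to the one
  with the diagonal action, and an isomorphism of \<open>[G, C]\<close> is one of the base; so its
  underlying square is a pullback as well.\<close>

lemma gcat_pullback_underlying:
  assumes u: "((f, a), u, (f'', a'')) \<in> Arr (gcat C G)" "((f', a'), v, (f'', a'')) \<in> Arr (gcat C G)"
    and n: "is_pullback (gcat C G) ((f, a), u, (f'', a'')) ((f', a'), v, (f'', a'')) n1 n2"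
  shows "\<exists>t A k1 k2. n1 = ((t, A), k1, (f, a)) \<and> n2 = ((t, A), k2, (f', a')) \<and> is_pullback C u v k1 k2"
proof -
  interpret gc: catl "gcat C G" by unfold_locales (rule category_gcat)
  obtain N k1 k2 where pb: "is_pullback C u v k1 k2"
    and pb': "is_pullback (gcat C G) ((f, a), u, (f'', a'')) ((f', a'), v, (f'', a'')) (N, k1, (f, a)) (N, k2, (f', a'))"
    using gcat_pullback_ex[OF u] by blast
  note pn = gc.is_pullbackD[OF pb']
  obtain s B where N: "N = (s, B)" by (cases N)
  obtain j where j: "iso (gcat C G) j" "j \<in> hom (gcat C G) (Dom (gcat C G) n1) (s, B)"
     "((s, B), k1, (f, a)) \<cdot>\<^bsub>gcat C G\<^esub> j = n1" "((s, B), k2, (f', a')) \<cdot>\<^bsub>gcat C G\<^esub> j = n2"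
    using gc.pullback_is_iso[OF pb' n u] unfolding N gcat_simps by auto
  obtain t A where d: "Dom (gcat C G) n1 = (t, A)" by (cases "Dom (gcat C G) n1")
  obtain h where h: "j = ((t, A), h, (s, B))"
    using j(2) unfolding d by (cases j) (auto simp: gcat_simps)
  have i: "iso C h" "Cod C h = Dom C s" using h j(1,2) iso_gcat[of t A h s B] by (auto simp: gcat_simps)
  have "Dom C k1 = Dom C s" using pn(1) unfolding N gcat_simps by simp
  then have "is_pullback C u v (k1 \<cdot> h) (k2 \<cdot> h)"
    using is_pullback_iso[OF pb i(1)] i u unfolding gcat_simps by simp
  then show ?thesis using j(3,4) unfolding h gcat_simps by blast
qed

text \<open>Equivariant arrows lie over \<open>G0\<close>, so a product in \<open>[G, C]\<close> is
  carried by the pullback of the two structure maps.\<close>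

lemma gcat_productI:
  assumes X: "is_gobj C G f a" "is_gobj C G f' a'" "is_gobj C G t A"
    and pb: "is_pullback C f f' k1 k2" and k: "((t, A), k1, (f, a)) \<in> Arr (gcat C G)" "((t, A), k2, (f', a')) \<in> Arr (gcat C G)"
  shows "is_product (gcat C G) (f, a) (f', a') ((t, A), k1, (f, a)) ((t, A), k2, (f', a'))"
proof -
  note [simp] = gobj_arr[OF X(1)] gobj_arr[OF X(2)] gobj_arr[OF X(3)]
  have kt [simp]: "k1 \<in> Arr C" "Dom C k1 = Dom C t" "Cod C k1 = Dom C f" "k2 \<in> Arr C" "Dom C k2 = Dom C t" "Cod C k2 = Dom C f'"
    and ke: "equivariant C G (t, A) k1 (f, a)" "equivariant C G (t, A) k2 (f', a')"
    using k unfolding gcat_simps by auto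
  show ?thesis
    unfolding is_product_def
  proof (intro conjI allI ballI)
    fix T r s assume rs: "r \<in> hom (gcat C G) T (f, a)" "s \<in> hom (gcat C G) T (f', a')"
    obtain b B where T: "T = (b, B)" by (cases T)
    obtain x y where r: "r = ((b, B), x, (f, a))" and s: "s = ((b, B), y, (f', a'))"
      using rs unfolding T by (cases r; cases s) (auto simp: gcat_simps)
    have xy: "x \<in> Arr C" "y \<in> Arr C" "Dom C x = Dom C b" "Dom C y = Dom C b" "Cod C x = Dom C f" "Cod C y = Dom C f'" "is_gobj C G b B"
      "equivariant C G (b, B) x (f, a)" "equivariant C G (b, B) y (f', a')"
      using rs unfolding r s hom_def mem_Collect_eq gcat_simps by auto
    have uv: "f \<cdot> x = f' \<cdot> y"
      using equivariantD(1)[OF xy(8)] equivariantD(1)[OF xy(9)] xy X by simp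
    obtain h where h: "h \<in> Arr C" "Dom C h = Dom C b" "Cod C h = Dom C t" "k1 \<cdot> h = x" "k2 \<cdot> h = y"
      using is_pullback_ex[OF pb, of x y] xy uv by auto
    have e: "equivariant C G (b, B) h (t, A)"
      by (rule equivariant_into_pullback[OF X(1,2,3) xy(7) _ _ _ pb _ _ _ ke]) (use h xy in simp_all)
    show "\<exists>!h. h \<in> hom (gcat C G) T (Dom (gcat C G) ((t, A), k1, (f, a))) \<and>
       ((t, A), k1, (f, a)) \<cdot>\<^bsub>gcat C G\<^esub> h = r \<and> ((t, A), k2, (f', a')) \<cdot>\<^bsub>gcat C G\<^esub> h = s"
    proof (rule ex1I[of _ "((b, B), h, (t, A))"])
      fix h' assume h': "h' \<in> hom (gcat C G) T (Dom (gcat C G) ((t, A), k1, (f, a))) \<and>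
        ((t, A), k1, (f, a)) \<cdot>\<^bsub>gcat C G\<^esub> h' = r \<and> ((t, A), k2, (f', a')) \<cdot>\<^bsub>gcat C G\<^esub> h' = s"
      then obtain l where l: "h' = ((b, B), l, (t, A))" "k1 \<cdot> l = x" "k2 \<cdot> l = y" "l \<in> Arr C" "Dom C l = Dom C b" "Cod C l = Dom C t"
        by (cases h') (auto simp: gcat_simps T r s)
      have "l = h" by (rule is_pullback_ext[OF pb]) (use h l in simp_all)
      with l show "h' = ((b, B), h, (t, A))" by simp
    qed (use h e xy X in \<open>simp add: gcat_simps T r s\<close>)
  qed (use k in \<open>simp_all add: gcat_simps\<close>)
qed

lemma diag_product:
  assumes X [simp]: "is_gobj C G f a" "is_gobj C G f' a'"
  shows "case diag f a f' a' f f' of (t, A) \<Rightarrow> is_gobj C G t A \<and> t = f \<cdot> pb1 C f f' \<and>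
    equivariant C G (t, A) (pb1 C f f') (f, a) \<and> equivariant C G (t, A) (pb2 C f f') (f', a') \<and>
    (\<forall>g z. pel (d0 G) t g z \<longrightarrow> pb1 C f f' \<cdot> ac t A g z = ac f a g (pb1 C f f' \<cdot> z) \<and>
      pb2 C f f' \<cdot> ac t A g z = ac f' a' g (pb2 C f f' \<cdot> z))"
proof -
  note [simp] = gobj_arr[OF X(1)] gobj_arr[OF X(2)]
  show ?thesis by (rule diag) simp_all
qed

lemma gcat_product_ex:
  assumes X: "is_gobj C G f a" "is_gobj C G f' a'"
  shows "\<exists>N k1 k2. is_pullback C f f' k1 k2 \<and> is_product (gcat C G) (f, a) (f', a') (N, k1, (f, a)) (N, k2, (f', a'))"
proof -
  note [simp] = gobj_arr[OF X(1)] gobj_arr[OF X(2)]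
  obtain t A where tA: "diag f a f' a' f f' = (t, A)" by (cases "diag f a f' a' f f'")
  have d: "is_gobj C G t A" "t = f \<cdot> pb1 C f f'" "equivariant C G (t, A) (pb1 C f f') (f, a)"
      "equivariant C G (t, A) (pb2 C f f') (f', a')"
    using diag_product[OF X] unfolding tA case_prod_conv by blast+
  from d(2) have [simp]: "Dom C t = pb_obj C f f'" by simp
  have "is_product (gcat C G) (f, a) (f', a') ((t, A), pb1 C f f', (f, a)) ((t, A), pb2 C f f', (f', a'))"
    by (rule gcat_productI) (use d(1,3,4) X in \<open>simp_all add: pb_is_pullback gcat_simps\<close>)
  then show ?thesis using pb_is_pullback[of f f'] by auto
qed

lemma gcat_product_underlying:
  assumes X: "is_gobj C G f a" "is_gobj C G f' a'"
    and n: "is_product (gcat C G) (f, a) (f', a') n1 n2"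
  shows "\<exists>t A k1 k2. n1 = ((t, A), k1, (f, a)) \<and> n2 = ((t, A), k2, (f', a')) \<and> n1 \<in> Arr (gcat C G) \<and> n2 \<in> Arr (gcat C G) \<and>
    is_pullback C f f' k1 k2"
proof -
  interpret gc: catl "gcat C G" by unfold_locales (rule category_gcat)
  obtain N k1 k2 where pb: "is_pullback C f f' k1 k2"
    and pb': "is_product (gcat C G) (f, a) (f', a') (N, k1, (f, a)) (N, k2, (f', a'))"
    using gcat_product_ex[OF X] by blast
  have pn: "(N, k1, (f, a)) \<in> Arr (gcat C G)" and nn: "n1 \<in> Arr (gcat C G)" "n2 \<in> Arr (gcat C G)"
    using pb' n unfolding is_product_def by auto
  obtain s B where N: "N = (s, B)" by (cases N)
  obtain j where j: "iso (gcat C G) j" "j \<in> hom (gcat C G) (Dom (gcat C G) n1) (s, B)"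
     "((s, B), k1, (f, a)) \<cdot>\<^bsub>gcat C G\<^esub> j = n1" "((s, B), k2, (f', a')) \<cdot>\<^bsub>gcat C G\<^esub> j = n2"
    using gc.is_product_iso[OF pb' n] unfolding N gcat_simps by auto
  obtain t A where d: "Dom (gcat C G) n1 = (t, A)" by (cases "Dom (gcat C G) n1")
  obtain h where h: "j = ((t, A), h, (s, B))"
    using j(2) unfolding d by (cases j) (auto simp: gcat_simps)
  have i: "iso C h" "Cod C h = Dom C s" using h j(1,2) iso_gcat[of t A h s B] by (auto simp: gcat_simps)
  have "Dom C k1 = Dom C s" using pn unfolding N gcat_simps by simp
  then have "is_pullback C f f' (k1 \<cdot> h) (k2 \<cdot> h)"
    using is_pullback_iso[OF pb i(1)] i gobj_arr[OF X(1)] gobj_arr[OF X(2)] by simp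
  then show ?thesis using j(3,4) nn unfolding h gcat_simps by blast
qed

lemma inv_mul:
  assumes [simp]: "a \<in> Arr C" "b \<in> Arr C" "Dom C a = Dom C b" "Cod C a = G1 G" "Cod C b = G1 G" "d0 G \<cdot> a = d1 G \<cdot> b"
  shows "gi G \<cdot> mul a b = mul (gi G \<cdot> b) (gi G \<cdot> a)"
proof -
  have 1: "mul (mul a b) (mul (gi G \<cdot> b) (gi G \<cdot> a)) = ge G \<cdot> (d1 G \<cdot> a)"
    by simp
  have "gi G \<cdot> mul a b = mul (gi G \<cdot> mul a b) (ge G \<cdot> (d1 G \<cdot> a))" by simp
  also have "\<dots> = mul (gi G \<cdot> mul a b) (mul (mul a b) (mul (gi G \<cdot> b) (gi G \<cdot> a)))" unfolding 1 ..
  also have "\<dots> = mul (gi G \<cdot> b) (gi G \<cdot> a)" by (simp del: mul_assoc)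
  finally show ?thesis .
qed

lemma inv_unit [simp]:
  assumes [simp]: "x \<in> Arr C" "Cod C x = G0 G"
  shows "gi G \<cdot> (ge G \<cdot> x) = ge G \<cdot> x"
proof -
  have "gi G \<cdot> (ge G \<cdot> x) = mul (gi G \<cdot> (ge G \<cdot> x)) (ge G \<cdot> x)"
    by simp
  then show ?thesis by (simp only: mul_unit_inv d_simps assms comp_Arr Cod_comp gpd_arr)
qed

subsection \<open>Free and trivial actions\<close>

lemma ac_free_one: "ac (d1 G) (gm G) g x = mul g x"
  unfolding act_def gmul_def ..

lemma gobj_free_one [simp]: "is_gobj C G (d1 G) (gm G)"
  by (rule gobjI) (simp_all add: ac_free_one)

lemma free_gobj:
  assumes [simp]: "f \<in> Arr C" "Cod C f = G0 G"
  shows "case free_gobj C G f of (t, A) \<Rightarrow> is_gobj C G t A \<and> t = d1 G \<cdot> pb1 C (d0 G) f \<and>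
    (\<forall>g y. pel (d0 G) t g y \<longrightarrow> pb1 C (d0 G) f \<cdot> ac t A g y = mul g (pb1 C (d0 G) f \<cdot> y) \<and>
      pb2 C (d0 G) f \<cdot> ac t A g y = pb2 C (d0 G) f \<cdot> y)"
proof -
  define p where "p = pb1 C (d0 G) f"
  define x where "x = pb2 C (d0 G) f"
  have px [simp]: "p \<in> Arr C" "x \<in> Arr C" "Dom C p = pb_obj C (d0 G) f" "Dom C x = pb_obj C (d0 G) f" "Cod C p = G1 G" "Cod C x = Dom C f"
    "y \<in> Arr C \<Longrightarrow> Cod C y = pb_obj C (d0 G) f \<Longrightarrow> d0 G \<cdot> (p \<cdot> y) = f \<cdot> (x \<cdot> y)" for y
    unfolding p_def x_def by (simp_all add: pb_comm)
  define t where "t = d1 G \<cdot> p"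
  have t [simp]: "t \<in> Arr C" "Dom C t = pb_obj C (d0 G) f" "Cod C t = G0 G"
      "y \<in> Arr C \<Longrightarrow> Cod C y = pb_obj C (d0 G) f \<Longrightarrow> d1 G \<cdot> (p \<cdot> y) = t \<cdot> y" for y
    unfolding t_def by simp_all
  define g' where "g' = pb1 C (d0 G) t"
  define y where "y = pb2 C (d0 G) t"
  have gy [simp]: "g' \<in> Arr C" "y \<in> Arr C" "Dom C g' = pb_obj C (d0 G) t" "Dom C y = pb_obj C (d0 G) t" "Cod C g' = G1 G" "Cod C y = pb_obj C (d0 G) f"
      "d0 G \<cdot> g' = t \<cdot> y"
    unfolding g'_def y_def by (simp_all add: pb_comm)
  define A where "A = pb_pair C (d0 G) f (mul g' (p \<cdot> y)) (x \<cdot> y)"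
  have A [simp]: "A \<in> Arr C" "Dom C A = pb_obj C (d0 G) t" "Cod C A = pb_obj C (d0 G) f" "p \<cdot> A = mul g' (p \<cdot> y)" "x \<cdot> A = x \<cdot> y"
    using pb_pair_arr(4,5)[of "mul g' (p \<cdot> y)" "x \<cdot> y" "d0 G" f]
    unfolding A_def p_def[symmetric] x_def[symmetric] by simp_all
  have gp [simp]: "g' \<cdot> pb_pair C (d0 G) t g z = g" "y \<cdot> pb_pair C (d0 G) t g z = z" if "pel (d0 G) t g z" for g z
    using that unfolding g'_def y_def by simp_all
  have ca [simp]: "p \<cdot> ac t A g z = mul g (p \<cdot> z)" "x \<cdot> ac t A g z = x \<cdot> z"
    "ac t A g z \<in> Arr C" "Dom C (ac t A g z) = Dom C z" "Cod C (ac t A g z) = pb_obj C (d0 G) f" if "pel (d0 G) t g z" for g z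
    using comp_reassoc[OF A(4), of "pb_pair C (d0 G) t g z"] comp_reassoc[OF A(5), of "pb_pair C (d0 G) t g z"] that
    unfolding act_def[of C G t] by simp_all
  have fa: "t \<cdot> ac t A g z = d1 G \<cdot> g" if "pel (d0 G) t g z" for g z
  proof -
    have "t \<cdot> ac t A g z = d1 G \<cdot> (p \<cdot> ac t A g z)"
      by (rule t(4)[symmetric]) (use that in simp_all)
    also have "\<dots> = d1 G \<cdot> g" using that by simp
    finally show ?thesis .
  qed
  have eqI: "z = z'" if "z \<in> Arr C" "z' \<in> Arr C" "Dom C z = Dom C z'" "Cod C z = pb_obj C (d0 G) f" "Cod C z' = pb_obj C (d0 G) f"
      "p \<cdot> z = p \<cdot> z'" "x \<cdot> z = x \<cdot> z'" for z z'
    by (rule pb_eqI[of "d0 G" f]) (use that in \<open>simp_all add: p_def x_def\<close>)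
  have "is_gobj C G t A"
  proof (rule gobjI)
    fix z assume z: "z \<in> Arr C" "Cod C z = Dom C t"
    have q: "pel (d0 G) t (ge G \<cdot> (t \<cdot> z)) z" using z by simp
    show "ac t A (ge G \<cdot> (t \<cdot> z)) z = z"
      by (rule eqI) (use z ca[OF q] in simp_all)
  next
    fix g1 g2 z assume z: "pel (d0 G) t g2 z" and g1: "g1 \<in> Arr C" "Dom C g1 = Dom C z" "Cod C g1 = G1 G" "d0 G \<cdot> g1 = d1 G \<cdot> g2"
    have q: "pel (d0 G) t g1 (ac t A g2 z)" using z g1 fa[OF z] by simp
    have r: "pel (d0 G) t (mul g1 g2) z" using z g1 by simp
    show "ac t A g1 (ac t A g2 z) = ac t A (mul g1 g2) z"
      by (rule eqI) (use z g1 ca[OF q] ca[OF r] ca[OF z] in simp_all)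
  qed (use fa in simp_all)
  moreover have "free_gobj C G f = (t, A)"
    unfolding free_gobj_def Let_def p_def[symmetric] x_def[symmetric] t_def[symmetric] g'_def[symmetric] y_def[symmetric] A_def ..
  ultimately show ?thesis using ca(1,2) unfolding p_def x_def t_def by simp
qed

lemma star_gobj:
  assumes [simp]: "X \<in> Obj C"
  shows "\<exists>A. star_obj C G X = (pr1 C (G0 G) X, A) \<and> is_gobj C G (pr1 C (G0 G) X) A \<and>
    (\<forall>g y. pel (d0 G) (pr1 C (G0 G) X) g y \<longrightarrow> pr2 C (G0 G) X \<cdot> ac (pr1 C (G0 G) X) A g y = pr2 C (G0 G) X \<cdot> y)"
proof -
  define f where "f = pr1 C (G0 G) X"
  define r where "r = pr2 C (G0 G) X"
  have f [simp]: "f \<in> Arr C" "r \<in> Arr C" "Dom C f = prod_obj C (G0 G) X" "Dom C r = prod_obj C (G0 G) X" "Cod C f = G0 G" "Cod C r = X"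
    unfolding f_def r_def by simp_all
  define A where "A = prod_pair C (d1 G \<cdot> pb1 C (d0 G) f) (r \<cdot> pb2 C (d0 G) f)"
  have A [simp]: "A \<in> Arr C" "Dom C A = pb_obj C (d0 G) f" "Cod C A = Dom C f" "f \<cdot> A = d1 G \<cdot> pb1 C (d0 G) f" "r \<cdot> A = r \<cdot> pb2 C (d0 G) f"
    unfolding A_def by (simp_all add: f_def r_def)
  have ca [simp]: "f \<cdot> ac f A g z = d1 G \<cdot> g" "r \<cdot> ac f A g z = r \<cdot> z"
    "ac f A g z \<in> Arr C" "Dom C (ac f A g z) = Dom C z" "Cod C (ac f A g z) = Dom C f" if "pel (d0 G) f g z" for g z
    using comp_reassoc[OF A(4), of "pb_pair C (d0 G) f g z"] comp_reassoc[OF A(5), of "pb_pair C (d0 G) f g z"] that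
    unfolding act_def[of C G f] by simp_all
  have eqI: "z = z'" if "z \<in> Arr C" "z' \<in> Arr C" "Dom C z = Dom C z'" "Cod C z = Dom C f" "Cod C z' = Dom C f"
      "f \<cdot> z = f \<cdot> z'" "r \<cdot> z = r \<cdot> z'" for z z'
    by (rule prod_eqI[of "G0 G" X]) (use that in \<open>simp_all add: f_def r_def\<close>)
  have "is_gobj C G f A"
  proof (rule gobjI)
    fix z assume z: "z \<in> Arr C" "Cod C z = Dom C f"
    have q: "pel (d0 G) f (ge G \<cdot> (f \<cdot> z)) z" using z by simp
    show "ac f A (ge G \<cdot> (f \<cdot> z)) z = z"
      by (rule eqI) (use z ca[OF q] in simp_all)
  next
    fix g1 g2 z assume z: "pel (d0 G) f g2 z" and g1: "g1 \<in> Arr C" "Dom C g1 = Dom C z" "Cod C g1 = G1 G" "d0 G \<cdot> g1 = d1 G \<cdot> g2"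
    have q: "pel (d0 G) f g1 (ac f A g2 z)" using z g1 ca[OF z] by simp
    have r: "pel (d0 G) f (mul g1 g2) z" using z g1 by simp
    show "ac f A g1 (ac f A g2 z) = ac f A (mul g1 g2) z"
      by (rule eqI) (use z g1 ca[OF q] ca[OF r] ca[OF z] in simp_all)
  qed simp_all
  moreover have "star_obj C G X = (f, A)"
    unfolding star_obj_def Let_def f_def[symmetric] r_def[symmetric] A_def ..
  ultimately show ?thesis using ca(2) unfolding f_def r_def by blast
qed

text \<open>Together with \<open>star_arrD\<close>: an arrow into \<open>G\<^sup>* X\<close> has its
  first component forced, and its second component is an arbitrary invariant arrow to
  \<open>X\<close>. This is why a left adjoint of \<open>G\<^sup>*\<close> computes
  quotients.\<close>

lemma star_arrI:
  assumes X: "is_gobj C G f a" and t: "invariant f a t" "Cod C t = X"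
  shows "((f, a), prod_pair C f t, star_obj C G X) \<in> Arr (gcat C G)"
proof -
  note [simp] = gobj_arr[OF X] X invariantD[OF t(1)] t(2)
  have XO [simp]: "X \<in> Obj C" using Cod_Obj[of t] by simp
  obtain A where A: "star_obj C G X = (pr1 C (G0 G) X, A)" "is_gobj C G (pr1 C (G0 G) X) A"
    "\<And>g y. pel (d0 G) (pr1 C (G0 G) X) g y \<Longrightarrow> pr2 C (G0 G) X \<cdot> ac (pr1 C (G0 G) X) A g y = pr2 C (G0 G) X \<cdot> y"
    using star_gobj[OF XO] by blast
  note [simp] = A(2)
  have "equivariant C G (f, a) (prod_pair C f t) (pr1 C (G0 G) X, A)"
  proof (rule equivariantI)
    fix g x assume gx: "pel (d0 G) f g x"
    have p: "pel (d0 G) (pr1 C (G0 G) X) g (prod_pair C (f \<cdot> x) (t \<cdot> x))" using gx by simp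
    show "prod_pair C f t \<cdot> ac f a g x = ac (pr1 C (G0 G) X) A g (prod_pair C f t \<cdot> x)"
      by (rule prod_eqI[of "G0 G" X]) (use gx p A(3)[OF p] in simp_all)
  qed simp_all
  then show ?thesis unfolding A(1) gcat_simps by simp
qed

lemma star_arrD:
  assumes h: "((f, a), h, star_obj C G X) \<in> Arr (gcat C G)" and [simp]: "X \<in> Obj C"
  shows "invariant f a (pr2 C (G0 G) X \<cdot> h)" "pr1 C (G0 G) X \<cdot> h = f" "h = prod_pair C f (pr2 C (G0 G) X \<cdot> h)"
    "h \<in> Arr C" "Dom C h = Dom C f" "Cod C h = prod_obj C (G0 G) X"
proof -
  obtain A where A: "star_obj C G X = (pr1 C (G0 G) X, A)" "is_gobj C G (pr1 C (G0 G) X) A"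
    "\<And>g y. pel (d0 G) (pr1 C (G0 G) X) g y \<Longrightarrow> pr2 C (G0 G) X \<cdot> ac (pr1 C (G0 G) X) A g y = pr2 C (G0 G) X \<cdot> y"
    using star_gobj[of X] by auto
  have X: "is_gobj C G f a" and t: "h \<in> Arr C" "Dom C h = Dom C f" "Cod C h = prod_obj C (G0 G) X"
    and e: "equivariant C G (f, a) h (pr1 C (G0 G) X, A)"
    using h unfolding A(1) gcat_simps by simp_all
  from t show "h \<in> Arr C" "Dom C h = Dom C f" "Cod C h = prod_obj C (G0 G) X" by simp_all
  note [simp] = A(2) X t gobj_arr[OF X]
  have t3: "Cod C h = Dom C (pr1 C (G0 G) X)" by simp
  note e' = equivariantD[OF e X A(2) t(1,2) t3]
  show *: "pr1 C (G0 G) X \<cdot> h = f" by (rule e'(1))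
  show "invariant f a (pr2 C (G0 G) X \<cdot> h)"
  proof (rule invariantI)
    fix g x assume gx: "pel (d0 G) f g x"
    have "pel (d0 G) (pr1 C (G0 G) X) g (h \<cdot> x)" using gx e'(2)[of x] by simp
    from A(3)[OF this] show "(pr2 C (G0 G) X \<cdot> h) \<cdot> ac f a g x = (pr2 C (G0 G) X \<cdot> h) \<cdot> x"
      using e'(3)[OF gx] gx by simp
  qed simp_all
  show "h = prod_pair C f (pr2 C (G0 G) X \<cdot> h)"
    by (rule prod_eqI[of "G0 G" X]) (simp_all add: *)
qed

text \<open>The arrow \<open>(g, x) \<mapsto> g\<inverse> x\<close> exhibits \<open>X\<close> as the quotient of \<open>T\<^sub>G 1 \<times> X\<close>: it is split by \<open>x \<mapsto> (1, x)\<close>.\<close>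

lemma quot_free_product:
  assumes X [simp]: "is_gobj C G f a" "is_gobj C G t A" and pb: "is_pullback C (d1 G) f k1 k2" and [simp]: "Dom C k1 = Dom C t"
    and k: "equivariant C G (t, A) k1 (free_one G)" "equivariant C G (t, A) k2 (f, a)"
  shows "quot t A (ac f a (gi G \<cdot> k1) k2)"
proof -
  note [simp] = gobj_arr[OF X(1)] gobj_arr[OF X(2)]
  have kt: "k1 \<in> Arr C" "Dom C k1 = Dom C t" "Cod C k1 = Dom C (d1 G)" "k2 \<in> Arr C" "Dom C k2 = Dom C t" "Cod C k2 = Dom C f"
    "d1 G \<cdot> k1 = f \<cdot> k2"
    using is_pullbackD[OF pb] by simp_all
  note [simp] = kt
  note e1 = equivariantD[OF k(1)[unfolded free_one_def] X(2) gobj_free_one kt(1-3), unfolded ac_free_one]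
    and e2 = equivariantD[OF k(2) X(2,1) kt(4-6)]
  define \<kappa> where "\<kappa> = ac f a (gi G \<cdot> k1) k2"
  have \<kappa> [simp]: "\<kappa> \<in> Arr C" "Dom C \<kappa> = Dom C t" "Cod C \<kappa> = Dom C f" "f \<cdot> \<kappa> = d0 G \<cdot> k1"
    unfolding \<kappa>_def by simp_all
  have k12: "d1 G \<cdot> (k1 \<cdot> y) = t \<cdot> y" "f \<cdot> (k2 \<cdot> y) = t \<cdot> y" if "y \<in> Arr C" "Cod C y = Dom C t" for y
    using e1(2)[of y] e2(2)[of y] that by simp_all
  have \<kappa>y: "\<kappa> \<cdot> y = ac f a (gi G \<cdot> (k1 \<cdot> y)) (k2 \<cdot> y)" if "y \<in> Arr C" "Cod C y = Dom C t" for y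
    unfolding \<kappa>_def using that by simp
  define \<sigma> where "\<sigma> = (SOME h. h \<in> Arr C \<and> Dom C h = Dom C f \<and> Cod C h = Dom C t \<and> k1 \<cdot> h = ge G \<cdot> f \<and> k2 \<cdot> h = Id C (Dom C f))"
  have "\<exists>h. h \<in> Arr C \<and> Dom C h = Dom C f \<and> Cod C h = Dom C t \<and> k1 \<cdot> h = ge G \<cdot> f \<and> k2 \<cdot> h = Id C (Dom C f)"
    using is_pullback_ex[OF pb, of "ge G \<cdot> f" "Id C (Dom C f)"] by (simp, blast)
  from someI_ex[OF this] have \<sigma> [simp]: "\<sigma> \<in> Arr C" "Dom C \<sigma> = Dom C f" "Cod C \<sigma> = Dom C t" "k1 \<cdot> \<sigma> = ge G \<cdot> f" "k2 \<cdot> \<sigma> = Id C (Dom C f)"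
    unfolding \<sigma>_def by blast+
  have \<kappa>\<sigma>: "\<kappa> \<cdot> \<sigma> = Id C (Dom C f)" by (simp add: \<kappa>y)
  have p: "pel (d0 G) t (gi G \<cdot> k1) (Id C (Dom C t))"
    using k12(1)[of "Id C (Dom C t)"] by simp
  \<comment> \<open>This composite need not be the identity, but it moves each element by the action
    of \<open>k1\<close> inverted. Invariant arrows do not see the difference, so
    \<open>s \<cdot> \<sigma>\<close> is the required factorization of \<open>s\<close>.\<close>
  have \<sigma>\<kappa>: "\<sigma> \<cdot> \<kappa> = ac t A (gi G \<cdot> k1) (Id C (Dom C t))"
  proof (rule is_pullback_ext[OF pb])
    show "k1 \<cdot> (\<sigma> \<cdot> \<kappa>) = k1 \<cdot> ac t A (gi G \<cdot> k1) (Id C (Dom C t))"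
      unfolding e1(3)[OF p] using comp_reassoc[OF \<sigma>(4), of \<kappa>] by simp
    show "k2 \<cdot> (\<sigma> \<cdot> \<kappa>) = k2 \<cdot> ac t A (gi G \<cdot> k1) (Id C (Dom C t))"
      unfolding e2(3)[OF p] using comp_reassoc[OF \<sigma>(5), of \<kappa>] by (simp add: \<kappa>_def)
  qed (use p in simp_all)
  have "quot t A \<kappa>"
  proof (rule quotI)
    show "invariant t A \<kappa>"
    proof (rule invariantI)
      fix g y assume gy: "pel (d0 G) t g y"
      have *: "mul (gi G \<cdot> mul g (k1 \<cdot> y)) g = gi G \<cdot> (k1 \<cdot> y)"
        using gy by (simp add: inv_mul k12)
      have "\<kappa> \<cdot> ac t A g y = ac f a (gi G \<cdot> (k1 \<cdot> ac t A g y)) (k2 \<cdot> ac t A g y)"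
        using gy by (simp add: \<kappa>y)
      also have "\<dots> = ac f a (gi G \<cdot> mul g (k1 \<cdot> y)) (ac f a g (k2 \<cdot> y))"
        unfolding e1(3)[OF gy] e2(3)[OF gy] ..
      also have "\<dots> = ac f a (mul (gi G \<cdot> mul g (k1 \<cdot> y)) g) (k2 \<cdot> y)"
        by (rule ac_ac) (use gy in \<open>simp_all add: k12\<close>)
      also have "\<dots> = \<kappa> \<cdot> y" unfolding * using gy by (simp add: \<kappa>y)
      finally show "\<kappa> \<cdot> ac t A g y = \<kappa> \<cdot> y" .
    qed simp_all
    fix s assume s: "invariant t A s"
    note st [simp] = invariantD(1,2)[OF s]
    have "(s \<cdot> \<sigma>) \<cdot> \<kappa> = s \<cdot> ac t A (gi G \<cdot> k1) (Id C (Dom C t))" by (simp add: \<sigma>\<kappa>)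
    also have "\<dots> = s" using invariantD(3)[OF s p] by simp
    finally show "\<exists>k. k \<in> Arr C \<and> Dom C k = Cod C \<kappa> \<and> Cod C k = Cod C s \<and> k \<cdot> \<kappa> = s"
      by (intro exI[of _ "s \<cdot> \<sigma>"]) simp
  next
    fix k k' assume kk: "k \<in> Arr C" "k' \<in> Arr C" "Dom C k = Cod C \<kappa>" "Dom C k' = Cod C \<kappa>" "Cod C k = Cod C k'" "k \<cdot> \<kappa> = k' \<cdot> \<kappa>"
    have "k = (k \<cdot> \<kappa>) \<cdot> \<sigma>" "k' = (k' \<cdot> \<kappa>) \<cdot> \<sigma>" using kk(1-5) \<kappa>\<sigma> by simp_all
    then show "k = k'" using kk(6) by simp
  qed
  then show ?thesis unfolding \<kappa>_def .
qed

end

section \<open>Stably Frobenius groupoids\<close>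

locale sf_groupoid = fincat C for C :: "('o, 'm) cat" (structure) +
  fixes G :: "('o, 'm) igpd" and S :: "('o, 'm) sigma_adj"
  assumes sf: "stably_frobenius_groupoid C G S"
begin

sublocale groupoid
  using sf unfolding stably_frobenius_groupoid_def by unfold_locales simp

sublocale S: adjl "gcat C G" C S
  by unfold_locales (use sf category_gcat category in \<open>simp_all add: stably_frobenius_groupoid_def\<close>)

lemma Radj_S: "Radj S = star C G"
  using sf unfolding stably_frobenius_groupoid_def by simp

lemma RO [simp]: "S.R X = star_obj C G X"
  and RA: "S.RA h = (star_obj C G (Dom C h),
     prod_pair C (pr1 C (G0 G) (Dom C h)) (h \<cdot> pr2 C (G0 G) (Dom C h)), star_obj C G (Cod C h))"
  unfolding Radj_S star_def by auto

text \<open>The quotient map \<open>X \<rightarrow> \<Sigma>\<^sub>G X\<close>, read off from the unit.\<close>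

definition "zeta X = pr2 C (G0 G) (S.L X) \<cdot> fst (snd (unit S X))"

text \<open>The equation for the transpose is the second component of \<open>tr_unit\<close>. The
  facts about \<open>zeta\<close> come along because they are the two components of the
  unit.\<close>

lemma tr_zeta:
  assumes X [simp]: "is_gobj C G f a" and h: "((f, a), h, star_obj C G Y) \<in> Arr (gcat C G)" and Y [simp]: "Y \<in> Obj C"
  shows "S.tr Y ((f, a), h, star_obj C G Y) \<in> Arr C" "Dom C (S.tr Y ((f, a), h, star_obj C G Y)) = S.L (f, a)"
    "Cod C (S.tr Y ((f, a), h, star_obj C G Y)) = Y" "S.tr Y ((f, a), h, star_obj C G Y) \<cdot> zeta (f, a) = pr2 C (G0 G) Y \<cdot> h"
    and "zeta (f, a) \<in> Arr C" "Dom C (zeta (f, a)) = Dom C f" "Cod C (zeta (f, a)) = S.L (f, a)" "invariant f a (zeta (f, a))"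
    and "unit S (f, a) = ((f, a), prod_pair C f (zeta (f, a)), star_obj C G (S.L (f, a)))"
proof -
  note [simp] = gobj_arr[OF X]
  have O: "(f, a) \<in> Obj (gcat C G)" using X by (simp add: gcat_simps)
  have LO [simp]: "S.L (f, a) \<in> Obj C" by (rule S.LR_simps(1)[OF O])
  obtain u where u: "unit S (f, a) = ((f, a), u, star_obj C G (S.L (f, a)))"
    using S.unit_simps(1-3)[OF O] by (cases "unit S (f, a)") (auto simp: gcat_simps)
  have ua: "((f, a), u, star_obj C G (S.L (f, a))) \<in> Arr (gcat C G)"
    using S.unit_simps(1)[OF O] unfolding u .
  note uD = star_arrD[OF ua LO]
  have z: "zeta (f, a) = pr2 C (G0 G) (S.L (f, a)) \<cdot> u" unfolding zeta_def u by simp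
  show zt: "zeta (f, a) \<in> Arr C" "Dom C (zeta (f, a)) = Dom C f" "Cod C (zeta (f, a)) = S.L (f, a)" "invariant f a (zeta (f, a))"
    unfolding z using uD by simp_all
  show "unit S (f, a) = ((f, a), prod_pair C f (zeta (f, a)), star_obj C G (S.L (f, a)))"
    unfolding u z using uD(3) by simp
  define k where "k = S.tr Y ((f, a), h, star_obj C G Y)"
  have c: "Cod (gcat C G) ((f, a), h, star_obj C G Y) = S.R Y" by (simp add: gcat_simps)
  show k: "S.tr Y ((f, a), h, star_obj C G Y) \<in> Arr C" "Dom C (S.tr Y ((f, a), h, star_obj C G Y)) = S.L (f, a)"
    "Cod C (S.tr Y ((f, a), h, star_obj C G Y)) = Y"
    using S.tr_simps[OF h c Y] by (simp_all add: gcat_simps)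
  note kt [simp] = k[folded k_def]
  have "S.RA k \<cdot>\<^bsub>gcat C G\<^esub> unit S (f, a) = ((f, a), h, star_obj C G Y)"
    using S.tr_unit[OF h c Y] unfolding k_def gcat_simps .
  then have "prod_pair C (pr1 C (G0 G) (S.L (f, a))) (k \<cdot> pr2 C (G0 G) (S.L (f, a))) \<cdot> u = h"
    unfolding RA u gcat_simps by simp
  then have "pr2 C (G0 G) Y \<cdot> h = pr2 C (G0 G) Y \<cdot> (prod_pair C (pr1 C (G0 G) (S.L (f, a))) (k \<cdot> pr2 C (G0 G) (S.L (f, a))) \<cdot> u)"
    by simp
  also have "\<dots> = k \<cdot> zeta (f, a)" unfolding z using uD(4-6) by simp
  finally show "S.tr Y ((f, a), h, star_obj C G Y) \<cdot> zeta (f, a) = pr2 C (G0 G) Y \<cdot> h" unfolding k_def by simp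
qed

text \<open>The unit itself serves as the arrow into an object of the form
  \<open>G\<^sup>* Y\<close> that \<open>tr_zeta\<close> asks for.\<close>

lemma zeta_simps [simp]:
  assumes X: "is_gobj C G f a"
  shows "zeta (f, a) \<in> Arr C" "Dom C (zeta (f, a)) = Dom C f" "Cod C (zeta (f, a)) = S.L (f, a)" "S.L (f, a) \<in> Obj C"
    and zeta_invariant: "invariant f a (zeta (f, a))"
    and unit_zeta: "unit S (f, a) = ((f, a), prod_pair C f (zeta (f, a)), star_obj C G (S.L (f, a)))"
proof -
  have O: "(f, a) \<in> Obj (gcat C G)" using X by (simp add: gcat_simps)
  have LO: "S.L (f, a) \<in> Obj C" by (rule S.LR_simps(1)[OF O])
  have "unit S (f, a) \<in> Arr (gcat C G)" "Dom (gcat C G) (unit S (f, a)) = (f, a)"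
     "Cod (gcat C G) (unit S (f, a)) = star_obj C G (S.L (f, a))"
    using S.unit_simps(1-3)[OF O] by simp_all
  then have "((f, a), fst (snd (unit S (f, a))), star_obj C G (S.L (f, a))) \<in> Arr (gcat C G)"
    by (cases "unit S (f, a)") (auto simp: gcat_simps)
  note tr_zeta(5-9)[OF X this LO]
  then show "zeta (f, a) \<in> Arr C" "Dom C (zeta (f, a)) = Dom C f" "Cod C (zeta (f, a)) = S.L (f, a)" "S.L (f, a) \<in> Obj C"
    "invariant f a (zeta (f, a))"
    "unit S (f, a) = ((f, a), prod_pair C f (zeta (f, a)), star_obj C G (S.L (f, a)))"
    using LO by blast+
qed

text \<open>Arrows out of \<open>\<Sigma>\<^sub>G X\<close> correspond by transposition to arrows
  into some \<open>G\<^sup>* Y\<close>, and these to invariant arrows on the carrier; the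
  correspondence is composition with \<open>zeta\<close>.\<close>

lemma quot_zeta:
  assumes X: "is_gobj C G f a"
  shows "quot f a (zeta (f, a))"
proof (rule quotI)
  note [simp] = gobj_arr[OF X] zeta_simps(1-4)[OF X]
  have O: "(f, a) \<in> Obj (gcat C G)" using X by (simp add: gcat_simps)
  show "invariant f a (zeta (f, a))" by (rule zeta_invariant[OF X])
  show "\<exists>k. k \<in> Arr C \<and> Dom C k = Cod C (zeta (f, a)) \<and> Cod C k = Cod C t \<and> k \<cdot> zeta (f, a) = t"
    if t: "invariant f a t" for t
  proof -
    note [simp] = invariantD(1,2)[OF t]
    note tr_zeta[OF X star_arrI[OF X t refl] Cod_Obj]
    then show ?thesis by (intro exI[of _ "S.tr (Cod C t) ((f, a), prod_pair C f t, star_obj C G (Cod C t))"]) simp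
  qed
  fix k k' assume k [simp]: "k \<in> Arr C" "k' \<in> Arr C" "Dom C k = Cod C (zeta (f, a))" "Dom C k' = Cod C (zeta (f, a))" "Cod C k = Cod C k'"
    and eq: "k \<cdot> zeta (f, a) = k' \<cdot> zeta (f, a)"
  have "S.RA k \<cdot>\<^bsub>gcat C G\<^esub> unit S (f, a) = S.RA k' \<cdot>\<^bsub>gcat C G\<^esub> unit S (f, a)"
    unfolding RA unit_zeta[OF X] gcat_simps using eq by simp
  then show "k = k'"
    using k by - (rule S.tr_ext[OF _ _ _ _ O], simp_all)
qed

lemma zeta_natural:
  assumes h: "((f, a), h, (f', a')) \<in> Arr (gcat C G)"
  shows "S.LA ((f, a), h, (f', a')) \<in> Arr C" "Dom C (S.LA ((f, a), h, (f', a'))) = S.L (f, a)" "Cod C (S.LA ((f, a), h, (f', a'))) = S.L (f', a')"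
    "S.LA ((f, a), h, (f', a')) \<cdot> zeta (f, a) = zeta (f', a') \<cdot> h"
proof -
  have X: "is_gobj C G f a" "is_gobj C G f' a'" and [simp]: "h \<in> Arr C" "Dom C h = Dom C f" "Cod C h = Dom C f'"
    using h unfolding gcat_simps by simp_all
  note [simp] = gobj_arr[OF X(1)] zeta_simps(1-4)[OF X(1)] gobj_arr[OF X(2)] zeta_simps(1-4)[OF X(2)]
  show l [simp]: "S.LA ((f, a), h, (f', a')) \<in> Arr C" "Dom C (S.LA ((f, a), h, (f', a'))) = S.L (f, a)" "Cod C (S.LA ((f, a), h, (f', a'))) = S.L (f', a')"
    using S.LR_simps(2-4)[OF h] by (simp_all add: gcat_simps)
  let ?k = "S.LA ((f, a), h, (f', a'))"
  have "prod_pair C (pr1 C (G0 G) (S.L (f, a))) (?k \<cdot> pr2 C (G0 G) (S.L (f, a))) \<cdot> prod_pair C f (zeta (f, a)) = prod_pair C f' (zeta (f', a')) \<cdot> h"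
    using S.unit_nat[OF h] unfolding RA gcat_simps l unit_zeta[OF X(1)] unit_zeta[OF X(2)] by simp
  then have "pr2 C (G0 G) (S.L (f', a')) \<cdot> (prod_pair C (pr1 C (G0 G) (S.L (f, a))) (?k \<cdot> pr2 C (G0 G) (S.L (f, a))) \<cdot> prod_pair C f (zeta (f, a)))
     = pr2 C (G0 G) (S.L (f', a')) \<cdot> (prod_pair C f' (zeta (f', a')) \<cdot> h)" by simp
  then show "S.LA ((f, a), h, (f', a')) \<cdot> zeta (f, a) = zeta (f', a') \<cdot> h" by simp
qed

text \<open>Frobenius reciprocity over \<open>cod z\<close> for \<open>X \<rightarrow> G\<^sup>*(cod z)\<close> and \<open>u\<close>.\<close>

lemma quot_pullback:
  assumes X: "is_gobj C G f a" "is_gobj C G f' a'" and z: "quot f a z" and u: "u \<in> Arr C" "Cod C u = Cod C z"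
    and b1: "equivariant C G (f', a') b1 (f, a)" and m: "invariant f' a' m"
    and pb: "is_pullback C z u b1 m" and [simp]: "Dom C b1 = Dom C f'"
  shows "quot f' a' m"
proof -
  note [simp] = gobj_arr[OF X(1)] gobj_arr[OF X(2)] u X quotD(2,3)[OF z] invariantD(1,2)[OF m]
  have pt: "b1 \<in> Arr C" "Dom C b1 = Dom C f'" "Cod C b1 = Dom C f" "Cod C m = Dom C u" "z \<cdot> b1 = u \<cdot> m"
    using is_pullbackD[OF pb] by simp_all
  note [simp] = pt
  have fb: "f \<cdot> b1 = f'" "f \<cdot> (b1 \<cdot> x) = f' \<cdot> x" if "x \<in> Arr C" "Cod C x = Dom C f'" for x
    using equivariantD[OF b1 X(2,1) pt(1-3)] that by simp_all
  have fb1: "f \<cdot> b1 = f'" using fb(1)[of "Id C (Dom C f')"] by simp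
  define Z where "Z = Cod C z"
  define M where "M = Dom C u"
  have [simp]: "Z \<in> Obj C" "M \<in> Obj C" "Cod C z = Z" "Dom C u = M" unfolding Z_def M_def by simp_all
  define pu where "pu = prod_pair C (pr1 C (G0 G) M) (u \<cdot> pr2 C (G0 G) M)"
  have pu [simp]: "pu \<in> Arr C" "Dom C pu = prod_obj C (G0 G) M" "Cod C pu = prod_obj C (G0 G) Z"
    unfolding pu_def by simp_all
  define g where "g = ((f, a), prod_pair C f z, star_obj C G Z)"
  have g: "g \<in> Arr (gcat C G)" unfolding g_def by (rule star_arrI[OF X(1) quotD(1)[OF z]]) simp
  have ru: "S.RA u = (star_obj C G M, pu, star_obj C G Z)" unfolding RA pu_def by simp
  have rua: "(star_obj C G M, pu, star_obj C G Z) \<in> Arr (gcat C G)"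
    using S.LR_simps(8)[of u] unfolding ru by simp
  obtain AM where AM: "star_obj C G M = (pr1 C (G0 G) M, AM)" "is_gobj C G (pr1 C (G0 G) M) AM" using star_gobj[of M] by auto
  obtain AZ where AZ: "star_obj C G Z = (pr1 C (G0 G) Z, AZ)" "is_gobj C G (pr1 C (G0 G) Z) AZ" using star_gobj[of Z] by auto
  have mM: "((f', a'), prod_pair C f' m, star_obj C G M) \<in> Arr (gcat C G)"
    by (rule star_arrI[OF X(2) m]) simp
  \<comment> \<open>Pulling \<open>(f, z)\<close> back along the product of \<open>G0\<close> with
    \<open>u\<close> gives the same object as pulling \<open>z\<close> back along \<open>u\<close>.
    So the given square becomes a pullback along \<open>G\<^sup>*\<close> of \<open>u\<close>, which
    is the input of Frobenius reciprocity.\<close>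
  have pbC: "is_pullback C (prod_pair C f z) pu b1 (prod_pair C f' m)"
  proof (rule is_pullbackI)
    show "prod_pair C f z \<cdot> b1 = pu \<cdot> prod_pair C f' m"
      unfolding pu_def by (simp add: fb1)
    fix x y assume xy: "x \<in> Arr C" "y \<in> Arr C" "Dom C x = Dom C y" "Cod C x = Dom C (prod_pair C f z)" "Cod C y = Dom C pu"
      "prod_pair C f z \<cdot> x = pu \<cdot> y"
    have e: "prod_pair C (f \<cdot> x) (z \<cdot> x) = prod_pair C (pr1 C (G0 G) M \<cdot> y) (u \<cdot> (pr2 C (G0 G) M \<cdot> y))"
      using xy unfolding pu_def by simp
    have e1: "f \<cdot> x = pr1 C (G0 G) M \<cdot> y"
      using arg_cong[OF e, of "\<lambda>w. pr1 C (G0 G) Z \<cdot> w"] xy by simp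
    have e2: "z \<cdot> x = u \<cdot> (pr2 C (G0 G) M \<cdot> y)"
      using arg_cong[OF e, of "\<lambda>w. pr2 C (G0 G) Z \<cdot> w"] xy by simp
    obtain h where h: "h \<in> Arr C" "Dom C h = Dom C (pr2 C (G0 G) M \<cdot> y)" "Cod C h = Dom C b1" "b1 \<cdot> h = x" "m \<cdot> h = pr2 C (G0 G) M \<cdot> y"
      using is_pullback_ex[OF pb, of x "pr2 C (G0 G) M \<cdot> y"] xy e2 by auto
    have "prod_pair C f' m \<cdot> h = y"
      by (rule prod_eqI[of "G0 G" M]) (use h xy fb(2)[of h] e1 in simp_all)
    then show "\<exists>h. h \<in> Arr C \<and> Dom C h = Dom C y \<and> Cod C h = Dom C b1 \<and> b1 \<cdot> h = x \<and> prod_pair C f' m \<cdot> h = y"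
      using h xy by (intro exI[of _ h]) simp
  next
    fix h k assume hk: "h \<in> Arr C" "k \<in> Arr C" "Dom C h = Dom C k" "Cod C h = Dom C b1" "Cod C k = Dom C b1" "b1 \<cdot> h = b1 \<cdot> k"
      "prod_pair C f' m \<cdot> h = prod_pair C f' m \<cdot> k"
    have "m \<cdot> h = m \<cdot> k"
      using arg_cong[OF hk(7), of "\<lambda>w. pr2 C (G0 G) M \<cdot> w"] hk(1-5) by simp
    then show "h = k" by - (rule is_pullback_ext[OF pb], use hk in simp_all)
  qed simp_all
  have pbD: "is_pullback (gcat C G) g (S.RA u) ((f', a'), b1, (f, a)) ((f', a'), prod_pair C f' m, star_obj C G M)"
    unfolding ru g_def AM(1) AZ(1)
    by (rule gcat_pullbackI[OF X(1) AM(2) AZ(2) X(2) pbC])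
      (use g rua mM b1 in \<open>simp_all add: gcat_simps g_def AM(1) AZ(1)\<close>)
  have gc: "Cod (gcat C G) g = S.R Z" unfolding g_def gcat_simps by simp
  have gd: "Dom (gcat C G) g = (f, a)" unfolding g_def gcat_simps ..
  have tr: "S.tr Z g \<in> Arr C" "Dom C (S.tr Z g) = S.L (f, a)" "Cod C (S.tr Z g) = Z" "S.tr Z g \<cdot> zeta (f, a) = z"
    using tr_zeta(1-4)[OF X(1) g[unfolded g_def]] unfolding g_def by simp_all
  \<comment> \<open>Both \<open>zeta\<close> and \<open>z\<close> are quotient maps of the same
    object, so the transpose comparing them is invertible, and so is its pullback
    \<open>m2\<close>.\<close>
  have itr: "iso C (S.tr Z g)"
    by (rule quot_iso[OF X(1) quot_zeta[OF X(1)] z]) (use tr X in simp_all)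
  have exC: "\<exists>m1 m2. is_pullback C (S.tr Z g) u m1 m2"
    by (rule pullback_ex) (use tr in simp_all)
  have exD: "\<exists>n1 n2. is_pullback (gcat C G) g (S.RA u) n1 n2" using pbD by blast
  obtain n1 n2 m1 m2 k where n: "is_pullback (gcat C G) g (S.RA u) n1 n2" and mm: "is_pullback C (S.tr Z g) u m1 m2"
    and k: "k \<in> hom C (S.L (Dom (gcat C G) n1)) (Dom C m1)" "m2 \<cdot> k = counit S M \<cdot> S.LA n2"
    "iso (slice C Z) (frob_map (slice (gcat C G) (S.R Z)) (slice C Z) (sliced_adj (gcat C G) C S Z) g u) \<longleftrightarrow> iso C k"
    using S.frob_map_slice[OF \<open>Z \<in> Obj C\<close> g gc, of u] exD exC by auto
  have "stably_frobenius (gcat C G) C S" using sf unfolding stably_frobenius_groupoid_def by simp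
  moreover have "g \<in> Obj (slice (gcat C G) (S.R Z))" using g gc by (simp only: S.D.slice_simps(1) mem_Collect_eq)
  moreover have "u \<in> Obj (slice C Z)" by simp
  ultimately have "iso (slice C Z) (frob_map (slice (gcat C G) (S.R Z)) (slice C Z) (sliced_adj (gcat C G) C S Z) g u)"
    unfolding stably_frobenius_def frobenius_def using \<open>Z \<in> Obj C\<close> by blast
  then have ik: "iso C k" using k(3) by simp
  have im: "iso C m2" by (rule pullback_of_iso[OF mm itr]) (use tr in simp_all)
  obtain t A where tA: "Dom (gcat C G) n1 = (t, A)" by (cases "Dom (gcat C G) n1")
  have RAu: "S.RA u \<in> Arr (gcat C G)" "Cod (gcat C G) g = Cod (gcat C G) (S.RA u)"
    unfolding gc using S.LR_simps(8,10)[of u] by simp_all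
  \<comment> \<open>The pullback used by the Frobenius map was chosen; \<open>j\<close> identifies
    it with the given one, and the conclusion is transported back along \<open>j\<close> at the
    end.\<close>
  obtain j where j: "iso (gcat C G) j" "j \<in> hom (gcat C G) (t, A) (f', a')"
      "((f', a'), prod_pair C f' m, star_obj C G M) \<cdot>\<^bsub>gcat C G\<^esub> j = n2"
    using S.D.pullback_is_iso[OF pbD n g RAu] unfolding tA gcat_simps by auto
  obtain h where h: "j = ((t, A), h, (f', a'))"
    using j(2) by (cases j) (auto simp: gcat_simps)
  have ja: "((t, A), h, (f', a')) \<in> Arr (gcat C G)" using j(2) unfolding h by simp
  have ih [simp]: "iso C h" using j(1) iso_gcat[OF ja] unfolding h by simp
  have T: "is_gobj C G t A" and ht [simp]: "Dom C h = Dom C t" "Cod C h = Dom C f'" and he: "equivariant C G (t, A) h (f', a')"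
    using ja unfolding gcat_simps by simp_all
  note [simp] = gobj_arr[OF T]
  have n2: "n2 = ((t, A), prod_pair C f' m \<cdot> h, star_obj C G M)" using j(3) unfolding h gcat_simps by simp
  have n2a: "((t, A), prod_pair C f' m \<cdot> h, star_obj C G M) \<in> Arr (gcat C G)"
    using S.D.comp_Arr[OF ja mM] unfolding gcat_simps(3-5) by simp
  \<comment> \<open>The transpose of the second projection is the Frobenius comparison
    \<open>k\<close> followed by \<open>m2\<close>. Both are invertible, so \<open>m\<close> is
    \<open>zeta\<close> up to isomorphisms.\<close>
  define \<tau> where "\<tau> = S.tr M n2"
  have "\<tau> = m2 \<cdot> k" unfolding \<tau>_def adj_transpose_def k(2) ..
  moreover have "Dom C m2 = Cod C k" using k(1) is_pullbackD[OF mm] by simp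
  ultimately have i\<tau>: "iso C \<tau>" using ik im by simp
  have \<tau>: "Dom C \<tau> = S.L (t, A)" "\<tau> \<cdot> zeta (t, A) = m \<cdot> h"
    using tr_zeta(2,4)[OF T n2a] unfolding \<tau>_def n2 by simp_all
  have "quot t A (m \<cdot> h)"
    using quot_post[OF T quot_zeta[OF T] i\<tau>] \<tau> T by simp
  moreover have "equivariant C G (f', a') (inv_arr C h) (t, A)"
    by (rule equivariant_inv[OF he ih T X(2)]) simp_all
  ultimately have "quot f' a' ((m \<cdot> h) \<cdot> inv_arr C h)"
    by (rule quot_pre[OF T X(2)]) simp_all
  then show ?thesis by simp
qed

text \<open>As \<open>z\<close> is invariant, the groupoid acts on the pullback of \<open>z\<close>
  and \<open>u\<close> by moving the first component and fixing the second. The projection to the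
  domain of \<open>u\<close> is then the quotient by \<open>quot_pullback\<close>.\<close>

lemma quot_lift:
  assumes X: "is_gobj C G f a" and z: "quot f a z" and u: "u \<in> Arr C" "Cod C u = Cod C z"
  shows "\<exists>t A. is_gobj C G t A \<and> Dom C t = pb_obj C z u \<and> quot t A (pb2 C z u) \<and> t = f \<cdot> pb1 C z u \<and>
    (\<forall>g y. pel (d0 G) t g y \<longrightarrow> pb1 C z u \<cdot> ac t A g y = ac f a g (pb1 C z u \<cdot> y) \<and> pb2 C z u \<cdot> ac t A g y = pb2 C z u \<cdot> y)"
proof -
  note [simp] = gobj_arr[OF X] u X quotD(2,3)[OF z]
  define t where "t = f \<cdot> pb1 C z u"
  have t [simp]: "t \<in> Arr C" "Dom C t = pb_obj C z u" "Cod C t = G0 G" "y \<in> Arr C \<Longrightarrow> Cod C y = pb_obj C z u \<Longrightarrow> f \<cdot> (pb1 C z u \<cdot> y) = t \<cdot> y" for y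
    unfolding t_def by simp_all
  define b where "b = pb2 C z u \<cdot> pb2 C (d0 G) t"
  have b [simp]: "b \<in> Arr C" "Dom C b = pb_obj C (d0 G) t" "Cod C b = Dom C u" unfolding b_def by simp_all
  have bp [simp]: "b \<cdot> pb_pair C (d0 G) t g y = pb2 C z u \<cdot> y" if "pel (d0 G) t g y" for g y
    using that unfolding b_def by simp
  obtain t' A where tA: "pb_act f a z u b = (t', A)" by (cases "pb_act f a z u b")
  have "case pb_act f a z u b of (f', a') \<Rightarrow> is_gobj C G f' a' \<and> f' = f \<cdot> pb1 C z u \<and>
    (\<forall>g y. pel (d0 G) (f \<cdot> pb1 C z u) g y \<longrightarrow> pb1 C z u \<cdot> ac f' a' g y = ac f a g (pb1 C z u \<cdot> y) \<and>
      pb2 C z u \<cdot> ac f' a' g y = b \<cdot> pb_pair C (d0 G) (f \<cdot> pb1 C z u) g y)"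
  proof (rule pb_act, unfold t_def[symmetric])
    fix g y assume gy: "pel (d0 G) t g y"
    have "z \<cdot> ac f a g (pb1 C z u \<cdot> y) = z \<cdot> (pb1 C z u \<cdot> y)"
      by (rule quotD(4)[OF z]) (use gy in simp)
    then show "u \<cdot> (b \<cdot> pb_pair C (d0 G) t g y) = z \<cdot> ac f a g (pb1 C z u \<cdot> y)"
      using gy pb_comm(2)[of z u y] by simp
  next
    fix g1 g2 y y' assume y: "pel (d0 G) t g2 y" "g1 \<in> Arr C" "Dom C g1 = Dom C y" "Cod C g1 = G1 G" "d0 G \<cdot> g1 = d1 G \<cdot> g2"
      "y' \<in> Arr C" "Dom C y' = Dom C y" "Cod C y' = pb_obj C z u" "pb1 C z u \<cdot> y' = ac f a g2 (pb1 C z u \<cdot> y)"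
      "pb2 C z u \<cdot> y' = b \<cdot> pb_pair C (d0 G) t g2 y"
    have "t \<cdot> y' = f \<cdot> (pb1 C z u \<cdot> y')" using y(6,8) by simp
    also have "\<dots> = d1 G \<cdot> g2" unfolding y(9) using y(1) by simp
    finally show "b \<cdot> pb_pair C (d0 G) t g1 y' = b \<cdot> pb_pair C (d0 G) t (mul g1 g2) y"
      using y by simp
  qed simp_all
  then have *: "is_gobj C G t A" "t' = t" and
    **: "\<And>g y. pel (d0 G) t g y \<Longrightarrow> pb1 C z u \<cdot> ac t A g y = ac f a g (pb1 C z u \<cdot> y) \<and> pb2 C z u \<cdot> ac t A g y = pb2 C z u \<cdot> y"
    unfolding tA t_def[symmetric] by auto
  have ft: "f \<cdot> pb1 C z u = t" unfolding t_def ..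
  note [simp] = *(1)
  have e: "equivariant C G (t, A) (pb1 C z u) (f, a)"
    by (rule equivariantI) (use ** ft in simp_all)
  have i: "invariant t A (pb2 C z u)"
    by (rule invariantI) (use ** in simp_all)
  have "quot t A (pb2 C z u)"
    by (rule quot_pullback[OF X *(1) z u e i pb_is_pullback]) simp_all
  then show ?thesis using * ** t_def t(2) by blast
qed

text \<open>Quotient maps are stably epic. This is the form in which stability replaces the choice
  of representatives.\<close>

lemma quot_lift_cancel:
  assumes X: "is_gobj C G f a" and z: "quot f a z" and u: "u \<in> Arr C" "Cod C u = Cod C z"
    and k: "k \<in> Arr C" "k' \<in> Arr C" "Dom C k = Dom C u" "Dom C k' = Dom C u" "Cod C k = Cod C k'"
    and eq: "k \<cdot> pb2 C z u = k' \<cdot> pb2 C z u"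
  shows "k = k'"
proof -
  obtain t A where t: "is_gobj C G t A" "quot t A (pb2 C z u)" using quot_lift[OF X z u] by blast
  show ?thesis by (rule quot_ext[OF t]) (use k eq u quotD(2)[OF z] in simp_all)
qed

text \<open>\<open>sigma_prod\<close> is built from transposes and a chosen inverse, but it is
  determined by its composite with the quotient map \<open>zeta\<close>. That composite is the split
  quotient map of \<open>quot_free_product\<close>, so \<open>sigma_prod\<close> compares two
  quotients and is invertible.\<close>

lemma sigma_prod_zeta:
  assumes X [simp]: "is_gobj C G f a"
    and k1: "pr1 (gcat C G) (free_one G) (f, a) = ((t, A), k1, free_one G)"
    and k2: "pr2 (gcat C G) (free_one G) (f, a) = ((t, A), k2, (f, a))"
  shows "iso C (sigma_prod C G S (f, a))" "Dom C (sigma_prod C G S (f, a)) = S.L (t, A)"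
    "Cod C (sigma_prod C G S (f, a)) = Dom C f"
    "sigma_prod C G S (f, a) \<cdot> zeta (t, A) = ac f a (gi G \<cdot> k1) k2"
proof -
  note [simp] = gobj_arr[OF X]
  have ex: "\<exists>p q. is_product (gcat C G) (free_one G) (f, a) p q"
    using gcat_product_ex[OF gobj_free_one X] unfolding free_one_def by blast
  note pr = S.D.is_product_pr[OF ex]
  have pbk: "is_pullback C (d1 G) f k1 k2" and ka: "((t, A), k1, free_one G) \<in> Arr (gcat C G)" "((t, A), k2, (f, a)) \<in> Arr (gcat C G)"
    using gcat_product_underlying[OF gobj_free_one X pr[unfolded free_one_def]] k1 k2 unfolding free_one_def by auto
  have T [simp]: "is_gobj C G t A" and kt [simp]: "k1 \<in> Arr C" "Dom C k1 = Dom C t" "Cod C k1 = G1 G" "k2 \<in> Arr C" "Dom C k2 = Dom C t" "Cod C k2 = Dom C f"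
    and ke: "equivariant C G (t, A) k1 (free_one G)" "equivariant C G (t, A) k2 (f, a)"
    using ka unfolding free_one_def gcat_simps by simp_all
  note [simp] = gobj_arr[OF T]
  have dk: "d1 G \<cdot> k1 = f \<cdot> k2" using is_pullbackD[OF pbk] by simp
  have dk': "d1 G \<cdot> (k1 \<cdot> y) = f \<cdot> (k2 \<cdot> y)" if "y \<in> Arr C" "Cod C y = Dom C t" for y
    using comp_reassoc[OF dk, of y] that by simp
  define \<kappa> where "\<kappa> = ac f a (gi G \<cdot> k1) k2"
  have q\<kappa>: "quot t A \<kappa>" unfolding \<kappa>_def by (rule quot_free_product[OF X T pbk _ ke]) simp
  have \<kappa> [simp]: "\<kappa> \<in> Arr C" "Dom C \<kappa> = Dom C t" "Cod C \<kappa> = Dom C f" "f \<cdot> \<kappa> = d0 G \<cdot> k1"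
    unfolding \<kappa>_def using dk by simp_all
  obtain s B where sB: "free_gobj C G f = (s, B)" by (cases "free_gobj C G f")
  have F [simp]: "is_gobj C G s B" and s: "s = d1 G \<cdot> pb1 C (d0 G) f"
    and sact: "\<And>g y. pel (d0 G) s g y \<Longrightarrow> pb1 C (d0 G) f \<cdot> ac s B g y = mul g (pb1 C (d0 G) f \<cdot> y) \<and>
      pb2 C (d0 G) f \<cdot> ac s B g y = pb2 C (d0 G) f \<cdot> y"
    using free_gobj[OF gobj_arr(1,2)[OF X]] unfolding sB case_prod_conv by blast+
  define p where "p = pb1 C (d0 G) f"
  define x where "x = pb2 C (d0 G) f"
  have px [simp]: "p \<in> Arr C" "x \<in> Arr C" "Dom C p = pb_obj C (d0 G) f" "Dom C x = pb_obj C (d0 G) f" "Cod C p = G1 G" "Cod C x = Dom C f"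
    "d0 G \<cdot> p = f \<cdot> x"
    "y \<in> Arr C \<Longrightarrow> Cod C y = pb_obj C (d0 G) f \<Longrightarrow> d0 G \<cdot> (p \<cdot> y) = f \<cdot> (x \<cdot> y)" for y
    unfolding p_def x_def by (simp_all add: pb_comm)
  have st [simp]: "s \<in> Arr C" "Dom C s = pb_obj C (d0 G) f" "Cod C s = G0 G" "d1 G \<cdot> p = s"
    "y \<in> Arr C \<Longrightarrow> Cod C y = pb_obj C (d0 G) f \<Longrightarrow> d1 G \<cdot> (p \<cdot> y) = s \<cdot> y" for y
    unfolding s p_def by simp_all
  note sa [simp] = sact[folded p_def x_def, THEN conjunct1] sact[folded p_def x_def, THEN conjunct2]
  have ap: "ac f a p x = a" unfolding p_def x_def by (rule ac_eta[OF X])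
  have ay: "a \<cdot> y = ac f a (p \<cdot> y) (x \<cdot> y)" if "y \<in> Arr C" "Cod C y = pb_obj C (d0 G) f" for y
    unfolding p_def x_def by (rule ac_eta_comp[OF X that])
  have fa: "f \<cdot> a = s" using ac_arr(4)[OF X, of p x] unfolding ap by simp
  have pe: "equivariant C G (s, B) p (d1 G, gm G)"
    by (rule equivariantI) (simp_all add: ac_free_one)
  have ae: "equivariant C G (s, B) a (f, a)"
  proof (rule equivariantI)
    fix g y assume gy: "pel (d0 G) s g y"
    have q: "pel (d0 G) s g y \<and> ac s B g y \<in> Arr C \<and> Cod C (ac s B g y) = pb_obj C (d0 G) f" using gy by simp
    have "a \<cdot> ac s B g y = ac f a (p \<cdot> ac s B g y) (x \<cdot> ac s B g y)"
      by (rule ay) (use q in simp_all)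
    also have "\<dots> = ac f a (mul g (p \<cdot> y)) (x \<cdot> y)" using gy by simp
    also have "\<dots> = ac f a g (ac f a (p \<cdot> y) (x \<cdot> y))" using gy by simp
    finally show "a \<cdot> ac s B g y = ac f a g (a \<cdot> y)" using gy by (simp add: ay)
  qed (use fa in simp_all)
  have arrs: "((s, B), p, free_one G) \<in> Arr (gcat C G)" "((s, B), a, (f, a)) \<in> Arr (gcat C G)"
    using pe ae unfolding free_one_def gcat_simps by simp_all
  define \<phi> where "\<phi> = free_to_prod C G (f, a)"
  have \<phi>_eq: "\<phi> = prod_pair (gcat C G) ((s, B), p, free_one G) ((s, B), a, (f, a))"
    unfolding \<phi>_def free_to_prod_def case_prod_conv sB p_def ..
  have \<phi>: "\<phi> \<in> Arr (gcat C G)" "Dom (gcat C G) \<phi> = (s, B)" "Cod (gcat C G) \<phi> = (t, A)"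
     "((t, A), k1, free_one G) \<cdot>\<^bsub>gcat C G\<^esub> \<phi> = ((s, B), p, free_one G)" "((t, A), k2, (f, a)) \<cdot>\<^bsub>gcat C G\<^esub> \<phi> = ((s, B), a, (f, a))"
    unfolding \<phi>_eq using S.D.prod_pair_simps[OF ex arrs, unfolded gcat_simps(3,4)] unfolding prod_obj_def k1 k2 gcat_simps(3,4) by simp_all
  then obtain h where h: "\<phi> = ((s, B), h, (t, A))" by (cases \<phi>) (auto simp: gcat_simps)
  have ht [simp]: "h \<in> Arr C" "Dom C h = pb_obj C (d0 G) f" "Cod C h = Dom C t" "k1 \<cdot> h = p" "k2 \<cdot> h = a"
    using \<phi> unfolding h gcat_simps by simp_all
  have \<kappa>h: "\<kappa> \<cdot> h = x"
  proof -
    have "\<kappa> \<cdot> h = ac f a (gi G \<cdot> p) a" unfolding \<kappa>_def using dk by simp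
    also have "\<dots> = ac f a (gi G \<cdot> p) (ac f a p x)" unfolding ap ..
    also have "\<dots> = x" by simp
    finally show ?thesis .
  qed
  \<comment> \<open>In components \<open>h\<close> is \<open>(g, x) \<mapsto> (g, g x)\<close>; the
    inverse \<open>l\<close> undoes the action on the second component, which is what
    \<open>\<kappa>\<close> computes.\<close>
  define l where "l = pb_pair C (d0 G) f k1 \<kappa>"
  have l [simp]: "l \<in> Arr C" "Dom C l = Dom C t" "Cod C l = pb_obj C (d0 G) f" "p \<cdot> l = k1" "x \<cdot> l = \<kappa>"
    unfolding l_def p_def x_def by simp_all
  have al: "a \<cdot> l = k2" using dk by (simp add: ay \<kappa>_def)
  have hl: "h \<cdot> l = Id C (Dom C t)"
  proof (rule is_pullback_ext[OF pbk])
    show "k1 \<cdot> (h \<cdot> l) = k1 \<cdot> Id C (Dom C t)" using comp_reassoc[OF ht(4), of l] by simp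
    show "k2 \<cdot> (h \<cdot> l) = k2 \<cdot> Id C (Dom C t)" using comp_reassoc[OF ht(5), of l] al by simp
  qed simp_all
  have lh: "l \<cdot> h = Id C (pb_obj C (d0 G) f)"
  proof (rule pb_eqI[of "d0 G" f])
    show "pb1 C (d0 G) f \<cdot> (l \<cdot> h) = pb1 C (d0 G) f \<cdot> Id C (pb_obj C (d0 G) f)"
      using comp_reassoc[OF l(4), of h] by (simp add: p_def[symmetric])
    show "pb2 C (d0 G) f \<cdot> (l \<cdot> h) = pb2 C (d0 G) f \<cdot> Id C (pb_obj C (d0 G) f)"
      using comp_reassoc[OF l(5), of h] \<kappa>h by (simp add: x_def[symmetric])
  qed simp_all
  have ih: "iso C h" by (rule isoI[where g = l]) (simp_all add: hl lh)
  have "iso (gcat C G) \<phi>" using \<phi>(1) iso_gcat[of s B h t A] ih unfolding h by simp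
  note i\<phi> = S.D.inv_arr_simps[OF this]
  obtain r where r: "inv_arr (gcat C G) \<phi> = ((t, A), r, (s, B))"
    using i\<phi>(2-4) unfolding \<phi>(2,3) by (cases "inv_arr (gcat C G) \<phi>") (auto simp: gcat_simps)
  have ra: "((t, A), r, (s, B)) \<in> Arr (gcat C G)" using i\<phi>(2) unfolding r .
  have rt [simp]: "r \<in> Arr C" "Dom C r = Dom C t" "Cod C r = pb_obj C (d0 G) f" using ra unfolding gcat_simps by simp_all
  have hr: "h \<cdot> r = Id C (Dom C t)"
    using i\<phi>(6) unfolding r unfolding h gcat_simps by simp
  have xr: "x \<cdot> r = \<kappa>"
    using comp_reassoc[OF \<kappa>h, of r] hr by simp
  have xi: "invariant s B x" by (rule invariantI) simp_all
  have fs: "free_to_star C G f = ((s, B), prod_pair C s x, star_obj C G (Dom C f))"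
    unfolding free_to_star_def sB x_def s ..
  have DO: "Dom C f \<in> Obj C" by simp
  have fsa: "((s, B), prod_pair C s x, star_obj C G (Dom C f)) \<in> Arr (gcat C G)"
    by (rule star_arrI[OF F xi]) simp
  note tz = tr_zeta(1-4)[OF F fsa DO, folded fs, folded sigma_free_def]
  note zn = zeta_natural[OF ra]
  have sp: "sigma_prod C G S (f, a) = sigma_free C G S f \<cdot> S.LA ((t, A), r, (s, B))"
    unfolding sigma_prod_def fst_conv \<phi>_def[symmetric] r ..
  note zt = zeta_simps[OF T] zeta_simps[OF F]
  have spz: "sigma_prod C G S (f, a) \<cdot> zeta (t, A) = \<kappa>"
  proof -
    have "sigma_prod C G S (f, a) \<cdot> zeta (t, A) = sigma_free C G S f \<cdot> (zeta (s, B) \<cdot> r)"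
      unfolding sp using tz zn zt by simp
    also have "\<dots> = (pr2 C (G0 G) (Dom C f) \<cdot> prod_pair C s x) \<cdot> r"
      by (rule comp_reassoc[OF tz(4)]) (use tz zt in simp_all)
    also have "\<dots> = \<kappa>" using xr by simp
    finally show ?thesis .
  qed
  then show "sigma_prod C G S (f, a) \<cdot> zeta (t, A) = ac f a (gi G \<cdot> k1) k2" unfolding \<kappa>_def .
  have spt: "sigma_prod C G S (f, a) \<in> Arr C" and "Dom C (sigma_prod C G S (f, a)) = S.L (t, A)" "Cod C (sigma_prod C G S (f, a)) = Dom C f"
    unfolding sp using tz zn by simp_all
  then show "Dom C (sigma_prod C G S (f, a)) = S.L (t, A)" "Cod C (sigma_prod C G S (f, a)) = Dom C f" by simp_all
  with spt spz show "iso C (sigma_prod C G S (f, a))"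
    by - (rule quot_iso[OF T quot_zeta[OF T] q\<kappa>], simp_all add: zt)
qed

end

section \<open>Hilsum--Skandalis maps\<close>

locale hs = fincat C for C :: "('o, 'm) cat" (structure) +
  fixes H G :: "('o, 'm) igpd" and SH SG :: "('o, 'm) sigma_adj" and p q c d :: 'm
  assumes sfH: "stably_frobenius_groupoid C H SH" and sfG: "stably_frobenius_groupoid C G SG"
    and hilsum_skandalis: "hilsum_skandalis C H G \<lparr>hs_p = p, hs_q = q, hs_c = c, hs_d = d\<rparr>"
begin

sublocale H: sf_groupoid C H SH by unfold_locales (rule sfH)
sublocale G: sf_groupoid C G SG by unfold_locales (rule sfG)
sublocale E: effective_descent_arrow C p
  by unfold_locales (use hilsum_skandalis in \<open>simp add: hilsum_skandalis_def\<close>)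

section \<open>The axioms of a Hilsum--Skandalis map in generalized elements, and the division
  map\<close>

lemma gp [simp]: "is_gobj C H p c" and gq [simp]: "is_gobj C G q d" and Dom_q [simp]: "Dom C q = Dom C p"
  using hilsum_skandalis unfolding hilsum_skandalis_def by simp_all

lemma pq_arr [simp]: "Cod C p = G0 H" "c \<in> Arr C" "Dom C c = pb_obj C (d0 H) p" "Cod C c = Dom C p"
  "q \<in> Arr C" "Cod C q = G0 G" "d \<in> Arr C" "Dom C d = pb_obj C (d0 G) q" "Cod C d = Dom C p"
  using H.gobj_arr[OF gp] G.gobj_arr[OF gq] by simp_all

abbreviation "ha \<equiv> act C H p c"
abbreviation "ga \<equiv> act C G q d"

lemma p_ga [simp]:
  assumes "pel (d0 G) q g x" shows "p \<cdot> ga g x = p \<cdot> x"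
proof -
  have *: "p \<cdot> d = p \<cdot> pb2 C (d0 G) q"
    using hilsum_skandalis unfolding hilsum_skandalis_def by simp
  show ?thesis
    unfolding act_def using comp_reassoc[OF *, of "pb_pair C (d0 G) q g x"] assms by simp
qed

lemma q_ha [simp]:
  assumes "pel (d0 H) p h x" shows "q \<cdot> ha h x = q \<cdot> x"
proof -
  have *: "q \<cdot> c = q \<cdot> pb2 C (d0 H) p"
    using hilsum_skandalis unfolding hilsum_skandalis_def by simp
  show ?thesis
    unfolding act_def using comp_reassoc[OF *, of "pb_pair C (d0 H) p h x"] assms by simp
qed

lemma ha_ga [simp]:
  assumes "pel (d0 G) q g x" "h \<in> Arr C" "Dom C h = Dom C x" "Cod C h = G1 H" "d0 H \<cdot> h = p \<cdot> x"
  shows "ha h (ga g x) = ga g (ha h x)"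
proof -
  have "h \<in> hom C (Dom C x) (G1 H)" "g \<in> hom C (Dom C x) (G1 G)" "x \<in> hom C (Dom C x) (Dom C p)"
    "d0 H \<cdot> h = p \<cdot> x \<and> d0 G \<cdot> g = q \<cdot> x" using assms by simp_all
  then show ?thesis using hilsum_skandalis unfolding hilsum_skandalis_def by (simp del: hom_def)
qed

text \<open>The division map: \<open>dv x y\<close> is the unique \<open>g\<close> with \<open>g y = x\<close>.\<close>

definition "dvar = pb1 C (d0 G) q \<cdot> inv_arr C (pb_pair C p p d (pb2 C (d0 G) q))"
definition "dv x y = dvar \<cdot> pb_pair C p p x y"

lemma translation_iso: "iso C (pb_pair C p p d (pb2 C (d0 G) q))"
  using hilsum_skandalis unfolding hilsum_skandalis_def by simp

lemma p_d: "p \<cdot> d = p \<cdot> pb2 C (d0 G) q"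
  using hilsum_skandalis unfolding hilsum_skandalis_def by simp

lemma dvar_arr [simp]: "dvar \<in> Arr C" "Dom C dvar = pb_obj C p p" "Cod C dvar = G1 G"
proof -
  have "Dom C (pb_pair C p p d (pb2 C (d0 G) q)) = pb_obj C (d0 G) q" "Cod C (pb_pair C p p d (pb2 C (d0 G) q)) = pb_obj C p p"
    by (simp_all add: p_d)
  then show "dvar \<in> Arr C" "Dom C dvar = pb_obj C p p" "Cod C dvar = G1 G"
    unfolding dvar_def using translation_iso by simp_all
qed

lemma dv_arr [simp]:
  assumes "pel p p x y"
  shows "dv x y \<in> Arr C" "Dom C (dv x y) = Dom C y" "Cod C (dv x y) = G1 G" "d0 G \<cdot> dv x y = q \<cdot> y" "ga (dv x y) y = x"
    "d1 G \<cdot> dv x y = q \<cdot> x"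
proof -
  define i where "i = pb_pair C p p d (pb2 C (d0 G) q)"
  have i [simp]: "iso C i" "i \<in> Arr C" "Dom C i = pb_obj C (d0 G) q" "Cod C i = pb_obj C p p" "pb1 C p p \<cdot> i = d" "pb2 C p p \<cdot> i = pb2 C (d0 G) q"
    using translation_iso unfolding i_def by (simp_all add: p_d)
  show a [simp]: "dv x y \<in> Arr C" "Dom C (dv x y) = Dom C y" "Cod C (dv x y) = G1 G"
    unfolding dv_def using assms by simp_all
  define z where "z = inv_arr C i \<cdot> pb_pair C p p x y"
  have z [simp]: "z \<in> Arr C" "Dom C z = Dom C y" "Cod C z = pb_obj C (d0 G) q" "i \<cdot> z = pb_pair C p p x y"
    unfolding z_def using assms by simp_all
  have dz: "dv x y = pb1 C (d0 G) q \<cdot> z"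
    unfolding dv_def dvar_def i_def[symmetric] z_def using assms by simp
  have "pb2 C (d0 G) q \<cdot> z = pb2 C p p \<cdot> (i \<cdot> z)"
    by (rule comp_reassoc[OF i(6), symmetric]) simp_all
  also have "\<dots> = y" using assms by simp
  finally have yz: "pb2 C (d0 G) q \<cdot> z = y" .
  show *: "d0 G \<cdot> dv x y = q \<cdot> y"
    unfolding dz using pb_comm(2)[of "d0 G" q z] by (simp add: yz)
  have "ga (dv x y) y = d \<cdot> z"
    using G.ac_eta_comp[OF gq, of z] dz yz by simp
  also have "\<dots> = pb1 C p p \<cdot> (i \<cdot> z)"
    by (rule comp_reassoc[OF i(5), symmetric]) simp_all
  also have "\<dots> = x" using assms by simp
  finally show **: "ga (dv x y) y = x" .
  have "q \<cdot> ga (dv x y) y = d1 G \<cdot> dv x y"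
    by (rule G.ac_arr(4)[OF gq]) (use assms * in simp)
  then show "d1 G \<cdot> dv x y = q \<cdot> x" unfolding ** by simp
qed

lemma dv_ga [simp]:
  assumes "pel (d0 G) q g y"
  shows "dv (ga g y) y = g"
proof -
  define i where "i = pb_pair C p p d (pb2 C (d0 G) q)"
  have i [simp]: "iso C i" "i \<in> Arr C" "Dom C i = pb_obj C (d0 G) q" "Cod C i = pb_obj C p p" "pb1 C p p \<cdot> i = d" "pb2 C p p \<cdot> i = pb2 C (d0 G) q"
    using translation_iso unfolding i_def by (simp_all add: p_d)
  define z where "z = pb_pair C (d0 G) q g y"
  have z [simp]: "z \<in> Arr C" "Dom C z = Dom C y" "Cod C z = pb_obj C (d0 G) q" "pb1 C (d0 G) q \<cdot> z = g" "pb2 C (d0 G) q \<cdot> z = y"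
    unfolding z_def using assms by simp_all
  have "d \<cdot> z = ga g y" unfolding act_def z_def ..
  then have "i \<cdot> z = pb_pair C p p (ga g y) y"
    by - (rule pb_eqI[of p p], use assms comp_reassoc[OF i(5), of z] comp_reassoc[OF i(6), of z] in simp_all)
  then have "dv (ga g y) y = pb1 C (d0 G) q \<cdot> (inv_arr C i \<cdot> (i \<cdot> z))"
    unfolding dv_def dvar_def i_def[symmetric] using assms by simp
  then show ?thesis by simp
qed

lemma dv_unique: "pel (d0 G) q g y \<Longrightarrow> ga g y = x \<Longrightarrow> dv x y = g"
  using dv_ga by metis

lemma dv_comp [simp]:
  assumes "pel p p x y" "s \<in> Arr C" "Cod C s = Dom C y"
  shows "dv x y \<cdot> s = dv (x \<cdot> s) (y \<cdot> s)"
  unfolding dv_def using assms by simp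

lemma dv_refl: "x \<in> Arr C \<Longrightarrow> Cod C x = Dom C p \<Longrightarrow> dv x x = ge G \<cdot> (q \<cdot> x)"
  by (rule dv_unique) simp_all

lemma dv_trans:
  assumes "pel p p x y" "pel p p y z"
  shows "gmul C G (dv x y) (dv y z) = dv x z"
proof -
  have "ga (gmul C G (dv x y) (dv y z)) z = ga (dv x y) (ga (dv y z) z)"
    by (rule G.ac_ac[symmetric, OF gq]) (use assms in simp_all)
  then show ?thesis using assms by (intro dv_unique[symmetric]) simp_all
qed

lemma dv_ha:
  assumes "pel p p x y" "h \<in> Arr C" "Dom C h = Dom C y" "Cod C h = G1 H" "d0 H \<cdot> h = p \<cdot> y"
  shows "dv (ha h x) (ha h y) = dv x y"
proof (rule dv_unique)
  have "ha h (ga (dv x y) y) = ga (dv x y) (ha h y)"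
    by (rule ha_ga) (use assms in simp_all)
  then show "ga (dv x y) (ha h y) = ha h x" using assms by simp
qed (use assms in simp)

text \<open>Two points in the same fibre of \<open>p\<close> differ by the action of an arrow of
  \<open>G\<close>, namely \<open>dv x x'\<close>. Hence invariance under \<open>G\<close> is enough
  for an arrow to descend along \<open>p\<close>.\<close>

lemma descend:
  assumes w: "w \<in> Arr C" "Cod C w = G0 H" and \<phi>: "\<phi> \<in> Arr C" "Dom C \<phi> = pb_obj C p w"
    and inv: "\<And>g x v. pel p w x v \<Longrightarrow> pel (d0 G) q g x \<Longrightarrow> \<phi> \<cdot> pb_pair C p w (ga g x) v = \<phi> \<cdot> pb_pair C p w x v"
  obtains k where "k \<in> Arr C" "Dom C k = Dom C w" "Cod C k = Cod C \<phi>" "k \<cdot> pb2 C p w = \<phi>"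
proof -
  have "\<exists>k. k \<in> Arr C \<and> Dom C k = Dom C w \<and> Cod C k = Cod C \<phi> \<and> k \<cdot> pb2 C p w = \<phi>"
  proof (rule E.descend)
    fix x x' v assume x: "x \<in> Arr C" "x' \<in> Arr C" "v \<in> Arr C" "Dom C x = Dom C v" "Dom C x' = Dom C v" "Cod C x = Dom C p"
      "Cod C x' = Dom C p" "Cod C v = Dom C w" "p \<cdot> x = w \<cdot> v" "p \<cdot> x' = w \<cdot> v"
    have "\<phi> \<cdot> pb_pair C p w (ga (dv x x') x') v = \<phi> \<cdot> pb_pair C p w x' v"
      by (rule inv) (use x in simp_all)
    then show "\<phi> \<cdot> pb_pair C p w x v = \<phi> \<cdot> pb_pair C p w x' v" using x by simp
  qed (use w \<phi> in simp_all)
  then show ?thesis using that by blast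
qed

lemma descend_unique:
  assumes "w \<in> Arr C" "Cod C w = G0 H" "k \<in> Arr C" "k' \<in> Arr C" "Dom C k = Dom C w" "Dom C k' = Dom C w"
    "Cod C k = Cod C k'" "k \<cdot> pb2 C p w = k' \<cdot> pb2 C p w"
  shows "k = k'"
  using E.descend_unique[of w k k'] assms by simp

text \<open>\<open>gbil w \<phi> f a\<close>: \<open>\<phi>\<close> is a \<open>G\<close>-equivariant map over \<open>G\<^sub>0\<close> from the pullback of \<open>p\<close> and \<open>w\<close> to \<open>(f, a)\<close>;
  \<open>bil w b \<phi> f a\<close>: in addition it is invariant under \<open>H\<close>.\<close>

definition "gbil w \<phi> f a \<longleftrightarrow> \<phi> \<in> Arr C \<and> Dom C \<phi> = pb_obj C p w \<and> Cod C \<phi> = Dom C f \<and>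
  (\<forall>x v. pel p w x v \<longrightarrow> f \<cdot> (\<phi> \<cdot> pb_pair C p w x v) = q \<cdot> x) \<and>
  (\<forall>g x v. pel p w x v \<and> pel (d0 G) q g x \<longrightarrow> \<phi> \<cdot> pb_pair C p w (ga g x) v = act C G f a g (\<phi> \<cdot> pb_pair C p w x v))"

definition "bil w b \<phi> f a \<longleftrightarrow> gbil w \<phi> f a \<and>
  (\<forall>h x v. pel p w x v \<and> pel (d0 H) p h x \<longrightarrow> \<phi> \<cdot> pb_pair C p w (ha h x) (act C H w b h v) = \<phi> \<cdot> pb_pair C p w x v)"

lemma gbilD:
  assumes "gbil w \<phi> f a"
  shows "\<phi> \<in> Arr C" "Dom C \<phi> = pb_obj C p w" "Cod C \<phi> = Dom C f"
    "pel p w x v \<Longrightarrow> f \<cdot> (\<phi> \<cdot> pb_pair C p w x v) = q \<cdot> x"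
    "pel p w x v \<Longrightarrow> pel (d0 G) q g x \<Longrightarrow> \<phi> \<cdot> pb_pair C p w (ga g x) v = act C G f a g (\<phi> \<cdot> pb_pair C p w x v)"
  using assms unfolding gbil_def by blast+

lemma bilD:
  assumes "bil w b \<phi> f a"
  shows "gbil w \<phi> f a"
    "pel p w x v \<Longrightarrow> pel (d0 H) p h x \<Longrightarrow> \<phi> \<cdot> pb_pair C p w (ha h x) (act C H w b h v) = \<phi> \<cdot> pb_pair C p w x v"
  using assms unfolding bil_def by blast+

text \<open>In elements: for fixed \<open>x\<close>, the map \<open>v \<mapsto> \<rho>(x, v)\<close>
  is a bijection from the points of \<open>w\<close> over \<open>p x\<close> to the points of
  \<open>f\<close> over \<open>q x\<close>. Together with equivariance, this says that
  \<open>w\<close> is the object to which the pullback of \<open>q\<close> and \<open>f\<close>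
  descends along \<open>p\<close>. The action of \<open>H\<close> on it is constructed
  afterwards.\<close>

definition "preR w \<rho> f a \<longleftrightarrow> w \<in> Arr C \<and> Cod C w = G0 H \<and> gbil w \<rho> f a \<and>
  (\<forall>x y. pel q f x y \<longrightarrow> (\<exists>!v. v \<in> Arr C \<and> Dom C v = Dom C y \<and> Cod C v = Dom C w \<and> w \<cdot> v = p \<cdot> x \<and> \<rho> \<cdot> pb_pair C p w x v = y))"

lemma preRD:
  assumes "preR w \<rho> f a"
  shows "w \<in> Arr C" "Cod C w = G0 H" "gbil w \<rho> f a"
    "pel q f x y \<Longrightarrow> \<exists>v. v \<in> Arr C \<and> Dom C v = Dom C y \<and> Cod C v = Dom C w \<and> w \<cdot> v = p \<cdot> x \<and> \<rho> \<cdot> pb_pair C p w x v = y"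
    "pel q f x y \<Longrightarrow> v \<in> Arr C \<Longrightarrow> v' \<in> Arr C \<Longrightarrow> Dom C v = Dom C y \<Longrightarrow> Dom C v' = Dom C y \<Longrightarrow> Cod C v = Dom C w \<Longrightarrow>
     Cod C v' = Dom C w \<Longrightarrow> w \<cdot> v = p \<cdot> x \<Longrightarrow> w \<cdot> v' = p \<cdot> x \<Longrightarrow> \<rho> \<cdot> pb_pair C p w x v = y \<Longrightarrow> \<rho> \<cdot> pb_pair C p w x v' = y \<Longrightarrow> v = v'"
  using assms unfolding preR_def by blast+

text \<open>The laws of a descent datum come from the division map: \<open>dv_refl\<close> gives the
  unit law and \<open>dv_trans\<close> the associativity law. Effectiveness gives \<open>w\<close>
  and \<open>\<sigma>\<close>, and \<open>\<rho>\<close> is the second component of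
  \<open>\<sigma>\<close>.\<close>

lemma preR_ex:
  assumes X [simp]: "is_gobj C G f a"
  shows "\<exists>w \<rho>. preR w \<rho> f a"
proof -
  note [simp] = G.gobj_arr[OF X]
  define y where "y = pb1 C q f"
  define r where "r = pb2 C q f"
  have yr [simp]: "y \<in> Arr C" "Dom C y = pb_obj C q f" "Cod C y = Dom C p" "r \<in> Arr C" "Dom C r = pb_obj C q f" "Cod C r = Dom C f"
    "v \<in> Arr C \<Longrightarrow> Cod C v = pb_obj C q f \<Longrightarrow> f \<cdot> (r \<cdot> v) = q \<cdot> (y \<cdot> v)" "f \<cdot> r = q \<cdot> y" for v
    unfolding y_def r_def by (simp_all add: pb_comm)
  have [simp]: "y \<cdot> pb_pair C q f u v = u" "r \<cdot> pb_pair C q f u v = v" if "pel q f u v" for u v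
    using that unfolding y_def r_def by simp_all
  define x0 where "x0 = pb1 C p (p \<cdot> y)"
  define v0 where "v0 = pb2 C p (p \<cdot> y)"
  have xv [simp]: "x0 \<in> Arr C" "v0 \<in> Arr C" "Dom C x0 = pb_obj C p (p \<cdot> y)" "Dom C v0 = pb_obj C p (p \<cdot> y)" "Cod C x0 = Dom C p"
    "Cod C v0 = pb_obj C q f" "p \<cdot> x0 = p \<cdot> (y \<cdot> v0)"
    unfolding x0_def v0_def by (simp_all add: pb_comm)
  have [simp]: "x0 \<cdot> pb_pair C p (p \<cdot> y) x v = x" "v0 \<cdot> pb_pair C p (p \<cdot> y) x v = v"
    if "x \<in> Arr C" "v \<in> Arr C" "Dom C x = Dom C v" "Cod C x = Dom C p" "Cod C v = pb_obj C q f" "p \<cdot> x = p \<cdot> (y \<cdot> v)" for x v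
    using that unfolding x0_def v0_def by simp_all
  \<comment> \<open>A pair \<open>(y, r)\<close> is transported to the point \<open>x\<close> by
    acting on both components with the arrow \<open>dv x y\<close>, which takes \<open>y\<close> to
    \<open>x\<close>.\<close>
  define s where "s = pb_pair C q f x0 (act C G f a (dv x0 (y \<cdot> v0)) (r \<cdot> v0))"
  have s [simp]: "s \<in> Arr C" "Dom C s = pb_obj C p (p \<cdot> y)" "Cod C s = pb_obj C q f" "y \<cdot> s = x0"
    unfolding s_def by simp_all
  have sp: "s \<cdot> pb_pair C p (p \<cdot> y) x v = pb_pair C q f x (act C G f a (dv x (y \<cdot> v)) (r \<cdot> v))"
    if "x \<in> Arr C" "v \<in> Arr C" "Dom C x = Dom C v" "Cod C x = Dom C p" "Cod C v = pb_obj C q f" "p \<cdot> x = p \<cdot> (y \<cdot> v)" for x v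
    unfolding s_def using that by simp
  have s1: "s \<cdot> pb_pair C p (p \<cdot> y) y (Id C (Dom C y)) = Id C (Dom C y)"
    by (rule pb_eqI[of q f, folded y_def r_def]) (simp_all add: sp dv_refl)
  have s2: "s \<cdot> pb_pair C p (p \<cdot> y) x (s \<cdot> pb_pair C p (p \<cdot> y) x' v) = s \<cdot> pb_pair C p (p \<cdot> y) x v"
    if "x \<in> Arr C" "x' \<in> Arr C" "v \<in> Arr C" "Dom C x = Dom C v" "Dom C x' = Dom C v" "Cod C x = Dom C p" "Cod C x' = Dom C p"
      "Cod C v = pb_obj C q f" "p \<cdot> x = p \<cdot> (y \<cdot> v)" "p \<cdot> x' = p \<cdot> (y \<cdot> v)" for x x' v
  proof -
    define z where "z = pb_pair C q f x' (act C G f a (dv x' (y \<cdot> v)) (r \<cdot> v))"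
    have z [simp]: "z \<in> Arr C" "Dom C z = Dom C v" "Cod C z = pb_obj C q f" "y \<cdot> z = x'" "r \<cdot> z = act C G f a (dv x' (y \<cdot> v)) (r \<cdot> v)"
      unfolding z_def using that by simp_all
    have "act C G f a (dv x x') (act C G f a (dv x' (y \<cdot> v)) (r \<cdot> v)) = act C G f a (gmul C G (dv x x') (dv x' (y \<cdot> v))) (r \<cdot> v)"
      by (rule G.ac_ac) (use that in simp_all)
    also have "gmul C G (dv x x') (dv x' (y \<cdot> v)) = dv x (y \<cdot> v)"
      by (rule dv_trans) (use that in simp_all)
    finally show ?thesis
      using that by (simp add: sp[of x' v] z_def[symmetric] sp)
  qed
  have ex: "\<exists>w \<sigma>. w \<in> Arr C \<and> Cod C w = Cod C p \<and> iso C \<sigma> \<and> Dom C \<sigma> = pb_obj C p w \<and> Cod C \<sigma> = Dom C y \<and> y \<cdot> \<sigma> = pb1 C p w \<and>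
     (\<forall>x x' v. x \<in> Arr C \<and> x' \<in> Arr C \<and> v \<in> Arr C \<and> Dom C x = Dom C v \<and> Dom C x' = Dom C v \<and>
      Cod C x = Dom C p \<and> Cod C x' = Dom C p \<and> Cod C v = Dom C w \<and> p \<cdot> x = w \<cdot> v \<and> p \<cdot> x' = w \<cdot> v \<longrightarrow>
      \<sigma> \<cdot> pb_pair C p w x v = s \<cdot> pb_pair C p (p \<cdot> y) x (\<sigma> \<cdot> pb_pair C p w x' v))"
    by (rule E.datum_effective[OF _ _ _ _ _ _ s1]) (use s2 in \<open>simp_all add: x0_def[symmetric]\<close>)
  obtain w \<sigma> where w: "w \<in> Arr C" "Cod C w = Cod C p" and \<sigma>: "iso C \<sigma>" "Dom C \<sigma> = pb_obj C p w" "Cod C \<sigma> = Dom C y" "y \<cdot> \<sigma> = pb1 C p w"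
    and \<sigma>s: "\<And>x x' v. x \<in> Arr C \<Longrightarrow> x' \<in> Arr C \<Longrightarrow> v \<in> Arr C \<Longrightarrow> Dom C x = Dom C v \<Longrightarrow> Dom C x' = Dom C v \<Longrightarrow>
      Cod C x = Dom C p \<Longrightarrow> Cod C x' = Dom C p \<Longrightarrow> Cod C v = Dom C w \<Longrightarrow> p \<cdot> x = w \<cdot> v \<Longrightarrow> p \<cdot> x' = w \<cdot> v \<Longrightarrow>
      \<sigma> \<cdot> pb_pair C p w x v = s \<cdot> pb_pair C p (p \<cdot> y) x (\<sigma> \<cdot> pb_pair C p w x' v)"
    using ex by blast
  have [simp]: "w \<in> Arr C" "Cod C w = G0 H" using w by simp_all
  note [simp] = \<sigma>
  have y\<sigma>: "y \<cdot> (\<sigma> \<cdot> pb_pair C p w x v) = x" if "pel p w x v" for x v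
    using comp_reassoc[OF \<sigma>(4), of "pb_pair C p w x v"] that by simp
  define \<rho> where "\<rho> = r \<cdot> \<sigma>"
  have \<rho> [simp]: "\<rho> \<in> Arr C" "Dom C \<rho> = pb_obj C p w" "Cod C \<rho> = Dom C f" unfolding \<rho>_def by simp_all
  have \<rho>p: "\<rho> \<cdot> pb_pair C p w x v = r \<cdot> (\<sigma> \<cdot> pb_pair C p w x v)" if "pel p w x v" for x v
    unfolding \<rho>_def using that by simp
  have "gbil w \<rho> f a"
    unfolding gbil_def
  proof (intro conjI allI impI)
    fix x v assume xv: "pel p w x v"
    show "f \<cdot> (\<rho> \<cdot> pb_pair C p w x v) = q \<cdot> x" using xv by (simp add: \<rho>p y\<sigma>)
  next
    fix g x v assume xv: "pel p w x v \<and> pel (d0 G) q g x"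
    define z where "z = \<sigma> \<cdot> pb_pair C p w x v"
    have z [simp]: "z \<in> Arr C" "Dom C z = Dom C v" "Cod C z = pb_obj C q f" "y \<cdot> z = x"
      unfolding z_def using xv y\<sigma>[of x v] by simp_all
    \<comment> \<open>The homomorphism law of \<open>\<sigma>\<close> for the points
      \<open>ga g x\<close> and \<open>x\<close>, whose division is \<open>g\<close>; this makes
      \<open>\<rho>\<close> equivariant.\<close>
    have "\<sigma> \<cdot> pb_pair C p w (ga g x) v = s \<cdot> pb_pair C p (p \<cdot> y) (ga g x) z"
      unfolding z_def by (rule \<sigma>s) (use xv in simp_all)
    also have "\<dots> = pb_pair C q f (ga g x) (act C G f a g (r \<cdot> z))"
      using xv by (simp add: sp)
    finally show "\<rho> \<cdot> pb_pair C p w (ga g x) v = act C G f a g (\<rho> \<cdot> pb_pair C p w x v)"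
      using xv by (simp add: \<rho>p z_def[symmetric])
  qed simp_all
  moreover have "\<exists>!v. v \<in> Arr C \<and> Dom C v = Dom C u \<and> Cod C v = Dom C w \<and> w \<cdot> v = p \<cdot> x \<and> \<rho> \<cdot> pb_pair C p w x v = u"
    if xu: "pel q f x u" for x u
  proof -
    define z where "z = inv_arr C \<sigma> \<cdot> pb_pair C q f x u"
    have z [simp]: "z \<in> Arr C" "Dom C z = Dom C u" "Cod C z = pb_obj C p w" "\<sigma> \<cdot> z = pb_pair C q f x u"
      unfolding z_def using xu by simp_all
    have "pb1 C p w \<cdot> z = y \<cdot> (\<sigma> \<cdot> z)"
      by (rule comp_reassoc[OF \<sigma>(4), symmetric]) simp_all
    also have "\<dots> = x" using xu by simp
    finally have z1: "pb1 C p w \<cdot> z = x" .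
    have wz: "w \<cdot> (pb2 C p w \<cdot> z) = p \<cdot> x" using pb_comm(2)[of p w z] z1 by simp
    have zz: "pb_pair C p w x (pb2 C p w \<cdot> z) = z" using pb_pair_eta(2)[of p w z] z1 by simp
    show ?thesis
    proof (rule ex1I[of _ "pb2 C p w \<cdot> z"])
      show "pb2 C p w \<cdot> z \<in> Arr C \<and> Dom C (pb2 C p w \<cdot> z) = Dom C u \<and> Cod C (pb2 C p w \<cdot> z) = Dom C w \<and> w \<cdot> (pb2 C p w \<cdot> z) = p \<cdot> x \<and>
        \<rho> \<cdot> pb_pair C p w x (pb2 C p w \<cdot> z) = u"
        using wz zz xu by (simp add: \<rho>_def)
      fix v
      assume v: "v \<in> Arr C \<and> Dom C v = Dom C u \<and> Cod C v = Dom C w \<and> w \<cdot> v = p \<cdot> x \<and> \<rho> \<cdot> pb_pair C p w x v = u"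
      then have vt: "pel p w x v" using xu by simp
      have e: "\<sigma> \<cdot> pb_pair C p w x v = pb_pair C q f x u"
      proof (rule pb_eqI[of q f, folded y_def r_def])
        have "r \<cdot> (\<sigma> \<cdot> pb_pair C p w x v) = u" using \<rho>p[OF vt] v by metis
        then show "r \<cdot> (\<sigma> \<cdot> pb_pair C p w x v) = r \<cdot> pb_pair C q f x u" using xu by simp
        show "y \<cdot> (\<sigma> \<cdot> pb_pair C p w x v) = y \<cdot> pb_pair C q f x u" unfolding y\<sigma>[OF vt] using xu by simp
        show "Dom C (\<sigma> \<cdot> pb_pair C p w x v) = Dom C (pb_pair C q f x u)" using vt v xu by simp
      qed (use vt xu in simp_all)
      have "z = inv_arr C \<sigma> \<cdot> (\<sigma> \<cdot> pb_pair C p w x v)" unfolding z_def e ..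
      also have "\<dots> = pb_pair C p w x v" using vt by simp
      finally have "pb2 C p w \<cdot> z = pb2 C p w \<cdot> pb_pair C p w x v" by simp
      also have "\<dots> = v" using vt by simp
      finally show "v = pb2 C p w \<cdot> z" ..
    qed
  qed
  ultimately have "preR w \<rho> f a" unfolding preR_def by simp
  then show ?thesis by blast
qed

subsection \<open>The right adjoint\<close>

text \<open>After pulling back to \<open>P\<close>, the lift \<open>v'\<close> is forced by the
  bijection in \<open>preR\<close>. It does not depend on the point \<open>x\<close> in its
  \<open>G\<close>-orbit, so it descends along \<open>p\<close>.\<close>

lemma preR_lift:
  assumes X [simp]: "is_gobj C G f a" and R: "preR w \<rho> f a" and t [simp]: "t \<in> Arr C" "Cod C t = G0 H" and \<phi>: "gbil t \<phi> f a"
  obtains v where "v \<in> Arr C" "Dom C v = Dom C t" "Cod C v = Dom C w" "w \<cdot> v = t"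
    "\<And>x s. pel p t x s \<Longrightarrow> \<rho> \<cdot> pb_pair C p w x (v \<cdot> s) = \<phi> \<cdot> pb_pair C p t x s"
proof -
  note [simp] = G.gobj_arr[OF X] preRD(1,2)[OF R]
  note \<rho> [simp] = gbilD(1-3)[OF preRD(3)[OF R]] and \<phi>t [simp] = gbilD(1-3)[OF \<phi>]
  define x0 where "x0 = pb1 C p t"
  define s0 where "s0 = pb2 C p t"
  have xs [simp]: "x0 \<in> Arr C" "s0 \<in> Arr C" "Dom C x0 = pb_obj C p t" "Dom C s0 = pb_obj C p t" "Cod C x0 = Dom C p" "Cod C s0 = Dom C t"
     "p \<cdot> x0 = t \<cdot> s0"
    unfolding x0_def s0_def by (simp_all add: pb_comm)
  have xsp [simp]: "x0 \<cdot> pb_pair C p t x s = x" "s0 \<cdot> pb_pair C p t x s = s" if "pel p t x s" for x s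
    using that unfolding x0_def s0_def by simp_all
  have "f \<cdot> (\<phi> \<cdot> pb_pair C p t x0 s0) = q \<cdot> x0" by (rule gbilD(4)[OF \<phi>]) simp
  then have f\<phi>: "pel q f x0 \<phi>" unfolding x0_def s0_def by simp
  obtain v' where v' [simp]: "v' \<in> Arr C" "Dom C v' = pb_obj C p t" "Cod C v' = Dom C w" "w \<cdot> v' = t \<cdot> s0" and \<rho>v': "\<rho> \<cdot> pb_pair C p w x0 v' = \<phi>"
    using preRD(4)[OF R f\<phi>] by auto
  have el: "w \<cdot> (v' \<cdot> pb_pair C p t x s) = t \<cdot> s" "\<rho> \<cdot> pb_pair C p w x (v' \<cdot> pb_pair C p t x s) = \<phi> \<cdot> pb_pair C p t x s"
    if "pel p t x s" for x s
    using comp_reassoc[OF v'(4), of "pb_pair C p t x s"] comp_reassoc[OF \<rho>v', of "pb_pair C p t x s"] that by simp_all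
  \<comment> \<open>Both \<open>\<rho>\<close> and \<open>\<phi>\<close> are equivariant, so the
    defining equation of \<open>v'\<close> at \<open>ga g x\<close> reads as its equation at
    \<open>x\<close> with \<open>g\<close> applied to both sides. Cancelling \<open>g\<close> and
    using uniqueness in \<open>preR\<close> shows that \<open>v'\<close> is invariant.\<close>
  obtain v where v [simp]: "v \<in> Arr C" "Dom C v = Dom C t" "Cod C v = Dom C w" "v \<cdot> s0 = v'"
  proof (rule descend[OF t v'(1,2)])
    fix g x s assume xs: "pel p t x s" and gx: "pel (d0 G) q g x"
    have gs: "pel p t (ga g x) s" using xs gx by simp
    define u where "u = v' \<cdot> pb_pair C p t (ga g x) s"
    define y where "y = \<phi> \<cdot> pb_pair C p t x s"
    have u [simp]: "u \<in> Arr C" "Dom C u = Dom C s" "Cod C u = Dom C w" "w \<cdot> u = t \<cdot> s"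
      using gs el(1)[OF gs] unfolding u_def by simp_all
    have y [simp]: "y \<in> Arr C" "Dom C y = Dom C s" "Cod C y = Dom C f" "f \<cdot> y = q \<cdot> x"
      using xs gbilD(4)[OF \<phi> xs] unfolding y_def by simp_all
    have ux: "pel p w x u" using xs by simp
    have "act C G f a g (\<rho> \<cdot> pb_pair C p w x u) = \<rho> \<cdot> pb_pair C p w (ga g x) u"
      by (rule gbilD(5)[OF preRD(3)[OF R] ux gx, symmetric])
    also have "\<dots> = act C G f a g y"
      using el(2)[OF gs] gbilD(5)[OF \<phi> xs gx] unfolding u_def y_def by simp
    finally have "\<rho> \<cdot> pb_pair C p w x u = y"
      by - (rule G.ac_inj[OF X], use ux xs gx gbilD(4)[OF preRD(3)[OF R] ux] in simp_all)
    then show "v' \<cdot> pb_pair C p t (ga g x) s = v' \<cdot> pb_pair C p t x s"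
      unfolding u_def[symmetric] using xs el[OF xs] unfolding y_def[symmetric]
      by - (rule preRD(5)[OF R, of x y], simp_all)
  qed (simp_all add: s0_def)
  have "w \<cdot> v = t"
    by (rule descend_unique[OF t]) (simp_all add: s0_def[symmetric])
  moreover have "\<rho> \<cdot> pb_pair C p w x (v \<cdot> s) = \<phi> \<cdot> pb_pair C p t x s" if "pel p t x s" for x s
    using el(2)[OF that] comp_reassoc[OF v(4), of "pb_pair C p t x s"] that by simp
  ultimately show ?thesis using that v(1-3) by blast
qed

text \<open>Points of \<open>w\<close> may be compared after pulling back along \<open>p\<close>,
  where points \<open>x\<close> of \<open>P\<close> are available and \<open>\<rho>(x, _)\<close>
  separates them.\<close>

lemma preR_eqI:
  assumes R: "preR w \<rho> f a" and v: "v \<in> Arr C" "v' \<in> Arr C" "Dom C v = Dom C v'" "Cod C v = Dom C w" "Cod C v' = Dom C w" "w \<cdot> v = w \<cdot> v'"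
    and eq: "\<And>x s. s \<in> Arr C \<Longrightarrow> x \<in> Arr C \<Longrightarrow> Dom C x = Dom C s \<Longrightarrow> Cod C s = Dom C v' \<Longrightarrow> Cod C x = Dom C p \<Longrightarrow> p \<cdot> x = w \<cdot> (v' \<cdot> s) \<Longrightarrow>
      \<rho> \<cdot> pb_pair C p w x (v \<cdot> s) = \<rho> \<cdot> pb_pair C p w x (v' \<cdot> s)"
  shows "v = v'"
proof -
  note [simp] = preRD(1,2)[OF R]
  note \<rho> [simp] = gbilD(1-3)[OF preRD(3)[OF R]]
  define t where "t = w \<cdot> v'"
  have t [simp]: "t \<in> Arr C" "Dom C t = Dom C v'" "Cod C t = G0 H" "s \<in> Arr C \<Longrightarrow> Cod C s = Dom C v' \<Longrightarrow> w \<cdot> (v' \<cdot> s) = t \<cdot> s"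
    "s \<in> Arr C \<Longrightarrow> Cod C s = Dom C v' \<Longrightarrow> w \<cdot> (v \<cdot> s) = t \<cdot> s" for s
    unfolding t_def using v comp_reassoc[OF v(6), of s] by simp_all
  define x0 where "x0 = pb1 C p t"
  define s0 where "s0 = pb2 C p t"
  have xs [simp]: "x0 \<in> Arr C" "s0 \<in> Arr C" "Dom C x0 = pb_obj C p t" "Dom C s0 = pb_obj C p t" "Cod C x0 = Dom C p" "Cod C s0 = Dom C v'"
     "p \<cdot> x0 = t \<cdot> s0"
    unfolding x0_def s0_def by (simp_all add: pb_comm)
  have e: "\<rho> \<cdot> pb_pair C p w x0 (v \<cdot> s0) = \<rho> \<cdot> pb_pair C p w x0 (v' \<cdot> s0)"
    by (rule eq) simp_all
  have p2: "pel p w x0 (v' \<cdot> s0)" using v by simp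
  have "v \<cdot> s0 = v' \<cdot> s0"
    by (rule preRD(5)[OF R, of x0 "\<rho> \<cdot> pb_pair C p w x0 (v' \<cdot> s0)"])
      (use v e gbilD(4)[OF preRD(3)[OF R] p2] in simp_all)
  then show ?thesis
    by - (rule descend_unique[OF t(1,3)], use v in \<open>simp_all add: s0_def\<close>)
qed

definition "repR w b \<rho> f a \<longleftrightarrow> is_gobj C H w b \<and> preR w \<rho> f a \<and> bil w b \<rho> f a"

text \<open>The action on \<open>w\<close> is forced by \<open>H\<close>-invariance of
  \<open>\<rho>\<close>: the element \<open>h v\<close> must satisfy
  \<open>\<rho>(x, h v) = \<rho>(h\<inverse> x, v)\<close>. The right-hand side is equivariant under
  \<open>G\<close> because the two actions on \<open>P\<close> commute, so \<open>preR_lift\<close>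
  produces the action, and its laws are tested by \<open>preR_eqI\<close>.\<close>

lemma repR_ex:
  assumes X [simp]: "is_gobj C G f a"
  shows "\<exists>w b \<rho>. repR w b \<rho> f a"
proof -
  obtain w \<rho> where R: "preR w \<rho> f a" using preR_ex[OF X] by blast
  note [simp] = G.gobj_arr[OF X] preRD(1,2)[OF R]
  note \<rho> [simp] = gbilD(1-3)[OF preRD(3)[OF R]]
  \<comment> \<open>The carrier of the action, the object of pairs \<open>(h, v)\<close>, regarded
    over \<open>H0\<close> by the target of \<open>h\<close>; \<open>preR_lift\<close> is applied to
    it.\<close>
  define t where "t = d1 H \<cdot> pb1 C (d0 H) w"
  have t [simp]: "t \<in> Arr C" "Dom C t = pb_obj C (d0 H) w" "Cod C t = G0 H"
    "k \<in> Arr C \<Longrightarrow> Cod C k = pb_obj C (d0 H) w \<Longrightarrow> d1 H \<cdot> (pb1 C (d0 H) w \<cdot> k) = t \<cdot> k"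
    "k \<in> Arr C \<Longrightarrow> Cod C k = pb_obj C (d0 H) w \<Longrightarrow> d0 H \<cdot> (pb1 C (d0 H) w \<cdot> k) = w \<cdot> (pb2 C (d0 H) w \<cdot> k)" for k
    unfolding t_def by (simp_all add: pb_comm)
  define x1 where "x1 = pb1 C p t"
  define k1 where "k1 = pb2 C p t"
  have xk [simp]: "x1 \<in> Arr C" "k1 \<in> Arr C" "Dom C x1 = pb_obj C p t" "Dom C k1 = pb_obj C p t" "Cod C x1 = Dom C p" "Cod C k1 = pb_obj C (d0 H) w"
     "p \<cdot> x1 = t \<cdot> k1"
    unfolding x1_def k1_def by (simp_all add: pb_comm)
  have [simp]: "x1 \<cdot> pb_pair C p t x s = x" "k1 \<cdot> pb_pair C p t x s = s" if "pel p t x s" for x s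
    using that unfolding x1_def k1_def by simp_all
  define h1 where "h1 = pb1 C (d0 H) w \<cdot> k1"
  define v1 where "v1 = pb2 C (d0 H) w \<cdot> k1"
  have hv [simp]: "h1 \<in> Arr C" "v1 \<in> Arr C" "Dom C h1 = pb_obj C p t" "Dom C v1 = pb_obj C p t" "Cod C h1 = G1 H" "Cod C v1 = Dom C w"
    "d0 H \<cdot> h1 = w \<cdot> v1" "d1 H \<cdot> h1 = t \<cdot> k1"
    unfolding h1_def v1_def by simp_all
  define \<phi> where "\<phi> = \<rho> \<cdot> pb_pair C p w (ha (gi H \<cdot> h1) x1) v1"
  have \<phi>t: "\<phi> \<in> Arr C" "Dom C \<phi> = pb_obj C p t" "Cod C \<phi> = Dom C f" unfolding \<phi>_def by simp_all
  have \<phi>p: "\<phi> \<cdot> pb_pair C p t x k = \<rho> \<cdot> pb_pair C p w (ha (gi H \<cdot> (pb1 C (d0 H) w \<cdot> k)) x) (pb2 C (d0 H) w \<cdot> k)" if "pel p t x k" for x k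
    unfolding \<phi>_def h1_def v1_def using that by simp
  have "gbil t \<phi> f a"
    unfolding gbil_def
  proof (intro conjI allI impI)
    fix x k assume xk: "pel p t x k"
    show "f \<cdot> (\<phi> \<cdot> pb_pair C p t x k) = q \<cdot> x"
      unfolding \<phi>p[OF xk] by (subst gbilD(4)[OF preRD(3)[OF R]]) (use xk in simp_all)
  next
    fix g x k assume xk: "pel p t x k \<and> pel (d0 G) q g x"
    let ?h = "gi H \<cdot> (pb1 C (d0 H) w \<cdot> k)" and ?v = "pb2 C (d0 H) w \<cdot> k"
    have a: "pel p w (ha ?h x) ?v" "pel (d0 G) q g (ha ?h x)" using xk by simp_all
    have b: "ha ?h (ga g x) = ga g (ha ?h x)" using xk by simp
    have c: "pel p t x k" "pel p t (ga g x) k" using xk by simp_all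
    show "\<phi> \<cdot> pb_pair C p t (ga g x) k = act C G f a g (\<phi> \<cdot> pb_pair C p t x k)"
      unfolding \<phi>p[OF c(1)] \<phi>p[OF c(2)] b by (rule gbilD(5)[OF preRD(3)[OF R] a])
  qed (use \<phi>t in simp_all)
  then obtain b where b [simp]: "b \<in> Arr C" "Dom C b = pb_obj C (d0 H) w" "Cod C b = Dom C w" and wb: "w \<cdot> b = t"
    and \<rho>b: "\<And>x k. pel p t x k \<Longrightarrow> \<rho> \<cdot> pb_pair C p w x (b \<cdot> k) = \<phi> \<cdot> pb_pair C p t x k"
    using preR_lift[OF X R t(1,3)] t(2) by metis
  let ?b = "act C H w b"
  have bt [simp]: "?b h v \<in> Arr C" "Dom C (?b h v) = Dom C v" "Cod C (?b h v) = Dom C w" "w \<cdot> ?b h v = d1 H \<cdot> h" if "pel (d0 H) w h v" for h v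
    using that comp_reassoc[OF wb, of "pb_pair C (d0 H) w h v"] unfolding act_def by (simp_all add: t_def)
  have bs [simp]: "?b h v \<cdot> s = ?b (h \<cdot> s) (v \<cdot> s)" if "pel (d0 H) w h v" "s \<in> Arr C" "Cod C s = Dom C v" for h v s
    using that unfolding act_def by simp
  have \<rho>a: "\<rho> \<cdot> pb_pair C p w x (?b h v) = \<rho> \<cdot> pb_pair C p w (ha (gi H \<cdot> h) x) v"
    if hv: "pel (d0 H) w h v" and x: "x \<in> Arr C" "Dom C x = Dom C v" "Cod C x = Dom C p" "p \<cdot> x = d1 H \<cdot> h" for h v x
  proof -
    have "t \<cdot> pb_pair C (d0 H) w h v = d1 H \<cdot> h" unfolding t_def using hv by simp
    then have xk: "pel p t x (pb_pair C (d0 H) w h v)" using hv x by simp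
    show ?thesis using \<rho>b[OF xk] \<phi>p[OF xk] hv unfolding act_def[of C H w] by simp
  qed
  have W [simp]: "is_gobj C H w b"
  proof (rule H.gobjI)
    fix v assume v: "v \<in> Arr C" "Cod C v = Dom C w"
    show "?b (ge H \<cdot> (w \<cdot> v)) v = v"
    proof (rule preR_eqI[OF R])
      fix x s assume s: "s \<in> Arr C" "x \<in> Arr C" "Dom C x = Dom C s" "Cod C s = Dom C v" "Cod C x = Dom C p" "p \<cdot> x = w \<cdot> (v \<cdot> s)"
      show "\<rho> \<cdot> pb_pair C p w x (?b (ge H \<cdot> (w \<cdot> v)) v \<cdot> s) = \<rho> \<cdot> pb_pair C p w x (v \<cdot> s)"
        using s v by (simp add: \<rho>a)
    qed (use v in simp_all)
  next
    fix h1 h2 v assume v: "pel (d0 H) w h2 v" and h1: "h1 \<in> Arr C" "Dom C h1 = Dom C v" "Cod C h1 = G1 H" "d0 H \<cdot> h1 = d1 H \<cdot> h2"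
    show "?b h1 (?b h2 v) = ?b (gmul C H h1 h2) v"
    proof (rule preR_eqI[OF R])
      fix x s assume s: "s \<in> Arr C" "x \<in> Arr C" "Dom C x = Dom C s" "Cod C s = Dom C (?b (gmul C H h1 h2) v)" "Cod C x = Dom C p"
        "p \<cdot> x = w \<cdot> (?b (gmul C H h1 h2) v \<cdot> s)"
      have st [simp]: "s \<in> Arr C" "x \<in> Arr C" "Dom C x = Dom C s" "Cod C x = Dom C p" "Cod C s = Dom C v"
        using s(1-5) v h1 by simp_all
      have d0s [simp]: "d0 H \<cdot> (h1 \<cdot> s) = d1 H \<cdot> (h2 \<cdot> s)" "d0 H \<cdot> (h2 \<cdot> s) = w \<cdot> (v \<cdot> s)"
        using v h1 comp_reassoc[OF h1(4), of s] comp_reassoc[of "d0 H" h2 "w \<cdot> v" s] by simp_all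
      have s' [simp]: "p \<cdot> x = d1 H \<cdot> (h1 \<cdot> s)"
        using s(6) v h1 by simp
      have "\<rho> \<cdot> pb_pair C p w x (?b h1 (?b h2 v) \<cdot> s) = \<rho> \<cdot> pb_pair C p w (ha (gi H \<cdot> (h2 \<cdot> s)) (ha (gi H \<cdot> (h1 \<cdot> s)) x)) (v \<cdot> s)"
        using v h1 by (simp add: \<rho>a del: H.ac_ac)
      also have "\<dots> = \<rho> \<cdot> pb_pair C p w x (?b (gmul C H h1 h2) v \<cdot> s)"
        using v h1 by (simp add: \<rho>a H.inv_mul)
      finally show "\<rho> \<cdot> pb_pair C p w x (?b h1 (?b h2 v) \<cdot> s) = \<rho> \<cdot> pb_pair C p w x (?b (gmul C H h1 h2) v \<cdot> s)" .
    qed (use v h1 in simp_all)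
  qed simp_all
  have "bil w b \<rho> f a"
    unfolding bil_def
  proof (intro conjI allI impI)
    fix h x v assume "pel p w x v \<and> pel (d0 H) p h x"
    then show "\<rho> \<cdot> pb_pair C p w (ha h x) (?b h v) = \<rho> \<cdot> pb_pair C p w x v"
      by (simp add: \<rho>a)
  qed (rule preRD(3)[OF R])
  then show ?thesis using W R unfolding repR_def by blast
qed

text \<open>The functor that sends \<open>w\<close> to the pullback of \<open>p\<close> and
  \<open>w\<close>, on an arrow \<open>k\<close> over \<open>H0\<close>.\<close>

definition "pm w w' k = pb_pair C p w (pb1 C p w') (k \<cdot> pb2 C p w')"

lemma pm [simp]:
  assumes "w \<in> Arr C" "Cod C w = G0 H" "w' \<in> Arr C" "Cod C w' = G0 H" "k \<in> Arr C" "Dom C k = Dom C w'" "Cod C k = Dom C w" "w \<cdot> k = w'"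
  shows "pm w w' k \<in> Arr C" "Dom C (pm w w' k) = pb_obj C p w'" "Cod C (pm w w' k) = pb_obj C p w"
    "pel p w' x s \<Longrightarrow> pm w w' k \<cdot> pb_pair C p w' x s = pb_pair C p w x (k \<cdot> s)"
    "pb1 C p w \<cdot> pm w w' k = pb1 C p w'" "pb2 C p w \<cdot> pm w w' k = k \<cdot> pb2 C p w'"
proof -
  have e: "p \<cdot> pb1 C p w' = w \<cdot> (k \<cdot> pb2 C p w')"
    using assms comp_reassoc[OF assms(8), of "pb2 C p w'"] by (simp add: pb_comm)
  show "pm w w' k \<in> Arr C" "Dom C (pm w w' k) = pb_obj C p w'" "Cod C (pm w w' k) = pb_obj C p w"
    "pb1 C p w \<cdot> pm w w' k = pb1 C p w'" "pb2 C p w \<cdot> pm w w' k = k \<cdot> pb2 C p w'"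
    unfolding pm_def using assms e by simp_all
  show "pel p w' x s \<Longrightarrow> pm w w' k \<cdot> pb_pair C p w' x s = pb_pair C p w x (k \<cdot> s)"
    unfolding pm_def using assms(1-7) e by simp
qed

lemma arrow_eqI:
  assumes w [simp]: "w \<in> Arr C" "Cod C w = G0 H" and \<phi> [simp]: "\<phi> \<in> Arr C" "\<psi> \<in> Arr C" "Dom C \<phi> = pb_obj C p w" "Dom C \<psi> = pb_obj C p w"
    and "\<And>x v. pel p w x v \<Longrightarrow> \<phi> \<cdot> pb_pair C p w x v = \<psi> \<cdot> pb_pair C p w x v"
  shows "\<phi> = \<psi>"
  using assms(7)[of "pb1 C p w" "pb2 C p w"] by (simp add: pb_comm)

text \<open>The arrow comes from \<open>preR_lift\<close>, which handles the structure over
  \<open>H0\<close> and the action of \<open>G\<close>. Equivariance under \<open>H\<close> is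
  tested against points of \<open>P\<close> by \<open>preR_eqI\<close>, where it follows from
  invariance of both \<open>\<phi>\<close> and \<open>\<rho>\<close>.\<close>

lemma repR_univ:
  assumes X: "is_gobj C G f a" and R: "repR w b \<rho> f a" and W: "is_gobj C H w' b'" and \<phi>: "bil w' b' \<phi> f a"
  shows "\<exists>k. k \<in> Arr C \<and> Dom C k = Dom C w' \<and> Cod C k = Dom C w \<and> equivariant C H (w', b') k (w, b) \<and> \<rho> \<cdot> pm w w' k = \<phi>"
    and "k \<in> Arr C \<Longrightarrow> k' \<in> Arr C \<Longrightarrow> Dom C k = Dom C w' \<Longrightarrow> Dom C k' = Dom C w' \<Longrightarrow> Cod C k = Dom C w \<Longrightarrow> Cod C k' = Dom C w \<Longrightarrow>
      w \<cdot> k = w' \<Longrightarrow> w \<cdot> k' = w' \<Longrightarrow> \<rho> \<cdot> pm w w' k = \<phi> \<Longrightarrow> \<rho> \<cdot> pm w w' k' = \<phi> \<Longrightarrow> k = k'"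
proof -
  have W' [simp]: "is_gobj C H w b" and pR: "preR w \<rho> f a" and \<rho>b: "bil w b \<rho> f a" using R unfolding repR_def by auto
  note [simp] = G.gobj_arr[OF X] H.gobj_arr[OF W] H.gobj_arr[OF W'] X W
  note [simp] = gbilD(1-3)[OF bilD(1)[OF \<rho>b]] gbilD(1-3)[OF bilD(1)[OF \<phi>]]
  obtain k where k [simp]: "k \<in> Arr C" "Dom C k = Dom C w'" "Cod C k = Dom C w" "w \<cdot> k = w'"
    and \<rho>k: "\<And>x s. pel p w' x s \<Longrightarrow> \<rho> \<cdot> pb_pair C p w x (k \<cdot> s) = \<phi> \<cdot> pb_pair C p w' x s"
    using preR_lift[OF X pR _ _ bilD(1)[OF \<phi>]] by (metis H.gobj_arr(1,2)[OF W])
  have wk [simp]: "w \<cdot> (k \<cdot> s) = w' \<cdot> s" if "s \<in> Arr C" "Cod C s = Dom C w'" for s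
    using comp_reassoc[OF k(4), of s] that by simp
  have "equivariant C H (w', b') k (w, b)"
  proof (rule H.equivariantI)
    fix h v assume hv: "pel (d0 H) w' h v"
    show "k \<cdot> act C H w' b' h v = act C H w b h (k \<cdot> v)"
    proof (rule preR_eqI[OF pR])
      fix x s assume s: "s \<in> Arr C" "x \<in> Arr C" "Dom C x = Dom C s" "Cod C s = Dom C (act C H w b h (k \<cdot> v))" "Cod C x = Dom C p"
        "p \<cdot> x = w \<cdot> (act C H w b h (k \<cdot> v) \<cdot> s)"
      have st [simp]: "s \<in> Arr C" "x \<in> Arr C" "Dom C x = Dom C s" "Cod C x = Dom C p" "Cod C s = Dom C v"
        using s(1-5) hv by simp_all
      have d0s [simp]: "d0 H \<cdot> (h \<cdot> s) = w' \<cdot> (v \<cdot> s)"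
        using hv comp_reassoc[of "d0 H" h "w' \<cdot> v" s] by simp
      have px [simp]: "p \<cdot> x = d1 H \<cdot> (h \<cdot> s)"
        using s(6) hv by simp
      \<comment> \<open>The test point \<open>x\<close> lies over the target of \<open>h\<close>,
        whereas invariance starts from a point over the source; \<open>?x\<close> is that point, and
        acting with \<open>h\<close> gives \<open>x\<close> back.\<close>
      let ?x = "ha (gi H \<cdot> (h \<cdot> s)) x"
      have x1: "pel p w ?x (k \<cdot> (v \<cdot> s))" "pel (d0 H) p (h \<cdot> s) ?x" "pel p w' ?x (v \<cdot> s)" using hv by simp_all
      have x2: "ha (h \<cdot> s) ?x = x" using hv by simp
      have x3: "pel p w' x (act C H w' b' (h \<cdot> s) (v \<cdot> s))" using hv by simp
      have "\<rho> \<cdot> pb_pair C p w x (k \<cdot> act C H w' b' (h \<cdot> s) (v \<cdot> s)) = \<phi> \<cdot> pb_pair C p w' (ha (h \<cdot> s) ?x) (act C H w' b' (h \<cdot> s) (v \<cdot> s))"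
        unfolding x2 by (rule \<rho>k[OF x3])
      also have "\<dots> = \<phi> \<cdot> pb_pair C p w' ?x (v \<cdot> s)" by (rule bilD(2)[OF \<phi> x1(3,2)])
      also have "\<dots> = \<rho> \<cdot> pb_pair C p w ?x (k \<cdot> (v \<cdot> s))" by (rule \<rho>k[OF x1(3), symmetric])
      also have "\<dots> = \<rho> \<cdot> pb_pair C p w (ha (h \<cdot> s) ?x) (act C H w b (h \<cdot> s) (k \<cdot> (v \<cdot> s)))" by (rule bilD(2)[OF \<rho>b x1(1,2), symmetric])
      finally show "\<rho> \<cdot> pb_pair C p w x ((k \<cdot> act C H w' b' h v) \<cdot> s) = \<rho> \<cdot> pb_pair C p w x (act C H w b h (k \<cdot> v) \<cdot> s)"
        unfolding x2 using hv by simp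
    qed (use hv in simp_all)
  qed simp_all
  moreover have "\<rho> \<cdot> pm w w' k = \<phi>"
    by (rule arrow_eqI[of w']) (simp_all add: \<rho>k)
  ultimately show "\<exists>k. k \<in> Arr C \<and> Dom C k = Dom C w' \<and> Cod C k = Dom C w \<and> equivariant C H (w', b') k (w, b) \<and> \<rho> \<cdot> pm w w' k = \<phi>"
    using k by blast
next
  have W' [simp]: "is_gobj C H w b" and pR: "preR w \<rho> f a" and \<rho>b: "bil w b \<rho> f a" using R unfolding repR_def by auto
  note [simp] = H.gobj_arr[OF W] H.gobj_arr[OF W'] gbilD(1-3)[OF bilD(1)[OF \<rho>b]]
  assume k: "k \<in> Arr C" "k' \<in> Arr C" "Dom C k = Dom C w'" "Dom C k' = Dom C w'" "Cod C k = Dom C w" "Cod C k' = Dom C w"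
      "w \<cdot> k = w'" "w \<cdot> k' = w'" and e: "\<rho> \<cdot> pm w w' k = \<phi>" "\<rho> \<cdot> pm w w' k' = \<phi>"
  show "k = k'"
  proof (rule preR_eqI[OF pR])
    fix x s assume s: "s \<in> Arr C" "x \<in> Arr C" "Dom C x = Dom C s" "Cod C s = Dom C k'" "Cod C x = Dom C p" "p \<cdot> x = w \<cdot> (k' \<cdot> s)"
    have xs: "pel p w' x s" using s k comp_reassoc[OF k(8), of s] by simp
    have "\<rho> \<cdot> (pm w w' k \<cdot> pb_pair C p w' x s) = \<phi> \<cdot> pb_pair C p w' x s"
      by (rule comp_reassoc[OF e(1)]) (use k xs in simp_all)
    moreover have "\<rho> \<cdot> (pm w w' k' \<cdot> pb_pair C p w' x s) = \<phi> \<cdot> pb_pair C p w' x s"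
      by (rule comp_reassoc[OF e(2)]) (use k xs in simp_all)
    moreover have "pm w w' k \<cdot> pb_pair C p w' x s = pb_pair C p w x (k \<cdot> s)" "pm w w' k' \<cdot> pb_pair C p w' x s = pb_pair C p w x (k' \<cdot> s)"
      using k xs by simp_all
    ultimately show "\<rho> \<cdot> pb_pair C p w x (k \<cdot> s) = \<rho> \<cdot> pb_pair C p w x (k' \<cdot> s)" by simp
  qed (use k in simp_all)
qed

text \<open>Points of \<open>T\<^sub>G 1\<close> over \<open>q x\<close> are arrows \<open>y\<close>
  of \<open>G\<close> with target \<open>q x\<close>, and \<open>v = y\<inverse> x\<close> is the
  unique point in the fibre of \<open>p\<close> through \<open>x\<close> with division
  \<open>dv x v = y\<close>. Invariance under \<open>H\<close> is \<open>dv_ha\<close>.\<close>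

lemma repR_free_one: "repR p c dvar (d1 G) (gm G)"
proof -
  have g: "gbil p dvar (d1 G) (gm G)"
    unfolding gbil_def
  proof (intro conjI allI impI)
    fix x v assume "pel p p x v"
    then show "d1 G \<cdot> (dvar \<cdot> pb_pair C p p x v) = q \<cdot> x" by (simp add: dv_def[symmetric])
  next
    fix g x v assume x: "pel p p x v \<and> pel (d0 G) q g x"
    have "dv (ga g x) v = gmul C G g (dv x v)"
    proof (rule dv_unique)
      have "ga (gmul C G g (dv x v)) v = ga g (ga (dv x v) v)"
        by (rule G.ac_ac[OF gq, symmetric]) (use x in simp_all)
      then show "ga (gmul C G g (dv x v)) v = ga g x" using x by simp
    qed (use x in simp)
    then show "dvar \<cdot> pb_pair C p p (ga g x) v = act C G (d1 G) (gm G) g (dvar \<cdot> pb_pair C p p x v)"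
      unfolding G.ac_free_one dv_def .
  qed simp_all
  have "preR p dvar (d1 G) (gm G)"
    unfolding preR_def
  proof (intro conjI allI impI)
    fix x y assume xy: "pel q (d1 G) x y"
    show "\<exists>!v. v \<in> Arr C \<and> Dom C v = Dom C y \<and> Cod C v = Dom C p \<and> p \<cdot> v = p \<cdot> x \<and> dvar \<cdot> pb_pair C p p x v = y"
    proof (rule ex1I[of _ "ga (gi G \<cdot> y) x"])
      have "dv x (ga (gi G \<cdot> y) x) = y" by (rule dv_unique) (use xy in simp_all)
      then show "ga (gi G \<cdot> y) x \<in> Arr C \<and> Dom C (ga (gi G \<cdot> y) x) = Dom C y \<and> Cod C (ga (gi G \<cdot> y) x) = Dom C p \<and>
          p \<cdot> ga (gi G \<cdot> y) x = p \<cdot> x \<and> dvar \<cdot> pb_pair C p p x (ga (gi G \<cdot> y) x) = y"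
        using xy unfolding dv_def by simp
      fix v
      assume v: "v \<in> Arr C \<and> Dom C v = Dom C y \<and> Cod C v = Dom C p \<and> p \<cdot> v = p \<cdot> x \<and> dvar \<cdot> pb_pair C p p x v = y"
      then have xv: "pel p p x v" and y: "dv x v = y" using xy unfolding dv_def by simp_all
      have "ga (gi G \<cdot> dv x v) (ga (dv x v) v) = v"
        by (subst G.ac_ac[OF gq]) (use xv in simp_all)
      then show "v = ga (gi G \<cdot> y) x" using dv_arr(5)[OF xv] unfolding y by simp
    qed
  qed (use g in simp_all)
  moreover have "bil p c dvar (d1 G) (gm G)"
    unfolding bil_def using g dv_ha unfolding dv_def by simp
  ultimately show ?thesis unfolding repR_def by simp
qed

subsection \<open>The left adjoint\<close>

text \<open>The product of \<open>(P, c)\<close> and \<open>(w, b)\<close> in \<open>[H, C]\<close> has structure map \<open>PWf w\<close> and action \<open>PWa w b\<close>.\<close>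

definition "PWf w = p \<cdot> pb1 C p w"
definition "PWa w b = snd (H.diag p c w b p w)"

lemma PW:
  assumes W [simp]: "is_gobj C H w b"
  shows "is_gobj C H (PWf w) (PWa w b)" "Dom C (PWf w) = pb_obj C p w"
    "equivariant C H (PWf w, PWa w b) (pb1 C p w) (p, c)" "equivariant C H (PWf w, PWa w b) (pb2 C p w) (w, b)"
    "pel p w x v \<Longrightarrow> pel (d0 H) p h x \<Longrightarrow> act C H (PWf w) (PWa w b) h (pb_pair C p w x v) = pb_pair C p w (ha h x) (act C H w b h v)"
    "y \<in> Arr C \<Longrightarrow> Cod C y = pb_obj C p w \<Longrightarrow> PWf w \<cdot> y = p \<cdot> (pb1 C p w \<cdot> y)"
proof -
  note [simp] = H.gobj_arr[OF W]
  obtain t A where tA: "H.diag p c w b p w = (t, A)" by (cases "H.diag p c w b p w")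
  have *: "is_gobj C H t A" "t = PWf w" "equivariant C H (t, A) (pb1 C p w) (p, c)" "equivariant C H (t, A) (pb2 C p w) (w, b)"
    "\<And>g z. pel (d0 H) t g z \<Longrightarrow> pb1 C p w \<cdot> act C H t A g z = ha g (pb1 C p w \<cdot> z) \<and>
      pb2 C p w \<cdot> act C H t A g z = act C H w b g (pb2 C p w \<cdot> z)"
    using H.diag_product[OF gp W] unfolding tA case_prod_conv PWf_def by blast+
  have A: "PWa w b = A" unfolding PWa_def tA by simp
  show g: "is_gobj C H (PWf w) (PWa w b)" and D: "Dom C (PWf w) = pb_obj C p w"
    using * unfolding A by (simp_all add: PWf_def)
  show "equivariant C H (PWf w, PWa w b) (pb1 C p w) (p, c)" "equivariant C H (PWf w, PWa w b) (pb2 C p w) (w, b)"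
    using * unfolding A by simp_all
  show e: "y \<in> Arr C \<Longrightarrow> Cod C y = pb_obj C p w \<Longrightarrow> PWf w \<cdot> y = p \<cdot> (pb1 C p w \<cdot> y)" for y
    unfolding PWf_def by simp
  assume xv: "pel p w x v" and hx: "pel (d0 H) p h x"
  have r: "pel (d0 H) (PWf w) h (pb_pair C p w x v)" using xv hx D by (simp add: e)
  show "act C H (PWf w) (PWa w b) h (pb_pair C p w x v) = pb_pair C p w (ha h x) (act C H w b h v)"
  proof (rule pb_eqI[of p w])
    show "pb1 C p w \<cdot> act C H (PWf w) (PWa w b) h (pb_pair C p w x v) = pb1 C p w \<cdot> pb_pair C p w (ha h x) (act C H w b h v)"
      using *(5)[of h "pb_pair C p w x v"] r xv hx unfolding A *(2) by simp
    show "pb2 C p w \<cdot> act C H (PWf w) (PWa w b) h (pb_pair C p w x v) = pb2 C p w \<cdot> pb_pair C p w (ha h x) (act C H w b h v)"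
      using *(5)[of h "pb_pair C p w x v"] r xv hx unfolding A *(2) by simp
  qed (use H.ac_arr(1-3)[OF g r] xv hx D in simp_all)
qed

lemma PW_invariant:
  assumes W: "is_gobj C H w b"
  shows "H.invariant (PWf w) (PWa w b) \<phi> \<longleftrightarrow> \<phi> \<in> Arr C \<and> Dom C \<phi> = pb_obj C p w \<and>
    (\<forall>h x v. pel p w x v \<and> pel (d0 H) p h x \<longrightarrow> \<phi> \<cdot> pb_pair C p w (ha h x) (act C H w b h v) = \<phi> \<cdot> pb_pair C p w x v)"
    (is "?l \<longleftrightarrow> ?r")
proof
  note [simp] = H.gobj_arr[OF W] PW(2)[OF W] W
  assume l: ?l
  have "\<phi> \<cdot> pb_pair C p w (ha h x) (act C H w b h v) = \<phi> \<cdot> pb_pair C p w x v" if "pel p w x v" "pel (d0 H) p h x" for h x v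
    using H.invariantD(3)[OF l, of h "pb_pair C p w x v"] PW(5)[OF W that] that by (simp add: PW(6)[OF W])
  then show ?r using H.invariantD(1,2)[OF l] by simp
next
  note [simp] = H.gobj_arr[OF W] PW(2)[OF W] W
  assume r: ?r
  show ?l
  proof (rule H.invariantI)
    fix h y assume hy: "pel (d0 H) (PWf w) h y"
    define x where "x = pb1 C p w \<cdot> y"
    define v where "v = pb2 C p w \<cdot> y"
    have y: "y = pb_pair C p w x v" and xv: "pel p w x v"
      unfolding x_def v_def using hy pb_comm(2)[of p w y] by simp_all
    have hx: "pel (d0 H) p h x" using hy by (simp add: x_def PW(6)[OF W])
    show "\<phi> \<cdot> act C H (PWf w) (PWa w b) h y = \<phi> \<cdot> y"
      unfolding y PW(5)[OF W xv hx] using r xv hx by blast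
  qed (use r in simp_all)
qed

text \<open>The quotient clause carries the universal property: \<open>repL_univ\<close> and
  \<open>repL_ext\<close> derive from it that \<open>lm\<close> is the universal bilinear map out of
  \<open>(w, b)\<close>.\<close>

definition "repL w b lm f a \<longleftrightarrow> is_gobj C G f a \<and> bil w b lm f a \<and> H.quot (PWf w) (PWa w b) lm"

text \<open>A point \<open>m\<close> of the quotient has no representative, but it acquires one,
  \<open>(x, v)\<close>, after restriction along \<open>e\<close>, the pullback of the quotient map
  along \<open>m\<close>. Equations about \<open>m\<close> may be tested on \<open>e\<close> by
  \<open>quot_lift_cancel\<close>.\<close>

lemma quot_local:
  assumes W: "is_gobj C H w b" and q: "H.quot (PWf w) (PWa w b) z" and m: "m \<in> Arr C" "Cod C m = Cod C z"
  obtains e x v where "e \<in> Arr C" "Cod C e = Dom C m" "Dom C e = Dom C v" "pel p w x v" "z \<cdot> pb_pair C p w x v = m \<cdot> e"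
    "\<And>k k'. k \<in> Arr C \<Longrightarrow> k' \<in> Arr C \<Longrightarrow> Dom C k = Dom C m \<Longrightarrow> Dom C k' = Dom C m \<Longrightarrow> Cod C k = Cod C k' \<Longrightarrow> k \<cdot> e = k' \<cdot> e \<Longrightarrow> k = k'"
proof -
  note [simp] = H.gobj_arr[OF W] PW(2)[OF W] W m H.quotD(2,3)[OF q]
  define y where "y = pb1 C z m"
  have y [simp]: "y \<in> Arr C" "Dom C y = pb_obj C z m" "Cod C y = pb_obj C p w" unfolding y_def by simp_all
  have xv: "pel p w (pb1 C p w \<cdot> y) (pb2 C p w \<cdot> y)" using pb_comm(2)[of p w y] by simp
  have 1: "z \<cdot> pb_pair C p w (pb1 C p w \<cdot> y) (pb2 C p w \<cdot> y) = m \<cdot> pb2 C z m"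
    using pb_comm(1)[of z m] by (simp add: y_def)
  have 2: "k = k'" if "k \<in> Arr C" "k' \<in> Arr C" "Dom C k = Dom C m" "Dom C k' = Dom C m" "Cod C k = Cod C k'" "k \<cdot> pb2 C z m = k' \<cdot> pb2 C z m" for k k'
    by (rule H.quot_lift_cancel[OF PW(1)[OF W] q m that])
  show ?thesis
    by (rule that[OF _ _ _ xv 1 2]) simp_all
qed

text \<open>The action of \<open>G\<close> on classes should be \<open>g [x, v] = [g x, v]\<close>.
  To define it, pairs \<open>(g, [x, v])\<close> must themselves form a quotient by \<open>H\<close>
  of the triples \<open>(g, x, v)\<close>, and this is the stability statement
  \<open>H.quot_lift\<close>. All laws are then verified on local representatives.\<close>

lemma repL_ex:
  assumes W: "is_gobj C H w b"
  shows "\<exists>f a lm. repL w b lm f a"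
proof -
  note [simp] = H.gobj_arr[OF W] PW(2)[OF W] W
  note PW1 [simp] = PW(1)[OF W]
  define z where "z = H.zeta (PWf w, PWa w b)"
  have qz: "H.quot (PWf w) (PWa w b) z" unfolding z_def by (rule H.quot_zeta[OF PW1])
  have z [simp]: "z \<in> Arr C" "Dom C z = pb_obj C p w" using H.quotD(2,3)[OF qz] by simp_all
  have z_inv: "z \<cdot> pb_pair C p w (ha h x) (act C H w b h v) = z \<cdot> pb_pair C p w x v" if "pel p w x v" "pel (d0 H) p h x" for h x v
    using H.quotD(1)[OF qz] that unfolding PW_invariant[OF W] by blast
  have i: "H.invariant (PWf w) (PWa w b) (q \<cdot> pb1 C p w)"
    unfolding PW_invariant[OF W] by simp
  obtain f where f0: "f \<in> Arr C" "Dom C f = Cod C z" "Cod C f = Cod C (q \<cdot> pb1 C p w)" and fz: "f \<cdot> z = q \<cdot> pb1 C p w"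
    using H.quot_ex[OF qz i] by blast
  then have f [simp]: "f \<in> Arr C" "Dom C f = Cod C z" "Cod C f = G0 G" by simp_all
  have fzy: "f \<cdot> (z \<cdot> y) = q \<cdot> (pb1 C p w \<cdot> y)" if "y \<in> Arr C" "Cod C y = pb_obj C p w" for y
    using comp_reassoc[OF fz, of y] that by simp
  \<comment> \<open>Pulling the quotient map \<open>z\<close> back along \<open>u\<close> gives the
    triples \<open>(g, x, v)\<close> with their map \<open>k0\<close> to the pairs
    \<open>(g, [x, v])\<close>.\<close>
  define u where "u = pb2 C (d0 G) f"
  have u [simp]: "u \<in> Arr C" "Dom C u = pb_obj C (d0 G) f" "Cod C u = Cod C z" unfolding u_def by simp_all
  obtain t' A' where T': "is_gobj C H t' A'" and DT' [simp]: "Dom C t' = pb_obj C z u" and q': "H.quot t' A' (pb2 C z u)" and t': "t' = PWf w \<cdot> pb1 C z u"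
    and act': "\<And>h m. pel (d0 H) t' h m \<Longrightarrow> pb1 C z u \<cdot> act C H t' A' h m = act C H (PWf w) (PWa w b) h (pb1 C z u \<cdot> m) \<and>
       pb2 C z u \<cdot> act C H t' A' h m = pb2 C z u \<cdot> m"
    using H.quot_lift[OF PW1 qz u(1,3)] by blast
  define y0 where "y0 = pb1 C z u"
  define k0 where "k0 = pb2 C z u"
  have yk [simp]: "y0 \<in> Arr C" "k0 \<in> Arr C" "Dom C y0 = pb_obj C z u" "Dom C k0 = pb_obj C z u" "Cod C y0 = pb_obj C p w" "Cod C k0 = pb_obj C (d0 G) f"
    "z \<cdot> y0 = u \<cdot> k0"
    unfolding y0_def k0_def by (simp_all add: pb_comm)
  define x0 where "x0 = pb1 C p w \<cdot> y0"
  define v0 where "v0 = pb2 C p w \<cdot> y0"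
  define g0 where "g0 = pb1 C (d0 G) f \<cdot> k0"
  have xv0 [simp]: "x0 \<in> Arr C" "v0 \<in> Arr C" "g0 \<in> Arr C" "Dom C x0 = pb_obj C z u" "Dom C v0 = pb_obj C z u" "Dom C g0 = pb_obj C z u"
    "Cod C x0 = Dom C p" "Cod C v0 = Dom C w" "Cod C g0 = G1 G" "p \<cdot> x0 = w \<cdot> v0"
    unfolding x0_def v0_def g0_def by (simp_all add: pb_comm)
  have dg0 [simp]: "d0 G \<cdot> g0 = q \<cdot> x0"
  proof -
    have "d0 G \<cdot> g0 = f \<cdot> (u \<cdot> k0)" unfolding g0_def u_def by (simp add: pb_comm)
    also have "\<dots> = q \<cdot> x0" unfolding yk(7)[symmetric] x0_def by (rule fzy) simp_all
    finally show ?thesis .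
  qed
  \<comment> \<open>The intended action before passing to the quotient. It is invariant under
    \<open>H\<close> because the actions of \<open>G\<close> and \<open>H\<close> on
    \<open>P\<close> commute, so it factors through \<open>k0\<close>.\<close>
  define \<chi> where "\<chi> = z \<cdot> pb_pair C p w (ga g0 x0) v0"
  have \<chi> [simp]: "\<chi> \<in> Arr C" "Dom C \<chi> = pb_obj C z u" "Cod C \<chi> = Cod C z" unfolding \<chi>_def by simp_all
  have \<chi>m: "\<chi> \<cdot> m = z \<cdot> pb_pair C p w (ga (g0 \<cdot> m) (x0 \<cdot> m)) (v0 \<cdot> m)" if "m \<in> Arr C" "Cod C m = pb_obj C z u" for m
    unfolding \<chi>_def using that by simp
  have i': "H.invariant t' A' \<chi>"
  proof (rule H.invariantI)
    fix h m assume hm: "pel (d0 H) t' h m"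
    have mt [simp]: "m \<in> Arr C" "Dom C h = Dom C m" "Cod C m = pb_obj C z u" "h \<in> Arr C" "Cod C h = G1 H" using hm by simp_all
    have d0h [simp]: "d0 H \<cdot> h = w \<cdot> (v0 \<cdot> m)"
    proof -
      have "d0 H \<cdot> h = PWf w \<cdot> (y0 \<cdot> m)"
        using hm H.gobj_arr[OF PW1] unfolding t' y0_def by simp
      also have "\<dots> = p \<cdot> (x0 \<cdot> m)" unfolding x0_def by (subst PW(6)[OF W]) simp_all
      also have "\<dots> = w \<cdot> (v0 \<cdot> m)" using comp_reassoc[OF xv0(10), of m] by simp
      finally show ?thesis .
    qed
    have pxm [simp]: "p \<cdot> (x0 \<cdot> m) = w \<cdot> (v0 \<cdot> m)" "d0 G \<cdot> (g0 \<cdot> m) = q \<cdot> (x0 \<cdot> m)"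
      using comp_reassoc[OF xv0(10), of m] comp_reassoc[OF dg0, of m] by simp_all
    let ?m = "act C H t' A' h m"
    have m' [simp]: "?m \<in> Arr C" "Dom C ?m = Dom C m" "Cod C ?m = pb_obj C z u"
      using H.ac_arr[OF T' hm] by simp_all
    have ym: "y0 \<cdot> m = pb_pair C p w (x0 \<cdot> m) (v0 \<cdot> m)"
      unfolding x0_def v0_def by simp
    have "y0 \<cdot> ?m = act C H (PWf w) (PWa w b) h (y0 \<cdot> m)"
      using act'[OF hm] unfolding y0_def by blast
    also have "\<dots> = pb_pair C p w (ha h (x0 \<cdot> m)) (act C H w b h (v0 \<cdot> m))"
      unfolding ym by (rule PW(5)[OF W]) simp_all
    finally have y0m: "y0 \<cdot> ?m = pb_pair C p w (ha h (x0 \<cdot> m)) (act C H w b h (v0 \<cdot> m))" .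
    have "x0 \<cdot> ?m = pb1 C p w \<cdot> (y0 \<cdot> ?m)" "v0 \<cdot> ?m = pb2 C p w \<cdot> (y0 \<cdot> ?m)"
      unfolding x0_def v0_def by simp_all
    then have x0m: "x0 \<cdot> ?m = ha h (x0 \<cdot> m)" and v0m: "v0 \<cdot> ?m = act C H w b h (v0 \<cdot> m)"
      unfolding y0m by simp_all
    have g0m: "g0 \<cdot> ?m = g0 \<cdot> m"
      using act'[OF hm] unfolding g0_def k0_def by simp
    have "\<chi> \<cdot> ?m = z \<cdot> pb_pair C p w (ha h (ga (g0 \<cdot> m) (x0 \<cdot> m))) (act C H w b h (v0 \<cdot> m))"
      by (subst \<chi>m) (simp_all add: x0m v0m g0m)
    also have "\<dots> = z \<cdot> pb_pair C p w (ga (g0 \<cdot> m) (x0 \<cdot> m)) (v0 \<cdot> m)"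
      by (rule z_inv) simp_all
    also have "\<dots> = \<chi> \<cdot> m" by (subst \<chi>m) simp_all
    finally show "\<chi> \<cdot> ?m = \<chi> \<cdot> m" .
  qed simp_all
  obtain a where a0: "a \<in> Arr C" "Dom C a = Cod C k0" "Cod C a = Cod C \<chi>" and ak: "a \<cdot> k0 = \<chi>"
    using H.quot_ex[OF q' i'] unfolding k0_def by blast
  then have a [simp]: "a \<in> Arr C" "Dom C a = pb_obj C (d0 G) f" "Cod C a = Cod C z" by simp_all
  let ?a = "act C G f a"
  have az: "?a g (z \<cdot> pb_pair C p w x v) = z \<cdot> pb_pair C p w (ga g x) v" if xv: "pel p w x v" and gx: "pel (d0 G) q g x" for g x v
  proof -
    define n where "n = pb_pair C (d0 G) f g (z \<cdot> pb_pair C p w x v)"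
    have "d0 G \<cdot> g = f \<cdot> (z \<cdot> pb_pair C p w x v)" using xv gx by (simp add: fzy)
    then have n [simp]: "n \<in> Arr C" "Dom C n = Dom C v" "Cod C n = pb_obj C (d0 G) f" "pb1 C (d0 G) f \<cdot> n = g" "u \<cdot> n = z \<cdot> pb_pair C p w x v"
      unfolding n_def u_def using xv gx by simp_all
    define m where "m = pb_pair C z u (pb_pair C p w x v) n"
    have m [simp]: "m \<in> Arr C" "Dom C m = Dom C v" "Cod C m = pb_obj C z u" "y0 \<cdot> m = pb_pair C p w x v" "k0 \<cdot> m = n"
      unfolding m_def y0_def k0_def using xv by simp_all
    have "?a g (z \<cdot> pb_pair C p w x v) = a \<cdot> n" unfolding act_def n_def ..
    also have "\<dots> = \<chi> \<cdot> m" using comp_reassoc[OF ak, of m] by simp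
    also have "\<dots> = z \<cdot> pb_pair C p w (ga g x) v"
      by (subst \<chi>m) (use xv in \<open>simp_all add: x0_def v0_def g0_def\<close>)
    finally show ?thesis .
  qed
  have at [simp]: "?a g m \<in> Arr C" "Dom C (?a g m) = Dom C m" "Cod C (?a g m) = Cod C z" if "pel (d0 G) f g m" for g m
    using that unfolding act_def by simp_all
  have as: "?a g m \<cdot> s = ?a (g \<cdot> s) (m \<cdot> s)" if "pel (d0 G) f g m" "s \<in> Arr C" "Cod C s = Dom C m" for g m s
    using that unfolding act_def by simp
  have fa [simp]: "f \<cdot> ?a g m = d1 G \<cdot> g" if gm: "pel (d0 G) f g m" for g m
  proof -
    have "m \<in> Arr C" "Cod C m = Cod C z" using gm by simp_all
    then obtain e x v where e [simp]: "e \<in> Arr C" "Cod C e = Dom C m" "Dom C e = Dom C v" and xv: "pel p w x v" and zm: "z \<cdot> pb_pair C p w x v = m \<cdot> e"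
      and eq: "\<And>k k'. k \<in> Arr C \<Longrightarrow> k' \<in> Arr C \<Longrightarrow> Dom C k = Dom C m \<Longrightarrow> Dom C k' = Dom C m \<Longrightarrow> Cod C k = Cod C k' \<Longrightarrow> k \<cdot> e = k' \<cdot> e \<Longrightarrow> k = k'"
      using quot_local[OF W qz, of m] by metis
    have "d0 G \<cdot> (g \<cdot> e) = f \<cdot> (m \<cdot> e)" using gm comp_reassoc[of "d0 G" g "f \<cdot> m" e] by simp
    also have "\<dots> = q \<cdot> x" unfolding zm[symmetric] using xv by (simp add: fzy)
    finally have ge: "pel (d0 G) q (g \<cdot> e) x" using gm xv by simp
    have "(f \<cdot> ?a g m) \<cdot> e = f \<cdot> ?a (g \<cdot> e) (z \<cdot> pb_pair C p w x v)" using gm zm by (simp add: as)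
    also have "\<dots> = (d1 G \<cdot> g) \<cdot> e" unfolding az[OF xv ge] using gm ge xv by (simp add: fzy)
    finally show ?thesis by - (rule eq, use gm in simp_all)
  qed
  have X [simp]: "is_gobj C G f a"
  proof (rule G.gobjI)
    fix m assume m [simp]: "m \<in> Arr C" "Cod C m = Dom C f"
    obtain e x v where e [simp]: "e \<in> Arr C" "Cod C e = Dom C m" "Dom C e = Dom C v" and xv: "pel p w x v" and zm: "z \<cdot> pb_pair C p w x v = m \<cdot> e"
      and eq: "\<And>k k'. k \<in> Arr C \<Longrightarrow> k' \<in> Arr C \<Longrightarrow> Dom C k = Dom C m \<Longrightarrow> Dom C k' = Dom C m \<Longrightarrow> Cod C k = Cod C k' \<Longrightarrow> k \<cdot> e = k' \<cdot> e \<Longrightarrow> k = k'"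
      using quot_local[OF W qz, of m] m f(2) by metis
    have fm: "f \<cdot> (m \<cdot> e) = q \<cdot> x" unfolding zm[symmetric] using xv by (simp add: fzy)
    have ge: "pel (d0 G) q (ge G \<cdot> (q \<cdot> x)) x" using xv by simp
    have "?a (ge G \<cdot> (f \<cdot> m)) m \<cdot> e = ?a (ge G \<cdot> (q \<cdot> x)) (z \<cdot> pb_pair C p w x v)" using zm fm by (simp add: as)
    also have "\<dots> = m \<cdot> e" unfolding az[OF xv ge] zm[symmetric] using xv by simp
    finally show "?a (ge G \<cdot> (f \<cdot> m)) m = m" by - (rule eq, simp_all)
  next
    fix g1 g2 m assume gm: "pel (d0 G) f g2 m" and g1: "g1 \<in> Arr C" "Dom C g1 = Dom C m" "Cod C g1 = G1 G" "d0 G \<cdot> g1 = d1 G \<cdot> g2"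
    then have "m \<in> Arr C" "Cod C m = Cod C z" by simp_all
    then obtain e x v where e [simp]: "e \<in> Arr C" "Cod C e = Dom C m" "Dom C e = Dom C v" and xv: "pel p w x v" and zm: "z \<cdot> pb_pair C p w x v = m \<cdot> e"
      and eq: "\<And>k k'. k \<in> Arr C \<Longrightarrow> k' \<in> Arr C \<Longrightarrow> Dom C k = Dom C m \<Longrightarrow> Dom C k' = Dom C m \<Longrightarrow> Cod C k = Cod C k' \<Longrightarrow> k \<cdot> e = k' \<cdot> e \<Longrightarrow> k = k'"
      using quot_local[OF W qz, of m] by metis
    have "d0 G \<cdot> (g2 \<cdot> e) = f \<cdot> (m \<cdot> e)" using gm comp_reassoc[of "d0 G" g2 "f \<cdot> m" e] by simp
    also have "\<dots> = q \<cdot> x" unfolding zm[symmetric] using xv by (simp add: fzy)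
    finally have ge: "pel (d0 G) q (g2 \<cdot> e) x" using gm xv by simp
    have g1e: "d0 G \<cdot> (g1 \<cdot> e) = d1 G \<cdot> (g2 \<cdot> e)" using gm g1 comp_reassoc[OF g1(4), of e] by simp
    have ge1: "pel p w (ga (g2 \<cdot> e) x) v" "pel (d0 G) q (g1 \<cdot> e) (ga (g2 \<cdot> e) x)" using gm g1 xv ge g1e by simp_all
    have ge2: "pel (d0 G) q (gmul C G (g1 \<cdot> e) (g2 \<cdot> e)) x" using gm g1 xv ge g1e by simp
    have "?a g1 (?a g2 m) \<cdot> e = ?a (g1 \<cdot> e) (?a (g2 \<cdot> e) (z \<cdot> pb_pair C p w x v))" using gm g1 zm by (simp add: as)
    also have "\<dots> = z \<cdot> pb_pair C p w (ga (g1 \<cdot> e) (ga (g2 \<cdot> e) x)) v" unfolding az[OF xv ge] az[OF ge1] ..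
    also have "ga (g1 \<cdot> e) (ga (g2 \<cdot> e) x) = ga (gmul C G (g1 \<cdot> e) (g2 \<cdot> e)) x"
      by (rule G.ac_ac[OF gq]) (use gm g1 ge g1e in simp_all)
    also have "z \<cdot> pb_pair C p w (ga (gmul C G (g1 \<cdot> e) (g2 \<cdot> e)) x) v = ?a (gmul C G g1 g2) m \<cdot> e"
      unfolding az[OF xv ge2, symmetric] zm using gm g1 by (simp add: as)
    finally show "?a g1 (?a g2 m) = ?a (gmul C G g1 g2) m"
      by - (rule eq, use gm g1 in simp_all)
  qed simp_all
  have "bil w b z f a"
    unfolding bil_def gbil_def using z_inv az by (auto simp: fzy)
  then show ?thesis using qz X unfolding repL_def by blast
qed

text \<open>The factorization of \<open>\<phi>\<close> exists since \<open>\<phi>\<close> is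
  invariant under \<open>H\<close>. It lies over \<open>G0\<close> because this may be checked after
  the quotient map, and its equivariance is checked on local representatives, where it is
  equivariance of \<open>\<phi>\<close> and \<open>lm\<close>.\<close>

lemma repL_univ:
  assumes W: "is_gobj C H w b" and L: "repL w b lm f a" and X: "is_gobj C G f' a'" and \<phi>: "bil w b \<phi> f' a'"
  shows "\<exists>k. k \<in> Arr C \<and> Dom C k = Dom C f \<and> Cod C k = Dom C f' \<and> equivariant C G (f, a) k (f', a') \<and> k \<cdot> lm = \<phi>"
proof -
  have F [simp]: "is_gobj C G f a" and lmb: "bil w b lm f a" and q: "H.quot (PWf w) (PWa w b) lm" using L unfolding repL_def by auto
  note [simp] = G.gobj_arr[OF X] G.gobj_arr[OF F] H.gobj_arr[OF W] X W
  note lmt [simp] = gbilD(1-3)[OF bilD(1)[OF lmb]] and \<phi>t [simp] = gbilD(1-3)[OF bilD(1)[OF \<phi>]]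
  have "H.invariant (PWf w) (PWa w b) \<phi>"
    unfolding PW_invariant[OF W] using bilD(2)[OF \<phi>] by simp
  then obtain k where k [simp]: "k \<in> Arr C" "Dom C k = Dom C f" "Cod C k = Dom C f'" and klm: "k \<cdot> lm = \<phi>"
    using H.quot_ex[OF q] by (metis \<phi>t(3) lmt(3))
  have klmx: "k \<cdot> (lm \<cdot> pb_pair C p w x v) = \<phi> \<cdot> pb_pair C p w x v" if "pel p w x v" for x v
    using comp_reassoc[OF klm, of "pb_pair C p w x v"] that by simp
  have fk: "f' \<cdot> k = f"
  proof -
    have "(f' \<cdot> k) \<cdot> lm = f \<cdot> lm"
      by (rule arrow_eqI[of w]) (simp_all add: klmx gbilD(4)[OF bilD(1)[OF \<phi>]] gbilD(4)[OF bilD(1)[OF lmb]])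
    then show ?thesis
      by - (rule H.quot_ext[OF PW(1)[OF W] q], simp_all)
  qed
  have fkx: "f' \<cdot> (k \<cdot> x) = f \<cdot> x" if "x \<in> Arr C" "Cod C x = Dom C f" for x
    using comp_reassoc[OF fk, of x] that by simp
  have "equivariant C G (f, a) k (f', a')"
  proof (rule G.equivariantI)
    fix g m assume gm: "pel (d0 G) f g m"
    then have "m \<in> Arr C" "Cod C m = Cod C lm" by simp_all
    then obtain e x v where e [simp]: "e \<in> Arr C" "Cod C e = Dom C m" "Dom C e = Dom C v" and xv: "pel p w x v" and zm: "lm \<cdot> pb_pair C p w x v = m \<cdot> e"
      and eq: "\<And>k k'. k \<in> Arr C \<Longrightarrow> k' \<in> Arr C \<Longrightarrow> Dom C k = Dom C m \<Longrightarrow> Dom C k' = Dom C m \<Longrightarrow> Cod C k = Cod C k' \<Longrightarrow> k \<cdot> e = k' \<cdot> e \<Longrightarrow> k = k'"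
      using quot_local[OF W q, of m] by metis
    have "d0 G \<cdot> (g \<cdot> e) = f \<cdot> (m \<cdot> e)" using gm comp_reassoc[of "d0 G" g "f \<cdot> m" e] by simp
    also have "\<dots> = q \<cdot> x" unfolding zm[symmetric] by (rule gbilD(4)[OF bilD(1)[OF lmb] xv])
    finally have ge: "pel (d0 G) q (g \<cdot> e) x" using gm xv by simp
    have gx: "pel p w (ga (g \<cdot> e) x) v" using xv ge by simp
    have "(k \<cdot> act C G f a g m) \<cdot> e = k \<cdot> act C G f a (g \<cdot> e) (lm \<cdot> pb_pair C p w x v)" using gm zm by simp
    also have "\<dots> = \<phi> \<cdot> pb_pair C p w (ga (g \<cdot> e) x) v"
      unfolding gbilD(5)[OF bilD(1)[OF lmb] xv ge, symmetric] by (rule klmx[OF gx])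
    also have "\<dots> = act C G f' a' (g \<cdot> e) (k \<cdot> (m \<cdot> e))"
      unfolding gbilD(5)[OF bilD(1)[OF \<phi>] xv ge] klmx[OF xv, symmetric] zm ..
    also have "\<dots> = act C G f' a' g (k \<cdot> m) \<cdot> e" using gm by (simp add: fkx)
    finally show "k \<cdot> act C G f a g m = act C G f' a' g (k \<cdot> m)"
      by - (rule eq, use gm in \<open>simp_all add: fkx\<close>)
  qed (simp_all add: fk)
  then show ?thesis using k klm by blast
qed

lemma repL_ext:
  assumes "is_gobj C H w b" "repL w b lm f a" "k \<in> Arr C" "k' \<in> Arr C" "Dom C k = Dom C f" "Dom C k' = Dom C f" "Cod C k = Cod C k'"
    "k \<cdot> lm = k' \<cdot> lm"
  shows "k = k'"
proof -
  have q: "H.quot (PWf w) (PWa w b) lm" and "Cod C lm = Dom C f" using assms(2) unfolding repL_def bil_def gbil_def by auto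
  then show ?thesis using assms by - (rule H.quot_ext[OF PW(1) q], simp_all)
qed

text \<open>The map \<open>(x, h) \<mapsto> h\<inverse> x\<close>, which is the split quotient map
  of \<open>quot_free_product\<close> with the factors exchanged.\<close>

definition "lam1 = ha (gi H \<cdot> pb2 C p (d1 H)) (pb1 C p (d1 H))"

lemma lam1:
  "lam1 \<in> Arr C" "Dom C lam1 = pb_obj C p (d1 H)" "Cod C lam1 = Dom C p"
  "pel p (d1 H) x h \<Longrightarrow> lam1 \<cdot> pb_pair C p (d1 H) x h = ha (gi H \<cdot> h) x"
  unfolding lam1_def by (simp_all add: pb_comm)

lemma repL_free_one: "repL (d1 H) (gm H) lam1 q d"
proof -
  note [simp] = lam1
  have g: "gbil (d1 H) lam1 q d" unfolding gbil_def by auto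
  have "lam1 \<cdot> pb_pair C p (d1 H) (ha k x) (act C H (d1 H) (gm H) k h) = lam1 \<cdot> pb_pair C p (d1 H) x h"
    if "pel p (d1 H) x h" "pel (d0 H) p k x" for k x h
    using that by (simp add: H.ac_free_one H.inv_mul)
  then have "bil (d1 H) (gm H) lam1 q d" unfolding bil_def using g by blast
  moreover have "H.quot (PWf (d1 H)) (PWa (d1 H) (gm H)) lam1"
    unfolding lam1_def
    by (rule H.quot_free_product[OF gp PW(1)[OF H.gobj_free_one] is_pullback_sym[OF pb_is_pullback]])
      (use PW(2-4)[OF H.gobj_free_one] in \<open>simp_all add: free_one_def\<close>)
  ultimately show ?thesis unfolding repL_def by simp
qed

subsection \<open>The adjunction\<close>

text \<open>The representing objects are chosen so that \<open>R T\<^sub>G 1\<close> and \<open>L T\<^sub>H 1\<close> are carried by \<open>P\<close> itself.\<close>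

definition "Rsel X = (if X = free_one G then ((p, c), dvar) else SOME s. repR (fst (fst s)) (snd (fst s)) (snd s) (fst X) (snd X))"
definition "Lsel W = (if W = free_one H then ((q, d), lam1) else SOME s. repL (fst W) (snd W) (snd s) (fst (fst s)) (snd (fst s)))"
definition "Rob X = fst (Rsel X)"
definition "rho X = snd (Rsel X)"
definition "Lob W = fst (Lsel W)"
definition "lam W = snd (Lsel W)"

lemma Rob_free: "Rob (free_one G) = (p, c)" "rho (free_one G) = dvar"
  and Lob_free: "Lob (free_one H) = (q, d)" "lam (free_one H) = lam1"
  unfolding Rob_def rho_def Lob_def lam_def Rsel_def Lsel_def by simp_all

lemma repR_sel:
  assumes X: "is_gobj C G f a"
  shows "repR (fst (Rob (f, a))) (snd (Rob (f, a))) (rho (f, a)) f a"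
proof (cases "(f, a) = free_one G")
  case True
  then show ?thesis using repR_free_one unfolding Rob_def rho_def Rsel_def by (simp add: free_one_def)
next
  case False
  have "\<exists>s. repR (fst (fst s)) (snd (fst s)) (snd s) (fst (f, a)) (snd (f, a))"
    using repR_ex[OF X] by auto
  from someI_ex[OF this] show ?thesis using False unfolding Rob_def rho_def Rsel_def by simp
qed

lemma repL_sel:
  assumes W: "is_gobj C H w b"
  shows "repL w b (lam (w, b)) (fst (Lob (w, b))) (snd (Lob (w, b)))"
proof (cases "(w, b) = free_one H")
  case True
  then show ?thesis using repL_free_one unfolding Lob_def lam_def Lsel_def by (simp add: free_one_def)
next
  case False
  have "\<exists>s. repL (fst (w, b)) (snd (w, b)) (snd s) (fst (fst s)) (snd (fst s))"
    using repL_ex[OF W] by auto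
  from someI_ex[OF this] show ?thesis using False unfolding Lob_def lam_def Lsel_def by simp
qed

definition "Bil W \<phi> X \<longleftrightarrow> bil (fst W) (snd W) \<phi> (fst X) (snd X)"
definition lc :: "('m \<times> 'm) \<times> 'm \<times> ('m \<times> 'm) \<Rightarrow> 'm \<Rightarrow> 'm" where "lc h \<phi> = fst (snd h) \<cdot> \<phi>"
text \<open>The induced arrow \<open>pm\<close> depends on the structure maps at both ends of
  \<open>k\<close>; they are read off its tags.\<close>

definition rc :: "'m \<Rightarrow> ('m \<times> 'm) \<times> 'm \<times> ('m \<times> 'm) \<Rightarrow> 'm" where
  "rc \<phi> k = \<phi> \<cdot> pm (fst (snd (snd k))) (fst (fst k)) (fst (snd k))"

lemma bil_lc:
  assumes W: "is_gobj C H w b" and b: "bil w b \<phi> f a" and h: "((f, a), h, (f', a')) \<in> Arr (gcat C G)"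
  shows "bil w b (h \<cdot> \<phi>) f' a'"
proof -
  have X: "is_gobj C G f a" "is_gobj C G f' a'" and ht: "h \<in> Arr C" "Dom C h = Dom C f" "Cod C h = Dom C f'"
    and e: "equivariant C G (f, a) h (f', a')" using h unfolding G.gcat_simps by simp_all
  note [simp] = G.gobj_arr[OF X(1)] G.gobj_arr[OF X(2)] H.gobj_arr[OF W] ht
  note [simp] = gbilD(1-3)[OF bilD(1)[OF b]]
  note e' = G.equivariantD[OF e X ht]
  show ?thesis
    unfolding bil_def gbil_def
  proof (intro conjI allI impI)
    fix x v assume xv: "pel p w x v"
    show "f' \<cdot> ((h \<cdot> \<phi>) \<cdot> pb_pair C p w x v) = q \<cdot> x"
      using e'(2)[of "\<phi> \<cdot> pb_pair C p w x v"] xv gbilD(4)[OF bilD(1)[OF b] xv] by simp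
  next
    fix g x v assume *: "pel p w x v \<and> pel (d0 G) q g x"
    then have xv: "pel p w x v" and gx: "pel (d0 G) q g x" by simp_all
    have "pel (d0 G) f g (\<phi> \<cdot> pb_pair C p w x v)" using gbilD(4)[OF bilD(1)[OF b] xv] xv gx by simp
    then show "(h \<cdot> \<phi>) \<cdot> pb_pair C p w (ga g x) v = act C G f' a' g ((h \<cdot> \<phi>) \<cdot> pb_pair C p w x v)"
      using gbilD(5)[OF bilD(1)[OF b] xv gx] e'(3)[of g "\<phi> \<cdot> pb_pair C p w x v"] xv gx by simp
  next
    fix k x v assume *: "pel p w x v \<and> pel (d0 H) p k x"
    then have xv: "pel p w x v" and kx: "pel (d0 H) p k x" by simp_all
    show "(h \<cdot> \<phi>) \<cdot> pb_pair C p w (ha k x) (act C H w b k v) = (h \<cdot> \<phi>) \<cdot> pb_pair C p w x v"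
      using bilD(2)[OF b xv kx] xv kx W by simp
  qed simp_all
qed

lemma bil_rc:
  assumes X: "is_gobj C G f a" and b: "bil w b \<phi> f a" and k: "((w', b'), k, (w, b)) \<in> Arr (gcat C H)"
  shows "bil w' b' (\<phi> \<cdot> pm w w' k) f a"
proof -
  have W: "is_gobj C H w' b'" "is_gobj C H w b" and kt: "k \<in> Arr C" "Dom C k = Dom C w'" "Cod C k = Dom C w"
    and e: "equivariant C H (w', b') k (w, b)" using k unfolding H.gcat_simps by simp_all
  note [simp] = H.gobj_arr[OF W(1)] H.gobj_arr[OF W(2)] G.gobj_arr[OF X] kt W X
  note [simp] = gbilD(1-3)[OF bilD(1)[OF b]]
  note e' = H.equivariantD[OF e W kt]
  note [simp] = e'(1,2)
  have p1: "(\<phi> \<cdot> pm w w' k) \<cdot> pb_pair C p w' x v = \<phi> \<cdot> pb_pair C p w x (k \<cdot> v)" if "pel p w' x v" for x v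
    using that by simp
  show ?thesis
    unfolding bil_def gbil_def
  proof (intro conjI allI impI)
    fix x v assume xv: "pel p w' x v"
    have "pel p w x (k \<cdot> v)" using xv by simp
    then show "f \<cdot> ((\<phi> \<cdot> pm w w' k) \<cdot> pb_pair C p w' x v) = q \<cdot> x"
      unfolding p1[OF xv] by (rule gbilD(4)[OF bilD(1)[OF b]])
  next
    fix g x v assume *: "pel p w' x v \<and> pel (d0 G) q g x"
    then have 1: "pel p w' x v" "pel p w' (ga g x) v" "pel p w x (k \<cdot> v)" "pel (d0 G) q g x" by simp_all
    show "(\<phi> \<cdot> pm w w' k) \<cdot> pb_pair C p w' (ga g x) v = act C G f a g ((\<phi> \<cdot> pm w w' k) \<cdot> pb_pair C p w' x v)"
      unfolding p1[OF 1(1)] p1[OF 1(2)] by (rule gbilD(5)[OF bilD(1)[OF b] 1(3,4)])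
  next
    fix h x v assume *: "pel p w' x v \<and> pel (d0 H) p h x"
    then have 1: "pel p w' x v" "pel p w' (ha h x) (act C H w' b' h v)" "pel p w x (k \<cdot> v)" "pel (d0 H) p h x" "pel (d0 H) w' h v" by simp_all
    show "(\<phi> \<cdot> pm w w' k) \<cdot> pb_pair C p w' (ha h x) (act C H w' b' h v) = (\<phi> \<cdot> pm w w' k) \<cdot> pb_pair C p w' x v"
      unfolding p1[OF 1(1)] p1[OF 1(2)] e'(3)[OF 1(5)] by (rule bilD(2)[OF b 1(3,4)])
  qed simp_all
qed

lemma pm_Id:
  assumes "w \<in> Arr C" "Cod C w = G0 H"
  shows "pm w w (Id C (Dom C w)) = Id C (pb_obj C p w)"
  unfolding pm_def using assms by simp

lemma pm_comp:
  assumes [simp]: "w \<in> Arr C" "Cod C w = G0 H" "w' \<in> Arr C" "Cod C w' = G0 H" "w'' \<in> Arr C" "Cod C w'' = G0 H"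
    "k \<in> Arr C" "Dom C k = Dom C w'" "Cod C k = Dom C w" "w \<cdot> k = w'" "l \<in> Arr C" "Dom C l = Dom C w''" "Cod C l = Dom C w'" "w' \<cdot> l = w''"
  shows "pm w w'' (k \<cdot> l) = pm w w' k \<cdot> pm w' w'' l"
proof -
  have wkl [simp]: "w \<cdot> (k \<cdot> l) = w''" using comp_reassoc[OF assms(10), of l] by simp
  have e: "pm w w' k \<cdot> (pm w' w'' l \<cdot> pb_pair C p w'' x v) = pb_pair C p w x (k \<cdot> (l \<cdot> v))" if xv: "pel p w'' x v" for x v
  proof -
    have "pel p w' x (l \<cdot> v)" using xv comp_reassoc[OF assms(14), of v] by simp
    then show ?thesis
      unfolding pm(4)[OF assms(3-6) assms(11-14) xv] by (rule pm(4)[OF assms(1-4) assms(7-10)])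
  qed
  show ?thesis
  proof (rule arrow_eqI[of w''])
    fix x v assume xv: "pel p w'' x v"
    have "(pm w w' k \<cdot> pm w' w'' l) \<cdot> pb_pair C p w'' x v = pm w w' k \<cdot> (pm w' w'' l \<cdot> pb_pair C p w'' x v)"
      by (rule comp_assoc) (use xv in simp_all)
    then show "pm w w'' (k \<cdot> l) \<cdot> pb_pair C p w'' x v = (pm w w' k \<cdot> pm w' w'' l) \<cdot> pb_pair C p w'' x v"
      unfolding e[OF xv] using xv by simp
  qed simp_all
qed

lemma gcat_G_cases:
  assumes "h \<in> Arr (gcat C G)"
  obtains f a k f' a' where "h = ((f, a), k, (f', a'))" "is_gobj C G f a" "is_gobj C G f' a'" "k \<in> Arr C" "Dom C k = Dom C f" "Cod C k = Dom C f'"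
    "equivariant C G (f, a) k (f', a')" "f' \<cdot> k = f"
proof -
  obtain f a k f' a' where h: "h = ((f, a), k, (f', a'))" by (cases h) auto
  note * = assms[unfolded h G.gcat_simps]
  then show ?thesis using that[OF h] G.equivariantD(1)[of f a k f' a'] by blast
qed

lemma gcat_H_cases:
  assumes "h \<in> Arr (gcat C H)"
  obtains f a k f' a' where "h = ((f, a), k, (f', a'))" "is_gobj C H f a" "is_gobj C H f' a'" "k \<in> Arr C" "Dom C k = Dom C f" "Cod C k = Dom C f'"
    "equivariant C H (f, a) k (f', a')" "f' \<cdot> k = f"
proof -
  obtain f a k f' a' where h: "h = ((f, a), k, (f', a'))" by (cases h) auto
  note * = assms[unfolded h H.gcat_simps]
  then show ?thesis using that[OF h] H.equivariantD(1)[of f a k f' a'] by blast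
qed

lemma BilD:
  assumes "Bil W \<phi> X"
  shows "\<phi> \<in> Arr C" "Dom C \<phi> = pb_obj C p (fst W)" "Cod C \<phi> = Dom C (fst X)"
  using gbilD(1-3)[OF bilD(1)] assms unfolding Bil_def by blast+

lemma Obj_H: "W \<in> Obj (gcat C H) \<longleftrightarrow> is_gobj C H (fst W) (snd W)"
  and Obj_G: "X \<in> Obj (gcat C G) \<longleftrightarrow> is_gobj C G (fst X) (snd X)"
  using H.gcat_simps(1)[of "fst W" "snd W"] G.gcat_simps(1)[of "fst X" "snd X"] by simp_all

lemma gobj_HD: "is_gobj C H w b \<Longrightarrow> w \<in> Arr C \<and> Cod C w = G0 H"
  using H.gobj_arr by blast

sublocale B: biprofunctor "gcat C H" "gcat C G" Bil lc rc Lob lam Rob rho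
proof unfold_locales
  fix W \<phi> X h assume *: "Bil W \<phi> X" "W \<in> Obj (gcat C H)" "h \<in> Arr (gcat C G)" "Dom (gcat C G) h = X"
  from *(3) obtain f a k f' a' where h: "h = ((f, a), k, (f', a'))" by (rule gcat_G_cases)
  then show "Bil W (lc h \<phi>) (Cod (gcat C G) h)"
    using * bil_lc[of "fst W" "snd W" \<phi> f a k f' a'] unfolding Bil_def lc_def Obj_H by (auto simp: G.gcat_simps(3,4))
next
  fix W \<phi> X k assume *: "Bil W \<phi> X" "X \<in> Obj (gcat C G)" "k \<in> Arr (gcat C H)" "Cod (gcat C H) k = W"
  from *(3) obtain f a l f' a' where k: "k = ((f, a), l, (f', a'))" by (rule gcat_H_cases)
  then show "Bil (Dom (gcat C H) k) (rc \<phi> k) X"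
    using * bil_rc[of "fst X" "snd X" f' a' \<phi> f a l] unfolding Bil_def rc_def Obj_G by (auto simp: H.gcat_simps(3,4))
next
  fix W \<phi> X assume *: "Bil W \<phi> X" "W \<in> Obj (gcat C H)" "X \<in> Obj (gcat C G)"
  show "lc (Id (gcat C G) X) \<phi> = \<phi>"
    using BilD[OF *(1)] G.gcat_simps(6)[of "fst X" "snd X"] unfolding lc_def by simp
  show "rc \<phi> (Id (gcat C H) W) = \<phi>"
    using BilD[OF *(1)] H.gcat_simps(6)[of "fst W" "snd W"] gobj_HD *(2) unfolding rc_def Obj_H by (simp add: pm_Id)
next
  fix W \<phi> X f g
  assume *: "Bil W \<phi> X" "f \<in> Arr (gcat C G)" "g \<in> Arr (gcat C G)" "Dom (gcat C G) f = X" "Cod (gcat C G) f = Dom (gcat C G) g"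
  from *(2) obtain f1 a1 k f2 a2 where f: "f = ((f1, a1), k, (f2, a2))" "k \<in> Arr C" "Dom C k = Dom C f1" "Cod C k = Dom C f2" by (rule gcat_G_cases)
  from *(3) obtain g1 b1 l g2 b2 where g: "g = ((g1, b1), l, (g2, b2))" "l \<in> Arr C" "Dom C l = Dom C g1" by (rule gcat_G_cases)
  show "lc (g \<cdot>\<^bsub>gcat C G\<^esub> f) \<phi> = lc g (lc f \<phi>)"
    using *(4,5) BilD[OF *(1)] f g unfolding lc_def by (auto simp: G.gcat_simps(3-5))
next
  fix W \<phi> X f g
  assume *: "Bil W \<phi> X" "f \<in> Arr (gcat C H)" "g \<in> Arr (gcat C H)" "Cod (gcat C H) g = W" "Cod (gcat C H) f = Dom (gcat C H) g"
  from *(2) obtain f1 a1 k f2 a2 where f: "f = ((f1, a1), k, (f2, a2))" "is_gobj C H f1 a1" "k \<in> Arr C" "Dom C k = Dom C f1" "Cod C k = Dom C f2" "f2 \<cdot> k = f1" by (rule gcat_H_cases)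
  from *(3) obtain g1 b1 l g2 b2 where g: "g = ((g1, b1), l, (g2, b2))" "is_gobj C H g1 b1" "is_gobj C H g2 b2" "l \<in> Arr C" "Dom C l = Dom C g1" "Cod C l = Dom C g2" "g2 \<cdot> l = g1" by (rule gcat_H_cases)
  have e: "f2 = g1" "W = (g2, b2)" using *(4,5) f(1) g(1) by (auto simp: H.gcat_simps(3-5))
  have ft: "Cod C k = Dom C g1" "g1 \<cdot> k = f1" using f e by simp_all
  note gt = conjunct1[OF gobj_HD[OF g(3)]] conjunct2[OF gobj_HD[OF g(3)]] conjunct1[OF gobj_HD[OF g(2)]] conjunct2[OF gobj_HD[OF g(2)]]
    conjunct1[OF gobj_HD[OF f(2)]] conjunct2[OF gobj_HD[OF f(2)]]
  have "pm g2 f1 (l \<cdot> k) = pm g2 g1 l \<cdot> pm g1 f1 k"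
    by (rule pm_comp[OF gt g(4-7) f(3,4) ft])
  moreover have "pm g2 g1 l \<in> Arr C" "Dom C (pm g2 g1 l) = pb_obj C p g1" "Cod C (pm g2 g1 l) = pb_obj C p g2"
    "pm g1 f1 k \<in> Arr C" "Cod C (pm g1 f1 k) = pb_obj C p g1"
    using pm(1-3)[OF gt(1-4) g(4-7)] pm(1-3)[OF gt(3-6) f(3,4) ft] by simp_all
  ultimately show "rc \<phi> (g \<cdot>\<^bsub>gcat C H\<^esub> f) = rc (rc \<phi> g) f"
    using BilD[OF *(1)] unfolding rc_def f(1) g(1) e H.gcat_simps by simp
next
  fix W \<phi> X h k
  assume *: "Bil W \<phi> X" "h \<in> Arr (gcat C G)" "Dom (gcat C G) h = X" "k \<in> Arr (gcat C H)" "Cod (gcat C H) k = W"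
  from *(2) obtain f1 a1 l f2 a2 where h: "h = ((f1, a1), l, (f2, a2))" "l \<in> Arr C" "Dom C l = Dom C f1" by (rule gcat_G_cases)
  from *(4) obtain g1 b1 m g2 b2 where k: "k = ((g1, b1), m, (g2, b2))" "is_gobj C H g1 b1" "is_gobj C H g2 b2" "m \<in> Arr C" "Dom C m = Dom C g1" "Cod C m = Dom C g2" "g2 \<cdot> m = g1" by (rule gcat_H_cases)
  have e: "X = (f1, a1)" "W = (g2, b2)" using *(3,5) h(1) k(1) by (auto simp: H.gcat_simps(3-5) G.gcat_simps(3-5))
  note gt = conjunct1[OF gobj_HD[OF k(3)]] conjunct2[OF gobj_HD[OF k(3)]] conjunct1[OF gobj_HD[OF k(2)]] conjunct2[OF gobj_HD[OF k(2)]]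
  show "rc (lc h \<phi>) k = lc h (rc \<phi> k)"
    using BilD[OF *(1)] h(2,3) pm(1-3)[OF gt k(4-7)] unfolding rc_def lc_def h(1) k(1) e by simp
next
  fix W assume W: "W \<in> Obj (gcat C H)"
  note L = repL_sel[OF W[unfolded Obj_H], unfolded prod.collapse]
  show "Lob W \<in> Obj (gcat C G)" "Bil W (lam W) (Lob W)"
    using L unfolding repL_def Obj_G Bil_def by auto
next
  fix X assume X: "X \<in> Obj (gcat C G)"
  note R = repR_sel[OF X[unfolded Obj_G], unfolded prod.collapse]
  show "Rob X \<in> Obj (gcat C H)" "Bil (Rob X) (rho X) X"
    using R unfolding repR_def Obj_H Bil_def by auto
next
  fix W \<phi> X assume *: "W \<in> Obj (gcat C H)" "X \<in> Obj (gcat C G)" "Bil W \<phi> X"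
  have W: "is_gobj C H (fst W) (snd W)" and X: "is_gobj C G (fst X) (snd X)" and b: "bil (fst W) (snd W) \<phi> (fst X) (snd X)"
    using * unfolding Obj_H Obj_G Bil_def by auto
  note L = repL_sel[OF W, unfolded prod.collapse]
  have Lg: "is_gobj C G (fst (Lob W)) (snd (Lob W))" using L unfolding repL_def by simp
  obtain k where k: "k \<in> Arr C" "Dom C k = Dom C (fst (Lob W))" "Cod C k = Dom C (fst X)" "equivariant C G (Lob W) k X" "k \<cdot> lam W = \<phi>"
    using repL_univ[OF W L X b] by auto
  show "\<exists>!h. h \<in> hom (gcat C G) (Lob W) X \<and> lc h (lam W) = \<phi>"
  proof (rule ex1I[of _ "(Lob W, k, X)"])
    show "(Lob W, k, X) \<in> hom (gcat C G) (Lob W) X \<and> lc (Lob W, k, X) (lam W) = \<phi>"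
      using k X Lg G.gcat_simps(2)[of "fst (Lob W)" "snd (Lob W)" k "fst X" "snd X"] by (simp add: G.gcat_simps(3,4) lc_def)
    fix h assume h: "h \<in> hom (gcat C G) (Lob W) X \<and> lc h (lam W) = \<phi>"
    then have "h \<in> Arr (gcat C G)" by simp
    then obtain f a l f' a' where hh: "h = ((f, a), l, (f', a'))" "l \<in> Arr C" "Dom C l = Dom C f" "Cod C l = Dom C f'" by (rule gcat_G_cases)
    have e: "Lob W = (f, a)" "X = (f', a')" using h hh(1) by (auto simp: G.gcat_simps(3,4))
    have "l = k" by (rule repL_ext[OF W L]) (use h hh k e in \<open>simp_all add: lc_def\<close>)
    then show "h = (Lob W, k, X)" using hh e by simp
  qed
  note R = repR_sel[OF X, unfolded prod.collapse]
  have Rg: "is_gobj C H (fst (Rob X)) (snd (Rob X))" using R unfolding repR_def by simp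
  obtain k where k: "k \<in> Arr C" "Dom C k = Dom C (fst W)" "Cod C k = Dom C (fst (Rob X))" "equivariant C H W k (Rob X)"
      "rho X \<cdot> pm (fst (Rob X)) (fst W) k = \<phi>"
    using repR_univ(1)[OF X R W b] by auto
  have wk: "fst (Rob X) \<cdot> k = fst W" using H.equivariantD(1)[of "fst W" "snd W" k "fst (Rob X)" "snd (Rob X)"] k Rg W by simp
  show "\<exists>!h. h \<in> hom (gcat C H) W (Rob X) \<and> rc (rho X) h = \<phi>"
  proof (rule ex1I[of _ "(W, k, Rob X)"])
    show "(W, k, Rob X) \<in> hom (gcat C H) W (Rob X) \<and> rc (rho X) (W, k, Rob X) = \<phi>"
      using k W Rg H.gcat_simps(2)[of "fst W" "snd W" k "fst (Rob X)" "snd (Rob X)"] by (simp add: H.gcat_simps(3,4) rc_def)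
    fix h assume h: "h \<in> hom (gcat C H) W (Rob X) \<and> rc (rho X) h = \<phi>"
    then have "h \<in> Arr (gcat C H)" by simp
    then obtain f a l f' a' where hh: "h = ((f, a), l, (f', a'))" "l \<in> Arr C" "Dom C l = Dom C f" "Cod C l = Dom C f'" "f' \<cdot> l = f" by (rule gcat_H_cases)
    have e: "W = (f, a)" "Rob X = (f', a')" using h hh(1) by (auto simp: H.gcat_simps(3,4))
    have "l = k"
      by (rule repR_univ(2)[OF X R W b]) (use h hh k wk e in \<open>simp_all add: rc_def\<close>)
    then show "h = (W, k, Rob X)" using hh e by simp
  qed
qed

section \<open>The adjunction on arrows, and its stable Frobenius reciprocity\<close>

abbreviation "J \<equiv> B.bi_adj"

sublocale A: adjl "gcat C H" "gcat C G" J
  by unfold_locales (rule B.adjunction_bi)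

text \<open>The functors and transposes are given by unique existence. This lemma and the next two
  extract all that is used of them: the tags, and the composite with the universal bilinear
  map.\<close>

lemma LA_form:
  assumes k: "((w', b'), k, (w, b)) \<in> Arr (gcat C H)"
  obtains l where "A.LA ((w', b'), k, (w, b)) = (Lob (w', b'), l, Lob (w, b))" "(Lob (w', b'), l, Lob (w, b)) \<in> Arr (gcat C G)"
    "l \<cdot> lam (w', b') = lam (w, b) \<cdot> pm w w' k"
proof -
  obtain a l b'' where l: "A.LA ((w', b'), k, (w, b)) = (a, l, b'')" by (cases "A.LA ((w', b'), k, (w, b))")
  note * = B.bi_LA[OF k]
  have "a = Lob (w', b')" "b'' = Lob (w, b)"
    using *(2,3) unfolding l G.gcat_simps H.gcat_simps by simp_all
  then show ?thesis using that[of l] *(1,4) unfolding l G.gcat_simps H.gcat_simps lc_def rc_def by simp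
qed

lemma RA_form:
  assumes h: "((f, a), h, (f', a')) \<in> Arr (gcat C G)"
  obtains r where "A.RA ((f, a), h, (f', a')) = (Rob (f, a), r, Rob (f', a'))" "(Rob (f, a), r, Rob (f', a')) \<in> Arr (gcat C H)"
    "rho (f', a') \<cdot> pm (fst (Rob (f', a'))) (fst (Rob (f, a))) r = h \<cdot> rho (f, a)"
proof -
  obtain c' r b'' where r: "A.RA ((f, a), h, (f', a')) = (c', r, b'')" by (cases "A.RA ((f, a), h, (f', a'))")
  note * = B.bi_RA[OF h]
  have "c' = Rob (f, a)" "b'' = Rob (f', a')"
    using *(2,3) unfolding r G.gcat_simps H.gcat_simps by simp_all
  then show ?thesis using that[of r] *(1,4) unfolding r G.gcat_simps H.gcat_simps lc_def rc_def by simp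
qed

lemma tr_form:
  assumes g: "((w, b), g, Rob (f, a)) \<in> Arr (gcat C H)" and X: "is_gobj C G f a"
  obtains \<tau> where "A.tr (f, a) ((w, b), g, Rob (f, a)) = (Lob (w, b), \<tau>, (f, a))" "(Lob (w, b), \<tau>, (f, a)) \<in> Arr (gcat C G)"
    "\<tau> \<cdot> lam (w, b) = rho (f, a) \<cdot> pm (fst (Rob (f, a))) w g"
proof -
  have c: "Cod (gcat C H) ((w, b), g, Rob (f, a)) = A.R (f, a)" and O: "(f, a) \<in> Obj (gcat C G)"
    using X by (simp_all add: H.gcat_simps(3,4) G.gcat_simps(1))
  have c': "Cod (gcat C H) ((w, b), g, Rob (f, a)) = Rob (f, a)" by (simp add: H.gcat_simps(3,4))
  obtain a' t b'' where t: "A.tr (f, a) ((w, b), g, Rob (f, a)) = (a', t, b'')" by (cases "A.tr (f, a) ((w, b), g, Rob (f, a))")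
  note * = A.tr_simps[OF g c O]
  have "a' = Lob (w, b)" "b'' = (f, a)"
    using *(2,3) unfolding t G.gcat_simps H.gcat_simps by simp_all
  then show ?thesis using that[of t] *(1) B.lc_adj_transpose[OF g c' O] unfolding t G.gcat_simps H.gcat_simps lc_def rc_def by simp
qed

lemma pm_el:
  assumes "is_gobj C H w b" "is_gobj C H w' b'" "k \<in> Arr C" "Dom C k = Dom C w'" "Cod C k = Dom C w" "w \<cdot> k = w'"
    and "\<rho> \<in> Arr C" "Dom C \<rho> = pb_obj C p w" and xs: "pel p w' x s"
  shows "(\<rho> \<cdot> pm w w' k) \<cdot> pb_pair C p w' x s = \<rho> \<cdot> pb_pair C p w x (k \<cdot> s)"
proof -
  note [simp] = H.gobj_arr[OF assms(1)] H.gobj_arr[OF assms(2)] assms(3-8)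
  show ?thesis using xs by simp
qed

lemma equivariant_pm:
  assumes W: "is_gobj C H w b" "is_gobj C H w' b'" and k: "k \<in> Arr C" "Dom C k = Dom C w'" "Cod C k = Dom C w"
    and e: "equivariant C H (w', b') k (w, b)"
  shows "equivariant C H (PWf w', PWa w' b') (pm w w' k) (PWf w, PWa w b)"
proof -
  note e' = H.equivariantD[OF e W(2,1) k]
  note [simp] = H.gobj_arr[OF W(1)] H.gobj_arr[OF W(2)] W k e'(1,2) PW(1,2)[OF W(1)] PW(1,2)[OF W(2)]
  note pmt [simp] = pm(1-3)[of w w' k]
  show ?thesis
  proof (rule H.equivariantI)
    have "PWf w \<cdot> pm w w' k = p \<cdot> (pb1 C p w \<cdot> pm w w' k)" by (rule PW(6)[OF W(1)]) simp_all
    also have "\<dots> = PWf w'" by (simp add: PWf_def)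
    finally show "PWf w \<cdot> pm w w' k = PWf w'" .
    fix h y assume hy: "pel (d0 H) (PWf w') h y"
    define x where "x = pb1 C p w' \<cdot> y"
    define v where "v = pb2 C p w' \<cdot> y"
    have y: "y = pb_pair C p w' x v" and xv: "pel p w' x v"
      unfolding x_def v_def using hy pb_comm(2)[of p w' y] by simp_all
    have hx: "pel (d0 H) p h x" using hy by (simp add: x_def PW(6)[OF W(2)])
    have hv: "pel (d0 H) w' h v" using xv hx by simp
    have xv2: "pel p w' (ha h x) (act C H w' b' h v)" using xv hx by simp
    have xv3: "pel p w x (k \<cdot> v)" using xv by simp
    show "pm w w' k \<cdot> act C H (PWf w') (PWa w' b') h y = act C H (PWf w) (PWa w b) h (pm w w' k \<cdot> y)"
      unfolding y PW(5)[OF W(2) xv hx] using xv xv2 PW(5)[OF W(1) xv3 hx] e'(3)[OF hv] by simp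
  qed simp_all
qed

text \<open>Let \<open>(n, N)\<close> be the pullback of \<open>g\<close> and \<open>R f\<close>,
  and \<open>(m, M)\<close> the pullback of the transpose of \<open>g\<close> and \<open>f\<close>;
  the task is to invert \<open>\<kappa>\<close> from \<open>L (n, N)\<close> to
  \<open>(m, M)\<close>. The composite \<open>\<phi>\<close> of \<open>\<kappa>\<close> with the
  universal map of \<open>(n, N)\<close> is shown to be a pullback of the quotient map
  \<open>lam (w, b)\<close>, hence a quotient map, so \<open>\<kappa>\<close> compares two
  quotients. That the square is a pullback holds by the bijections in \<open>preR\<close> for
  \<open>X\<close> and for the domain of \<open>f\<close>.\<close>

lemma stably_frobenius_J: "stably_frobenius (gcat C H) (gcat C G) J"
  unfolding stably_frobenius_def frobenius_def
proof (intro ballI)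
  fix X g f
  assume X: "X \<in> Obj (gcat C G)" and "g \<in> Obj (slice (gcat C H) (A.R X))" "f \<in> Obj (slice (gcat C G) X)"
  then have g: "g \<in> Arr (gcat C H)" "Cod (gcat C H) g = A.R X" and f: "f \<in> Arr (gcat C G)" "Cod (gcat C G) f = X"
    by (simp_all only: H.S.D.slice_simps(1) G.S.D.slice_simps(1) mem_Collect_eq)
  obtain x \<xi> where Xx: "X = (x, \<xi>)" by (cases X)
  obtain r s where rs: "Rob (x, \<xi>) = (r, s)" by (cases "Rob (x, \<xi>)")
  obtain w b \<gamma> where g_eq: "g = ((w, b), \<gamma>, (r, s))"
    using g unfolding Xx by (cases g) (auto simp: H.gcat_simps(3,4) rs)
  obtain y \<upsilon> f0 where f_eq: "f = ((y, \<upsilon>), f0, (x, \<xi>))"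
    using f unfolding Xx by (cases f) (auto simp: G.gcat_simps(3,4))
  obtain ry sy where rsy: "Rob (y, \<upsilon>) = (ry, sy)" by (cases "Rob (y, \<upsilon>)")
  have gx: "is_gobj C G x \<xi>" using X unfolding Xx G.gcat_simps .
  have ga: "((w, b), \<gamma>, (r, s)) \<in> Arr (gcat C H)" using g(1) unfolding g_eq .
  have fa: "((y, \<upsilon>), f0, (x, \<xi>)) \<in> Arr (gcat C G)" using f(1) unfolding f_eq .
  have W: "is_gobj C H w b" and gr: "is_gobj C H r s" and \<gamma>: "\<gamma> \<in> Arr C" "Dom C \<gamma> = Dom C w" "Cod C \<gamma> = Dom C r" and e\<gamma>: "equivariant C H (w, b) \<gamma> (r, s)"
    using ga unfolding H.gcat_simps by simp_all
  have gy: "is_gobj C G y \<upsilon>" and f0: "f0 \<in> Arr C" "Dom C f0 = Dom C y" "Cod C f0 = Dom C x" and ef: "equivariant C G (y, \<upsilon>) f0 (x, \<xi>)"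
    using fa unfolding G.gcat_simps by simp_all
  have RX: "repR r s (rho (x, \<xi>)) x \<xi>" using repR_sel[OF gx] unfolding rs by simp
  have RY: "repR ry sy (rho (y, \<upsilon>)) y \<upsilon>" using repR_sel[OF gy] unfolding rsy by simp
  have gry: "is_gobj C H ry sy" using RY unfolding repR_def by simp
  have pRX: "preR r (rho (x, \<xi>)) x \<xi>" and pRY: "preR ry (rho (y, \<upsilon>)) y \<upsilon>" using RX RY unfolding repR_def by auto
  note \<rho>X = gbilD[OF preRD(3)[OF pRX]] and \<rho>Y = gbilD[OF preRD(3)[OF pRY]]
  obtain rf where rf: "A.RA f = ((ry, sy), rf, (r, s))" "((ry, sy), rf, (r, s)) \<in> Arr (gcat C H)"
    "rho (x, \<xi>) \<cdot> pm r ry rf = f0 \<cdot> rho (y, \<upsilon>)"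
    using RA_form[OF fa] unfolding rs rsy fst_conv f_eq by blast
  have rft: "rf \<in> Arr C" "Dom C rf = Dom C ry" "Cod C rf = Dom C r" and erf: "equivariant C H (ry, sy) rf (r, s)"
    using rf(2) unfolding H.gcat_simps by simp_all
  obtain fl al where Lw: "Lob (w, b) = (fl, al)" by (cases "Lob (w, b)")
  have LW: "repL w b (lam (w, b)) fl al" using repL_sel[OF W] unfolding Lw by simp
  have gl: "is_gobj C G fl al" and lb: "bil w b (lam (w, b)) fl al" and ql: "H.quot (PWf w) (PWa w b) (lam (w, b))"
    using LW unfolding repL_def by auto
  note lt = gbilD[OF bilD(1)[OF lb]]
  obtain \<tau> where \<tau>: "A.tr X g = ((fl, al), \<tau>, (x, \<xi>))" "((fl, al), \<tau>, (x, \<xi>)) \<in> Arr (gcat C G)"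
    "\<tau> \<cdot> lam (w, b) = rho (x, \<xi>) \<cdot> pm r w \<gamma>"
    using tr_form[OF ga[folded rs] gx] unfolding rs Lw fst_conv g_eq Xx by blast
  have exD: "\<exists>n1 n2. is_pullback (gcat C H) g (A.RA f) n1 n2"
    unfolding g_eq rf(1) using H.gcat_pullback_ex[OF ga rf(2)] by blast
  have exC: "\<exists>m1 m2. is_pullback (gcat C G) (A.tr X g) f m1 m2"
    unfolding \<tau>(1) f_eq using G.gcat_pullback_ex[OF \<tau>(2) fa] by blast
  obtain n1 n2 m1 m2 K where pbn: "is_pullback (gcat C H) g (A.RA f) n1 n2" and pbm: "is_pullback (gcat C G) (A.tr X g) f m1 m2"
    and K: "K \<in> hom (gcat C G) (A.L (Dom (gcat C H) n1)) (Dom (gcat C G) m1)" "m1 \<cdot>\<^bsub>gcat C G\<^esub> K = A.LA n1"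
      "m2 \<cdot>\<^bsub>gcat C G\<^esub> K = counit J (Dom (gcat C G) f) \<cdot>\<^bsub>gcat C G\<^esub> A.LA n2"
    and fr: "iso (slice (gcat C G) X) (frob_map (slice (gcat C H) (A.R X)) (slice (gcat C G) X) (sliced_adj (gcat C H) (gcat C G) J X) g f) \<longleftrightarrow> iso (gcat C G) K"
    using A.frob_map_slice[OF X g f exD exC] by blast
  obtain n N \<nu>1 \<nu>2 where n: "n1 = ((n, N), \<nu>1, (w, b))" "n2 = ((n, N), \<nu>2, (ry, sy))" and pb\<nu>: "is_pullback C \<gamma> rf \<nu>1 \<nu>2"
    using H.gcat_pullback_underlying[OF ga rf(2) pbn[unfolded g_eq rf(1)]] by blast
  obtain m M \<mu>1 \<mu>2 where m: "m1 = ((m, M), \<mu>1, (fl, al))" "m2 = ((m, M), \<mu>2, (y, \<upsilon>))" and pb\<mu>: "is_pullback C \<tau> f0 \<mu>1 \<mu>2"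
    using G.gcat_pullback_underlying[OF \<tau>(2) fa pbm[unfolded \<tau>(1) f_eq]] by blast
  have n1a: "((n, N), \<nu>1, (w, b)) \<in> Arr (gcat C H)" and n2a: "((n, N), \<nu>2, (ry, sy)) \<in> Arr (gcat C H)"
    using H.S.D.is_pullbackD(1,2)[OF pbn] unfolding n .
  have m1a: "((m, M), \<mu>1, (fl, al)) \<in> Arr (gcat C G)" and m2a: "((m, M), \<mu>2, (y, \<upsilon>)) \<in> Arr (gcat C G)"
    using G.S.D.is_pullbackD(1,2)[OF pbm] unfolding m .
  have gn: "is_gobj C H n N" and \<nu>t: "\<nu>1 \<in> Arr C" "Dom C \<nu>1 = Dom C n" "Cod C \<nu>1 = Dom C w" "\<nu>2 \<in> Arr C" "Dom C \<nu>2 = Dom C n" "Cod C \<nu>2 = Dom C ry"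
    and e\<nu>: "equivariant C H (n, N) \<nu>1 (w, b)" "equivariant C H (n, N) \<nu>2 (ry, sy)"
    using n1a n2a unfolding H.gcat_simps by simp_all
  have gm: "is_gobj C G m M" and \<mu>t: "\<mu>1 \<in> Arr C" "Dom C \<mu>1 = Dom C m" "Cod C \<mu>1 = Dom C fl" "\<mu>2 \<in> Arr C" "Dom C \<mu>2 = Dom C m" "Cod C \<mu>2 = Dom C y"
    and e\<mu>: "equivariant C G (m, M) \<mu>1 (fl, al)" "equivariant C G (m, M) \<mu>2 (y, \<upsilon>)"
    using m1a m2a unfolding G.gcat_simps by simp_all
  have \<tau>t: "\<tau> \<in> Arr C" "Dom C \<tau> = Dom C fl" "Cod C \<tau> = Dom C x" using \<tau>(2) unfolding G.gcat_simps by simp_all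
  obtain ln an where Ln: "Lob (n, N) = (ln, an)" by (cases "Lob (n, N)")
  have LN: "repL n N (lam (n, N)) ln an" using repL_sel[OF gn] unfolding Ln by simp
  have gln: "is_gobj C G ln an" and lnb: "bil n N (lam (n, N)) ln an" and qn: "H.quot (PWf n) (PWa n N) (lam (n, N))"
    using LN unfolding repL_def by auto
  note lnt = gbilD[OF bilD(1)[OF lnb]]
  obtain \<kappa> where \<kappa>: "K = ((ln, an), \<kappa>, (m, M))"
    using K(1) unfolding n m by (cases K) (auto simp: H.gcat_simps(3,4) G.gcat_simps(3,4) Ln)
  have \<kappa>a: "((ln, an), \<kappa>, (m, M)) \<in> Arr (gcat C G)" using K(1) unfolding \<kappa> by simp
  have \<kappa>t: "\<kappa> \<in> Arr C" "Dom C \<kappa> = Dom C ln" "Cod C \<kappa> = Dom C m" using \<kappa>a unfolding G.gcat_simps by simp_all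
  obtain l1 where l1: "A.LA n1 = ((ln, an), l1, (fl, al))" "l1 \<cdot> lam (n, N) = lam (w, b) \<cdot> pm w n \<nu>1"
    using LA_form[OF n1a] unfolding Ln Lw n by blast
  have \<mu>1\<kappa>: "\<mu>1 \<cdot> \<kappa> = l1" using K(2) unfolding m \<kappa> l1(1) G.gcat_simps by simp
  obtain l2 where l2: "A.tr (y, \<upsilon>) n2 = ((ln, an), l2, (y, \<upsilon>))" "l2 \<cdot> lam (n, N) = rho (y, \<upsilon>) \<cdot> pm ry n \<nu>2"
    using tr_form[OF n2a[folded rsy] gy] unfolding rsy Ln n fst_conv by blast
  have "m2 \<cdot>\<^bsub>gcat C G\<^esub> K = A.tr (y, \<upsilon>) n2"
    unfolding K(3) adj_transpose_def f_eq G.gcat_simps ..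
  then have \<mu>2\<kappa>: "\<mu>2 \<cdot> \<kappa> = l2" unfolding m \<kappa> l2(1) G.gcat_simps by simp
  note [simp] = H.gobj_arr[OF W] H.gobj_arr[OF gr] H.gobj_arr[OF gry] H.gobj_arr[OF gn] G.gobj_arr[OF gx] G.gobj_arr[OF gy] G.gobj_arr[OF gl]
    G.gobj_arr[OF gm] G.gobj_arr[OF gln] \<gamma> f0 rft \<nu>t \<mu>t \<tau>t \<kappa>t \<rho>X(1-3) \<rho>Y(1-3) lt(1-3) lnt(1-3) W gr gry gn gx gy gl gm gln
  have r\<gamma>: "r \<cdot> \<gamma> = w" "r \<cdot> rf = ry" "w \<cdot> \<nu>1 = n" "ry \<cdot> \<nu>2 = n"
    using H.equivariantD(1)[OF e\<gamma>] H.equivariantD(1)[OF erf] H.equivariantD(1)[OF e\<nu>(1)] H.equivariantD(1)[OF e\<nu>(2)] by simp_all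
  note [simp] = r\<gamma>
  have el [simp]: "v \<in> Arr C \<Longrightarrow> Cod C v = Dom C w \<Longrightarrow> r \<cdot> (\<gamma> \<cdot> v) = w \<cdot> v" "v \<in> Arr C \<Longrightarrow> Cod C v = Dom C ry \<Longrightarrow> r \<cdot> (rf \<cdot> v) = ry \<cdot> v"
    "v \<in> Arr C \<Longrightarrow> Cod C v = Dom C n \<Longrightarrow> w \<cdot> (\<nu>1 \<cdot> v) = n \<cdot> v" "v \<in> Arr C \<Longrightarrow> Cod C v = Dom C n \<Longrightarrow> ry \<cdot> (\<nu>2 \<cdot> v) = n \<cdot> v" for v
    using comp_reassoc[OF r\<gamma>(1), of v] comp_reassoc[OF r\<gamma>(2), of v] comp_reassoc[OF r\<gamma>(3), of v] comp_reassoc[OF r\<gamma>(4), of v] by simp_all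
  define \<phi> where "\<phi> = \<kappa> \<cdot> lam (n, N)"
  have \<phi> [simp]: "\<phi> \<in> Arr C" "Dom C \<phi> = pb_obj C p n" "Cod C \<phi> = Dom C m" unfolding \<phi>_def by simp_all
  have \<mu>1\<phi>: "\<mu>1 \<cdot> \<phi> = lam (w, b) \<cdot> pm w n \<nu>1" unfolding \<phi>_def l1(2)[symmetric] \<mu>1\<kappa>[symmetric] by simp
  have \<mu>2\<phi>: "\<mu>2 \<cdot> \<phi> = rho (y, \<upsilon>) \<cdot> pm ry n \<nu>2" unfolding \<phi>_def l2(2)[symmetric] \<mu>2\<kappa>[symmetric] by simp
  have \<mu>2\<phi>x: "\<mu>2 \<cdot> (\<phi> \<cdot> pb_pair C p n u v) = rho (y, \<upsilon>) \<cdot> pb_pair C p ry u (\<nu>2 \<cdot> v)" if "pel p n u v" for u v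
    using comp_reassoc[OF \<mu>2\<phi>, of "pb_pair C p n u v"] pm_el[OF gry gn \<nu>t(4-6) r\<gamma>(4) \<rho>Y(1,2) that] that by simp
  have \<tau>x: "\<tau> \<cdot> (lam (w, b) \<cdot> pb_pair C p w u v) = rho (x, \<xi>) \<cdot> pb_pair C p r u (\<gamma> \<cdot> v)" if "pel p w u v" for u v
    using comp_reassoc[OF \<tau>(3), of "pb_pair C p w u v"] pm_el[OF gr W \<gamma> r\<gamma>(1) \<rho>X(1,2) that] that by simp
  have f0x: "rho (x, \<xi>) \<cdot> pb_pair C p r u (rf \<cdot> v) = f0 \<cdot> (rho (y, \<upsilon>) \<cdot> pb_pair C p ry u v)" if "pel p ry u v" for u v
    using pm_el[OF gr gry rft r\<gamma>(2) \<rho>X(1,2) that] that unfolding rf(3) by simp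
  have \<mu>c: "\<tau> \<cdot> \<mu>1 = f0 \<cdot> \<mu>2" by (rule is_pullbackD(6)[OF pb\<mu>])
  have flm: "fl \<cdot> \<mu>1 = m" "y \<cdot> \<mu>2 = m" using G.equivariantD(1)[OF e\<mu>(1)] G.equivariantD(1)[OF e\<mu>(2)] by simp_all
  \<comment> \<open>An element of the pullback on the right consists of \<open>(u, v)\<close> in the
    product of \<open>P\<close> and \<open>W\<close> and a point \<open>y0\<close> of the domain of
    \<open>f\<close>, with equal images in \<open>X\<close>. It has to be matched with a pair
    \<open>(u, l)\<close>, where \<open>l\<close> is a point of \<open>(n, N)\<close>.\<close>
  have pb: "is_pullback C (lam (w, b)) \<mu>1 (pm w n \<nu>1) \<phi>"
  proof (rule is_pullbackI)
    fix a B assume aB: "a \<in> Arr C" "B \<in> Arr C" "Dom C a = Dom C B" "Cod C a = Dom C (lam (w, b))" "Cod C B = Dom C \<mu>1" "lam (w, b) \<cdot> a = \<mu>1 \<cdot> B"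
    define u where "u = pb1 C p w \<cdot> a"
    define v where "v = pb2 C p w \<cdot> a"
    have a: "a = pb_pair C p w u v" unfolding u_def v_def using aB by simp
    have uv: "pel p w u v" unfolding u_def v_def using aB pb_comm(2)[of p w a] by simp
    have Dv: "Dom C v = Dom C B" unfolding v_def using aB by simp
    define y0 where "y0 = \<mu>2 \<cdot> B"
    have y0 [simp]: "y0 \<in> Arr C" "Dom C y0 = Dom C B" "Cod C y0 = Dom C y" unfolding y0_def using aB by simp_all
    have "q \<cdot> u = fl \<cdot> (\<mu>1 \<cdot> B)" using lt(4)[OF uv] aB(6) unfolding a by simp
    also have "\<dots> = y \<cdot> y0" unfolding y0_def using comp_reassoc[OF flm(1), of B] comp_reassoc[OF flm(2), of B] aB(1-5) by simp
    finally have qu: "pel q y u y0" using uv Dv by simp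
    \<comment> \<open>The point \<open>u\<close> of \<open>P\<close> turns \<open>y0\<close> into a
      point \<open>v2\<close> of the right adjoint at the domain of \<open>f\<close>.\<close>
    obtain v2 where v2: "v2 \<in> Arr C" "Dom C v2 = Dom C y0" "Cod C v2 = Dom C ry" "ry \<cdot> v2 = p \<cdot> u" "rho (y, \<upsilon>) \<cdot> pb_pair C p ry u v2 = y0"
      using preRD(4)[OF pRY qu] by blast
    have uv2: "pel p ry u v2" using v2 uv Dv by simp
    have e1: "rho (x, \<xi>) \<cdot> pb_pair C p r u (\<gamma> \<cdot> v) = f0 \<cdot> y0"
      unfolding \<tau>x[OF uv, symmetric] a[symmetric] aB(6) y0_def using comp_reassoc[OF \<mu>c, of B] aB(1-5) by simp
    have e2: "rho (x, \<xi>) \<cdot> pb_pair C p r u (rf \<cdot> v2) = f0 \<cdot> y0"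
      unfolding f0x[OF uv2] v2(5) ..
    have xf: "x \<cdot> (f0 \<cdot> y0) = q \<cdot> u"
      using \<rho>X(4)[of u "\<gamma> \<cdot> v"] e1 uv by simp
    \<comment> \<open>At \<open>u\<close>, both sides correspond to the same point
      \<open>f0 \<cdot> y0\<close> of \<open>X\<close>, so they agree by uniqueness in
      \<open>preR\<close>. Hence \<open>v\<close> and \<open>v2\<close> define a point
      \<open>l\<close> of \<open>(n, N)\<close>.\<close>
    have "\<gamma> \<cdot> v = rf \<cdot> v2"
      by (rule preRD(5)[OF pRX _ _ _ _ _ _ _ _ _ e1 e2]) (use uv v2(1-4) Dv xf in simp_all)
    then obtain l where l: "l \<in> Arr C" "Dom C l = Dom C v2" "Cod C l = Dom C \<nu>1" "\<nu>1 \<cdot> l = v" "\<nu>2 \<cdot> l = v2"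
      using is_pullback_ex[OF pb\<nu>, of v v2] uv v2(1-3) Dv by auto
    have "n \<cdot> l = w \<cdot> (\<nu>1 \<cdot> l)" using l(1-3) by simp
    then have ul: "pel p n u l" using l v2(2) uv Dv by simp
    define h where "h = pb_pair C p n u l"
    have h [simp]: "h \<in> Arr C" "Dom C h = Dom C B" "Cod C h = pb_obj C p n" unfolding h_def using ul l(2) v2(2) by simp_all
    have b1h: "pm w n \<nu>1 \<cdot> h = a" unfolding a h_def using ul l(4) by simp
    have "\<phi> \<cdot> h = B"
    proof (rule is_pullback_ext[OF pb\<mu>])
      have "\<mu>1 \<cdot> (\<phi> \<cdot> h) = lam (w, b) \<cdot> (pm w n \<nu>1 \<cdot> h)" using comp_reassoc[OF \<mu>1\<phi>, of h] by simp
      then show "\<mu>1 \<cdot> (\<phi> \<cdot> h) = \<mu>1 \<cdot> B" unfolding b1h aB(6) .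
      show "\<mu>2 \<cdot> (\<phi> \<cdot> h) = \<mu>2 \<cdot> B" unfolding h_def \<mu>2\<phi>x[OF ul] l(5) v2(5) y0_def ..
    qed (use aB in simp_all)
    then show "\<exists>h. h \<in> Arr C \<and> Dom C h = Dom C B \<and> Cod C h = Dom C (pm w n \<nu>1) \<and> pm w n \<nu>1 \<cdot> h = a \<and> \<phi> \<cdot> h = B"
      using b1h by (intro exI[of _ h]) simp
  next
    fix h k assume hk: "h \<in> Arr C" "k \<in> Arr C" "Dom C h = Dom C k" "Cod C h = Dom C (pm w n \<nu>1)" "Cod C k = Dom C (pm w n \<nu>1)"
      "pm w n \<nu>1 \<cdot> h = pm w n \<nu>1 \<cdot> k" "\<phi> \<cdot> h = \<phi> \<cdot> k"
    have hkt [simp]: "h \<in> Arr C" "k \<in> Arr C" "Dom C h = Dom C k" "Cod C h = pb_obj C p n" "Cod C k = pb_obj C p n" using hk(1-5) by simp_all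
    define u where "u = pb1 C p n \<cdot> k"
    define vh where "vh = pb2 C p n \<cdot> h"
    define vk where "vk = pb2 C p n \<cdot> k"
    have pmt: "pb1 C p w \<cdot> pm w n \<nu>1 = pb1 C p n" "pb2 C p w \<cdot> pm w n \<nu>1 = \<nu>1 \<cdot> pb2 C p n" by simp_all
    have "pb1 C p n \<cdot> h = pb1 C p w \<cdot> (pm w n \<nu>1 \<cdot> h)" by (rule comp_reassoc[OF pmt(1), symmetric]) simp_all
    also have "\<dots> = u" unfolding hk(6) u_def by (rule comp_reassoc[OF pmt(1)]) simp_all
    finally have uh: "pb1 C p n \<cdot> h = u" .
    have h_eq: "h = pb_pair C p n u vh" and k_eq: "k = pb_pair C p n u vk"
      unfolding vh_def vk_def uh[symmetric] by simp (simp add: uh u_def)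
    have uvk: "pel p n u vk" "pel p n u vh"
      using pb_comm(2)[of p n k] pb_comm(2)[of p n h] unfolding uh u_def vk_def vh_def by simp_all
    have "\<nu>1 \<cdot> vh = pb2 C p w \<cdot> (pm w n \<nu>1 \<cdot> h)" unfolding vh_def using comp_reassoc[OF pmt(2), of h] by simp
    also have "\<dots> = \<nu>1 \<cdot> vk" unfolding hk(6) vk_def using comp_reassoc[OF pmt(2), of k] by simp
    finally have v1: "\<nu>1 \<cdot> vh = \<nu>1 \<cdot> vk" .
    have e: "rho (y, \<upsilon>) \<cdot> pb_pair C p ry u (\<nu>2 \<cdot> vh) = rho (y, \<upsilon>) \<cdot> pb_pair C p ry u (\<nu>2 \<cdot> vk)"
      unfolding \<mu>2\<phi>x[OF uvk(1), symmetric] \<mu>2\<phi>x[OF uvk(2), symmetric] h_eq[symmetric] k_eq[symmetric] hk(7) ..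
    have v2: "\<nu>2 \<cdot> vh = \<nu>2 \<cdot> vk"
      by (rule preRD(5)[OF pRY _ _ _ _ _ _ _ _ _ e refl])
        (use uvk \<rho>Y(4)[of u "\<nu>2 \<cdot> vk"] in simp_all)
    have "vh = vk"
      by (rule is_pullback_ext[OF pb\<nu>]) (use uvk v1 v2 in simp_all)
    then show "h = k" using h_eq k_eq by simp
  qed (use \<mu>1\<phi> in simp_all)
  have "H.invariant (PWf n) (PWa n N) \<phi>"
    unfolding \<phi>_def by (rule H.invariant_comp[OF PW(1)[OF gn] H.quotD(1)[OF qn]]) simp_all
  then have "H.quot (PWf n) (PWa n N) \<phi>"
    by - (rule H.quot_pullback[OF PW(1)[OF W] PW(1)[OF gn] ql _ _ equivariant_pm[OF W gn \<nu>t(1-3) e\<nu>(1)] _ pb], simp_all add: PW(2)[OF gn])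
  then have "iso C \<kappa>"
    by - (rule H.quot_iso[OF PW(1)[OF gn] qn], simp_all add: \<phi>_def)
  then have "iso (gcat C G) K" using G.iso_gcat[OF \<kappa>a] unfolding \<kappa> by simp
  then show "iso (slice (gcat C G) X) (frob_map (slice (gcat C H) (A.R X)) (slice (gcat C G) X) (sliced_adj (gcat C H) (gcat C G) J X) g f)"
    using fr by simp
qed

subsection \<open>The isomorphism over the base\<close>

lemma Lob_facts:
  assumes W: "is_gobj C H w b" and Lw: "Lob (w, b) = (f, a)"
  shows "is_gobj C G f a" "repL w b (lam (w, b)) f a" "bil w b (lam (w, b)) f a" "H.quot (PWf w) (PWa w b) (lam (w, b))"
    "lam (w, b) \<in> Arr C" "Dom C (lam (w, b)) = pb_obj C p w" "Cod C (lam (w, b)) = Dom C f"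
proof -
  show L: "repL w b (lam (w, b)) f a" using repL_sel[OF W] unfolding Lw by simp
  then show "is_gobj C G f a" and b: "bil w b (lam (w, b)) f a" and "H.quot (PWf w) (PWa w b) (lam (w, b))"
    unfolding repL_def by auto
  show "lam (w, b) \<in> Arr C" "Dom C (lam (w, b)) = pb_obj C p w" "Cod C (lam (w, b)) = Dom C f"
    using gbilD(1-3)[OF bilD(1)[OF b]] by simp_all
qed

text \<open>\<open>zeta\<close> is the quotient map by \<open>G\<close> and \<open>lam\<close> the
  quotient map by \<open>H\<close>; both are epic. Arrows out of \<open>\<Sigma>\<^sub>G L W\<close>
  are therefore compared on the product of \<open>P\<close> and \<open>W\<close>.\<close>

lemma zeta_lam_ext:
  assumes W: "is_gobj C H w b" and Lw: "Lob (w, b) = (f, a)"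
    and k: "k \<in> Arr C" "k' \<in> Arr C" "Dom C k = G.S.L (f, a)" "Dom C k' = G.S.L (f, a)" "Cod C k = Cod C k'"
    and eq: "k \<cdot> (G.zeta (f, a) \<cdot> lam (w, b)) = k' \<cdot> (G.zeta (f, a) \<cdot> lam (w, b))"
  shows "k = k'"
proof -
  note L = Lob_facts[OF W Lw]
  note [simp] = G.zeta_simps[OF L(1)] L(5-7)
  have "(k \<cdot> G.zeta (f, a)) \<cdot> lam (w, b) = (k' \<cdot> G.zeta (f, a)) \<cdot> lam (w, b)" using k eq by simp
  then have "k \<cdot> G.zeta (f, a) = k' \<cdot> G.zeta (f, a)"
    by - (rule repL_ext[OF W L(2)], use k in simp_all)
  then show ?thesis
    by - (rule G.quot_ext[OF L(1) G.quot_zeta[OF L(1)]], use k in simp_all)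
qed

text \<open>Both \<open>\<Sigma>\<^sub>G L W\<close> and \<open>\<Sigma>\<^sub>H W\<close> are quotients of \<open>P \<times> W\<close> by the actions of \<open>G\<close> and \<open>H\<close>.\<close>

definition "theta W = (SOME t. t \<in> Arr C \<and> Dom C t = G.S.L (Lob W) \<and> Cod C t = H.S.L W \<and>
  t \<cdot> (G.zeta (Lob W) \<cdot> lam W) = H.zeta W \<cdot> pb2 C p (fst W))"

text \<open>The arrow from the product of \<open>P\<close> and \<open>W\<close> to
  \<open>\<Sigma>\<^sub>H W\<close> factors first through the quotient by \<open>H\<close>, then
  through that by \<open>G\<close>. For the inverse the order is exchanged: the map to
  \<open>\<Sigma>\<^sub>G L W\<close> is invariant under \<open>G\<close>, so it descends along
  \<open>p\<close> to \<open>W\<close>, and the result \<open>s2\<close> is invariant under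
  \<open>H\<close>.\<close>

lemma theta:
  assumes W: "is_gobj C H w b" and Lw: "Lob (w, b) = (f, a)"
  shows "theta (w, b) \<in> Arr C" "Dom C (theta (w, b)) = G.S.L (f, a)" "Cod C (theta (w, b)) = H.S.L (w, b)"
    "theta (w, b) \<cdot> (G.zeta (f, a) \<cdot> lam (w, b)) = H.zeta (w, b) \<cdot> pb2 C p w" "iso C (theta (w, b))"
proof -
  note L = Lob_facts[OF W Lw]
  note Gz [simp] = G.zeta_simps(1-4)[OF L(1)] and Hz [simp] = H.zeta_simps(1-4)[OF W] and Lt [simp] = L(5-7)
  note [simp] = H.gobj_arr[OF W] G.gobj_arr[OF L(1)] W L(1)
  note Hzi = H.invariantD(3)[OF H.zeta_invariant[OF W]] and Gzi = G.invariantD(3)[OF G.zeta_invariant[OF L(1)]]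
  note lb = gbilD(4,5)[OF bilD(1)[OF L(3)]] and lH = bilD(2)[OF L(3)]
  define t1 where "t1 = H.zeta (w, b) \<cdot> pb2 C p w"
  have t1 [simp]: "t1 \<in> Arr C" "Dom C t1 = pb_obj C p w" "Cod C t1 = H.S.L (w, b)" unfolding t1_def by simp_all
  have t1p: "t1 \<cdot> pb_pair C p w x v = H.zeta (w, b) \<cdot> v" if "pel p w x v" for x v
    unfolding t1_def using that by simp
  have i1: "H.invariant (PWf w) (PWa w b) t1"
    unfolding PW_invariant[OF W]
  proof (intro conjI allI impI)
    fix h x v assume *: "pel p w x v \<and> pel (d0 H) p h x"
    then have hv: "pel (d0 H) w h v" and xv: "pel p w x v" "pel p w (ha h x) (act C H w b h v)" by simp_all
    show "t1 \<cdot> pb_pair C p w (ha h x) (act C H w b h v) = t1 \<cdot> pb_pair C p w x v"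
      unfolding t1p[OF xv(1)] t1p[OF xv(2)] by (rule Hzi[OF hv])
  qed simp_all
  obtain t2 where t20: "t2 \<in> Arr C" "Dom C t2 = Cod C (lam (w, b))" "Cod C t2 = Cod C t1" and t2l: "t2 \<cdot> lam (w, b) = t1"
    using H.quot_ex[OF L(4) i1] by blast
  then have t2 [simp]: "t2 \<in> Arr C" "Dom C t2 = Dom C f" "Cod C t2 = H.S.L (w, b)" by simp_all
  have i2: "G.invariant f a t2"
  proof (rule G.invariantI)
    fix g m assume gm: "pel (d0 G) f g m"
    then have "m \<in> Arr C" "Cod C m = Cod C (lam (w, b))" by simp_all
    then obtain e x v where e [simp]: "e \<in> Arr C" "Cod C e = Dom C m" "Dom C e = Dom C v" and xv: "pel p w x v" and zm: "lam (w, b) \<cdot> pb_pair C p w x v = m \<cdot> e"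
      and eq: "\<And>k k'. k \<in> Arr C \<Longrightarrow> k' \<in> Arr C \<Longrightarrow> Dom C k = Dom C m \<Longrightarrow> Dom C k' = Dom C m \<Longrightarrow> Cod C k = Cod C k' \<Longrightarrow> k \<cdot> e = k' \<cdot> e \<Longrightarrow> k = k'"
      using quot_local[OF W L(4), of m] by metis
    have "d0 G \<cdot> (g \<cdot> e) = f \<cdot> (m \<cdot> e)" using gm comp_reassoc[of "d0 G" g "f \<cdot> m" e] by simp
    also have "\<dots> = q \<cdot> x" unfolding zm[symmetric] by (rule lb(1)[OF xv])
    finally have ge: "pel (d0 G) q (g \<cdot> e) x" using gm xv by simp
    have gx: "pel p w (ga (g \<cdot> e) x) v" using xv ge by simp
    have "(t2 \<cdot> act C G f a g m) \<cdot> e = t2 \<cdot> (lam (w, b) \<cdot> pb_pair C p w (ga (g \<cdot> e) x) v)"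
      unfolding lb(2)[OF xv ge] zm using gm by simp
    also have "\<dots> = H.zeta (w, b) \<cdot> v"
      using comp_reassoc[OF t2l, of "pb_pair C p w (ga (g \<cdot> e) x) v"] gx t1p[OF gx] by simp
    also have "\<dots> = t2 \<cdot> (lam (w, b) \<cdot> pb_pair C p w x v)"
      using comp_reassoc[OF t2l, of "pb_pair C p w x v"] xv t1p[OF xv] by simp
    also have "\<dots> = (t2 \<cdot> m) \<cdot> e" unfolding zm using gm by simp
    finally show "t2 \<cdot> act C G f a g m = t2 \<cdot> m"
      by - (rule eq, use gm in simp_all)
  qed simp_all
  obtain t where t0: "t \<in> Arr C" "Dom C t = Cod C (G.zeta (f, a))" "Cod C t = Cod C t2" and tz: "t \<cdot> G.zeta (f, a) = t2"
    using G.quot_ex[OF G.quot_zeta[OF L(1)] i2] by blast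
  have "t \<cdot> (G.zeta (f, a) \<cdot> lam (w, b)) = t1"
    using comp_reassoc[OF tz, of "lam (w, b)"] t0 t2l by simp
  then have "\<exists>t. t \<in> Arr C \<and> Dom C t = G.S.L (Lob (w, b)) \<and> Cod C t = H.S.L (w, b) \<and>
      t \<cdot> (G.zeta (Lob (w, b)) \<cdot> lam (w, b)) = H.zeta (w, b) \<cdot> pb2 C p (fst (w, b))"
    unfolding Lw t1_def using t0 by auto
  from someI_ex[OF this] show \<theta> [simp]: "theta (w, b) \<in> Arr C" "Dom C (theta (w, b)) = G.S.L (f, a)" "Cod C (theta (w, b)) = H.S.L (w, b)"
    and \<theta>z: "theta (w, b) \<cdot> (G.zeta (f, a) \<cdot> lam (w, b)) = H.zeta (w, b) \<cdot> pb2 C p w"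
    unfolding theta_def Lw by simp_all
  define s1 where "s1 = G.zeta (f, a) \<cdot> lam (w, b)"
  have s1 [simp]: "s1 \<in> Arr C" "Dom C s1 = pb_obj C p w" "Cod C s1 = G.S.L (f, a)" unfolding s1_def by simp_all
  have s1p: "s1 \<cdot> pb_pair C p w x v = G.zeta (f, a) \<cdot> (lam (w, b) \<cdot> pb_pair C p w x v)" if "pel p w x v" for x v
    unfolding s1_def using that by simp
  obtain s2 where s2 [simp]: "s2 \<in> Arr C" "Dom C s2 = Dom C w" and s20: "Cod C s2 = Cod C s1" and s2p: "s2 \<cdot> pb2 C p w = s1"
  proof (rule descend[of w s1])
    fix g x v assume xv: "pel p w x v" and gx: "pel (d0 G) q g x"
    have gm: "pel (d0 G) f g (lam (w, b) \<cdot> pb_pair C p w x v)" using lb(1)[OF xv] xv gx by simp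
    have gxv: "pel p w (ga g x) v" using xv gx by simp
    show "s1 \<cdot> pb_pair C p w (ga g x) v = s1 \<cdot> pb_pair C p w x v"
      unfolding s1p[OF xv] s1p[OF gxv] lb(2)[OF xv gx] by (rule Gzi[OF gm])
  qed simp_all
  then have s2c [simp]: "Cod C s2 = G.S.L (f, a)" by simp
  have s2v: "s2 \<cdot> v = s1 \<cdot> pb_pair C p w x v" if "pel p w x v" for x v
    using comp_reassoc[OF s2p, of "pb_pair C p w x v"] that by simp
  have i3: "H.invariant w b s2"
  proof (rule H.invariantI)
    fix h v assume hv: "pel (d0 H) w h v"
    \<comment> \<open>Invariance of \<open>s2\<close> needs a point of \<open>P\<close> over the
      target of \<open>h\<close>. The generic such point \<open>x\<close> exists after pulling
      \<open>p\<close> back along \<open>t\<close>, and \<open>descend_unique\<close> removes this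
      restriction.\<close>
    define t where "t = d1 H \<cdot> h"
    have t [simp]: "t \<in> Arr C" "Dom C t = Dom C v" "Cod C t = G0 H" unfolding t_def using hv by simp_all
    define x where "x = pb1 C p t"
    define s where "s = pb2 C p t"
    have xs [simp]: "x \<in> Arr C" "s \<in> Arr C" "Dom C x = Dom C s" "Cod C x = Dom C p" "Cod C s = Dom C v" "p \<cdot> x = t \<cdot> s"
      unfolding x_def s_def by (simp_all add: pb_comm)
    have ts: "t \<cdot> s = d1 H \<cdot> (h \<cdot> s)" unfolding t_def using hv by simp
    have d0s: "d0 H \<cdot> (h \<cdot> s) = w \<cdot> (v \<cdot> s)" using hv comp_reassoc[of "d0 H" h "w \<cdot> v" s] by simp
    let ?x = "ha (gi H \<cdot> (h \<cdot> s)) x"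
    have x1: "pel p w ?x (v \<cdot> s)" "pel (d0 H) p (h \<cdot> s) ?x" using hv ts d0s by simp_all
    have x2: "ha (h \<cdot> s) ?x = x" using hv ts d0s by simp
    have x3: "pel p w x (act C H w b (h \<cdot> s) (v \<cdot> s))" using hv ts d0s by simp
    have "(s2 \<cdot> act C H w b h v) \<cdot> s = s2 \<cdot> act C H w b (h \<cdot> s) (v \<cdot> s)" using hv by simp
    also have "\<dots> = G.zeta (f, a) \<cdot> (lam (w, b) \<cdot> pb_pair C p w (ha (h \<cdot> s) ?x) (act C H w b (h \<cdot> s) (v \<cdot> s)))"
      unfolding x2 s2v[OF x3] by (rule s1p[OF x3])
    also have "\<dots> = s2 \<cdot> (v \<cdot> s)"
      unfolding lH[OF x1] s2v[OF x1(1)] by (rule s1p[OF x1(1), symmetric])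
    finally have "(s2 \<cdot> act C H w b h v) \<cdot> pb2 C p t = (s2 \<cdot> v) \<cdot> pb2 C p t"
      unfolding s_def[symmetric] using hv by simp
    then show "s2 \<cdot> act C H w b h v = s2 \<cdot> v"
      by - (rule descend_unique[OF t(1,3)], use hv in simp_all)
  qed simp_all
  obtain k where k0: "k \<in> Arr C" "Dom C k = Cod C (H.zeta (w, b))" "Cod C k = Cod C s2" and kz: "k \<cdot> H.zeta (w, b) = s2"
    using H.quot_ex[OF H.quot_zeta[OF W] i3] by blast
  then have k [simp]: "k \<in> Arr C" "Dom C k = H.S.L (w, b)" "Cod C k = G.S.L (f, a)" by simp_all
  have "k \<cdot> theta (w, b) = Id C (G.S.L (f, a))"
  proof (rule zeta_lam_ext[OF W Lw])
    have "(k \<cdot> theta (w, b)) \<cdot> (G.zeta (f, a) \<cdot> lam (w, b)) = k \<cdot> (H.zeta (w, b) \<cdot> pb2 C p w)"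
      unfolding \<theta>z[symmetric] by (rule comp_assoc) simp_all
    also have "\<dots> = s2 \<cdot> pb2 C p w" by (rule comp_reassoc[OF kz]) simp_all
    also have "\<dots> = Id C (G.S.L (f, a)) \<cdot> (G.zeta (f, a) \<cdot> lam (w, b))" unfolding s2p s1_def by simp
    finally show "(k \<cdot> theta (w, b)) \<cdot> (G.zeta (f, a) \<cdot> lam (w, b)) = Id C (G.S.L (f, a)) \<cdot> (G.zeta (f, a) \<cdot> lam (w, b))" .
  qed simp_all
  moreover have "theta (w, b) \<cdot> k = Id C (H.S.L (w, b))"
  proof -
    have "theta (w, b) \<cdot> (k \<cdot> H.zeta (w, b)) = H.zeta (w, b)"
    proof (rule descend_unique[of w])
      have "(theta (w, b) \<cdot> s2) \<cdot> pb2 C p w = theta (w, b) \<cdot> (s2 \<cdot> pb2 C p w)" by (rule comp_assoc) simp_all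
      also have "\<dots> = H.zeta (w, b) \<cdot> pb2 C p w" unfolding s2p s1_def by (rule \<theta>z)
      finally show "(theta (w, b) \<cdot> (k \<cdot> H.zeta (w, b))) \<cdot> pb2 C p w = H.zeta (w, b) \<cdot> pb2 C p w" unfolding kz .
    qed simp_all
    then have "(theta (w, b) \<cdot> k) \<cdot> H.zeta (w, b) = Id C (H.S.L (w, b)) \<cdot> H.zeta (w, b)" by simp
    then show ?thesis
      by - (rule H.quot_ext[OF W H.quot_zeta[OF W]], simp_all)
  qed
  ultimately show "iso C (theta (w, b))" by (intro isoI[where g = k]) simp_all
qed

lemma over_base_theta: "over_base C H SH SG J theta"
  unfolding over_base_def nat_iso_def nat_trans_def
proof (intro conjI ballI)
  show "is_functor (gcat C H) C (Ladj SG \<circ>F Ladj J)"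
    using is_functorD[OF A.functor_L] is_functorD[OF G.S.functor_L] unfolding is_functor_def by (simp del: B.bi_FO)
  show "is_functor (gcat C H) C (Ladj SH)" by (rule H.S.functor_L)
next
  fix W assume W: "W \<in> Obj (gcat C H)"
  obtain w b where Wb: "W = (w, b)" by (cases W)
  obtain f a where Lw: "Lob (w, b) = (f, a)" by (cases "Lob (w, b)")
  have g: "is_gobj C H w b" using W unfolding Wb H.gcat_simps .
  show "theta W \<in> hom C (FO (Ladj SG \<circ>F Ladj J) W) (H.S.L W)" "iso C (theta W)"
    using theta[OF g Lw] unfolding Wb by (simp_all add: Lw)
next
  fix k assume k: "k \<in> Arr (gcat C H)"
  then obtain w' b' l w b where kk: "k = ((w', b'), l, (w, b))" and g: "is_gobj C H w' b'" "is_gobj C H w b" and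
    lt: "l \<in> Arr C" "Dom C l = Dom C w'" "Cod C l = Dom C w" "w \<cdot> l = w'" by (rule gcat_H_cases)
  obtain f a where Lw: "Lob (w, b) = (f, a)" by (cases "Lob (w, b)")
  obtain f' a' where Lw': "Lob (w', b') = (f', a')" by (cases "Lob (w', b')")
  note ka = k[unfolded kk]
  obtain m where m: "A.LA ((w', b'), l, (w, b)) = ((f', a'), m, (f, a))" "((f', a'), m, (f, a)) \<in> Arr (gcat C G)"
    "m \<cdot> lam (w', b') = lam (w, b) \<cdot> pm w w' l"
    using LA_form[OF ka] unfolding Lw Lw' by blast
  note L = Lob_facts[OF g(2) Lw] and L' = Lob_facts[OF g(1) Lw'] and T = theta[OF g(2) Lw] and T' = theta[OF g(1) Lw']
  note zG = G.zeta_natural[OF m(2)] and zH = H.zeta_natural[OF ka]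
  have mt: "m \<in> Arr C" "Dom C m = Dom C f'" "Cod C m = Dom C f" using m(2) unfolding G.gcat_simps by simp_all
  note [simp] = L(5-7) L'(5-7) T(1-3) T'(1-3) zG(1-3) zH(1-3) mt G.zeta_simps(1-4)[OF L(1)] G.zeta_simps(1-4)[OF L'(1)]
     H.zeta_simps(1-4)[OF g(1)] H.zeta_simps(1-4)[OF g(2)] H.gobj_arr[OF g(1)] H.gobj_arr[OF g(2)] lt
  let ?S = "G.S.LA ((f', a'), m, (f, a))"
  have zl: "G.zeta (f, a) \<cdot> lam (w, b) \<in> Arr C" "Dom C (G.zeta (f, a) \<cdot> lam (w, b)) = pb_obj C p w" "Cod C (G.zeta (f, a) \<cdot> lam (w, b)) = G.S.L (f, a)"
    by simp_all
  have "H.S.LA ((w', b'), l, (w, b)) \<cdot> theta (w', b') = theta (w, b) \<cdot> ?S"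
  proof (rule zeta_lam_ext[OF g(1) Lw'])
    have "(H.S.LA ((w', b'), l, (w, b)) \<cdot> theta (w', b')) \<cdot> (G.zeta (f', a') \<cdot> lam (w', b'))
       = H.S.LA ((w', b'), l, (w, b)) \<cdot> (theta (w', b') \<cdot> (G.zeta (f', a') \<cdot> lam (w', b')))" by (rule comp_assoc) simp_all
    also have "\<dots> = (H.S.LA ((w', b'), l, (w, b)) \<cdot> H.zeta (w', b')) \<cdot> pb2 C p w'" unfolding T'(4) by simp
    also have "\<dots> = H.zeta (w, b) \<cdot> (pb2 C p w \<cdot> pm w w' l)" unfolding zH(4) by simp
    also have "\<dots> = (theta (w, b) \<cdot> (G.zeta (f, a) \<cdot> lam (w, b))) \<cdot> pm w w' l" unfolding T(4) by simp
    also have "\<dots> = theta (w, b) \<cdot> (G.zeta (f, a) \<cdot> (m \<cdot> lam (w', b')))" unfolding m(3) using zl by simp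
    also have "G.zeta (f, a) \<cdot> (m \<cdot> lam (w', b')) = (?S \<cdot> G.zeta (f', a')) \<cdot> lam (w', b')" unfolding zG(4) by simp
    also have "theta (w, b) \<cdot> \<dots> = (theta (w, b) \<cdot> ?S) \<cdot> (G.zeta (f', a') \<cdot> lam (w', b'))" by simp
    finally show "(H.S.LA ((w', b'), l, (w, b)) \<cdot> theta (w', b')) \<cdot> (G.zeta (f', a') \<cdot> lam (w', b')) =
      (theta (w, b) \<cdot> ?S) \<cdot> (G.zeta (f', a') \<cdot> lam (w', b'))" .
  qed simp_all
  then show "H.S.LA k \<cdot> theta (Dom (gcat C H) k) = theta (Cod (gcat C H) k) \<cdot> FA (Ladj SG \<circ>F Ladj J) k"
    unfolding kk H.gcat_simps func_simps m(1) .
qed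

subsection \<open>The associated Hilsum--Skandalis map\<close>

text \<open>Since \<open>\<psi>\<close> is \<open>E\<close> followed backwards along the isomorphism
  \<open>\<Sigma>\<^sub>G L \<cong> \<Sigma>\<^sub>H\<close> and \<open>sigma_prod\<close> for
  \<open>H\<close>, it suffices to show that \<open>E\<close> equals the composite of these two. By
  \<open>zeta_lam_ext\<close> this is an equation between two explicit maps on the product of
  \<open>P\<close>, \<open>T\<^sub>H 1\<close> and \<open>P\<close>.\<close>

lemma hs_psi_Id: "hs_psi C H G SH SG J theta = Id C (Dom C p)"
proof -
  define n1 where "n1 = pr1 (gcat C H) (free_one H) (p, c)"
  define n2 where "n2 = pr2 (gcat C H) (free_one H) (p, c)"
  note fH = H.gobj_free_one and fG = G.gobj_free_one
  have exH: "\<exists>u v. is_product (gcat C H) (free_one H) (p, c) u v"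
    using H.gcat_product_ex[OF fH gp] unfolding free_one_def by blast
  obtain n N k1 k2 where n: "n1 = ((n, N), k1, free_one H)" "n2 = ((n, N), k2, (p, c))" and na: "n1 \<in> Arr (gcat C H)" "n2 \<in> Arr (gcat C H)"
    and pbn: "is_pullback C (d1 H) p k1 k2"
    using H.gcat_product_underlying[OF fH gp H.S.D.is_product_pr[OF exH, unfolded free_one_def]] unfolding free_one_def n1_def n2_def by blast
  note n' = n[unfolded n1_def n2_def]
  have gn: "is_gobj C H n N" and kt: "k1 \<in> Arr C" "Dom C k1 = Dom C n" "Cod C k1 = G1 H" "k2 \<in> Arr C" "Dom C k2 = Dom C n" "Cod C k2 = Dom C p"
    and ke: "equivariant C H (n, N) k1 (d1 H, gm H)" "equivariant C H (n, N) k2 (p, c)"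
    using na unfolding n free_one_def H.gcat_simps by simp_all
  have exG: "\<exists>u v. is_product (gcat C G) (q, d) (free_one G) u v"
    using G.gcat_product_ex[OF gq fG] unfolding free_one_def by blast
  obtain m M \<mu>1 \<mu>2 where m: "pr1 (gcat C G) (q, d) (free_one G) = ((m, M), \<mu>1, (q, d))" "pr2 (gcat C G) (q, d) (free_one G) = ((m, M), \<mu>2, free_one G)"
    and ma: "((m, M), \<mu>1, (q, d)) \<in> Arr (gcat C G)" "((m, M), \<mu>2, free_one G) \<in> Arr (gcat C G)"
    using G.gcat_product_underlying[OF gq fG G.S.D.is_product_pr[OF exG, unfolded free_one_def]] unfolding free_one_def by metis
  have exG': "\<exists>u v. is_product (gcat C G) (free_one G) (q, d) u v"
    using G.gcat_product_ex[OF fG gq] unfolding free_one_def by blast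
  obtain m' M' \<mu>1' \<mu>2' where m': "pr1 (gcat C G) (free_one G) (q, d) = ((m', M'), \<mu>1', free_one G)" "pr2 (gcat C G) (free_one G) (q, d) = ((m', M'), \<mu>2', (q, d))"
    and ma': "((m', M'), \<mu>1', free_one G) \<in> Arr (gcat C G)" "((m', M'), \<mu>2', (q, d)) \<in> Arr (gcat C G)"
    and pbm': "is_pullback C (d1 G) q \<mu>1' \<mu>2'"
    using G.gcat_product_underlying[OF fG gq G.S.D.is_product_pr[OF exG', unfolded free_one_def]] unfolding free_one_def by metis
  have \<mu>t [simp]: "\<mu>1 \<in> Arr C" "Dom C \<mu>1 = Dom C m" "Cod C \<mu>1 = Dom C p" "\<mu>2 \<in> Arr C" "Dom C \<mu>2 = Dom C m" "Cod C \<mu>2 = G1 G" and gm: "is_gobj C G m M"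
    using ma unfolding free_one_def G.gcat_simps by simp_all
  have \<mu>t' [simp]: "\<mu>1' \<in> Arr C" "Dom C \<mu>1' = Dom C m'" "Cod C \<mu>1' = G1 G" "\<mu>2' \<in> Arr C" "Dom C \<mu>2' = Dom C m'" "Cod C \<mu>2' = Dom C p" and gm': "is_gobj C G m' M'"
    using ma' unfolding free_one_def G.gcat_simps by simp_all
  obtain f a where Ln: "Lob (n, N) = (f, a)" by (cases "Lob (n, N)")
  note L = Lob_facts[OF gn Ln] and T = theta[OF gn Ln]
  obtain l1 where l1: "A.LA n1 = ((f, a), l1, (q, d))" "((f, a), l1, (q, d)) \<in> Arr (gcat C G)" "l1 \<cdot> lam (n, N) = lam1 \<cdot> pm (d1 H) n k1"
    using LA_form[OF na(1)[unfolded n free_one_def], folded free_one_def] unfolding Lob_free Ln n[symmetric] by blast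
  obtain l2 where l2: "A.tr (free_one G) n2 = ((f, a), l2, free_one G)" "((f, a), l2, free_one G) \<in> Arr (gcat C G)" "l2 \<cdot> lam (n, N) = dvar \<cdot> pm p n k2"
    using tr_form[OF na(2)[unfolded n, folded Rob_free, unfolded free_one_def] fG, folded free_one_def] unfolding Rob_free Ln n[symmetric] fst_conv by blast
  have ft: "Lob (free_one H) = (q, d)" "A.R (free_one G) = (p, c)" using Lob_free Rob_free by simp_all
  define F where "F = frob_map (gcat C H) (gcat C G) J (free_one H) (free_one G)"
  have F_eq: "F = prod_pair (gcat C G) ((f, a), l1, (q, d)) ((f, a), l2, free_one G)"
    unfolding F_def frob_map_def ft n1_def[symmetric] n2_def[symmetric] l1(1) l2(1)[unfolded adj_transpose_def] ..
  have F: "F \<in> Arr (gcat C G)" "Dom (gcat C G) F = (f, a)" "Cod (gcat C G) F = (m, M)"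
    "((m, M), \<mu>1, (q, d)) \<cdot>\<^bsub>gcat C G\<^esub> F = ((f, a), l1, (q, d))" "((m, M), \<mu>2, free_one G) \<cdot>\<^bsub>gcat C G\<^esub> F = ((f, a), l2, free_one G)"
    unfolding F_eq using G.S.D.prod_pair_simps[OF exG l1(2) l2(2), unfolded G.gcat_simps(3,4)] unfolding prod_obj_def m G.gcat_simps(3,4) by simp_all
  obtain \<phi> where \<phi>: "F = ((f, a), \<phi>, (m, M))" using F(2,3) by (cases F) (simp add: G.gcat_simps(3,4))
  have \<phi>a: "((f, a), \<phi>, (m, M)) \<in> Arr (gcat C G)" using F(1) unfolding \<phi> .
  have \<phi>t [simp]: "\<phi> \<in> Arr C" "Dom C \<phi> = Dom C f" "Cod C \<phi> = Dom C m" using \<phi>a unfolding G.gcat_simps by simp_all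
  have \<phi>1: "\<mu>1 \<cdot> \<phi> = l1" "\<mu>2 \<cdot> \<phi> = l2" using F(4,5) unfolding \<phi> G.gcat_simps by simp_all
  define Sw where "Sw = prod_swap (gcat C G) (q, d) (free_one G)"
  have Sw_eq: "Sw = prod_pair (gcat C G) ((m, M), \<mu>2, free_one G) ((m, M), \<mu>1, (q, d))"
    unfolding Sw_def prod_swap_def m ..
  have Sw: "Sw \<in> Arr (gcat C G)" "Dom (gcat C G) Sw = (m, M)" "Cod (gcat C G) Sw = (m', M')"
    "((m', M'), \<mu>1', free_one G) \<cdot>\<^bsub>gcat C G\<^esub> Sw = ((m, M), \<mu>2, free_one G)" "((m', M'), \<mu>2', (q, d)) \<cdot>\<^bsub>gcat C G\<^esub> Sw = ((m, M), \<mu>1, (q, d))"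
    unfolding Sw_eq using G.S.D.prod_pair_simps[OF exG' ma(2,1), unfolded G.gcat_simps(3,4)] unfolding prod_obj_def m' G.gcat_simps(3,4) by simp_all
  obtain \<sigma> where \<sigma>: "Sw = ((m, M), \<sigma>, (m', M'))" using Sw(2,3) by (cases Sw) (simp add: G.gcat_simps(3,4))
  have \<sigma>a: "((m, M), \<sigma>, (m', M')) \<in> Arr (gcat C G)" using Sw(1) unfolding \<sigma> .
  have \<sigma>t [simp]: "\<sigma> \<in> Arr C" "Dom C \<sigma> = Dom C m" "Cod C \<sigma> = Dom C m'" using \<sigma>a unfolding G.gcat_simps by simp_all
  have \<sigma>1: "\<mu>1' \<cdot> \<sigma> = \<mu>2" "\<mu>2' \<cdot> \<sigma> = \<mu>1" using Sw(4,5) unfolding \<sigma> G.gcat_simps by simp_all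
  note spG = G.sigma_prod_zeta[OF gq m'] and spH = H.sigma_prod_zeta[OF gp n'] and zF = G.zeta_natural[OF \<phi>a] and zS = G.zeta_natural[OF \<sigma>a]
  note [simp] = L(5-7) T(1-3) zF(1-3) zS(1-3) G.zeta_simps(1-4)[OF L(1)] G.zeta_simps(1-4)[OF gm] G.zeta_simps(1-4)[OF gm'] H.zeta_simps(1-4)[OF gn]
    kt H.gobj_arr[OF gn] G.gobj_arr[OF gm] G.gobj_arr[OF gm'] G.gobj_arr[OF L(1)] spG(1-3) spH(1-3)
  have k1D: "Cod C k1 = Dom C (d1 H)" by simp
  note ke1 [simp] = H.equivariantD(1,2)[OF ke(1) gn fH kt(1,2) k1D] and ke2 [simp] = H.equivariantD(1,2)[OF ke(2) gn gp kt(4-6)]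
  have dk': "d1 G \<cdot> \<mu>1' = q \<cdot> \<mu>2'" by (rule is_pullbackD(6)[OF pbm'])
  have \<kappa>G: "ga (gi G \<cdot> \<mu>1') \<mu>2' \<cdot> y = ga (gi G \<cdot> (\<mu>1' \<cdot> y)) (\<mu>2' \<cdot> y)" if "y \<in> Arr C" "Cod C y = Dom C m'" for y
    using that dk' by simp
  have \<kappa>Gt: "ga (gi G \<cdot> \<mu>1') \<mu>2' \<in> Arr C" "Dom C (ga (gi G \<cdot> \<mu>1') \<mu>2') = Dom C m'"
    using dk' by simp_all
  have \<kappa>H: "ha (gi H \<cdot> k1) k2 \<cdot> y = ha (gi H \<cdot> (k1 \<cdot> y)) (k2 \<cdot> y)" if "y \<in> Arr C" "Cod C y = Dom C n" for y
    using that by simp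
  define z where "z = G.zeta (f, a) \<cdot> lam (n, N)"
  have z [simp]: "z \<in> Arr C" "Dom C z = pb_obj C p n" "Cod C z = G.S.L (f, a)" unfolding z_def by simp_all
  \<comment> \<open>The part of \<open>\<psi>\<close> that lies over \<open>G\<close>: the image
    under \<open>\<Sigma>\<^sub>G\<close> of the Frobenius map and of the swap, followed by
    \<open>sigma_prod\<close>.\<close>
  define E where "E = sigma_prod C G SG (q, d) \<cdot> (G.S.LA Sw \<cdot> G.S.LA F)"
  have E [simp]: "E \<in> Arr C" "Dom C E = G.S.L (f, a)" "Cod C E = Dom C p" unfolding E_def \<sigma> \<phi> by simp_all
  define y where "y = \<sigma> \<cdot> (\<phi> \<cdot> lam (n, N))"
  have y [simp]: "y \<in> Arr C" "Dom C y = pb_obj C p n" "Cod C y = Dom C m'" unfolding y_def by simp_all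
  have Ez: "E \<cdot> z = ga (gi G \<cdot> \<mu>1') \<mu>2' \<cdot> y"
  proof -
    have "E \<cdot> z = sigma_prod C G SG (q, d) \<cdot> (G.S.LA Sw \<cdot> ((G.S.LA F \<cdot> G.zeta (f, a)) \<cdot> lam (n, N)))"
      unfolding E_def z_def \<sigma> \<phi> by simp
    also have "\<dots> = sigma_prod C G SG (q, d) \<cdot> ((G.S.LA Sw \<cdot> G.zeta (m, M)) \<cdot> (\<phi> \<cdot> lam (n, N)))"
      unfolding \<phi> zF(4) unfolding \<sigma> by simp
    also have "\<dots> = (sigma_prod C G SG (q, d) \<cdot> G.zeta (m', M')) \<cdot> y"
      unfolding \<sigma> zS(4) y_def by simp
    finally show ?thesis unfolding spG(4) .
  qed
  have Tz: "(sigma_prod C H SH (p, c) \<cdot> theta (n, N)) \<cdot> z = ha (gi H \<cdot> k1) k2 \<cdot> pb2 C p n"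
  proof -
    have "(sigma_prod C H SH (p, c) \<cdot> theta (n, N)) \<cdot> z = sigma_prod C H SH (p, c) \<cdot> (theta (n, N) \<cdot> z)" by (rule comp_assoc) simp_all
    also have "\<dots> = (sigma_prod C H SH (p, c) \<cdot> H.zeta (n, N)) \<cdot> pb2 C p n" unfolding z_def T(4) by simp
    finally show ?thesis unfolding spH(4) .
  qed
  have "ga (gi G \<cdot> \<mu>1') \<mu>2' \<cdot> y = ha (gi H \<cdot> k1) k2 \<cdot> pb2 C p n"
  proof (rule arrow_eqI[of n])
    fix x v assume xv: "pel p n x v"
    define u where "u = pb_pair C p n x v"
    have u [simp]: "u \<in> Arr C" "Dom C u = Dom C v" "Cod C u = pb_obj C p n" "pb2 C p n \<cdot> u = v" unfolding u_def using xv by simp_all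
    \<comment> \<open>A point is now a triple \<open>(x, h, x')\<close> with
      \<open>d1 h = p x = p x'\<close>. Equation \<open>e2\<close> computes its component in
      \<open>L T\<^sub>H 1\<close>, which is the class \<open>h\<inverse> x\<close>, and
      \<open>e1\<close> its component in \<open>T\<^sub>G 1\<close>, which is the division of
      \<open>x\<close> by \<open>x'\<close>.\<close>
    define h where "h = k1 \<cdot> v"
    define x' where "x' = k2 \<cdot> v"
    have hx: "h \<in> Arr C" "x' \<in> Arr C" "Dom C h = Dom C v" "Dom C x' = Dom C v" "Cod C h = G1 H" "Cod C x' = Dom C p" "d1 H \<cdot> h = p \<cdot> x" "p \<cdot> x' = p \<cdot> x"
      unfolding h_def x'_def using xv by simp_all
    have xh: "pel p (d1 H) x h" and xx: "pel p p x x'" using hx xv by simp_all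
    have "\<mu>2' \<cdot> (y \<cdot> u) = \<mu>1 \<cdot> (\<phi> \<cdot> (lam (n, N) \<cdot> u))"
      using comp_reassoc[OF \<sigma>1(2), of "\<phi> \<cdot> (lam (n, N) \<cdot> u)"] unfolding y_def by simp
    also have "\<dots> = (l1 \<cdot> lam (n, N)) \<cdot> u" unfolding \<phi>1(1)[symmetric] by simp
    also have "\<dots> = lam1 \<cdot> pb_pair C p (d1 H) x h"
      unfolding l1(3) u_def h_def by (rule pm_el[OF fH gn _ _ _ _ _ _ xv]) (simp_all add: lam1)
    also have "\<dots> = ha (gi H \<cdot> h) x" by (rule lam1(4)[OF xh])
    finally have e2: "\<mu>2' \<cdot> (y \<cdot> u) = ha (gi H \<cdot> h) x" .
    have "\<mu>1' \<cdot> (y \<cdot> u) = \<mu>2 \<cdot> (\<phi> \<cdot> (lam (n, N) \<cdot> u))"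
      using comp_reassoc[OF \<sigma>1(1), of "\<phi> \<cdot> (lam (n, N) \<cdot> u)"] unfolding y_def by simp
    also have "\<dots> = (l2 \<cdot> lam (n, N)) \<cdot> u" unfolding \<phi>1(2)[symmetric] by simp
    also have "\<dots> = dvar \<cdot> pb_pair C p p x x'"
      unfolding l2(3) u_def x'_def by (rule pm_el[OF gp gn _ _ _ _ _ _ xv]) simp_all
    finally have e1: "\<mu>1' \<cdot> (y \<cdot> u) = dv x x'" unfolding dv_def .
    have "(ga (gi G \<cdot> \<mu>1') \<mu>2' \<cdot> y) \<cdot> u = ga (gi G \<cdot> \<mu>1') \<mu>2' \<cdot> (y \<cdot> u)"
      by (rule comp_assoc) (use dk' in simp_all)
    also have "\<dots> = ga (gi G \<cdot> dv x x') (ha (gi H \<cdot> h) x)"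
      using \<kappa>G[of "y \<cdot> u"] unfolding e1 e2 by simp
    also have "\<dots> = ha (gi H \<cdot> h) (ga (gi G \<cdot> dv x x') x)"
      by (rule ha_ga[symmetric]) (use hx xv xx in simp_all)
    also have "ga (gi G \<cdot> dv x x') x = ga (gi G \<cdot> dv x x') (ga (dv x x') x')" using dv_arr(5)[OF xx] by simp
    also have "\<dots> = x'" by (subst G.ac_ac[OF gq]) (use xx in simp_all)
    also have "ha (gi H \<cdot> h) x' = (ha (gi H \<cdot> k1) k2 \<cdot> pb2 C p n) \<cdot> u"
      using \<kappa>H[of v] xv unfolding h_def x'_def by simp
    finally show "(ga (gi G \<cdot> \<mu>1') \<mu>2' \<cdot> y) \<cdot> pb_pair C p n x v = (ha (gi H \<cdot> k1) k2 \<cdot> pb2 C p n) \<cdot> pb_pair C p n x v" unfolding u_def .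
  qed (use \<kappa>Gt in \<open>simp_all del: G.ac_comp\<close>)
  then have "E = sigma_prod C H SH (p, c) \<cdot> theta (n, N)"
    by - (rule zeta_lam_ext[OF gn Ln, folded z_def], simp_all add: Ez Tz)
  moreover have "hs_psi C H G SH SG J theta = E \<cdot> (inv_arr C (theta (n, N)) \<cdot> inv_arr C (sigma_prod C H SH (p, c)))"
  proof -
    have "prod_obj (gcat C H) (free_one H) (p, c) = (n, N)" unfolding prod_obj_def n' H.gcat_simps ..
    then show ?thesis
      using T(5) unfolding hs_psi_def Let_def ft B.bi_FO E_def F_def[symmetric] Rob_free Lob_free Sw_def[symmetric]
      by (simp add: \<sigma> \<phi>)
  qed
  ultimately show ?thesis using T(5) by simp
qed

text \<open>Because \<open>\<psi>\<close> is the identity and the representing objects are the given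
  ones, the associated map equals the original on the nose, and the required isomorphism is an
  identity.\<close>

lemma hs_of_adj_eq: "hs_of_adj C H G SH SG J theta = \<lparr>hs_p = p, hs_q = q, hs_c = c, hs_d = d\<rparr>"
proof -
  have "d \<cdot> pb_pair C (d0 G) q (pb1 C (d0 G) q) (Id C (Dom C p) \<cdot> pb2 C (d0 G) q) = d" by simp
  then show ?thesis
    unfolding hs_of_adj_def Let_def hs_psi_Id B.bi_FO Rob_free Lob_free case_prod_conv by simp
qed

lemma isomorphic_hs_of_adj:
  "isomorphic (hs_cat C H G) \<lparr>hs_p = p, hs_q = q, hs_c = c, hs_d = d\<rparr> (hs_of_adj C H G SH SG J theta)"
proof -
  let ?P = "\<lparr>hs_p = p, hs_q = q, hs_c = c, hs_d = d\<rparr>"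
  let ?i = "(?P, Id C (Dom C p), ?P)"
  have i: "?i \<in> Arr (hs_cat C H G)"
    using H.equivariant_Id[OF gp] G.equivariant_Id[OF gq] hilsum_skandalis unfolding hs_cat_def structure_simps by simp
  moreover have "is_inverse (hs_cat C H G) ?i ?i"
    using i unfolding is_inverse_def hs_cat_def by (simp add: structure_simps)
  ultimately show ?thesis
    unfolding hs_of_adj_eq isomorphic_def iso_def hs_cat_def
    by (intro bexI[of _ ?i]) (auto simp: structure_simps)
qed

end

theorem theorem11p1:
  fixes C :: "('o, 'm) cat"
    and H G :: "('o, 'm) igpd"
    and SH SG :: "('o, 'm) sigma_adj"
    and P :: "'m hs_map"
  assumes "category C" and "has_finite_limits C"
    and "stably_frobenius_groupoid C H SH"
    and "stably_frobenius_groupoid C G SG"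
    and "hilsum_skandalis C H G P"
  shows "\<exists>(J :: 'm gcat_adj) \<theta>.
           adjunction (gcat C H) (gcat C G) J \<and>
           stably_frobenius (gcat C H) (gcat C G) J \<and>
           over_base C H SH SG J \<theta> \<and>
           isomorphic (hs_cat C H G) P (hs_of_adj C H G SH SG J \<theta>)"
proof -
  obtain p q c d where P: "P = \<lparr>hs_p = p, hs_q = q, hs_c = c, hs_d = d\<rparr>" by (cases P)
  interpret hs C H G SH SG p q c d
    using assms unfolding P by unfold_locales
  show ?thesis
    unfolding P using A.adjunction stably_frobenius_J over_base_theta isomorphic_hs_of_adj by blast
qed

end
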